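(* Let $i\ge 1$, let $W^{h,i}\in\tilde V_h$ be the streamline diffusion solution of the Maxwell equations at iteration step $i$, let $W^i$ be the exact solution of the approximated Maxwell equations at iteration step $i$, and let $\tilde e^i=W^i-W^{h,i}$ (with $\tilde e^i(T,\cdot)$ understood as the trace at $t=T$ from the left). There exists a constant $C$ (independent of the mesh parameter $h$, of $i$, and of the exact and discrete solutions; it may depend on $T$) such that $$\|\tilde e^i(T,\cdot)\|_{H^{-1}(\Omega_x)}\le C\left(\|h\tilde R_1^i\|_{L_2(\tilde Q_T)}+\|h\tilde R_2^i\|_{L_2(\tilde Q_T)}\right).$$
   Context: **Continuous problem.** Let $T>0$, let $\Omega_x\subset\mathbb R$ and $\Omega_v\subset\mathbb R^2$ be bounded space and velocity domains, $\tilde Q_T=[0,T]\times\Omega_x$, $\hat v=v/\sqrt{1+|v|^2}$ for $v\in\mathbb R^2$. The one and one-half dimensional relativistic Vlasov-Maxwell system, with unknowns $f(t,x,v)$, $E_1,E_2,B$ (functions of $(t,x)$) and given background density $\rho_b$, is $$\partial_t f+\hat v_1\partial_x f+(E_1+\hat v_2B)\partial_{v_1}f+(E_2-\hat v_1B)\partial_{v_2}f=0,$$ $$\partial_xE_1=\int f\,dv-\rho_b,\quad \partial_tE_1=-\int\hat v_1f\,dv,\quad \partial_tE_2+\partial_xB=-\int\hat v_2f\,dv,\quad \partial_tB+\partial_xE_2=0,$$ with initial data $f^0\ge0$, $E_2^0$, $B^0$ and $E_1^0(x)=\int_{-\infty}^x(\int f^0(y,v)\,dv-\rho_b(y))\,dy$.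 The background density is smooth, compactly supported and neutralizing: $\int(\int f^0\,dv-\rho_b)\,dx=0$. All functions of $x$ involved in the Maxwell problem are assumed to have compact support in $\Omega_x$, and $f$ has compact support in $\Omega_v$ as a function of $v$. **Matrix form.** Put $W=(E_1,E_2,B)^T$, $W^0=(E_1^0,E_2^0,B^0)^T$ and $$M_1=\begin{pmatrix}0&0&0\\1&0&0\\0&1&0\\0&0&1\end{pmatrix},\qquad M_2=\begin{pmatrix}1&0&0\\0&0&0\\0&0&1\\0&1&0\end{pmatrix}.$$ The Maxwell equations are $M_1W_t+M_2W_x=b$, $W(0,\cdot)=W^0$, with $b=(\int f\,dv-\rho_b,\,-\int\hat v_1f\,dv,\,-\int\hat v_2f\,dv,\,0)^T$. **Discretization.** Let $0=t_0<\dots<t_M=T$, $I_m=(t_{m-1},t_m]$, $S_m=I_m\times\Omega_x$. Let $\{\tau_x\}$ be a finite element subdivision of $\Omega_x$ and let $h$ be the mesh parameter (diameter of the elements; time steps have length $h$). For a fixed $k\in\{0,1,2,\dots\}$ let $P_k$ denote polynomials of degree at most $k$ and $$\tilde V_h=\{g\in[\tilde{\mathcal H}_0]^3:\ g_l|_{I_m\times\tau_x}\in P_k(I_m)\times P_k(\tau_x)\ \forall m,\tau_x,\ l=1,2,3\},$$ where $\tilde{\mathcal H}_0=\prod_{m=1}^M\{w\in H^1(I_m\times\Omega_x): w=0\text{ on }\partial\Omega_x\}$; functions may jump in time across the $t_m$. Write $g_\pm(t,x)=\lim_{s\to0^\pm}g(t+s,x)$, $[g]=g_+-g_-$, $(\cdot,\cdot)_m$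 for the $L_2(S_m)$ inner product, $\langle f,g\rangle_m=(f(t_m,\cdot),g(t_m,\cdot))_{L_2(\Omega_x)}$, and $\hat g=(g_1,g_1,g_2,g_3)^T$ for $g=(g_1,g_2,g_3)^T$. **Iteration and streamline diffusion scheme.** Given a numerical approximation $f^{h,i-1}$ of $f$ from the previous iteration step, let $b^{h,i-1}$ be $b$ with $f$ replaced by $f^{h,i-1}$. The streamline diffusion solution $W^{h,i}\in\tilde V_h$ satisfies, for $m=1,\dots,M$ and all $g\in\tilde V_h$, $$(M_1W^{h,i}_t+M_2W^{h,i}_x,\ \hat g+\delta(M_1g_t+M_2g_x))_m+\langle W^{h,i}_+,g_+\rangle_{m-1}=(b^{h,i-1},\ \hat g+\delta(M_1g_t+M_2g_x))_m+\langle W^{h,i}_-,g_+\rangle_{m-1},$$ with $W^{h,i}_-(0,\cdot)=W^0$ and $\delta$ a fixed multiple of $h$. The function $W^i$ is the exact solution of $M_1W^i_t+M_2W^i_x=b^{h,i-1}$, $W^i(0,\cdot)=W^0$. **Residuals.** $\tilde R_1^i=b^{h,i-1}-M_1W^{h,i}_t-M_2W^{h,i}_x$ (computed slab-wise) and $\tilde R_2^i|_{S_m}=\big(W^{h,i}_+(t_{m-1},x)-W^{h,i}_-(t_{m-1},x)\big)/h$, constant in time on each slab. **Negative norm.** For a domain $G$, $\|u\|_{H^{-1}(G)}=\sup_{\psi}\,(u,\psi)_{L_2(G)}/\|\psi\|_{H^1(G)}$, the supremum being over nonzero (vector-valued, if $u$ is) $\psi\in C_0^\infty(G)$.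
   Formalization: The degree k is taken ≥ 1, since for k = 0 the discrete space is {0} and the bound fails as h → 0; and C may depend on a fixed compact subset of Ω_x containing all the x-supports, since it cannot be uniform as supports approach the boundary. *)

theory Defs
  imports "HOL-Analysis.Analysis"
begin

definition bounded_domain :: "'a::euclidean_space set \<Rightarrow> bool" where
  "bounded_domain G \<longleftrightarrow> open G \<and> connected G \<and> G \<noteq> {} \<and> bounded G"

section \<open>Test functions, Lebesgue and Sobolev spaces\<close>

primrec C_diff :: "nat \<Rightarrow> ('a::euclidean_space \<Rightarrow> 'b::real_normed_vector) \<Rightarrow> bool" where
  "C_diff 0 f \<longleftrightarrow> continuous_on UNIV f"
| "C_diff (Suc n) f \<longleftrightarrow> (\<forall>x. f differentiable (at x)) \<and>
      (\<forall>b\<in>Basis. C_diff n (\<lambda>x. frechet_derivative f (at x) b))"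

text \<open>The space \<open>C\<^sub>0\<^sup>\<infinity>(G)\<close>.\<close>

definition test_function :: "'a::euclidean_space set \<Rightarrow> ('a \<Rightarrow> 'b::real_normed_vector) \<Rightarrow> bool" where
  "test_function G \<psi> \<longleftrightarrow> (\<forall>n. C_diff n \<psi>) \<and>
      compact (closure {x. \<psi> x \<noteq> 0}) \<and> closure {x. \<psi> x \<noteq> 0} \<subseteq> G"

text \<open>Elements of \<open>L\<^sub>2\<close> are given by Borel representatives. The integrals below are taken with respect
  to the completed measure, so that the pointwise derivatives of piecewise polynomials, which are
  arbitrary on the null set of element boundaries, cause no measurability problems.\<close>

definition L2_on :: "'a::euclidean_space set \<Rightarrow> ('a \<Rightarrow> 'b::euclidean_space) \<Rightarrow> bool" where
  "L2_on S u \<longleftrightarrow> set_borel_measurable lborel S u \<and>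
      set_integrable lborel S (\<lambda>x. (norm (u x))\<^sup>2)"

definition L2_inner ::
  "'a::euclidean_space set \<Rightarrow> ('a \<Rightarrow> 'b::euclidean_space) \<Rightarrow> ('a \<Rightarrow> 'b) \<Rightarrow> real" where
  "L2_inner S u v = (LINT x:S|lebesgue. u x \<bullet> v x)"

definition L2_norm :: "'a::euclidean_space set \<Rightarrow> ('a \<Rightarrow> 'b::euclidean_space) \<Rightarrow> real" where
  "L2_norm S u = sqrt (L2_inner S u u)"

definition H1_on :: "'a::euclidean_space set \<Rightarrow> ('a \<Rightarrow> real) \<Rightarrow> bool" where
  "H1_on G u \<longleftrightarrow> L2_on G u \<and>
      (\<forall>b\<in>Basis. \<exists>u'. L2_on G u' \<and>
         (\<forall>\<psi>. test_function G \<psi> \<longrightarrow>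
            L2_inner G u (\<lambda>x. frechet_derivative \<psi> (at x) b) = - L2_inner G u' \<psi>))"

text \<open>The \<open>H\<^sup>1\<close> norm of a differentiable function.\<close>

definition H1_norm :: "'a::euclidean_space set \<Rightarrow> ('a \<Rightarrow> 'b::euclidean_space) \<Rightarrow> real" where
  "H1_norm G \<psi> = sqrt ((L2_norm G \<psi>)\<^sup>2 +
      (\<Sum>b\<in>Basis. (L2_norm G (\<lambda>x. frechet_derivative \<psi> (at x) b))\<^sup>2))"

definition Hminus1_norm :: "'a::euclidean_space set \<Rightarrow> ('a \<Rightarrow> 'b::euclidean_space) \<Rightarrow> ereal" where
  "Hminus1_norm G u =
      (SUP \<psi>\<in>{\<psi>. test_function G \<psi> \<and> \<psi> \<noteq> (\<lambda>x. 0)}. ereal (L2_inner G u \<psi> / H1_norm G \<psi>))"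

section \<open>The Maxwell equations\<close>

text \<open>Functions of time and space take arguments \<open>(t, x)\<close>.\<close>

definition dt :: "(real \<times> real \<Rightarrow> 'b::real_normed_vector) \<Rightarrow> real \<times> real \<Rightarrow> 'b" where
  "dt u = (\<lambda>(t, x). vector_derivative (\<lambda>s. u (s, x)) (at t))"

definition dx :: "(real \<times> real \<Rightarrow> 'b::real_normed_vector) \<Rightarrow> real \<times> real \<Rightarrow> 'b" where
  "dx u = (\<lambda>(t, x). vector_derivative (\<lambda>y. u (t, y)) (at x))"

definition M1 :: "real^3^4" where
  "M1 = vector [vector [0, 0, 0],
                vector [1, 0, 0],
                vector [0, 1, 0],
                vector [0, 0, 1]]"

definition M2 :: "real^3^4" where
  "M2 = vector [vector [1, 0, 0],
                vector [0, 0, 0],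
                vector [0, 0, 1],
                vector [0, 1, 0]]"

definition vhat :: "real^2 \<Rightarrow> real^2" where
  "vhat v = v /\<^sub>R sqrt (1 + (norm v)\<^sup>2)"

definition maxwell_rhs :: "(real \<Rightarrow> real) \<Rightarrow> (real \<times> real \<Rightarrow> real^2 \<Rightarrow> real) \<Rightarrow> real \<times> real \<Rightarrow> real^4" where
  "maxwell_rhs \<rho>b f z = vector
     [(LINT v|lborel. f z v) - \<rho>b (snd z),
      - (LINT v|lborel. vhat v $ 1 * f z v),
      - (LINT v|lborel. vhat v $ 2 * f z v),
      0]"

definition initial_field ::
  "(real \<Rightarrow> real) \<Rightarrow> (real \<Rightarrow> real^2 \<Rightarrow> real) \<Rightarrow> (real \<Rightarrow> real) \<Rightarrow> (real \<Rightarrow> real) \<Rightarrow> real \<Rightarrow> real^3" where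
  "initial_field \<rho>b f0 E20 B0 x =
     vector [LINT y:{..x}|lborel. (LINT v|lborel. f0 y v) - \<rho>b y, E20 x, B0 x]"

text \<open>\<open>Kx\<close> is a compact subset of the space domain which contains the supports in \<open>x\<close> of all functions
  in the Maxwell problem.\<close>

definition admissible_data ::
  "real set \<Rightarrow> real set \<Rightarrow> (real^2) set \<Rightarrow>
   (real \<Rightarrow> real) \<Rightarrow> (real \<Rightarrow> real^2 \<Rightarrow> real) \<Rightarrow> (real \<Rightarrow> real) \<Rightarrow> (real \<Rightarrow> real) \<Rightarrow> bool" where
  "admissible_data \<Omega>x Kx \<Omega>v \<rho>b f0 E20 B0 \<longleftrightarrow>
     test_function \<Omega>x \<rho>b \<and> (\<forall>x. x \<notin> Kx \<longrightarrow> \<rho>b x = 0) \<and>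
     integrable lborel (\<lambda>(x, v). f0 x v) \<and> (\<forall>x v. f0 x v \<ge> 0) \<and>
     (\<forall>x v. x \<notin> Kx \<longrightarrow> f0 x v = 0) \<and>
     (\<exists>Kv. compact Kv \<and> Kv \<subseteq> \<Omega>v \<and> (\<forall>x v. v \<notin> Kv \<longrightarrow> f0 x v = 0)) \<and>
     (LINT x|lborel. (LINT v|lborel. f0 x v) - \<rho>b x) = 0 \<and>
     L2_on \<Omega>x E20 \<and> (\<forall>x. x \<notin> Kx \<longrightarrow> E20 x = 0) \<and>
     L2_on \<Omega>x B0 \<and> (\<forall>x. x \<notin> Kx \<longrightarrow> B0 x = 0)"

definition admissible_density ::
  "real \<Rightarrow> real set \<Rightarrow> real set \<Rightarrow> (real^2) set \<Rightarrow> (real \<times> real \<Rightarrow> real^2 \<Rightarrow> real) \<Rightarrow> bool" where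
  "admissible_density T \<Omega>x Kx \<Omega>v f \<longleftrightarrow>
     L2_on (({0..T} \<times> \<Omega>x) \<times> \<Omega>v) (\<lambda>(z, v). f z v) \<and>
     (\<forall>t\<in>{0..T}. \<forall>x v. x \<notin> Kx \<longrightarrow> f (t, x) v = 0) \<and>
     (\<exists>Kv. compact Kv \<and> Kv \<subseteq> \<Omega>v \<and> (\<forall>t\<in>{0..T}. \<forall>x v. v \<notin> Kv \<longrightarrow> f (t, x) v = 0))"

text \<open>Solutions of \<open>M\<^sub>1 W\<^sub>t + M\<^sub>2 W\<^sub>x = b\<close>, \<open>W(0,\<cdot>) = W\<^sup>0\<close> in \<open>C([0,T]; L\<^sub>2(\<Omega>))\<close>. The right-hand side is
  in general discontinuous in time, so the equation is understood in the sense of distributions;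
  classical and \<open>H\<^sup>1\<close> solutions are included. The continuity in time gives the traces at \<open>t = 0\<close>
  and \<open>t = T\<close> their meaning.\<close>

definition maxwell_solution ::
  "real \<Rightarrow> real set \<Rightarrow> (real \<times> real \<Rightarrow> real^4) \<Rightarrow> (real \<Rightarrow> real^3) \<Rightarrow> (real \<times> real \<Rightarrow> real^3) \<Rightarrow> bool" where
  "maxwell_solution T \<Omega> b W0 W \<longleftrightarrow>
     L2_on ({0..T} \<times> \<Omega>) W \<and>
     (\<forall>t\<in>{0..T}. L2_on \<Omega> (\<lambda>x. W (t, x))) \<and>
     (\<forall>s\<in>{0..T}. ((\<lambda>t. L2_norm \<Omega> (\<lambda>x. W (t, x) - W (s, x))) \<longlongrightarrow> 0) (at s within {0..T})) \<and>
     (AE x in lborel. x \<in> \<Omega> \<longrightarrow> W (0, x) = W0 x) \<and>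
     (\<forall>\<psi>. test_function ({0<..<T} \<times> \<Omega>) \<psi> \<longrightarrow>
        - L2_inner ({0..T} \<times> \<Omega>) (\<lambda>z. M1 *v W z) (dt \<psi>) -
          L2_inner ({0..T} \<times> \<Omega>) (\<lambda>z. M2 *v W z) (dx \<psi>) = L2_inner ({0..T} \<times> \<Omega>) b \<psi>)"

section \<open>The streamline diffusion scheme\<close>

definition time_mesh :: "real \<Rightarrow> real \<Rightarrow> nat \<Rightarrow> (nat \<Rightarrow> real) \<Rightarrow> bool" where
  "time_mesh T h M t \<longleftrightarrow> t 0 = 0 \<and> t M = T \<and> (\<forall>m\<in>{1..M}. t m - t (m - 1) = h)"

definition space_mesh :: "real set \<Rightarrow> real \<Rightarrow> real set set \<Rightarrow> bool" where
  "space_mesh \<Omega> h \<T> \<longleftrightarrow> \<T> division_of closure \<Omega> \<and>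
     (\<forall>\<tau>\<in>\<T>. interior \<tau> \<noteq> {} \<and> diameter \<tau> \<le> h)"

definition slab :: "(nat \<Rightarrow> real) \<Rightarrow> real set \<Rightarrow> nat \<Rightarrow> (real \<times> real) set" where
  "slab t \<Omega> m = {t (m - 1)<..t m} \<times> \<Omega>"

text \<open>The finite element space. The elements of a division are closed intervals and
  the polynomial representation holds pointwise on them, so the values on \<open>frontier \<Omega>\<close> are the traces.\<close>

definition fe_space ::
  "real set \<Rightarrow> nat \<Rightarrow> (nat \<Rightarrow> real) \<Rightarrow> real set set \<Rightarrow> nat \<Rightarrow> (real \<times> real \<Rightarrow> real^3) set" where
  "fe_space \<Omega> M t \<T> k = {g. \<forall>m\<in>{1..M}. \<forall>l.
     H1_on ({t (m - 1)<..<t m} \<times> \<Omega>) (\<lambda>z. g z $ l) \<and>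
     (\<forall>s\<in>{t (m - 1)<..t m}. \<forall>x\<in>frontier \<Omega>. g (s, x) $ l = 0) \<and>
     (\<forall>\<tau>\<in>\<T>. \<exists>a. \<forall>s\<in>{t (m - 1)<..t m}. \<forall>x\<in>\<tau>.
        g (s, x) $ l = (\<Sum>p\<le>k. \<Sum>q\<le>k. a p q * s ^ p * x ^ q))}"

definition trace_plus :: "(real \<times> real \<Rightarrow> real^3) \<Rightarrow> real \<Rightarrow> real \<Rightarrow> real^3" where
  "trace_plus g t x = Lim (at_right t) (\<lambda>s. g (s, x))"

definition trace_minus :: "(real \<times> real \<Rightarrow> real^3) \<Rightarrow> real \<Rightarrow> real \<Rightarrow> real^3" where
  "trace_minus g t x = Lim (at_left t) (\<lambda>s. g (s, x))"

text \<open>The convention \<open>W\<^sub>-(0,\<cdot>) = W\<^sup>0\<close>.\<close>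

definition trace_minus0 ::
  "(real \<Rightarrow> real^3) \<Rightarrow> (real \<times> real \<Rightarrow> real^3) \<Rightarrow> real \<Rightarrow> real \<Rightarrow> real^3" where
  "trace_minus0 W0 W t x = (if t = 0 then W0 x else trace_minus W t x)"

definition hat4 :: "real^3 \<Rightarrow> real^4" where
  "hat4 g = vector [g $ 1, g $ 1, g $ 2, g $ 3]"

definition maxwell_op :: "(real \<times> real \<Rightarrow> real^3) \<Rightarrow> real \<times> real \<Rightarrow> real^4" where
  "maxwell_op W z = M1 *v dt W z + M2 *v dx W z"

definition sd_solution ::
  "real set \<Rightarrow> nat \<Rightarrow> (nat \<Rightarrow> real) \<Rightarrow> real set set \<Rightarrow> nat \<Rightarrow> real \<Rightarrow>
   (real \<times> real \<Rightarrow> real^4) \<Rightarrow> (real \<Rightarrow> real^3) \<Rightarrow> (real \<times> real \<Rightarrow> real^3) \<Rightarrow> bool" where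
  "sd_solution \<Omega> M t \<T> k \<delta> b W0 Wh \<longleftrightarrow> Wh \<in> fe_space \<Omega> M t \<T> k \<and>
     (\<forall>m\<in>{1..M}. \<forall>g\<in>fe_space \<Omega> M t \<T> k.
        L2_inner (slab t \<Omega> m) (maxwell_op Wh) (\<lambda>z. hat4 (g z) + \<delta> *\<^sub>R maxwell_op g z) +
        L2_inner \<Omega> (trace_plus Wh (t (m - 1))) (trace_plus g (t (m - 1))) =
        L2_inner (slab t \<Omega> m) b (\<lambda>z. hat4 (g z) + \<delta> *\<^sub>R maxwell_op g z) +
        L2_inner \<Omega> (trace_minus0 W0 Wh (t (m - 1))) (trace_plus g (t (m - 1))))"

definition residual1 ::
  "(real \<times> real \<Rightarrow> real^4) \<Rightarrow> (real \<times> real \<Rightarrow> real^3) \<Rightarrow> real \<times> real \<Rightarrow> real^4" where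
  "residual1 b Wh z = b z - maxwell_op Wh z"

definition residual2 ::
  "nat \<Rightarrow> (nat \<Rightarrow> real) \<Rightarrow> real \<Rightarrow> (real \<Rightarrow> real^3) \<Rightarrow> (real \<times> real \<Rightarrow> real^3) \<Rightarrow>
   real \<times> real \<Rightarrow> real^3" where
  "residual2 M t h W0 Wh = (\<lambda>(s, x). \<Sum>m=1..M. indicator {t (m - 1)<..t m} s *\<^sub>R
     ((trace_plus Wh (t (m - 1)) x - trace_minus0 W0 Wh (t (m - 1)) x) /\<^sub>R h))"

end

theory Submission
  imports Defs
begin

text \<open>
The Maxwell operator has three characteristic directions \<open>v\<close>, namely \<open>(1, 0, 0)\<close>, \<open>(0, 1, 1)\<close> and
\<open>(0, 1, -1)\<close>, with speeds \<open>s = 1, 1, -1\<close>: for each of them \<open>w = W \<bullet> v\<close> solves the scalar transport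
equation \<open>w\<^sub>t + s w\<^sub>x = b \<bullet> hat4 v\<close>, and \<open>p = W\<^sup>h \<bullet> v\<close> solves a streamline diffusion scheme for it
(\<open>direction\<close>, \<open>scheme_direction\<close>). The directions are orthogonal, so it is enough to bound, for
each of them, the pairing of \<open>w - p\<close> at time \<open>T\<close> with a smooth function \<open>\<phi>\<close> supported in \<open>\<Omega>\<^sub>x\<close>
(\<open>dual_estimate\<close>).

The bound is a duality argument. Let \<open>u(t, x) = \<phi>(x + s(T - t))\<close> be the backward transport of \<open>\<phi>\<close>, so
that \<open>u\<^sub>t + s u\<^sub>x = 0\<close>. Integrating by parts, in the weak formulation for \<open>w\<close> and slab by slab for \<open>p\<close>,
turns the pairing into \<open>\<Sum>\<^sub>m (\<integral> r u - \<integral> J\<^sub>m u)\<close>, where \<open>r\<close> is the residual and \<open>J\<^sub>m\<close> the jump at the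
beginning of slab \<open>m\<close> (\<open>error_identity\<close>). By the Galerkin equations the interpolant of \<open>u\<close> at
the beginning of the slab may be subtracted from \<open>u\<close> up to the streamline term, which carries a
factor \<open>h\<close>; the interpolation error carries a factor \<open>h\<close> as well and needs only one derivative of
\<open>\<phi>\<close> (\<open>slab_bound_fine\<close>). This is the claimed estimate.

There is one obstacle. Discrete functions vanish at both ends of \<open>\<Omega>\<^sub>x\<close>. At the outflow end so does
\<open>u\<close>, but not at the inflow end, and there its interpolant is not an admissible test function.
Therefore \<open>u\<close> is multiplied by a cut-off \<open>\<lambda>\<close> that vanishes at the inflow end. The price is the term
\<open>\<integral> (w - p)(u\<^sub>t + s u\<^sub>x)\<close> with \<open>u\<^sub>t + s u\<^sub>x = s \<phi>(x + s(T - t)) \<lambda>'(x)\<close>, and the part of \<open>\<phi>\<close> lost at time \<open>T\<close>. Both are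
supported near the inflow end, outside the support of the data, where \<open>w\<close> and \<open>b\<close> vanish. So only
\<open>p\<close> has to be small there. Nothing flows into that region, hence an energy estimate can be expected,
and it has to be carried out on the discrete level (\<open>energy_slab\<close>): let \<open>\<omega>\<close> be the distance
to a node behind the region. The function \<open>\<omega> p\<close> has degree \<open>k + 1\<close> in \<open>x\<close>, but on every element its
leading term can be removed by adding a polynomial that vanishes at the nodes. The result is an
admissible test function (\<open>weighted_test_pw\<close>), and an inverse estimate for the leading coefficient
shows that the correction is of order \<open>h\<close> (\<open>bubble_bound\<close>). Testing with it bounds \<open>p\<close> on the region, and a weighted
norm of \<open>p\<close> at time \<open>T\<close>, by the residuals.

The remaining work connects this with the given notions: values of discrete functions are polynomials
in time with continuous piecewise polynomial coefficients (\<open>fe_slab_representation\<close>); sources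
and exact fields are represented by square integrable Borel functions; and the weak formulation, which
admits only test functions with compact support in the open space-time domain, is extended to smooth
functions \<open>u\<close> by means of the continuity of \<open>W\<close> in time (\<open>weak_trace_identity\<close>).
\<close>

section \<open>Square integrable and bounded functions\<close>

text \<open>Measurability is required on the whole space, boundedness only on the set: then sums, products, slices
  and restrictions are measurable as well.\<close>

definition bfun :: "'a::euclidean_space set \<Rightarrow> ('a \<Rightarrow> real) \<Rightarrow> bool" where
  "bfun S f \<longleftrightarrow> f \<in> borel_measurable borel \<and> (\<exists>C. \<forall>x\<in>S. \<bar>f x\<bar> \<le> C)"

lemma bfunI: "f \<in> borel_measurable borel \<Longrightarrow> (\<And>x. x \<in> S \<Longrightarrow> \<bar>f x\<bar> \<le> C) \<Longrightarrow> bfun S f"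
  unfolding bfun_def by blast

lemma bfun_meas[measurable_dest]: "bfun S f \<Longrightarrow> f \<in> borel_measurable borel"
  unfolding bfun_def by blast

lemma bfun_const: "bfun S (\<lambda>x. c)"
  by (rule bfunI[of _ _ "\<bar>c\<bar>"]) auto

lemma bfun_add: assumes "bfun S f" "bfun S g" shows "bfun S (\<lambda>x. f x + g x)"
proof -
  obtain C D where "\<forall>x\<in>S. \<bar>f x\<bar> \<le> C" "\<forall>x\<in>S. \<bar>g x\<bar> \<le> D"
    using assms unfolding bfun_def by blast
  then have "\<bar>f x + g x\<bar> \<le> C + D" if "x \<in> S" for x
    using that by (smt (verit))
  moreover have "(\<lambda>x. f x + g x) \<in> borel_measurable borel"
    using assms[THEN bfun_meas] by simp
  ultimately show ?thesis by (rule bfunI[rotated])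
qed

lemma bfun_mult: assumes "bfun S f" "bfun S g" shows "bfun S (\<lambda>x. f x * g x)"
proof -
  obtain C D where CD: "\<forall>x\<in>S. \<bar>f x\<bar> \<le> C" "\<forall>x\<in>S. \<bar>g x\<bar> \<le> D"
    using assms unfolding bfun_def by blast
  then have "\<bar>f x * g x\<bar> \<le> C * D" if "x \<in> S" for x
  proof -
    have "\<bar>f x\<bar> \<le> C" "\<bar>g x\<bar> \<le> D" using CD that by auto
    then show ?thesis unfolding abs_mult by (intro mult_mono) auto
  qed
  moreover have "(\<lambda>x. f x * g x) \<in> borel_measurable borel"
    using assms[THEN bfun_meas] by simp
  ultimately show ?thesis by (rule bfunI[rotated])
qed

lemma bfun_uminus: "bfun S f \<Longrightarrow> bfun S (\<lambda>x. - f x)"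
  using bfun_mult[OF bfun_const[of S "-1"], of f] by simp

lemma bfun_diff: "bfun S f \<Longrightarrow> bfun S g \<Longrightarrow> bfun S (\<lambda>x. f x - g x)"
  using bfun_add[OF _ bfun_uminus, of S f g] by simp

lemma bfun_power: "bfun S f \<Longrightarrow> bfun S (\<lambda>x. f x ^ n)"
  by (induction n) (simp_all add: bfun_const bfun_mult)

lemma bfun_sum: "(\<And>i. i \<in> I \<Longrightarrow> bfun S (f i)) \<Longrightarrow> bfun S (\<lambda>x. \<Sum>i\<in>I. f i x)"
  by (induction I rule: infinite_finite_induct) (simp_all add: bfun_const bfun_add)

lemma bfun_subset: "bfun S f \<Longrightarrow> S' \<subseteq> S \<Longrightarrow> bfun S' f"
  unfolding bfun_def by blast

lemma bfun_continuous:
  assumes "continuous_on UNIV f" "bounded S" shows "bfun S f"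
proof -
  have "compact (closure S)" using assms(2) by simp
  then have "bounded (f ` closure S)"
    using assms(1) by (meson compact_continuous_image compact_imp_bounded continuous_on_subset subset_UNIV)
  then obtain C where "\<forall>y\<in>f ` closure S. \<bar>y\<bar> \<le> C" unfolding bounded_iff real_norm_def by blast
  then have "\<bar>f x\<bar> \<le> C" if "x \<in> S" for x using that closure_subset[of S] by blast
  moreover have "f \<in> borel_measurable borel" using assms(1) by (rule borel_measurable_continuous_onI)
  ultimately show ?thesis by (rule bfunI[rotated])
qed

lemma bfun_integrable:
  assumes "bfun S f" "S \<in> sets borel" "bounded S" shows "set_integrable lborel S f"
proof -
  obtain C where C: "\<forall>x\<in>S. \<bar>f x\<bar> \<le> C" and m: "f \<in> borel_measurable borel"
    using assms(1) unfolding bfun_def by blast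
  have "emeasure lborel S < \<infinity>" using assms(3) by (rule emeasure_bounded_finite)
  then show ?thesis unfolding set_integrable_def
    using C m assms(2) by (intro integrableI_bounded_set_indicator[where B=C]) auto
qed

text \<open>As for \<open>bfun\<close>, the function is a Borel function on the whole space. The norm below uses the Borel
  measure \<open>lborel\<close>, because all slices of a Borel function are measurable.\<close>

definition sqi :: "'a::euclidean_space set \<Rightarrow> ('a \<Rightarrow> real) \<Rightarrow> bool" where
  "sqi S f \<longleftrightarrow> f \<in> borel_measurable borel \<and> S \<in> sets borel \<and> set_integrable lborel S (\<lambda>x. (f x)\<^sup>2)"

definition nrm :: "'a::euclidean_space set \<Rightarrow> ('a \<Rightarrow> real) \<Rightarrow> real" where
  "nrm S f = sqrt (LINT x:S|lborel. (f x)\<^sup>2)"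

lemma nrm_nonneg[simp]: "0 \<le> nrm S f"
  unfolding nrm_def set_lebesgue_integral_def by (auto intro!: integral_nonneg_AE)

lemma nrm_sq: "(nrm S f)\<^sup>2 = (LINT x:S|lborel. (f x)\<^sup>2)"
  unfolding nrm_def set_lebesgue_integral_def by (auto intro!: integral_nonneg_AE real_sqrt_pow2)

lemma bfun_sqi: "bfun S f \<Longrightarrow> S \<in> sets borel \<Longrightarrow> bounded S \<Longrightarrow> sqi S f"
  unfolding sqi_def using bfun_meas bfun_integrable[OF bfun_power[of S f 2]] by blast

lemma sqi_meas[measurable_dest]: "sqi S f \<Longrightarrow> f \<in> borel_measurable borel"
  unfolding sqi_def by blast

lemma sqi_mult_integrable:
  assumes "sqi S f" "sqi S g" shows "set_integrable lborel S (\<lambda>x. f x * g x)"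
proof -
  have S[measurable]: "S \<in> sets borel" and [measurable]: "f \<in> borel_measurable borel" "g \<in> borel_measurable borel"
    using assms unfolding sqi_def by auto
  have "set_integrable lborel S (\<lambda>x. (f x)\<^sup>2 + (g x)\<^sup>2)"
    using assms unfolding sqi_def by (intro set_integral_add) auto
  then show ?thesis
  proof (rule set_integrable_bound)
    show "set_borel_measurable lborel S (\<lambda>x. f x * g x)" unfolding set_borel_measurable_def by measurable
    have "\<bar>f x * g x\<bar> \<le> \<bar>(f x)\<^sup>2 + (g x)\<^sup>2\<bar>" for x
    proof -
      have "0 \<le> (\<bar>f x\<bar> - \<bar>g x\<bar>)\<^sup>2" by simp
      then have "2 * \<bar>f x * g x\<bar> \<le> (f x)\<^sup>2 + (g x)\<^sup>2" by (simp add: power2_diff abs_mult)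
      then show ?thesis using abs_ge_zero[of "f x * g x"] by linarith
    qed
    then show "AE x in lborel. x \<in> S \<longrightarrow> norm (f x * g x) \<le> norm ((f x)\<^sup>2 + (g x)\<^sup>2)" by simp
  qed
qed

lemma sqi_cs: assumes "sqi S f" "sqi S g"
  shows "\<bar>LINT x:S|lborel. f x * g x\<bar> \<le> nrm S f * nrm S g"
proof -
  let ?a = "LINT x:S|lborel. (f x)\<^sup>2" and ?b = "LINT x:S|lborel. (g x)\<^sup>2" and ?c = "LINT x:S|lborel. f x * g x"
  have i: "set_integrable lborel S (\<lambda>x. (f x)\<^sup>2)" "set_integrable lborel S (\<lambda>x. (g x)\<^sup>2)"
     "set_integrable lborel S (\<lambda>x. f x * g x)"
    using assms sqi_mult_integrable unfolding sqi_def by auto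
  have pos: "0 \<le> ?a * l\<^sup>2 + 2 * l * m * ?c + ?b * m\<^sup>2" for l m
  proof -
    have "0 \<le> (LINT x:S|lborel. (l * f x + m * g x)\<^sup>2)"
      unfolding set_lebesgue_integral_def by (auto intro!: integral_nonneg_AE)
    also have "(\<lambda>x. (l * f x + m * g x)\<^sup>2) = (\<lambda>x. (l\<^sup>2 * (f x)\<^sup>2 + (2*l*m) * (f x * g x)) + m\<^sup>2 * (g x)\<^sup>2)"
      by (auto simp: power2_eq_square algebra_simps)
    also have "(LINT x:S|lborel. (l\<^sup>2 * (f x)\<^sup>2 + (2*l*m) * (f x * g x)) + m\<^sup>2 * (g x)\<^sup>2) =
       l\<^sup>2 * ?a + (2*l*m) * ?c + m\<^sup>2 * ?b"
      using i by (simp add: set_integral_add set_integrable_mult_right)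
    finally show ?thesis by (simp add: algebra_simps)
  qed
  have a0: "0 \<le> ?a" "0 \<le> ?b" using nrm_sq[of S f] nrm_sq[of S g] by (metis zero_le_power2)+
  have "?c\<^sup>2 \<le> ?a * ?b"
  proof (cases "?a = 0")
    case True
    have "?c = 0"
    proof (rule ccontr)
      assume "?c \<noteq> 0"
      from pos[of "- (?b + 1) / (2 * ?c)" 1] True this show False
        by (simp add: field_simps)
    qed
    then show ?thesis using True by simp
  next
    case False
    then have "?a > 0" using a0 by simp
    from pos[of "- ?c" "?a"] have "0 \<le> ?a * (?a * ?b - ?c\<^sup>2)" by (simp add: power2_eq_square algebra_simps)
    then show ?thesis using \<open>?a > 0\<close> by (simp add: zero_le_mult_iff)
  qed
  then have "sqrt (?c\<^sup>2) \<le> sqrt (?a * ?b)" by (rule real_sqrt_le_mono)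
  then show ?thesis unfolding nrm_def by (simp add: real_sqrt_mult)
qed

lemma sqi_add: assumes "sqi S f" "sqi S g" shows "sqi S (\<lambda>x. f x + g x)"
proof -
  have "set_integrable lborel S (\<lambda>x. (f x)\<^sup>2 + 2 * (f x * g x) + (g x)\<^sup>2)"
    using assms sqi_mult_integrable[OF assms] unfolding sqi_def by (intro set_integral_add set_integrable_mult_right) auto
  then show ?thesis using assms unfolding sqi_def by (auto simp: power2_sum algebra_simps)
qed

lemma sqi_bmult: assumes "sqi S f" "bfun S g" shows "sqi S (\<lambda>x. g x * f x)"
proof -
  obtain C where C: "\<forall>x\<in>S. \<bar>g x\<bar> \<le> C" and [measurable]: "g \<in> borel_measurable borel"
    using assms unfolding bfun_def by blast
  have [measurable]: "f \<in> borel_measurable borel" "S \<in> sets borel" using assms unfolding sqi_def by auto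
  have "set_integrable lborel S (\<lambda>x. C\<^sup>2 * (f x)\<^sup>2)" using assms unfolding sqi_def by (intro set_integrable_mult_right) auto
  then have "set_integrable lborel S (\<lambda>x. (g x * f x)\<^sup>2)"
  proof (rule set_integrable_bound)
    show "set_borel_measurable lborel S (\<lambda>x. (g x * f x)\<^sup>2)" unfolding set_borel_measurable_def by measurable
    show "AE x in lborel. x \<in> S \<longrightarrow> norm ((g x * f x)\<^sup>2) \<le> norm (C\<^sup>2 * (f x)\<^sup>2)"
    proof (rule AE_I2, rule impI)
      fix x assume "x \<in> S"
      then have "(g x)\<^sup>2 \<le> C\<^sup>2" using C by (meson abs_ge_zero order_trans power2_le_iff_abs_le)
      then have "(g x)\<^sup>2 * (f x)\<^sup>2 \<le> C\<^sup>2 * (f x)\<^sup>2" by (rule mult_right_mono) simp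
      then show "norm ((g x * f x)\<^sup>2) \<le> norm (C\<^sup>2 * (f x)\<^sup>2)" by (simp add: power_mult_distrib)
    qed
  qed
  then show ?thesis unfolding sqi_def by simp
qed

lemma sqi_cmult: "sqi S f \<Longrightarrow> sqi S (\<lambda>x. c * f x)"
  by (rule sqi_bmult[OF _ bfun_const])

lemma sqi_uminus: "sqi S f \<Longrightarrow> sqi S (\<lambda>x. - f x)"
  using sqi_cmult[of S f "-1"] by simp

lemma sqi_diff: "sqi S f \<Longrightarrow> sqi S g \<Longrightarrow> sqi S (\<lambda>x. f x - g x)"
  using sqi_add[OF _ sqi_uminus, of S f g] by simp

lemma sqi_subset: assumes "sqi S f" "S' \<subseteq> S" "S' \<in> sets borel" shows "sqi S' f"
  using assms set_integrable_subset[of lborel S "\<lambda>x. (f x)\<^sup>2" S'] unfolding sqi_def by auto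

lemma set_integral_mono_set:
  fixes f :: "'a \<Rightarrow> real"
  assumes "set_integrable M S f" "S' \<subseteq> S" "S' \<in> sets M" "\<And>x. x \<in> S \<Longrightarrow> 0 \<le> f x"
  shows "(LINT x:S'|M. f x) \<le> (LINT x:S|M. f x)"
  unfolding set_lebesgue_integral_def
proof (rule integral_mono)
  show "integrable M (\<lambda>x. indicator S' x *\<^sub>R f x)" "integrable M (\<lambda>x. indicator S x *\<^sub>R f x)"
    using assms set_integrable_subset[OF assms(1,3,2)] unfolding set_integrable_def by auto
  show "indicator S' x *\<^sub>R f x \<le> indicator S x *\<^sub>R f x" for x
    using assms(2,4) by (auto simp: indicator_def)
qed

lemma nrm_subset: assumes "sqi S f" "S' \<subseteq> S" "S' \<in> sets borel" shows "nrm S' f \<le> nrm S f"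
  using assms unfolding nrm_def sqi_def
  by (intro real_sqrt_le_mono set_integral_mono_set) auto

lemma nrm_mono:
  assumes "sqi S f" "sqi S g" "\<And>x. x \<in> S \<Longrightarrow> \<bar>f x\<bar> \<le> \<bar>g x\<bar>" shows "nrm S f \<le> nrm S g"
  unfolding nrm_def using assms unfolding sqi_def
  by (intro real_sqrt_le_mono set_integral_mono) (auto simp: abs_le_square_iff)

lemma nrm_mono2:
  assumes "sqi S f" "sqi S g" "\<And>x. x \<in> S \<Longrightarrow> \<bar>f x\<bar> \<le> C * \<bar>g x\<bar>" "0 \<le> C" shows "nrm S f \<le> C * nrm S g"
proof -
  have "nrm S f \<le> nrm S (\<lambda>x. C * g x)"
    using assms by (intro nrm_mono sqi_cmult) (auto simp: abs_mult)
  also have "\<dots> = C * nrm S g" unfolding nrm_def using assms(4)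
    by (simp add: power_mult_distrib real_sqrt_mult)
  finally show ?thesis .
qed

lemma nrm_triangle:
  assumes "sqi S f" "sqi S g" shows "nrm S (\<lambda>x. f x + g x) \<le> nrm S f + nrm S g"
proof (rule power2_le_imp_le)
  have i: "set_integrable lborel S (\<lambda>x. (f x)\<^sup>2)" "set_integrable lborel S (\<lambda>x. (g x)\<^sup>2)"
     "set_integrable lborel S (\<lambda>x. f x * g x)"
    using assms sqi_mult_integrable unfolding sqi_def by auto
  have "(nrm S (\<lambda>x. f x + g x))\<^sup>2 = (LINT x:S|lborel. (f x)\<^sup>2 + 2 * (f x * g x) + (g x)\<^sup>2)"
    unfolding nrm_sq by (simp add: power2_sum algebra_simps)
  also have "\<dots> = (nrm S f)\<^sup>2 + 2 * (LINT x:S|lborel. f x * g x) + (nrm S g)\<^sup>2"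
    using i by (simp add: set_integral_add set_integrable_mult_right nrm_sq)
  also have "\<dots> \<le> (nrm S f)\<^sup>2 + 2 * (nrm S f * nrm S g) + (nrm S g)\<^sup>2"
    using sqi_cs[OF assms] by linarith
  finally show "(nrm S (\<lambda>x. f x + g x))\<^sup>2 \<le> (nrm S f + nrm S g)\<^sup>2" by (simp add: power2_sum algebra_simps)
qed simp

lemma set_fubini:
  fixes f :: "real \<times> real \<Rightarrow> real"
  assumes f: "set_integrable lborel (A \<times> B) f"
  shows set_fubini_tx: "(LINT z:A \<times> B|lborel. f z) = (LINT t:A|lborel. LINT x:B|lborel. f (t, x))"
    and set_fubini_xt: "(LINT z:A \<times> B|lborel. f z) = (LINT x:B|lborel. LINT t:A|lborel. f (t, x))"
    and set_fubini_tx_int: "set_integrable lborel A (\<lambda>t. LINT x:B|lborel. f (t, x))"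
    and set_fubini_xt_int: "set_integrable lborel B (\<lambda>x. LINT t:A|lborel. f (t, x))"
proof -
  let ?g = "\<lambda>z. indicator (A \<times> B) z *\<^sub>R f z"
  have i: "integrable (lborel \<Otimes>\<^sub>M lborel) (\<lambda>(t,x). ?g (t,x))"
    using f unfolding set_integrable_def lborel_prod by (subst case_prod_eta)
  have e1: "indicator A t *\<^sub>R (LINT x:B|lborel. f (t, x)) = (LINT x|lborel. ?g (t, x))" for t
    by (auto simp: set_lebesgue_integral_def indicator_def)
  have e2: "indicator B x *\<^sub>R (LINT t:A|lborel. f (t, x)) = (LINT t|lborel. ?g (t, x))" for x
    by (auto simp: set_lebesgue_integral_def indicator_def intro!: Bochner_Integration.integral_cong)
  have ce: "(LINT z:A \<times> B|lborel. f z) = integral\<^sup>L (lborel \<Otimes>\<^sub>M lborel) (\<lambda>(t,x). ?g (t,x))"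
    unfolding set_lebesgue_integral_def lborel_prod by (subst case_prod_eta) (rule refl)
  show "(LINT z:A \<times> B|lborel. f z) = (LINT t:A|lborel. LINT x:B|lborel. f (t, x))"
    unfolding ce using lborel_pair.integral_fst[OF i] e1 by (simp add: set_lebesgue_integral_def)
  show "(LINT z:A \<times> B|lborel. f z) = (LINT x:B|lborel. LINT t:A|lborel. f (t, x))"
    unfolding ce using lborel_pair.integral_snd[OF i] e2 by (simp add: set_lebesgue_integral_def)
  show "set_integrable lborel A (\<lambda>t. LINT x:B|lborel. f (t, x))"
    using lborel_pair.integrable_fst[OF i] e1 unfolding set_integrable_def by simp
  show "set_integrable lborel B (\<lambda>x. LINT t:A|lborel. f (t, x))"
    using lborel_pair.integrable_snd[OF i] e2 unfolding set_integrable_def by simp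
qed

lemma bfun_fst: assumes "bfun A f" shows "bfun (A \<times> B) (\<lambda>z::real\<times>real. f (fst z))"
proof -
  have [measurable]: "f \<in> borel_measurable borel" using assms by (rule bfun_meas)
  have "(\<lambda>z::real\<times>real. f (fst z)) \<in> borel_measurable borel"
    by (rule measurable_compose[OF _ \<open>f \<in> _\<close>]) (simp add: borel_prod[symmetric])
  then show ?thesis using assms unfolding bfun_def by auto
qed

lemma bfun_snd: assumes "bfun B f" shows "bfun (A \<times> B) (\<lambda>z::real\<times>real. f (snd z))"
proof -
  have [measurable]: "f \<in> borel_measurable borel" using assms by (rule bfun_meas)
  have "(\<lambda>z::real\<times>real. f (snd z)) \<in> borel_measurable borel"
    by (rule measurable_compose[OF _ \<open>f \<in> _\<close>]) (simp add: borel_prod[symmetric])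
  then show ?thesis using assms unfolding bfun_def by auto
qed

lemma bfun_slice: assumes "bfun (A \<times> B) f" "t \<in> A" shows "bfun B (\<lambda>x::real. f (t::real, x))"
proof -
  have m: "f \<in> borel_measurable borel" using assms(1) by (rule bfun_meas)
  have "(\<lambda>x. f (t, x)) \<in> borel_measurable borel"
    by (rule measurable_compose[OF _ m]) (simp add: borel_prod[symmetric])
  then show ?thesis using assms unfolding bfun_def by auto
qed

lemma bfun_slice2: assumes "bfun (A \<times> B) f" "x \<in> B" shows "bfun A (\<lambda>t::real. f (t, x::real))"
proof -
  have m: "f \<in> borel_measurable borel" using assms(1) by (rule bfun_meas)
  have "(\<lambda>t. f (t, x)) \<in> borel_measurable borel"
    by (rule measurable_compose[OF _ m]) (simp add: borel_prod[symmetric])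
  then show ?thesis using assms unfolding bfun_def by auto
qed

section \<open>Inverse estimates for polynomials\<close>

lemma pcompose_power: "pcompose (p ^ n) r = pcompose p r ^ n" for p :: "'a::comm_semiring_1 poly"
  by (induction n) (simp_all add: pcompose_mult pcompose_1)

text \<open>Passing to a finite difference lowers the degree by one and multiplies the leading coefficient by a
  known factor. This is the induction step of the estimates that follow.\<close>

lemma degree_shift_diff:
  fixes q :: "real poly"
  assumes "degree q \<le> Suc k"
  shows "degree (pcompose q [:c, 1:] - q) \<le> k"
    and "coeff (pcompose q [:c, 1:] - q) k = real (Suc k) * c * coeff q (Suc k)"
proof -
  have q: "q = (\<Sum>j\<le>Suc k. smult (coeff q j) ([:0, 1:] ^ j))"
  proof -
    have "q = (\<Sum>j\<le>degree q. monom (coeff q j) j)" by (rule poly_as_sum_of_monoms[symmetric])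
    also have "\<dots> = (\<Sum>j\<le>Suc k. monom (coeff q j) j)"
      using assms by (intro sum.mono_neutral_left) (auto simp: coeff_eq_0)
    finally show ?thesis by (simp add: monom_altdef)
  qed
  have li: "coeff ([:c, 1:] ^ j) i = real (j choose i) * c ^ (j - i)" for i j
  proof (cases "i \<le> j")
    case True then show ?thesis by (simp add: coeff_linear_poly_power)
  next
    case False
    then have "coeff ([:c, 1:] ^ j) i = 0" by (intro coeff_eq_0) (simp add: degree_linear_power)
    then show ?thesis using False by (simp add: binomial_eq_0)
  qed
  have co: "coeff (pcompose q [:c, 1:]) i = (\<Sum>j\<le>Suc k. coeff q j * (real (j choose i) * c ^ (j - i)))" for i
  proof -
    have x: "pcompose [:0, 1:] [:c, 1:] = [:c, 1:]" by (simp add: pcompose_pCons)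
    have "pcompose q [:c, 1:] = pcompose (\<Sum>j\<le>Suc k. smult (coeff q j) ([:0, 1:] ^ j)) [:c, 1:]"
      using q by (rule arg_cong)
    also have "\<dots> = (\<Sum>j\<le>Suc k. smult (coeff q j) ([:c, 1:] ^ j))"
      by (simp only: pcompose_sum pcompose_smult pcompose_power x)
    finally show ?thesis by (simp only: coeff_sum coeff_smult li)
  qed
  have z: "coeff (pcompose q [:c, 1:] - q) i = 0" if "i > k" for i
  proof (cases "i = Suc k")
    case True
    have "(\<Sum>j\<le>k. coeff q j * (real (j choose i) * c ^ (j - i))) = 0"
      using True by (intro sum.neutral) (auto simp: binomial_eq_0)
    then show ?thesis using True by (simp add: co)
  next
    case False
    then have "(\<Sum>j\<le>Suc k. coeff q j * (real (j choose i) * c ^ (j - i))) = 0"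
      using that by (intro sum.neutral) (auto simp: binomial_eq_0)
    moreover have "coeff q i = 0" using False that assms by (intro coeff_eq_0) simp
    ultimately show ?thesis by (simp only: coeff_diff co)
  qed
  show "degree (pcompose q [:c, 1:] - q) \<le> k" using z by (intro degree_le) auto
  have "(\<Sum>j\<le>Suc k. coeff q j * (real (j choose k) * c ^ (j - k))) =
        (\<Sum>j\<in>{k, Suc k}. coeff q j * (real (j choose k) * c ^ (j - k)))"
    by (rule sum.mono_neutral_right) (auto simp: binomial_eq_0)
  then show "coeff (pcompose q [:c, 1:] - q) k = real (Suc k) * c * coeff q (Suc k)"
    unfolding coeff_diff co by simp
qed

lemma abs_poly_integrable: "(\<lambda>x::real. \<bar>poly q x\<bar>) integrable_on {a..b}"
  by (intro integrable_continuous_real continuous_intros)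

text \<open>By induction on the degree, with step \<open>e = H / 2\<close>: the integral of the difference \<open>q(x + e) - q(x)\<close> over
  the left half of the interval is at most that of \<open>\<bar>q\<bar>\<close> over the whole interval, because the shifted copy
  covers the right half. The argument is invariant under translation and scaling, which gives a constant that depends on
  the degree only.\<close>

lemma leading_coeff_L1:
  "\<exists>C>0. \<forall>(q::real poly) l H. degree q \<le> k \<longrightarrow> H > 0 \<longrightarrow>
     \<bar>coeff q k\<bar> * H ^ Suc k \<le> C * integral {l..l+H} (\<lambda>x. \<bar>poly q x\<bar>)"
proof (induction k)
  case 0
  show ?case
  proof (intro exI[of _ 1] conjI allI impI)
    fix q :: "real poly" and l H :: real assume "degree q \<le> 0" "H > 0"
    then obtain c where "q = [:c:]" by (metis degree_eq_zeroE le_zero_eq)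
    then show "\<bar>coeff q 0\<bar> * H ^ Suc 0 \<le> 1 * integral {l..l + H} (\<lambda>x. \<bar>poly q x\<bar>)"
      using \<open>H > 0\<close> by simp
  qed simp
next
  case (Suc k)
  then obtain C where C: "C > 0" and IH: "\<And>(q::real poly) l H. degree q \<le> k \<Longrightarrow> H > 0 \<Longrightarrow>
     \<bar>coeff q k\<bar> * H ^ Suc k \<le> C * integral {l..l+H} (\<lambda>x. \<bar>poly q x\<bar>)" by blast
  show ?case
  proof (intro exI[of _ "C * 2 ^ Suc (Suc k)"] conjI allI impI)
    fix q :: "real poly" and l H :: real assume q: "degree q \<le> Suc k" and H: "H > 0"
    define e where "e = H / 2"
    then have e: "e > 0" "H = 2 * e" using H by auto
    let ?d = "pcompose q [:e, 1:] - q"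
    have "integral {l..l+e} (\<lambda>x. \<bar>poly ?d x\<bar>) \<le> integral {l..l+e} (\<lambda>x. \<bar>poly q (x + e)\<bar> + \<bar>poly q x\<bar>)"
      by (intro integral_le integrable_continuous_real continuous_intros)
        (auto simp: poly_pcompose algebra_simps intro: abs_triangle_ineq4)
    also have "\<dots> = integral {l..l+e} (\<lambda>x. \<bar>poly q (x + e)\<bar>) + integral {l..l+e} (\<lambda>x. \<bar>poly q x\<bar>)"
      by (intro integral_add integrable_continuous_real continuous_intros)
    also have "integral {l..l+e} (\<lambda>x. \<bar>poly q (x + e)\<bar>) = integral {l+e..l+H} (\<lambda>x. \<bar>poly q x\<bar>)"
      using integral_shift_real_ivl[where a="l+e" and c=e and b="l+H" and f="\<lambda>x. \<bar>poly q x\<bar>"] e by (simp add: algebra_simps)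
    also have "\<dots> + integral {l..l+e} (\<lambda>x. \<bar>poly q x\<bar>) = integral {l..l+H} (\<lambda>x. \<bar>poly q x\<bar>)"
      using Henstock_Kurzweil_Integration.integral_combine[where a=l and c="l+e" and b="l+H" and f="\<lambda>x. \<bar>poly q x\<bar>"] e abs_poly_integrable by simp
    finally have i: "integral {l..l+e} (\<lambda>x. \<bar>poly ?d x\<bar>) \<le> integral {l..l+H} (\<lambda>x. \<bar>poly q x\<bar>)" .
    have "\<bar>coeff q (Suc k)\<bar> * e ^ Suc (Suc k) \<le> \<bar>coeff ?d k\<bar> * e ^ Suc k"
    proof -
      have "1 * (\<bar>coeff q (Suc k)\<bar> * e ^ Suc (Suc k)) \<le> real (Suc k) * (\<bar>coeff q (Suc k)\<bar> * e ^ Suc (Suc k))"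
        using e by (intro mult_right_mono) auto
      moreover have "\<bar>real (Suc k) * e * coeff q (Suc k)\<bar> = real (Suc k) * e * \<bar>coeff q (Suc k)\<bar>"
        using e by (simp only: abs_mult abs_of_nat abs_of_pos)
      ultimately show ?thesis unfolding degree_shift_diff(2)[OF q] by (simp only: power_Suc mult_ac mult_1_left mult_1_right)
    qed
    also have "\<dots> \<le> C * integral {l..l+e} (\<lambda>x. \<bar>poly ?d x\<bar>)"
      by (rule IH[OF degree_shift_diff(1)[OF q] e(1)])
    also have "\<dots> \<le> C * integral {l..l+H} (\<lambda>x. \<bar>poly q x\<bar>)" using i C by simp
    finally have "\<bar>coeff q (Suc k)\<bar> * e ^ Suc (Suc k) * 2 ^ Suc (Suc k) \<le> C * integral {l..l+H} (\<lambda>x. \<bar>poly q x\<bar>) * 2 ^ Suc (Suc k)"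
      by (rule mult_right_mono) simp
    then show "\<bar>coeff q (Suc k)\<bar> * H ^ Suc (Suc k) \<le> C * 2 ^ Suc (Suc k) * integral {l..l + H} (\<lambda>x. \<bar>poly q x\<bar>)"
      unfolding e(2) power_mult_distrib by (simp only: mult_ac)
  qed (use C in simp)
qed

text \<open>Subtracting the leading coefficient times \<open>(x - l) ^ Suc k\<close> lowers the degree and keeps the value at \<open>l\<close>; the
  estimate of the leading coefficient controls what has been subtracted.\<close>

lemma end_value_L1:
  "\<exists>C>0. \<forall>(q::real poly) l H. degree q \<le> k \<longrightarrow> H > 0 \<longrightarrow>
     \<bar>poly q l\<bar> * H \<le> C * integral {l..l+H} (\<lambda>x. \<bar>poly q x\<bar>)"
proof (induction k)
  case 0
  show ?case
  proof (intro exI[of _ 1] conjI allI impI)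
    fix q :: "real poly" and l H :: real assume "degree q \<le> 0" "H > 0"
    then obtain c where "q = [:c:]" by (metis degree_eq_zeroE le_zero_eq)
    then show "\<bar>poly q l\<bar> * H \<le> 1 * integral {l..l + H} (\<lambda>x. \<bar>poly q x\<bar>)"
      using \<open>H > 0\<close> by simp
  qed simp
next
  case (Suc k)
  then obtain C where C: "C > 0" and IH: "\<And>(q::real poly) l H. degree q \<le> k \<Longrightarrow> H > 0 \<Longrightarrow>
     \<bar>poly q l\<bar> * H \<le> C * integral {l..l+H} (\<lambda>x. \<bar>poly q x\<bar>)" by blast
  obtain D where D: "D > 0" and lead: "\<And>(q::real poly) l H. degree q \<le> Suc k \<Longrightarrow> H > 0 \<Longrightarrow>
     \<bar>coeff q (Suc k)\<bar> * H ^ Suc (Suc k) \<le> D * integral {l..l+H} (\<lambda>x. \<bar>poly q x\<bar>)"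
    using leading_coeff_L1[of "Suc k"] by blast
  show ?case
  proof (intro exI[of _ "C * (1 + D)"] conjI allI impI)
    fix q :: "real poly" and l H :: real assume q: "degree q \<le> Suc k" and H: "H > 0"
    let ?a = "coeff q (Suc k)"
    let ?m = "[:-l, 1:] ^ Suc k :: real poly"
    define d where "d = q - smult ?a ?m"
    have dm: "degree ?m = Suc k" using degree_linear_power[of "-l" "Suc k"] by simp
    have lm: "coeff ?m (Suc k) = 1" by (rule coeff_linear_power)
    have "coeff d i = 0" if "i > k" for i
    proof (cases "i = Suc k")
      case True then show ?thesis unfolding d_def coeff_diff coeff_smult True lm by simp
    next
      case False
      then have "coeff q i = 0" "coeff ?m i = 0"
        using that q dm by (auto intro!: coeff_eq_0 simp del: power_Suc)
      then show ?thesis unfolding d_def by (simp del: power_Suc)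
    qed
    then have dd: "degree d \<le> k" by (intro degree_le) auto
    have pd: "poly d x = poly q x - ?a * (x - l) ^ Suc k" for x unfolding d_def by (simp add: algebra_simps)
    have "integral {l..l+H} (\<lambda>x. \<bar>poly d x\<bar>) \<le> integral {l..l+H} (\<lambda>x. \<bar>poly q x\<bar> + \<bar>?a\<bar> * H ^ Suc k)"
    proof (intro integral_le integrable_continuous_real continuous_intros)
      fix x assume x: "x \<in> {l..l+H}"
      have "\<bar>poly d x\<bar> \<le> \<bar>poly q x\<bar> + \<bar>?a * (x - l) ^ Suc k\<bar>" unfolding pd by (rule abs_triangle_ineq4)
      also have "\<bar>?a * (x - l) ^ Suc k\<bar> \<le> \<bar>?a\<bar> * H ^ Suc k"
        unfolding abs_mult power_abs using x by (intro mult_left_mono power_mono) auto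
      finally show "\<bar>poly d x\<bar> \<le> \<bar>poly q x\<bar> + \<bar>?a\<bar> * H ^ Suc k" by simp
    qed
    also have "\<dots> = integral {l..l+H} (\<lambda>x. \<bar>poly q x\<bar>) + \<bar>?a\<bar> * H ^ Suc (Suc k)"
      using H by (subst integral_add[OF abs_poly_integrable]) (auto simp: algebra_simps)
    also have "\<dots> \<le> (1 + D) * integral {l..l+H} (\<lambda>x. \<bar>poly q x\<bar>)"
      using lead[OF q H, of l] by (simp add: algebra_simps)
    finally have i: "integral {l..l+H} (\<lambda>x. \<bar>poly d x\<bar>) \<le> (1 + D) * integral {l..l+H} (\<lambda>x. \<bar>poly q x\<bar>)" .
    have "\<bar>poly q l\<bar> * H = \<bar>poly d l\<bar> * H" unfolding pd by simp
    also have "\<dots> \<le> C * integral {l..l+H} (\<lambda>x. \<bar>poly d x\<bar>)" by (rule IH[OF dd H])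
    also have "\<dots> \<le> C * ((1 + D) * integral {l..l+H} (\<lambda>x. \<bar>poly q x\<bar>))" using i C by simp
    finally show "\<bar>poly q l\<bar> * H \<le> C * (1 + D) * integral {l..l+H} (\<lambda>x. \<bar>poly q x\<bar>)" by (simp add: mult.assoc)
  qed (use C D in simp)
qed

lemma sq_integral_abs:
  fixes f :: "real \<Rightarrow> real" assumes f: "continuous_on UNIV f" and ab: "a \<le> b"
  shows "(integral {a..b} (\<lambda>x. \<bar>f x\<bar>))\<^sup>2 \<le> (b - a) * integral {a..b} (\<lambda>x. (f x)\<^sup>2)"
proof -
  have b: "bfun {a..b} (\<lambda>x. \<bar>f x\<bar>)" "bfun {a..b} (\<lambda>x. 1)"
    by (intro bfun_continuous continuous_intros bounded_closed_interval f)+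
  then have s: "sqi {a..b} (\<lambda>x. \<bar>f x\<bar>)" "sqi {a..b} (\<lambda>x. 1)"
    by (auto intro!: bfun_sqi)
  have "\<bar>LINT x:{a..b}|lborel. \<bar>f x\<bar> * 1\<bar>\<^sup>2 \<le> (nrm {a..b} (\<lambda>x. \<bar>f x\<bar>) * nrm {a..b} (\<lambda>x. 1))\<^sup>2"
    by (rule power_mono[OF sqi_cs[OF s]]) simp
  also have "\<dots> = (LINT x:{a..b}|lborel. (f x)\<^sup>2) * (LINT x:{a..b}|lborel. 1)"
    unfolding power_mult_distrib nrm_sq by simp
  also have "(LINT x:{a..b}|lborel. (1::real)) = integral {a..b} (\<lambda>x. 1)"
    by (rule set_borel_integral_eq_integral(2)) (use bfun_integrable[OF b(2)] in auto)
  also have "\<dots> = b - a" using ab by simp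
  also have "(LINT x:{a..b}|lborel. (f x)\<^sup>2) = integral {a..b} (\<lambda>x. (f x)\<^sup>2)"
    by (rule set_borel_integral_eq_integral(2)) (use bfun_integrable[OF bfun_power[OF b(1), of 2]] in auto)
  finally have "(LINT x:{a..b}|lborel. \<bar>f x\<bar>)\<^sup>2 \<le> (b - a) * integral {a..b} (\<lambda>x. (f x)\<^sup>2)"
    by (simp add: mult.commute)
  moreover have "(LINT x:{a..b}|lborel. \<bar>f x\<bar>) = integral {a..b} (\<lambda>x. \<bar>f x\<bar>)"
    by (rule set_borel_integral_eq_integral(2)) (use bfun_integrable[OF b(1)] in auto)
  ultimately show ?thesis by simp
qed

lemma sq_integral_abs_poly:
  fixes q :: "real poly" assumes "H > 0"
  shows "(integral {l..l+H} (\<lambda>x. \<bar>poly q x\<bar>))\<^sup>2 \<le> H * integral {l..l+H} (\<lambda>x. (poly q x)\<^sup>2)"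
  using sq_integral_abs[of "poly q" l "l+H"] assms by (simp add: continuous_intros)

lemma leading_coeff_L2:
  obtains C where "C > 0" "\<And>(q::real poly) a b. degree q \<le> k \<Longrightarrow> a < b \<Longrightarrow>
     (coeff q k)\<^sup>2 * (b - a) ^ (2 * k + 1) \<le> C * integral {a..b} (\<lambda>x. (poly q x)\<^sup>2)"
proof -
  obtain C where C: "C > 0" and c: "\<And>(q::real poly) l H. degree q \<le> k \<Longrightarrow> H > 0 \<Longrightarrow>
     \<bar>coeff q k\<bar> * H ^ Suc k \<le> C * integral {l..l+H} (\<lambda>x. \<bar>poly q x\<bar>)" using leading_coeff_L1[of k] by blast
  show thesis
  proof (rule that[of "C\<^sup>2"])
    fix q :: "real poly" and a b :: real assume q: "degree q \<le> k" "a < b"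
    let ?H = "b - a"
    have H: "?H > 0" "a + ?H = b" using q by auto
    have l1: "(\<bar>coeff q k\<bar> * ?H ^ Suc k)\<^sup>2 = ?H * ((coeff q k)\<^sup>2 * ?H ^ (2 * k + 1))"
      by (simp add: power2_eq_square power_add mult_2)
    have "(\<bar>coeff q k\<bar> * ?H ^ Suc k)\<^sup>2 \<le> (C * integral {a..a+?H} (\<lambda>x. \<bar>poly q x\<bar>))\<^sup>2"
      using H by (intro power_mono c q) auto
    also have "\<dots> \<le> C\<^sup>2 * (?H * integral {a..a+?H} (\<lambda>x. (poly q x)\<^sup>2))"
      unfolding power_mult_distrib using sq_integral_abs_poly[OF H(1), of a q] by (intro mult_left_mono) auto
    finally have "?H * ((coeff q k)\<^sup>2 * ?H ^ (2 * k + 1)) \<le> ?H * (C\<^sup>2 * integral {a..b} (\<lambda>x. (poly q x)\<^sup>2))"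
      unfolding l1 H(2) by (simp only: mult_ac)
    then show "(coeff q k)\<^sup>2 * ?H ^ (2 * k + 1) \<le> C\<^sup>2 * integral {a..b} (\<lambda>x. (poly q x)\<^sup>2)"
      using H(1) by simp
  qed (use C in simp)
qed

lemma end_value_L2:
  obtains C where "C > 0" "\<And>(q::real poly) a b. degree q \<le> k \<Longrightarrow> a < b \<Longrightarrow>
     (poly q a)\<^sup>2 * (b - a) \<le> C * integral {a..b} (\<lambda>x. (poly q x)\<^sup>2)"
proof -
  obtain C where C: "C > 0" and c: "\<And>(q::real poly) l H. degree q \<le> k \<Longrightarrow> H > 0 \<Longrightarrow>
     \<bar>poly q l\<bar> * H \<le> C * integral {l..l+H} (\<lambda>x. \<bar>poly q x\<bar>)" using end_value_L1[of k] by blast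
  show thesis
  proof (rule that[of "C\<^sup>2"])
    fix q :: "real poly" and a b :: real assume q: "degree q \<le> k" "a < b"
    let ?H = "b - a"
    have H: "?H > 0" "a + ?H = b" using q by auto
    have l1: "(\<bar>poly q a\<bar> * ?H)\<^sup>2 = ?H * ((poly q a)\<^sup>2 * ?H)" by (simp add: power2_eq_square)
    have "(\<bar>poly q a\<bar> * ?H)\<^sup>2 \<le> (C * integral {a..a+?H} (\<lambda>x. \<bar>poly q x\<bar>))\<^sup>2"
      using H by (intro power_mono c q) auto
    also have "\<dots> \<le> C\<^sup>2 * (?H * integral {a..a+?H} (\<lambda>x. (poly q x)\<^sup>2))"
      unfolding power_mult_distrib using sq_integral_abs_poly[OF H(1), of a q] by (intro mult_left_mono) auto
    finally have "?H * ((poly q a)\<^sup>2 * ?H) \<le> ?H * (C\<^sup>2 * integral {a..b} (\<lambda>x. (poly q x)\<^sup>2))"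
      unfolding l1 H(2) by (simp only: mult_ac)
    then show "(poly q a)\<^sup>2 * ?H \<le> C\<^sup>2 * integral {a..b} (\<lambda>x. (poly q x)\<^sup>2)"
      using H(1) by simp
  qed (use C in simp)
qed

text \<open>The constants of the two inverse estimates are named because they enter the final constant, which may depend
  on the degree but not on the mesh.\<close>

definition lead_const :: "nat \<Rightarrow> real" where
  "lead_const k = (SOME C. C > 0 \<and> (\<forall>(q::real poly) a b. degree q \<le> k \<longrightarrow> a < b \<longrightarrow>
     (coeff q k)\<^sup>2 * (b - a) ^ (2 * k + 1) \<le> C * integral {a..b} (\<lambda>x. (poly q x)\<^sup>2)))"

definition end_const :: "nat \<Rightarrow> real" where
  "end_const k = (SOME C. C > 0 \<and> (\<forall>(q::real poly) a b. degree q \<le> k \<longrightarrow> a < b \<longrightarrow>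
     (poly q a)\<^sup>2 * (b - a) \<le> C * integral {a..b} (\<lambda>x. (poly q x)\<^sup>2)))"

lemma lead_const: "lead_const k > 0"
  "\<And>(q::real poly) a b. degree q \<le> k \<Longrightarrow> a < b \<Longrightarrow>
     (coeff q k)\<^sup>2 * (b - a) ^ (2 * k + 1) \<le> lead_const k * integral {a..b} (\<lambda>x. (poly q x)\<^sup>2)"
proof -
  have "\<exists>C. C > 0 \<and> (\<forall>(q::real poly) a b. degree q \<le> k \<longrightarrow> a < b \<longrightarrow>
     (coeff q k)\<^sup>2 * (b - a) ^ (2 * k + 1) \<le> C * integral {a..b} (\<lambda>x. (poly q x)\<^sup>2))"
    using leading_coeff_L2[of k] by metis
  from someI_ex[OF this, folded lead_const_def]
  show "lead_const k > 0" "\<And>(q::real poly) a b. degree q \<le> k \<Longrightarrow> a < b \<Longrightarrow>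
     (coeff q k)\<^sup>2 * (b - a) ^ (2 * k + 1) \<le> lead_const k * integral {a..b} (\<lambda>x. (poly q x)\<^sup>2)" by blast+
qed

lemma end_const: "end_const k > 0"
  "\<And>(q::real poly) a b. degree q \<le> k \<Longrightarrow> a < b \<Longrightarrow>
     (poly q a)\<^sup>2 * (b - a) \<le> end_const k * integral {a..b} (\<lambda>x. (poly q x)\<^sup>2)"
proof -
  have "\<exists>C. C > 0 \<and> (\<forall>(q::real poly) a b. degree q \<le> k \<longrightarrow> a < b \<longrightarrow>
     (poly q a)\<^sup>2 * (b - a) \<le> C * integral {a..b} (\<lambda>x. (poly q x)\<^sup>2))"
    using end_value_L2[of k] by metis
  from someI_ex[OF this, folded end_const_def]
  show "end_const k > 0" "\<And>(q::real poly) a b. degree q \<le> k \<Longrightarrow> a < b \<Longrightarrow>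
     (poly q a)\<^sup>2 * (b - a) \<le> end_const k * integral {a..b} (\<lambda>x. (poly q x)\<^sup>2)" by blast+
qed

section \<open>Piecewise polynomials on a division of an interval\<close>

lemma pderiv_sum: "pderiv (sum f I) = (\<Sum>i\<in>I. pderiv (f i))"
  by (induction I rule: infinite_finite_induct) (simp_all add: pderiv_add)

lemma bounded_Ioo: "bounded {a<..<b::real}"
  by (metis bounded_box box_real(1))

lemma LINT_continuous:
  fixes f :: "real \<Rightarrow> real" assumes "continuous_on UNIV f"
  shows "(LINT x:{a..b}|lborel. f x) = integral {a..b} f"
    and "(LINT x:{a<..<b}|lborel. f x) = integral {a..b} f"
proof -
  have b: "bfun {a..b} f" "bfun {a<..<b} f"
    using assms by (intro bfun_continuous bounded_closed_interval bounded_Ioo; simp)+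
  then have i: "set_integrable lborel {a..b} f" "set_integrable lborel {a<..<b} f"
    by (auto intro!: bfun_integrable)
  show "(LINT x:{a..b}|lborel. f x) = integral {a..b} f"
    by (rule set_borel_integral_eq_integral(2)[OF i(1)])
  show "(LINT x:{a<..<b}|lborel. f x) = integral {a..b} f"
    unfolding integral_open_interval_real by (rule set_borel_integral_eq_integral(2)[OF i(2)])
qed

text \<open>Continuity at the exceptional points makes the boundary terms of neighbouring intervals cancel.\<close>

lemma ftc_piecewise:
  fixes F F' :: "real \<Rightarrow> real"
  assumes "finite N" "a \<le> b" "continuous_on {a..b} F"
    and "\<And>x. x \<in> {a<..<b} - N \<Longrightarrow> (F has_vector_derivative F' x) (at x)" and "bfun {a..b} F'"
  shows "(LINT x:{a..b}|lborel. F' x) = F b - F a"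
proof -
  have "set_integrable lborel {a..b} F'" using assms(5) by (intro bfun_integrable) auto
  then have "(LINT x:{a..b}|lborel. F' x) = integral {a..b} F'"
    by (rule set_borel_integral_eq_integral(2))
  also have "\<dots> = F b - F a"
    by (rule integral_unique[OF fundamental_theorem_of_calculus_interior_strong[OF assms(1,2) assms(4,3)]]) auto
  finally show ?thesis .
qed

lemma LINT_cong_off_finite:
  fixes f g :: "real \<Rightarrow> real"
  assumes "finite N" "S \<in> sets borel" "f \<in> borel_measurable borel" "g \<in> borel_measurable borel"
   "\<And>x. x \<in> S - N \<Longrightarrow> f x = g x"
  shows "(LINT x:S|lborel. f x) = (LINT x:S|lborel. g x)"
proof (rule set_lebesgue_integral_cong_AE)
  have "AE x in lborel. x \<notin> N" using assms(1) by (intro AE_not_in) (simp add: finite_imp_null_set_lborel)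
  then show "AE x\<in>S in lborel. f x = g x" by eventually_elim (use assms(5) in auto)
qed (use assms in auto)

definition lo :: "real set \<Rightarrow> real" where "lo \<tau> = Inf \<tau>"
definition hi :: "real set \<Rightarrow> real" where "hi \<tau> = Sup \<tau>"

locale mesh =
  fixes al be h :: real and \<T> :: "real set set" and k :: nat
  assumes ab: "al < be" and h0: "h > 0" and div: "\<T> division_of {al..be}"
    and ne: "\<And>\<tau>. \<tau> \<in> \<T> \<Longrightarrow> interior \<tau> \<noteq> {}" and diam: "\<And>\<tau>. \<tau> \<in> \<T> \<Longrightarrow> diameter \<tau> \<le> h"
    and k1: "1 \<le> k"
begin

lemma elem:
  assumes "\<tau> \<in> \<T>"
  shows "\<tau> = {lo \<tau>..hi \<tau>}" "lo \<tau> < hi \<tau>" "hi \<tau> - lo \<tau> \<le> h" "al \<le> lo \<tau>" "hi \<tau> \<le> be"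
    "interior \<tau> = {lo \<tau><..<hi \<tau>}"
proof -
  obtain a b where t: "\<tau> = {a..b}" using division_ofD(4)[OF div assms] by auto
  have lt: "a < b" using ne[OF assms] unfolding t by (auto simp: interior_atLeastAtMost_real)
  then have l: "lo \<tau> = a" "hi \<tau> = b" unfolding lo_def hi_def t by auto
  have "\<tau> \<subseteq> {al..be}" using division_ofD(2)[OF div assms] .
  then show "al \<le> lo \<tau>" "hi \<tau> \<le> be" using lt l t by auto
  show "\<tau> = {lo \<tau>..hi \<tau>}" "lo \<tau> < hi \<tau>" "interior \<tau> = {lo \<tau><..<hi \<tau>}"
    using t l lt by (auto simp: interior_atLeastAtMost_real)
  have "dist b a \<le> diameter \<tau>" using t lt by (intro diameter_bounded_bound) auto
  then show "hi \<tau> - lo \<tau> \<le> h" using diam[OF assms] lt l by (simp add: dist_real_def)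
qed

lemma fin: "finite \<T>" using div by (rule division_of_finite)

lemma cover: "x \<in> {al..be} \<Longrightarrow> \<exists>\<tau>\<in>\<T>. x \<in> \<tau>" using division_ofD(6)[OF div] by auto

lemma sub: "\<tau> \<in> \<T> \<Longrightarrow> \<tau> \<subseteq> {al..be}" using division_ofD(2)[OF div] .

lemma disj: "\<tau> \<in> \<T> \<Longrightarrow> \<tau>' \<in> \<T> \<Longrightarrow> x \<in> interior \<tau> \<Longrightarrow> x \<in> \<tau>' \<Longrightarrow> \<tau>' = \<tau>"
proof (rule ccontr)
  assume a: "\<tau> \<in> \<T>" "\<tau>' \<in> \<T>" "x \<in> interior \<tau>" "x \<in> \<tau>'" "\<tau>' \<noteq> \<tau>"
  have x: "lo \<tau> < x" "x < hi \<tau>" "lo \<tau>' \<le> x" "x \<le> hi \<tau>'" "lo \<tau>' < hi \<tau>'"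
    using a(3,4) elem[OF a(1)] elem[OF a(2)] by auto
  define y where "y = (max (lo \<tau>) (lo \<tau>') + min (hi \<tau>) (hi \<tau>')) / 2"
  have "y \<in> interior \<tau>" "y \<in> interior \<tau>'"
    unfolding elem(6)[OF a(1)] elem(6)[OF a(2)] y_def using x by (auto simp: max_def min_def)
  moreover have "interior \<tau> \<inter> interior \<tau>' = {}" using division_ofD(5)[OF div a(1,2)] a(5) by auto
  ultimately show False by blast
qed

definition nodes :: "real set" where "nodes = lo ` \<T> \<union> hi ` \<T>"

lemma fin_nodes: "finite nodes" unfolding nodes_def using fin by auto

lemma off_nodes: assumes "x \<in> {al..be} - nodes" shows "\<exists>\<tau>\<in>\<T>. x \<in> interior \<tau>"
proof -
  obtain \<tau> where t: "\<tau> \<in> \<T>" "x \<in> \<tau>" using cover assms by blast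
  then have "x \<noteq> lo \<tau>" "x \<noteq> hi \<tau>" using assms unfolding nodes_def by auto
  moreover have "x \<in> {lo \<tau>..hi \<tau>}" using t elem(1)[OF t(1)] by simp
  ultimately have "x \<in> interior \<tau>" unfolding elem(6)[OF t(1)] by auto
  then show ?thesis using t by blast
qed

lemma node_not_int: "x \<in> nodes \<Longrightarrow> \<tau> \<in> \<T> \<Longrightarrow> x \<notin> interior \<tau>"
proof
  assume a: "x \<in> nodes" "\<tau> \<in> \<T>" "x \<in> interior \<tau>"
  then obtain \<tau>' where t: "\<tau>' \<in> \<T>" "x = lo \<tau>' \<or> x = hi \<tau>'" unfolding nodes_def by auto
  then have "x \<in> \<tau>'" using elem[OF t(1)] by (metis atLeastAtMost_iff less_imp_le order_refl)
  then have "\<tau>' = \<tau>" using disj[OF a(2) t(1) a(3)] by simp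
  then show False using a(3) t(2) elem(6)[OF a(2)] by auto
qed

lemma interior_borel: "\<tau> \<in> \<T> \<Longrightarrow> interior \<tau> \<in> sets borel" using open_interior[of \<tau>] by (rule borel_open)

text \<open>Derivatives of piecewise polynomials and bubbles are given element by element. Using the interiors
  makes the sum below have at most one term; its value at the nodes is 0.\<close>

definition esum :: "(real set \<Rightarrow> real \<Rightarrow> real) \<Rightarrow> real \<Rightarrow> real" where
  "esum F x = (\<Sum>\<tau>\<in>\<T>. indicator (interior \<tau>) x * F \<tau> x)"

lemma esum_in: assumes "\<tau> \<in> \<T>" "x \<in> interior \<tau>" shows "esum F x = F \<tau> x"
proof -
  have "indicator (interior \<tau>') x * F \<tau>' x = (if \<tau>' = \<tau> then F \<tau> x else 0)" if "\<tau>' \<in> \<T>" for \<tau>'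
  proof (cases "\<tau>' = \<tau>")
    case False
    then have "x \<notin> interior \<tau>'" using disj[OF that assms(1)] assms(2) interior_subset by blast
    then show ?thesis using False by simp
  qed (use assms in simp)
  then have "esum F x = (\<Sum>\<tau>'\<in>\<T>. if \<tau>' = \<tau> then F \<tau> x else 0)" unfolding esum_def by (rule sum.cong[OF refl])
  then show ?thesis using fin assms(1) by simp
qed

lemma esum_out: assumes "\<And>\<tau>. \<tau> \<in> \<T> \<Longrightarrow> x \<notin> interior \<tau>" shows "esum F x = 0"
  unfolding esum_def using assms by simp

lemma esum_node: "x \<in> nodes \<Longrightarrow> esum F x = 0" using node_not_int by (intro esum_out) auto

lemma esum_bfun:
  assumes "\<And>\<tau>. \<tau> \<in> \<T> \<Longrightarrow> continuous_on UNIV (F \<tau>)" shows "bfun S (esum F)"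
proof -
  have "\<exists>C. \<forall>x. \<bar>indicator (interior \<tau>) x * F \<tau> x\<bar> \<le> C" if t: "\<tau> \<in> \<T>" for \<tau>
  proof -
    have "bounded \<tau>" using elem(1)[OF t] by (metis bounded_closed_interval)
    then obtain C where "\<forall>x\<in>\<tau>. \<bar>F \<tau> x\<bar> \<le> C" using bfun_continuous[OF assms[OF t]] unfolding bfun_def by blast
    then have "\<forall>x. \<bar>indicator (interior \<tau>) x * F \<tau> x\<bar> \<le> \<bar>C\<bar>"
      using interior_subset[of \<tau>] by (force simp: indicator_def)
    then show ?thesis by blast
  qed
  moreover have "(\<lambda>x. indicator (interior \<tau>) x * F \<tau> x) \<in> borel_measurable borel" if "\<tau> \<in> \<T>" for \<tau>
    using interior_borel[OF that] borel_measurable_continuous_onI[OF assms[OF that]] by measurable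
  ultimately show ?thesis unfolding esum_def by (intro bfun_sum) (unfold bfun_def, blast)
qed

lemma esum_cases:
  obtains \<tau> where "\<tau> \<in> \<T>" "x \<in> interior \<tau>" "\<And>F. esum F x = F \<tau> x" | "\<And>F. esum F x = 0"
    "\<And>\<tau>. \<tau> \<in> \<T> \<Longrightarrow> x \<notin> interior \<tau>"
  using esum_in esum_out by metis

text \<open>A zone cuts no element, so an estimate that holds on every element may be summed over it.\<close>

definition zone :: "real set \<Rightarrow> bool" where
  "zone Z \<longleftrightarrow> Z \<in> sets borel \<and> Z \<subseteq> {al..be} \<and> (\<forall>\<tau>\<in>\<T>. \<tau> \<subseteq> Z \<or> interior \<tau> \<inter> Z = {})"

lemma zone_all: "zone {al..be}" unfolding zone_def using sub by auto

lemma zone_LINT: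
  assumes Z: "zone Z" and F: "\<And>\<tau>. \<tau> \<in> \<T> \<Longrightarrow> continuous_on UNIV (F \<tau>)"
  shows "(LINT x:Z|lborel. esum F x) = (\<Sum>\<tau>\<in>{\<tau>\<in>\<T>. \<tau> \<subseteq> Z}. integral \<tau> (F \<tau>))"
proof -
  have i: "integrable lborel (\<lambda>x. indicator (interior \<tau>) x *\<^sub>R F \<tau> x)" if "\<tau> \<in> \<T>" for \<tau>
    using bfun_integrable[OF bfun_continuous[OF F[OF that]], of "interior \<tau>"] elem(6)[OF that]
    unfolding set_integrable_def by (metis bounded_Ioo borel_open open_interior)
  have "(LINT x:Z|lborel. esum F x) = (LINT x|lborel. (\<Sum>\<tau>\<in>{\<tau>\<in>\<T>. \<tau> \<subseteq> Z}. indicator (interior \<tau>) x *\<^sub>R F \<tau> x))"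
    unfolding set_lebesgue_integral_def
  proof (rule Bochner_Integration.integral_cong[OF refl])
    fix x
    have "indicator Z x *\<^sub>R esum F x = (\<Sum>\<tau>\<in>\<T>. indicator Z x * (indicator (interior \<tau>) x * F \<tau> x))"
      unfolding esum_def by (simp add: sum_distrib_left)
    also have "\<dots> = (\<Sum>\<tau>\<in>{\<tau>\<in>\<T>. \<tau> \<subseteq> Z}. indicator (interior \<tau>) x *\<^sub>R F \<tau> x)"
    proof (rule sum.mono_neutral_cong_right)
      show "finite \<T>" by (rule fin)
      show "\<forall>\<tau>\<in>\<T> - {\<tau> \<in> \<T>. \<tau> \<subseteq> Z}. indicator Z x * (indicator (interior \<tau>) x * F \<tau> x) = 0"
        using Z unfolding zone_def by (auto simp: indicator_def)
      show "indicator Z x * (indicator (interior \<tau>) x * F \<tau> x) = indicator (interior \<tau>) x *\<^sub>R F \<tau> x"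
        if "\<tau> \<in> {\<tau> \<in> \<T>. \<tau> \<subseteq> Z}" for \<tau>
        using that interior_subset[of \<tau>] by (auto simp: indicator_def)
    qed auto
    finally show "indicator Z x *\<^sub>R esum F x = (\<Sum>\<tau>\<in>{\<tau>\<in>\<T>. \<tau> \<subseteq> Z}. indicator (interior \<tau>) x *\<^sub>R F \<tau> x)" .
  qed
  also have "\<dots> = (\<Sum>\<tau>\<in>{\<tau>\<in>\<T>. \<tau> \<subseteq> Z}. LINT x|lborel. indicator (interior \<tau>) x *\<^sub>R F \<tau> x)"
    using i by (intro Bochner_Integration.integral_sum) auto
  also have "\<dots> = (\<Sum>\<tau>\<in>{\<tau>\<in>\<T>. \<tau> \<subseteq> Z}. integral \<tau> (F \<tau>))"
  proof (rule sum.cong[OF refl])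
    fix \<tau> assume "\<tau> \<in> {\<tau>\<in>\<T>. \<tau> \<subseteq> Z}"
    then have t: "\<tau> \<in> \<T>" by simp
    have "(LINT x:{lo \<tau><..<hi \<tau>}|lborel. F \<tau> x) = integral {lo \<tau>..hi \<tau>} (F \<tau>)"
      by (rule LINT_continuous(2)[OF F[OF t]])
    then show "(LINT x|lborel. indicator (interior \<tau>) x *\<^sub>R F \<tau> x) = integral \<tau> (F \<tau>)"
      unfolding set_lebesgue_integral_def elem(6)[OF t] using elem(1)[OF t] by simp
  qed
  finally show ?thesis .
qed

lemma zone_LINT_mono:
  assumes Z: "zone Z" and F: "\<And>\<tau>. \<tau> \<in> \<T> \<Longrightarrow> continuous_on UNIV (F \<tau>)"
    and G: "\<And>\<tau>. \<tau> \<in> \<T> \<Longrightarrow> continuous_on UNIV (G \<tau>)"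
    and le: "\<And>\<tau>. \<tau> \<in> \<T> \<Longrightarrow> integral \<tau> (F \<tau>) \<le> C * integral \<tau> (G \<tau>)"
  shows "(LINT x:Z|lborel. esum F x) \<le> C * (LINT x:Z|lborel. esum G x)"
proof -
  have "(LINT x:Z|lborel. esum F x) = (\<Sum>\<tau>\<in>{\<tau>\<in>\<T>. \<tau> \<subseteq> Z}. integral \<tau> (F \<tau>))"
    by (rule zone_LINT[OF Z F])
  also have "\<dots> \<le> (\<Sum>\<tau>\<in>{\<tau>\<in>\<T>. \<tau> \<subseteq> Z}. C * integral \<tau> (G \<tau>))" by (rule sum_mono) (use le in auto)
  also have "\<dots> = C * (LINT x:Z|lborel. esum G x)" unfolding sum_distrib_left[symmetric]
    by (rule arg_cong[OF zone_LINT[OF Z G, symmetric]])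
  finally show ?thesis .
qed

subsection \<open>Continuous piecewise polynomials\<close>

text \<open>Continuity is implied: neighbouring elements are closed and share a node, at which both polynomials
  have the value of \<open>c\<close>.\<close>

definition pw :: "(real \<Rightarrow> real) \<Rightarrow> bool" where
  "pw c \<longleftrightarrow> (\<forall>x. x \<notin> {al..be} \<longrightarrow> c x = 0) \<and>
     (\<forall>\<tau>\<in>\<T>. \<exists>q::real poly. degree q \<le> k \<and> (\<forall>x\<in>\<tau>. c x = poly q x))"

definition ppoly :: "(real \<Rightarrow> real) \<Rightarrow> real set \<Rightarrow> real poly" where
  "ppoly c \<tau> = (SOME q. degree q \<le> k \<and> (\<forall>x\<in>\<tau>. c x = poly q x))"

lemma ppoly: assumes "pw c" "\<tau> \<in> \<T>"
  shows "degree (ppoly c \<tau>) \<le> k" "\<And>x. x \<in> \<tau> \<Longrightarrow> c x = poly (ppoly c \<tau>) x"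
proof -
  have "degree (ppoly c \<tau>) \<le> k \<and> (\<forall>x\<in>\<tau>. c x = poly (ppoly c \<tau>) x)"
    unfolding ppoly_def by (rule someI_ex) (use assms in \<open>auto simp: pw_def\<close>)
  then show "degree (ppoly c \<tau>) \<le> k" "\<And>x. x \<in> \<tau> \<Longrightarrow> c x = poly (ppoly c \<tau>) x" by auto
qed

lemma poly_uniq: assumes "\<tau> \<in> \<T>" "\<And>x. x \<in> interior \<tau> \<Longrightarrow> poly p x = poly q x" shows "p = q"
proof (rule ccontr)
  assume "p \<noteq> q"
  then have "finite {x. poly (p - q) x = 0}" by (intro poly_roots_finite) simp
  moreover have "interior \<tau> \<subseteq> {x. poly (p - q) x = 0}" using assms(2) by auto
  ultimately have "finite {lo \<tau><..<hi \<tau>}" using elem(6)[OF assms(1)] finite_subset by metis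
  then show False using elem(2)[OF assms(1)] by (simp add: infinite_Ioo)
qed

lemma ppoly_eq: assumes "pw c" "\<tau> \<in> \<T>" "\<And>x. x \<in> interior \<tau> \<Longrightarrow> c x = poly q x" shows "ppoly c \<tau> = q"
proof (rule poly_uniq[OF assms(2)])
  fix x assume x: "x \<in> interior \<tau>"
  then have "x \<in> \<tau>" using interior_subset by blast
  then show "poly (ppoly c \<tau>) x = poly q x" using ppoly(2)[OF assms(1,2)] assms(3)[OF x] by simp
qed

lemma pw_lincomb: assumes "\<And>i. i \<in> I \<Longrightarrow> pw (c i)" shows "pw (\<lambda>x. \<Sum>i\<in>I. a i * c i x)"
    and "\<tau> \<in> \<T> \<Longrightarrow> ppoly (\<lambda>x. \<Sum>i\<in>I. a i * c i x) \<tau> = (\<Sum>i\<in>I. smult (a i) (ppoly (c i) \<tau>))"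
proof -
  have e: "(\<Sum>i\<in>I. a i * c i x) = poly (\<Sum>i\<in>I. smult (a i) (ppoly (c i) \<tau>)) x" if "\<tau> \<in> \<T>" "x \<in> \<tau>" for \<tau> x
    using ppoly(2)[OF assms that] by (simp add: poly_sum)
  have d: "degree (\<Sum>i\<in>I. smult (a i) (ppoly (c i) \<tau>)) \<le> k" if "\<tau> \<in> \<T>" for \<tau>
  proof (cases "finite I")
    case True
    then show ?thesis
      using ppoly(1)[OF assms that] by (intro degree_sum_le order_trans[OF degree_smult_le]) auto
  qed simp
  show p: "pw (\<lambda>x. \<Sum>i\<in>I. a i * c i x)" unfolding pw_def
  proof (intro conjI allI impI ballI)
    fix x assume "x \<notin> {al..be}"
    then show "(\<Sum>i\<in>I. a i * c i x) = 0" using assms unfolding pw_def by (intro sum.neutral) auto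
  next
    fix \<tau> assume "\<tau> \<in> \<T>"
    then show "\<exists>q. degree q \<le> k \<and> (\<forall>x\<in>\<tau>. (\<Sum>i\<in>I. a i * c i x) = poly q x)" using d e by blast
  qed
  show "ppoly (\<lambda>x. \<Sum>i\<in>I. a i * c i x) \<tau> = (\<Sum>i\<in>I. smult (a i) (ppoly (c i) \<tau>))" if "\<tau> \<in> \<T>"
    using e[OF that] interior_subset by (intro ppoly_eq[OF p that]) blast
qed

lemma pw_zero: "pw (\<lambda>x. 0)" using pw_lincomb(1)[of "{}"] by simp

lemma pw_cont: assumes "pw c" shows "continuous_on {al..be} c"
proof -
  have "continuous_on (\<Union>\<tau>\<in>\<T>. id \<tau>) c"
  proof (rule continuous_on_closed_Union)
    show "continuous_on (id \<tau>) c" if "\<tau> \<in> \<T>" for \<tau>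
    proof -
      have "continuous_on \<tau> (poly (ppoly c \<tau>))" by (intro continuous_intros)
      then show ?thesis using ppoly(2)[OF assms that] by (simp cong: continuous_on_cong)
    qed
  qed (use fin elem(1) in \<open>auto simp: \<close>, metis closed_atLeastAtMost)
  then show ?thesis using division_ofD(6)[OF div] by simp
qed

lemma pw_bfun: assumes "pw c" shows "bfun S c"
proof -
  have e: "c = (\<lambda>x. indicator {al..be} x *\<^sub>R c x)" using assms unfolding pw_def by (intro ext) (auto simp: indicator_def)
  have m: "c \<in> borel_measurable borel"
    by (subst e) (intro borel_measurable_continuous_on_indicator pw_cont[OF assms] borel_closed closed_atLeastAtMost)
  have "bounded (c ` {al..be})" using pw_cont[OF assms] by (intro compact_imp_bounded compact_continuous_image) auto
  then obtain C where C: "\<forall>y\<in>c ` {al..be}. \<bar>y\<bar> \<le> C" unfolding bounded_iff by auto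
  have "\<bar>c x\<bar> \<le> \<bar>C\<bar>" for x
  proof (cases "x \<in> {al..be}")
    case True
    then show ?thesis using C by force
  next
    case False
    then show ?thesis using assms unfolding pw_def by simp
  qed
  then show ?thesis using m by (intro bfunI) auto
qed

definition pd :: "(real \<Rightarrow> real) \<Rightarrow> real \<Rightarrow> real" where
  "pd c = esum (\<lambda>\<tau>. poly (pderiv (ppoly c \<tau>)))"

lemma pd_bfun: "bfun S (pd c)" unfolding pd_def by (intro esum_bfun continuous_intros)

lemma pd_deriv: assumes "pw c" "x \<in> {al..be} - nodes" shows "(c has_vector_derivative pd c x) (at x)"
proof -
  obtain \<tau> where t: "\<tau> \<in> \<T>" "x \<in> interior \<tau>" using off_nodes assms(2) by blast
  have "(poly (ppoly c \<tau>) has_vector_derivative poly (pderiv (ppoly c \<tau>)) x) (at x)"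
    using poly_DERIV by (simp add: has_real_derivative_iff_has_vector_derivative[symmetric])
  then have "(c has_vector_derivative poly (pderiv (ppoly c \<tau>)) x) (at x)"
    by (rule has_vector_derivative_transform_within_open[OF _ open_interior t(2)])
      (use ppoly(2)[OF assms(1) t(1)] interior_subset in force)
  then show ?thesis unfolding pd_def esum_in[OF t] .
qed

lemma pd_lincomb: assumes "\<And>i. i \<in> I \<Longrightarrow> pw (c i)"
  shows "pd (\<lambda>x. \<Sum>i\<in>I. a i * c i x) x = (\<Sum>i\<in>I. a i * pd (c i) x)"
proof (cases rule: esum_cases[of x])
  case (1 \<tau>)
  have e: "ppoly (\<lambda>x. \<Sum>i\<in>I. a i * c i x) \<tau> = (\<Sum>i\<in>I. smult (a i) (ppoly (c i) \<tau>))"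
    by (rule pw_lincomb(2)[OF assms 1(1)])
  show ?thesis unfolding pd_def 1(3) e by (simp add: pderiv_sum pderiv_smult poly_sum)
qed (simp add: pd_def)

end

context mesh begin

lemma end_cases: assumes "\<tau> \<in> \<T>" "x \<in> \<tau>" "x \<notin> interior \<tau>" shows "x = lo \<tau> \<or> x = hi \<tau>"
proof -
  have "x \<in> {lo \<tau>..hi \<tau>}" using elem(1)[OF assms(1)] assms(2) by blast
  moreover have "x \<notin> {lo \<tau><..<hi \<tau>}" using elem(6)[OF assms(1)] assms(3) by blast
  ultimately show ?thesis by auto
qed

subsection \<open>Bubbles\<close>

text \<open>A monic polynomial of degree \<open>k + 1\<close>. It vanishes at both end points, because \<open>k \<ge> 1\<close>.\<close>

definition node_poly :: "real set \<Rightarrow> real poly" where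
  "node_poly \<tau> = [:- lo \<tau>, 1:] ^ k * [:- hi \<tau>, 1:]"

lemma poly_node_poly: "poly (node_poly \<tau>) x = (x - lo \<tau>) ^ k * (x - hi \<tau>)"
  unfolding node_poly_def by (simp add: algebra_simps)

lemma degree_node_poly: "degree (node_poly \<tau>) = Suc k" and lead_node_poly: "coeff (node_poly \<tau>) (Suc k) = 1"
proof -
  have a: "degree ([:- lo \<tau>, 1:] ^ k) = k" "coeff ([:- lo \<tau>, 1:] ^ k) k = 1"
    by (simp_all add: degree_linear_power coeff_linear_power)
  then have nz: "[:- lo \<tau>, 1:] ^ k \<noteq> 0" by auto
  have "degree (node_poly \<tau>) = degree ([:- lo \<tau>, 1:] ^ k) + degree [:- hi \<tau>, 1:]"
    unfolding node_poly_def by (rule degree_mult_eq) (use nz in auto)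
  then show d: "degree (node_poly \<tau>) = Suc k" using a by simp
  have "lead_coeff (node_poly \<tau>) = lead_coeff ([:- lo \<tau>, 1:] ^ k) * lead_coeff [:- hi \<tau>, 1:]"
    unfolding node_poly_def by (rule lead_coeff_mult)
  then show "coeff (node_poly \<tau>) (Suc k) = 1" using d a by simp
qed

lemma node_poly_le: assumes "\<tau> \<in> \<T>" "x \<in> \<tau>" shows "\<bar>poly (node_poly \<tau>) x\<bar> \<le> (hi \<tau> - lo \<tau>) ^ Suc k"
proof -
  have x: "lo \<tau> \<le> x" "x \<le> hi \<tau>" using assms(2) elem(1)[OF assms(1)] by auto
  have "\<bar>poly (node_poly \<tau>) x\<bar> = (x - lo \<tau>) ^ k * (hi \<tau> - x)" unfolding poly_node_poly abs_mult using x by simp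
  also have "\<dots> \<le> (hi \<tau> - lo \<tau>) ^ k * (hi \<tau> - lo \<tau>)" using x by (intro mult_mono power_mono) auto
  finally show ?thesis by (simp add: mult.commute)
qed

lemma node_poly_deriv_le: assumes "\<tau> \<in> \<T>" "x \<in> \<tau>"
  shows "\<bar>poly (pderiv (node_poly \<tau>)) x\<bar> \<le> real (Suc k) * (hi \<tau> - lo \<tau>) ^ k"
proof -
  have x: "lo \<tau> \<le> x" "x \<le> hi \<tau>" using assms(2) elem(1)[OF assms(1)] by auto
  obtain j where j: "k = Suc j" using k1 by (cases k) auto
  have e: "node_poly \<tau> = [:- lo \<tau>, 1:] ^ Suc j * [:- hi \<tau>, 1:]" unfolding node_poly_def using j by simp
  have "poly (pderiv (node_poly \<tau>)) x = (x - lo \<tau>) ^ Suc j + real (Suc j) * (x - lo \<tau>) ^ j * (x - hi \<tau>)"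
    unfolding e pderiv_mult pderiv_power_Suc
    by (simp add: pderiv_pCons del: power_Suc) (simp add: algebra_simps)
  also have "\<bar>\<dots>\<bar> \<le> (x - lo \<tau>) ^ Suc j + real (Suc j) * ((x - lo \<tau>) ^ j * (hi \<tau> - x))"
    using x by (intro order_trans[OF abs_triangle_ineq]) (simp add: abs_mult)
  also have "\<dots> \<le> (hi \<tau> - lo \<tau>) ^ Suc j + real (Suc j) * ((hi \<tau> - lo \<tau>) ^ j * (hi \<tau> - lo \<tau>))"
    using x by (intro add_mono mult_left_mono mult_mono power_mono) auto
  also have "\<dots> = real (Suc (Suc j)) * (hi \<tau> - lo \<tau>) ^ Suc j" by (simp add: algebra_simps)
  finally show ?thesis using j by simp
qed

definition bubble_poly :: "(real set \<Rightarrow> real poly) \<Rightarrow> real set \<Rightarrow> real poly" where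
  "bubble_poly G \<tau> = smult (coeff (G \<tau>) k) (node_poly \<tau>)"

definition bubble :: "(real set \<Rightarrow> real poly) \<Rightarrow> real \<Rightarrow> real" where
  "bubble G = esum (\<lambda>\<tau>. poly (bubble_poly G \<tau>))"

definition bubble_deriv :: "(real set \<Rightarrow> real poly) \<Rightarrow> real \<Rightarrow> real" where
  "bubble_deriv G = esum (\<lambda>\<tau>. poly (pderiv (bubble_poly G \<tau>)))"

lemma bubble_bfun: "bfun S (bubble G)" "bfun S (bubble_deriv G)"
  unfolding bubble_def bubble_deriv_def by (intro esum_bfun continuous_intros)+

lemma esum_sq: "(esum F x)\<^sup>2 = esum (\<lambda>\<tau> x. (F \<tau> x)\<^sup>2) x"
  by (cases rule: esum_cases[of x]) auto

text \<open>On an element of length \<open>H\<close>, \<open>node_poly\<close> is at most \<open>H ^ Suc k\<close> and its derivative at most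
  \<open>Suc k * H ^ k\<close>, whereas \<open>lead_const\<close> bounds the leading coefficient by \<open>H powr (- k - 1/2)\<close> times the
  \<open>L\<^sub>2\<close> norm of the polynomial. The powers of \<open>H\<close> leave one factor \<open>H \<le> h\<close> for the bubble and none for its
  derivative, uniformly over all meshes with parameter \<open>h\<close>.\<close>

lemma bubble_bound:
  assumes Z: "zone Z" and G: "\<And>\<tau>. \<tau> \<in> \<T> \<Longrightarrow> degree (G \<tau>) \<le> k"
  shows "(LINT x:Z|lborel. (bubble G x)\<^sup>2) \<le> lead_const k * h\<^sup>2 * (LINT x:Z|lborel. (esum (\<lambda>\<tau>. poly (G \<tau>)) x)\<^sup>2)"
    and "(LINT x:Z|lborel. (bubble_deriv G x)\<^sup>2) \<le> lead_const k * (real (Suc k))\<^sup>2 * (LINT x:Z|lborel. (esum (\<lambda>\<tau>. poly (G \<tau>)) x)\<^sup>2)"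
proof -
  have key: "integral \<tau> (\<lambda>x. (coeff (G \<tau>) k * f x)\<^sup>2) \<le> (lead_const k * D) * integral \<tau> (\<lambda>x. (poly (G \<tau>) x)\<^sup>2)"
    if t: "\<tau> \<in> \<T>" and f: "continuous_on UNIV f" "\<And>x. x \<in> \<tau> \<Longrightarrow> (f x)\<^sup>2 \<le> D * (hi \<tau> - lo \<tau>) ^ (2 * k)" and D: "D \<ge> 0" for \<tau> f D
  proof -
    let ?H = "hi \<tau> - lo \<tau>" let ?a = "coeff (G \<tau>) k"
    have H: "?H > 0" using elem(2)[OF t] by simp
    have te: "\<tau> = {lo \<tau>..hi \<tau>}" using elem(1)[OF t] .
    have it: "integral \<tau> g = integral {lo \<tau>..hi \<tau>} g" for g :: "real \<Rightarrow> real" using te by (rule arg_cong)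
    have "integral \<tau> (\<lambda>x. (?a * f x)\<^sup>2) \<le> integral \<tau> (\<lambda>x. ?a\<^sup>2 * (D * ?H ^ (2 * k)))"
      unfolding it
    proof (rule integral_le)
      show "(\<lambda>x. (?a * f x)\<^sup>2) integrable_on {lo \<tau>..hi \<tau>}"
        by (intro integrable_continuous_real continuous_intros continuous_on_subset[OF f(1)]) auto
      show "(?a * f x)\<^sup>2 \<le> ?a\<^sup>2 * (D * ?H ^ (2 * k))" if "x \<in> {lo \<tau>..hi \<tau>}" for x
        unfolding power_mult_distrib using that te f(2) by (intro mult_left_mono) auto
    qed auto
    also have "\<dots> = D * (?a\<^sup>2 * ?H ^ (2 * k + 1))"
      unfolding it using H by (simp add: algebra_simps)
    also have "\<dots> \<le> D * (lead_const k * integral {lo \<tau>..hi \<tau>} (\<lambda>x. (poly (G \<tau>) x)\<^sup>2))"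
      using lead_const(2)[OF G[OF t] elem(2)[OF t]] D by (intro mult_left_mono) auto
    finally show ?thesis unfolding it by (simp add: mult_ac)
  qed
  have sq: "(\<lambda>x. (esum F x)\<^sup>2) = esum (\<lambda>\<tau> x. (F \<tau> x)\<^sup>2)" for F using esum_sq by auto
  show "(LINT x:Z|lborel. (bubble G x)\<^sup>2) \<le> lead_const k * h\<^sup>2 * (LINT x:Z|lborel. (esum (\<lambda>\<tau>. poly (G \<tau>)) x)\<^sup>2)"
    unfolding bubble_def sq
  proof (rule zone_LINT_mono[OF Z])
    fix \<tau> assume t: "\<tau> \<in> \<T>"
    have "(poly (node_poly \<tau>) x)\<^sup>2 \<le> h\<^sup>2 * (hi \<tau> - lo \<tau>) ^ (2 * k)" if "x \<in> \<tau>" for x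
    proof -
      have "(poly (node_poly \<tau>) x)\<^sup>2 \<le> ((hi \<tau> - lo \<tau>) ^ Suc k)\<^sup>2"
        using node_poly_le[OF t that] by (metis abs_ge_zero power2_abs power_mono)
      also have "\<dots> = (hi \<tau> - lo \<tau>)\<^sup>2 * (hi \<tau> - lo \<tau>) ^ (2 * k)"
        by (simp add: power2_eq_square mult_2 power_add)
      also have "\<dots> \<le> h\<^sup>2 * (hi \<tau> - lo \<tau>) ^ (2 * k)"
        using elem(2,3)[OF t] by (intro mult_right_mono power_mono) auto
      finally show ?thesis .
    qed
    then show "integral \<tau> (\<lambda>x. (poly (bubble_poly G \<tau>) x)\<^sup>2) \<le> lead_const k * h\<^sup>2 * integral \<tau> (\<lambda>x. (poly (G \<tau>) x)\<^sup>2)"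
      unfolding bubble_poly_def poly_smult by (intro key t continuous_intros) auto
  qed (intro continuous_intros)+
  show "(LINT x:Z|lborel. (bubble_deriv G x)\<^sup>2) \<le> lead_const k * (real (Suc k))\<^sup>2 * (LINT x:Z|lborel. (esum (\<lambda>\<tau>. poly (G \<tau>)) x)\<^sup>2)"
    unfolding bubble_deriv_def sq
  proof (rule zone_LINT_mono[OF Z])
    fix \<tau> assume t: "\<tau> \<in> \<T>"
    have "(poly (pderiv (node_poly \<tau>)) x)\<^sup>2 \<le> (real (Suc k))\<^sup>2 * (hi \<tau> - lo \<tau>) ^ (2 * k)" if "x \<in> \<tau>" for x
    proof -
      have "(poly (pderiv (node_poly \<tau>)) x)\<^sup>2 \<le> (real (Suc k) * (hi \<tau> - lo \<tau>) ^ k)\<^sup>2"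
        using node_poly_deriv_le[OF t that] by (metis abs_ge_zero power2_abs power_mono)
      then show ?thesis by (simp only: power_mult_distrib power_mult[symmetric] mult.commute[of 2])
    qed
    then show "integral \<tau> (\<lambda>x. (poly (pderiv (bubble_poly G \<tau>)) x)\<^sup>2) \<le> lead_const k * (real (Suc k))\<^sup>2 * integral \<tau> (\<lambda>x. (poly (G \<tau>) x)\<^sup>2)"
      unfolding bubble_poly_def pderiv_smult poly_smult by (intro key t continuous_intros) auto
  qed (intro continuous_intros)+
qed

subsection \<open>Weighted test functions\<close>

text \<open>Multiplication by the weight \<open>s * (z - x)\<close> raises the degree to \<open>k + 1\<close>. The bubble has the opposite
  leading term and vanishes at the nodes, so the sum is again continuous and piecewise of degree \<open>k\<close>.\<close>

definition weighted_test :: "real \<Rightarrow> real \<Rightarrow> real set \<Rightarrow> (real \<Rightarrow> real) \<Rightarrow> real \<Rightarrow> real" where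
  "weighted_test s z Z c x = indicator Z x * (s * ((z - x) * c x + bubble (ppoly c) x))"

text \<open>A zone that meets the other elements at most in the node \<open>z\<close>. A continuous function that vanishes at
  \<open>z\<close> stays continuous when it is cut off outside such a zone.\<close>

definition end_zone :: "real \<Rightarrow> real set \<Rightarrow> bool" where
  "end_zone z Z \<longleftrightarrow> z \<in> nodes \<and> zone Z \<and> (\<forall>\<tau>\<in>\<T>. \<tau> \<subseteq> Z \<or> \<tau> \<inter> Z \<subseteq> {z})"

lemma ends_not_int: "\<tau> \<in> \<T> \<Longrightarrow> al \<notin> interior \<tau>" "\<tau> \<in> \<T> \<Longrightarrow> be \<notin> interior \<tau>"
  using elem(4-6)[of \<tau>] by auto

lemma weighted_test_pw:
  assumes c: "pw c" and Z: "end_zone z Z"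
  shows "pw (weighted_test s z Z c)"
    and "\<And>x. x \<in> {al..be} - nodes \<Longrightarrow>
       pd (weighted_test s z Z c) x = indicator Z x * (s * ((z - x) * pd c x - c x + bubble_deriv (ppoly c) x))"
    and "c al = 0 \<Longrightarrow> weighted_test s z Z c al = 0" "c be = 0 \<Longrightarrow> weighted_test s z Z c be = 0"
proof -
  define P where "P \<tau> = (if \<tau> \<subseteq> Z then smult s ([:z, -1:] * ppoly c \<tau> + bubble_poly (ppoly c) \<tau>) else 0)" for \<tau>
  have zz: "Z \<subseteq> {al..be}" "z \<in> nodes" using Z unfolding end_zone_def zone_def by auto
  have eq: "weighted_test s z Z c x = poly (P \<tau>) x" if t: "\<tau> \<in> \<T>" and x: "x \<in> \<tau>" for \<tau> x
  proof (cases "\<tau> \<subseteq> Z")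
    case True
    have "bubble (ppoly c) x = poly (bubble_poly (ppoly c) \<tau>) x"
    proof (cases "x \<in> interior \<tau>")
      case True then show ?thesis by (simp add: bubble_def esum_in[OF t])
    next
      case False
      then have l: "x = lo \<tau> \<or> x = hi \<tau>" using end_cases[OF t x] by auto
      then have "x \<in> nodes" using t unfolding nodes_def by auto
      moreover have "poly (node_poly \<tau>) x = 0" using l k1 unfolding poly_node_poly by auto
      ultimately show ?thesis unfolding bubble_def bubble_poly_def by (simp add: esum_node)
    qed
    then show ?thesis using True x ppoly(2)[OF c t x] unfolding weighted_test_def P_def by (auto simp: algebra_simps)
  next
    case False
    then have "\<tau> \<inter> Z \<subseteq> {z}" using Z t unfolding end_zone_def by auto
    moreover have "bubble (ppoly c) z = 0" unfolding bubble_def by (rule esum_node[OF zz(2)])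
    ultimately show ?thesis using False x unfolding weighted_test_def P_def by (auto simp: indicator_def)
  qed
  have deg: "degree (P \<tau>) \<le> k" if t: "\<tau> \<in> \<T>" for \<tau>
  proof (rule degree_le, intro allI impI)
    fix i assume i: "k < i"
    let ?q = "ppoly c \<tau>"
    have dq: "degree ?q \<le> k" by (rule ppoly(1)[OF c t])
    have 1: "coeff ([:z, -1:] * ?q) i = z * coeff ?q i - coeff ?q (i - 1)"
      using i by (cases i) auto
    have "coeff ([:z, -1:] * ?q + bubble_poly (ppoly c) \<tau>) i = 0"
    proof (cases "i = Suc k")
      case True
      then show ?thesis unfolding coeff_add 1 bubble_poly_def coeff_smult using dq lead_node_poly by (simp add: coeff_eq_0)
    next
      case False
      then have "coeff ?q (i - 1) = 0" "coeff ?q i = 0" "coeff (node_poly \<tau>) i = 0"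
        using i dq degree_node_poly by (auto intro!: coeff_eq_0)
      then show ?thesis unfolding coeff_add 1 bubble_poly_def coeff_smult by simp
    qed
    then show "coeff (P \<tau>) i = 0" unfolding P_def by simp
  qed
  show pw: "pw (weighted_test s z Z c)" unfolding pw_def
  proof (intro conjI allI impI ballI)
    fix x assume "x \<notin> {al..be}"
    then have "x \<notin> Z" using zz by blast
    then show "weighted_test s z Z c x = 0" unfolding weighted_test_def by simp
  next
    fix \<tau> assume "\<tau> \<in> \<T>"
    then show "\<exists>q. degree q \<le> k \<and> (\<forall>x\<in>\<tau>. weighted_test s z Z c x = poly q x)" using deg eq by blast
  qed
  show "pd (weighted_test s z Z c) x = indicator Z x * (s * ((z - x) * pd c x - c x + bubble_deriv (ppoly c) x))"
    if "x \<in> {al..be} - nodes" for x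
  proof -
    obtain \<tau> where t: "\<tau> \<in> \<T>" "x \<in> interior \<tau>" using off_nodes \<open>x \<in> _\<close> by blast
    then have xt: "x \<in> \<tau>" using interior_subset by blast
    have "ppoly (weighted_test s z Z c) \<tau> = P \<tau>" using eq[OF t(1)] interior_subset by (intro ppoly_eq[OF pw t(1)]) blast
    then have e: "pd (weighted_test s z Z c) x = poly (pderiv (P \<tau>)) x" unfolding pd_def esum_in[OF t] by simp
    show ?thesis
    proof (cases "\<tau> \<subseteq> Z")
      case True
      have pc: "pd c x = poly (pderiv (ppoly c \<tau>)) x" "bubble_deriv (ppoly c) x = poly (pderiv (bubble_poly (ppoly c) \<tau>)) x"
        unfolding pd_def bubble_deriv_def esum_in[OF t] by simp_all
      have xZ: "x \<in> Z" using True xt by blast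
      from True show ?thesis unfolding e pc using xZ ppoly(2)[OF c t(1) xt]
        by (auto simp: P_def pderiv_smult pderiv_add pderiv_mult pderiv_minus pderiv_pCons algebra_simps)
    next
      case False
      then have "x \<notin> Z" using Z t xt zz(2) node_not_int unfolding end_zone_def by blast
      then show ?thesis unfolding e using False by (simp add: P_def)
    qed
  qed
  show "c al = 0 \<Longrightarrow> weighted_test s z Z c al = 0" "c be = 0 \<Longrightarrow> weighted_test s z Z c be = 0"
    using ends_not_int unfolding weighted_test_def bubble_def by (auto simp: esum_out)
qed

subsection \<open>Linear interpolation\<close>

definition chord :: "(real \<Rightarrow> real) \<Rightarrow> real set \<Rightarrow> real \<Rightarrow> real" where
  "chord v \<tau> x = v (lo \<tau>) + (v (hi \<tau>) - v (lo \<tau>)) / (hi \<tau> - lo \<tau>) * (x - lo \<tau>)"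

definition interp :: "(real \<Rightarrow> real) \<Rightarrow> real \<Rightarrow> real" where
  "interp v x = (if x \<in> {al..be} then chord v (SOME \<tau>. \<tau> \<in> \<T> \<and> x \<in> \<tau>) x else 0)"

lemma chord_ends: assumes "\<tau> \<in> \<T>" shows "chord v \<tau> (lo \<tau>) = v (lo \<tau>)" "chord v \<tau> (hi \<tau>) = v (hi \<tau>)"
  using elem(2)[OF assms] unfolding chord_def by auto

lemma interp_in: assumes t: "\<tau> \<in> \<T>" and x: "x \<in> \<tau>" shows "interp v x = chord v \<tau> x"
proof -
  define \<tau>' where "\<tau>' = (SOME \<tau>. \<tau> \<in> \<T> \<and> x \<in> \<tau>)"
  have "\<tau>' \<in> \<T> \<and> x \<in> \<tau>'" unfolding \<tau>'_def by (rule someI[of _ \<tau>]) (use t x in auto)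
  then have t': "\<tau>' \<in> \<T>" "x \<in> \<tau>'" by auto
  have "x \<in> {al..be}" using t x sub by blast
  then have e: "interp v x = chord v \<tau>' x" unfolding interp_def \<tau>'_def by simp
  show ?thesis
  proof (cases "x \<in> interior \<tau> \<or> x \<in> interior \<tau>'")
    case True
    then have "\<tau> = \<tau>'" using disj t t' x by metis
    then show ?thesis using e by simp
  next
    case False
    then have "x = lo \<tau> \<or> x = hi \<tau>" "x = lo \<tau>' \<or> x = hi \<tau>'"
      using end_cases[OF t x] end_cases[OF t'] by auto
    then show ?thesis using e chord_ends t t' by metis
  qed
qed

lemma interp_pw: "pw (interp v)"
  and interp_pd: "\<tau> \<in> \<T> \<Longrightarrow> x \<in> interior \<tau> \<Longrightarrow> pd (interp v) x = (v (hi \<tau>) - v (lo \<tau>)) / (hi \<tau> - lo \<tau>)"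
  and interp_ends: "interp v al = v al" "interp v be = v be"
proof -
  define P where "P \<tau> = [:v (lo \<tau>) - (v (hi \<tau>) - v (lo \<tau>)) / (hi \<tau> - lo \<tau>) * lo \<tau>, (v (hi \<tau>) - v (lo \<tau>)) / (hi \<tau> - lo \<tau>):]" for \<tau>
  have P: "interp v x = poly (P \<tau>) x" if "\<tau> \<in> \<T>" "x \<in> \<tau>" for x \<tau>
  proof -
    have "a + m * (x - l) = poly [:a - m * l, m:] x" for a m l :: real by (simp add: algebra_simps)
    then show ?thesis unfolding interp_in[OF that] chord_def P_def .
  qed
  have d: "degree (P \<tau>) \<le> k" for \<tau>
    using k1 unfolding P_def by (intro order_trans[OF degree_pCons_le]) auto
  show pw: "pw (interp v)" unfolding pw_def using P d by (auto simp: interp_def)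
  show "pd (interp v) x = (v (hi \<tau>) - v (lo \<tau>)) / (hi \<tau> - lo \<tau>)" if t: "\<tau> \<in> \<T>" "x \<in> interior \<tau>"
  proof -
    have "ppoly (interp v) \<tau> = P \<tau>" using P[OF t(1)] interior_subset by (intro ppoly_eq[OF pw t(1)]) blast
    then show ?thesis unfolding pd_def esum_in[OF t] by (simp add: P_def pderiv_pCons)
  qed
  have "interp v x = v x" if x: "x \<in> {al..be}" "\<And>\<tau>. \<tau> \<in> \<T> \<Longrightarrow> x \<notin> interior \<tau>" for x
  proof -
    obtain \<tau> where t: "\<tau> \<in> \<T>" "x \<in> \<tau>" using cover[OF x(1)] by blast
    then have "x = lo \<tau> \<or> x = hi \<tau>" using x(2)[OF t(1)] end_cases[OF t] by auto
    then show ?thesis unfolding interp_in[OF t] using chord_ends[OF t(1)] by auto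
  qed
  then show "interp v al = v al" "interp v be = v be" using ends_not_int ab by auto
qed

text \<open>On an element of length \<open>H\<close>, the distance of \<open>v\<close> to its chord and \<open>H\<close> times the slope of the chord are
  both at most the integral of \<open>\<bar>v'\<bar>\<close>, and the square of that integral is at most \<open>H\<close> times the integral of the square.\<close>

lemma interp_bounds:
  assumes v: "\<And>x. (v has_real_derivative v' x) (at x)" and v': "continuous_on UNIV v'"
  shows "(LINT x:{al..be}|lborel. (v x - interp v x)\<^sup>2) \<le> h\<^sup>2 * (LINT x:{al..be}|lborel. (v' x)\<^sup>2)"
    and "(LINT x:{al..be}|lborel. (pd (interp v) x)\<^sup>2) \<le> (LINT x:{al..be}|lborel. (v' x)\<^sup>2)"
proof -
  have cv: "continuous_on S v" for S
    using v by (meson DERIV_isCont continuous_at_imp_continuous_on)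
  have cl: "continuous_on UNIV (chord v \<tau>)" for \<tau> unfolding chord_def by (intro continuous_intros)
  have diff: "\<bar>v y - v x\<bar> \<le> integral {a..b} (\<lambda>x. \<bar>v' x\<bar>)" if "a \<le> x" "x \<le> y" "y \<le> b" for a b x y
  proof -
    have i: "(\<lambda>x. \<bar>v' x\<bar>) integrable_on {c..d}" for c d
      by (intro integrable_continuous_real continuous_intros continuous_on_subset[OF v']) auto
    have "(v' has_integral (v y - v x)) {x..y}"
      using v that by (intro fundamental_theorem_of_calculus)
        (auto simp: has_real_derivative_iff_has_vector_derivative[symmetric] intro: DERIV_subset)
    then have "\<bar>v y - v x\<bar> \<le> integral {x..y} (\<lambda>x. \<bar>v' x\<bar>)"
      using integral_norm_bound_integral[of v' "{x..y}" "\<lambda>x. \<bar>v' x\<bar>"] i by (auto simp: integrable_on_def integral_unique)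
    also have "\<dots> \<le> integral {a..b} (\<lambda>x. \<bar>v' x\<bar>)"
      using that i by (intro integral_subset_le) auto
    finally show ?thesis .
  qed
  have int_sq: "(LINT x:{al..be}|lborel. esum (\<lambda>\<tau> x. (v' x)\<^sup>2) x) = (LINT x:{al..be}|lborel. (v' x)\<^sup>2)"
  proof (rule LINT_cong_off_finite[OF fin_nodes])
    show "esum (\<lambda>\<tau> x. (v' x)\<^sup>2) x = (v' x)\<^sup>2" if "x \<in> {al..be} - nodes" for x
      using off_nodes[OF that] esum_in by blast
    show "esum (\<lambda>\<tau> x. (v' x)\<^sup>2) \<in> borel_measurable borel"
      by (rule bfun_meas, rule esum_bfun[of _ UNIV]) (intro continuous_intros v')
    show "(\<lambda>x. (v' x)\<^sup>2) \<in> borel_measurable borel" by (intro borel_measurable_continuous_onI continuous_intros v')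
  qed auto
  have e1: "(LINT x:{al..be}|lborel. (v x - interp v x)\<^sup>2) = (LINT x:{al..be}|lborel. esum (\<lambda>\<tau> x. (v x - chord v \<tau> x)\<^sup>2) x)"
  proof (rule LINT_cong_off_finite[OF fin_nodes])
    show "(v x - interp v x)\<^sup>2 = esum (\<lambda>\<tau> x. (v x - chord v \<tau> x)\<^sup>2) x" if "x \<in> {al..be} - nodes" for x
    proof -
      obtain \<tau> where t: "\<tau> \<in> \<T>" "x \<in> interior \<tau>" using off_nodes \<open>x \<in> _\<close> by blast
      then have "x \<in> \<tau>" using interior_subset by blast
      then show ?thesis unfolding esum_in[OF t] using interp_in[OF t(1)] by simp
    qed
    show "esum (\<lambda>\<tau> x. (v x - chord v \<tau> x)\<^sup>2) \<in> borel_measurable borel"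
      by (rule bfun_meas, rule esum_bfun[of _ UNIV]) (intro continuous_intros cv cl)
    have "v \<in> borel_measurable borel" by (intro borel_measurable_continuous_onI cv)
    then show "(\<lambda>x. (v x - interp v x)\<^sup>2) \<in> borel_measurable borel"
      using bfun_meas[OF pw_bfun[OF interp_pw, of UNIV v]] by simp
  qed auto
  have e2: "(LINT x:{al..be}|lborel. (pd (interp v) x)\<^sup>2) =
     (LINT x:{al..be}|lborel. esum (\<lambda>\<tau> x. ((v (hi \<tau>) - v (lo \<tau>)) / (hi \<tau> - lo \<tau>))\<^sup>2) x)"
  proof (rule LINT_cong_off_finite[OF fin_nodes])
    show "(pd (interp v) x)\<^sup>2 = esum (\<lambda>\<tau> x. ((v (hi \<tau>) - v (lo \<tau>)) / (hi \<tau> - lo \<tau>))\<^sup>2) x" if "x \<in> {al..be} - nodes" for x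
    proof -
      obtain \<tau> where t: "\<tau> \<in> \<T>" "x \<in> interior \<tau>" using off_nodes \<open>x \<in> _\<close> by blast
      then show ?thesis unfolding esum_in[OF t] using interp_pd[OF t] by simp
    qed
    show "esum (\<lambda>\<tau> x. ((v (hi \<tau>) - v (lo \<tau>)) / (hi \<tau> - lo \<tau>))\<^sup>2) \<in> borel_measurable borel"
      by (rule bfun_meas, rule esum_bfun[of _ UNIV]) (intro continuous_intros)
    show "(\<lambda>x. (pd (interp v) x)\<^sup>2) \<in> borel_measurable borel"
      using bfun_meas[OF pd_bfun[of UNIV]] by simp
  qed auto
  have cs: "(integral \<tau> (\<lambda>x. \<bar>v' x\<bar>))\<^sup>2 \<le> (hi \<tau> - lo \<tau>) * integral \<tau> (\<lambda>x. (v' x)\<^sup>2)" if "\<tau> \<in> \<T>" for \<tau>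
    using sq_integral_abs[OF v', of "lo \<tau>" "hi \<tau>"] elem(1,2)[OF that] by simp
  have "(LINT x:{al..be}|lborel. esum (\<lambda>\<tau> x. (v x - chord v \<tau> x)\<^sup>2) x) \<le> h\<^sup>2 * (LINT x:{al..be}|lborel. esum (\<lambda>\<tau> x. (v' x)\<^sup>2) x)"
  proof (rule zone_LINT_mono[OF zone_all])
    fix \<tau> assume t: "\<tau> \<in> \<T>"
    let ?I = "integral \<tau> (\<lambda>x. \<bar>v' x\<bar>)" and ?H = "hi \<tau> - lo \<tau>"
    have te: "\<tau> = {lo \<tau>..hi \<tau>}" and H: "0 < ?H" "?H \<le> h" using elem(1-3)[OF t] by auto
    have it: "integral \<tau> g = integral {lo \<tau>..hi \<tau>} g" for g :: "real \<Rightarrow> real" using te by (rule arg_cong)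
    have b: "\<bar>v x - chord v \<tau> x\<bar> \<le> ?I" if "x \<in> {lo \<tau>..hi \<tau>}" for x
    proof -
      define \<theta> where "\<theta> = (x - lo \<tau>) / ?H"
      have th: "0 \<le> \<theta>" "\<theta> \<le> 1" using that H unfolding \<theta>_def by auto
      have "v x - chord v \<tau> x = (1 - \<theta>) * (v x - v (lo \<tau>)) - \<theta> * (v (hi \<tau>) - v x)"
        unfolding chord_def \<theta>_def by (simp add: algebra_simps diff_divide_distrib)
      also have "\<bar>\<dots>\<bar> \<le> (1 - \<theta>) * \<bar>v x - v (lo \<tau>)\<bar> + \<theta> * \<bar>v (hi \<tau>) - v x\<bar>"
        using th by (intro order_trans[OF abs_triangle_ineq4]) (simp add: abs_mult)
      also have "\<dots> \<le> (1 - \<theta>) * ?I + \<theta> * ?I"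
        using th that diff[of "lo \<tau>" "lo \<tau>" x "hi \<tau>"] diff[of "lo \<tau>" x "hi \<tau>" "hi \<tau>"]
        unfolding it by (intro add_mono mult_left_mono) auto
      finally show ?thesis by (simp add: algebra_simps)
    qed
    have "integral \<tau> (\<lambda>x. (v x - chord v \<tau> x)\<^sup>2) \<le> integral \<tau> (\<lambda>x. ?I\<^sup>2)"
      unfolding it
    proof (rule integral_le)
      show "(\<lambda>x. (v x - chord v \<tau> x)\<^sup>2) integrable_on {lo \<tau>..hi \<tau>}"
        by (intro integrable_continuous_real continuous_intros cv continuous_on_subset[OF cl]) auto
      show "(v x - chord v \<tau> x)\<^sup>2 \<le> (integral {lo \<tau>..hi \<tau>} (\<lambda>x. \<bar>v' x\<bar>))\<^sup>2" if "x \<in> {lo \<tau>..hi \<tau>}" for x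
        using b[OF that] unfolding it by (metis abs_ge_zero power2_abs power_mono)
    qed auto
    also have "\<dots> = ?H * ?I\<^sup>2" unfolding it using H by simp
    also have "\<dots> \<le> ?H * (?H * integral \<tau> (\<lambda>x. (v' x)\<^sup>2))" using cs[OF t] H by (intro mult_left_mono) auto
    also have "\<dots> = ?H\<^sup>2 * integral \<tau> (\<lambda>x. (v' x)\<^sup>2)" by (simp add: power2_eq_square)
    also have "\<dots> \<le> h\<^sup>2 * integral \<tau> (\<lambda>x. (v' x)\<^sup>2)"
      unfolding it using H by (intro mult_right_mono power_mono integral_nonneg integrable_continuous_real continuous_intros continuous_on_subset[OF v']) (auto simp: it)
    finally show "integral \<tau> (\<lambda>x. (v x - chord v \<tau> x)\<^sup>2) \<le> h\<^sup>2 * integral \<tau> (\<lambda>x. (v' x)\<^sup>2)" .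
  qed (intro continuous_intros cv cl v')+
  then show "(LINT x:{al..be}|lborel. (v x - interp v x)\<^sup>2) \<le> h\<^sup>2 * (LINT x:{al..be}|lborel. (v' x)\<^sup>2)"
    unfolding e1 int_sq .
  have "(LINT x:{al..be}|lborel. esum (\<lambda>\<tau> x. ((v (hi \<tau>) - v (lo \<tau>)) / (hi \<tau> - lo \<tau>))\<^sup>2) x) \<le> 1 * (LINT x:{al..be}|lborel. esum (\<lambda>\<tau> x. (v' x)\<^sup>2) x)"
  proof (rule zone_LINT_mono[OF zone_all])
    fix \<tau> assume t: "\<tau> \<in> \<T>"
    let ?I = "integral \<tau> (\<lambda>x. \<bar>v' x\<bar>)" and ?H = "hi \<tau> - lo \<tau>"
    have te: "\<tau> = {lo \<tau>..hi \<tau>}" and H: "0 < ?H" "?H \<le> h" using elem(1-3)[OF t] by auto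
    have it: "integral \<tau> g = integral {lo \<tau>..hi \<tau>} g" for g :: "real \<Rightarrow> real" using te by (rule arg_cong)
    have "(v (hi \<tau>) - v (lo \<tau>))\<^sup>2 \<le> ?I\<^sup>2"
      using diff[of "lo \<tau>" "lo \<tau>" "hi \<tau>" "hi \<tau>"] H unfolding it by (metis abs_ge_zero power2_abs power_mono diff_gt_0_iff_gt less_imp_le order_refl)
    also have "\<dots> \<le> ?H * integral \<tau> (\<lambda>x. (v' x)\<^sup>2)" by (rule cs[OF t])
    finally have "(v (hi \<tau>) - v (lo \<tau>))\<^sup>2 / ?H \<le> integral \<tau> (\<lambda>x. (v' x)\<^sup>2)"
      using H by (simp add: field_simps)
    moreover have "integral \<tau> (\<lambda>x. ((v (hi \<tau>) - v (lo \<tau>)) / ?H)\<^sup>2) = (v (hi \<tau>) - v (lo \<tau>))\<^sup>2 / ?H"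
    proof -
      have "d\<^sup>2 / H = (d / H)\<^sup>2 * H" if "H > 0" for d H :: real using that by (simp add: power2_eq_square)
      from this[OF H(1)] show ?thesis unfolding it using H by (simp add: mult.commute)
    qed
    ultimately show "integral \<tau> (\<lambda>x. ((v (hi \<tau>) - v (lo \<tau>)) / (hi \<tau> - lo \<tau>))\<^sup>2) \<le> 1 * integral \<tau> (\<lambda>x. (v' x)\<^sup>2)"
      by simp
  qed (intro continuous_intros v')+
  then show "(LINT x:{al..be}|lborel. (pd (interp v) x)\<^sup>2) \<le> (LINT x:{al..be}|lborel. (v' x)\<^sup>2)"
    unfolding e2 int_sq by simp
qed

end

section \<open>Smooth functions\<close>

definition smooth :: "('a::euclidean_space \<Rightarrow> 'b::real_normed_vector) \<Rightarrow> bool" where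
  "smooth f \<longleftrightarrow> (\<forall>n. C_diff n f)"

lemma frechet_eq: "(f has_derivative f') (at x) \<Longrightarrow> frechet_derivative f (at x) = f'"
  by (rule frechet_derivative_at[symmetric])

lemma frechet_works: "f differentiable (at x) \<Longrightarrow> (f has_derivative frechet_derivative f (at x)) (at x)"
  by (simp add: frechet_derivative_works)

lemma C_diff_SucD: "C_diff (Suc n) f \<Longrightarrow> C_diff n f"
proof (induction n arbitrary: f)
  case 0
  then show ?case by (auto intro!: continuous_at_imp_continuous_on differentiable_imp_continuous_within)
next
  case (Suc n)
  then show ?case by (auto simp del: C_diff.simps(2) simp: C_diff.simps(2)[of "Suc n"] C_diff.simps(2)[of n])
qed

lemma C_diff_SucI:
  assumes "\<And>x. (f has_derivative D x) (at x)" "\<And>b. b \<in> Basis \<Longrightarrow> C_diff n (\<lambda>x. D x b)"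
  shows "C_diff (Suc n) f"
proof -
  have "frechet_derivative f (at x) = D x" for x using assms(1) by (rule frechet_eq)
  then show ?thesis using assms by (auto simp: differentiable_def)
qed

lemma C_diff_SucE:
  assumes "C_diff (Suc n) f"
  obtains D where "\<And>x. (f has_derivative D x) (at x)" "\<And>b. b \<in> Basis \<Longrightarrow> C_diff n (\<lambda>x. D x b)"
  using that[of "\<lambda>x. frechet_derivative f (at x)"] assms frechet_works by auto

lemma C_diff_const: "C_diff n (\<lambda>x. c)"
proof (induction n arbitrary: c)
  case (Suc n) then show ?case by (intro C_diff_SucI[where D="\<lambda>x v. 0"]) auto
qed simp

lemma C_diff_linear:
  assumes "bounded_linear L" shows "C_diff n f \<Longrightarrow> C_diff n (\<lambda>x. L (f x))"
proof (induction n arbitrary: f)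
  case 0 then show ?case using bounded_linear.continuous_on[OF assms] by auto
next
  case (Suc n)
  obtain D where D: "\<And>x. (f has_derivative D x) (at x)" "\<And>b. b \<in> Basis \<Longrightarrow> C_diff n (\<lambda>x. D x b)"
    using C_diff_SucE[OF Suc.prems] by blast
  show ?case
    by (rule C_diff_SucI[where D="\<lambda>x v. L (D x v)", OF bounded_linear.has_derivative[OF assms D(1)] Suc.IH[OF D(2)]])
qed

lemma C_diff_add: "C_diff n f \<Longrightarrow> C_diff n g \<Longrightarrow> C_diff n (\<lambda>x. f x + g x)"
proof (induction n arbitrary: f g)
  case 0 then show ?case by (auto intro!: continuous_intros)
next
  case (Suc n)
  obtain D where D: "\<And>x. (f has_derivative D x) (at x)" "\<And>b. b \<in> Basis \<Longrightarrow> C_diff n (\<lambda>x. D x b)"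
    using C_diff_SucE[OF Suc.prems(1)] by blast
  obtain E where E: "\<And>x. (g has_derivative E x) (at x)" "\<And>b. b \<in> Basis \<Longrightarrow> C_diff n (\<lambda>x. E x b)"
    using C_diff_SucE[OF Suc.prems(2)] by blast
  show ?case
    by (rule C_diff_SucI[where D="\<lambda>x v. D x v + E x v"])
      (use D E has_derivative_add Suc.IH in auto)
qed

lemma C_diff_sum: "(\<And>i. i \<in> I \<Longrightarrow> C_diff n (f i)) \<Longrightarrow> C_diff n (\<lambda>x. \<Sum>i\<in>I. f i x)"
  by (induction I rule: infinite_finite_induct) (simp_all add: C_diff_const C_diff_add)

lemma C_diff_mult:
  fixes f g :: "'a::euclidean_space \<Rightarrow> real"
  shows "C_diff n f \<Longrightarrow> C_diff n g \<Longrightarrow> C_diff n (\<lambda>x. f x * g x)"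
proof (induction n arbitrary: f g)
  case 0 then show ?case by (auto intro!: continuous_intros)
next
  case (Suc n)
  obtain D where D: "\<And>x. (f has_derivative D x) (at x)" "\<And>b. b \<in> Basis \<Longrightarrow> C_diff n (\<lambda>x. D x b)"
    using C_diff_SucE[OF Suc.prems(1)] by blast
  obtain E where E: "\<And>x. (g has_derivative E x) (at x)" "\<And>b. b \<in> Basis \<Longrightarrow> C_diff n (\<lambda>x. E x b)"
    using C_diff_SucE[OF Suc.prems(2)] by blast
  show ?case
  proof (rule C_diff_SucI)
    show "((\<lambda>x. f x * g x) has_derivative (\<lambda>v. f x * E x v + D x v * g x)) (at x)" for x
      by (rule has_derivative_mult[OF D(1) E(1)])
    show "C_diff n (\<lambda>x. f x * E x b + D x b * g x)" if "b \<in> Basis" for b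
      using Suc.IH[OF C_diff_SucD[OF Suc.prems(1)] E(2)[OF that]]
        Suc.IH[OF D(2)[OF that] C_diff_SucD[OF Suc.prems(2)]] by (rule C_diff_add)
  qed
qed

lemma C_diff_affine:
  fixes L :: "'a::euclidean_space \<Rightarrow> 'b::euclidean_space"
  assumes L: "bounded_linear L" shows "C_diff n f \<Longrightarrow> C_diff n (\<lambda>x. f (a + L x))"
proof (induction n arbitrary: f)
  case 0
  have "continuous_on UNIV (\<lambda>x. a + L x)" using bounded_linear.continuous_on[OF L continuous_on_id] by (intro continuous_intros) auto
  then show ?case using 0 continuous_on_compose2[of UNIV f UNIV "\<lambda>x. a + L x"] by auto
next
  case (Suc n)
  obtain D where D: "\<And>x. (f has_derivative D x) (at x)" "\<And>b. b \<in> Basis \<Longrightarrow> C_diff n (\<lambda>x. D x b)"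
    using C_diff_SucE[OF Suc.prems] by blast
  show ?case
  proof (rule C_diff_SucI)
    have "((\<lambda>x. a + L x) has_derivative L) (at x)" for x
      using has_derivative_add[OF has_derivative_const bounded_linear_imp_has_derivative[OF L]] by simp
    then show "((\<lambda>x. f (a + L x)) has_derivative (\<lambda>v. D (a + L x) (L v))) (at x)" for x
      using has_derivative_compose[of "\<lambda>x. a + L x" L x UNIV f "D (a + L x)"] D(1) by simp
    fix b :: 'a
    have e: "D y (L b) = (\<Sum>c\<in>Basis. (L b \<bullet> c) *\<^sub>R D y c)" for y
    proof -
      have l: "linear (D y)" using D(1) by (rule has_derivative_linear)
      have "D y (L b) = D y (\<Sum>c\<in>Basis. (L b \<bullet> c) *\<^sub>R c)" by (simp add: euclidean_representation)
      then show ?thesis using l by (simp add: linear_sum linear_scale)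
    qed
    show "C_diff n (\<lambda>x. D (a + L x) (L b))" unfolding e
      by (intro C_diff_sum C_diff_linear[OF bounded_linear_scaleR_right] Suc.IH D(2))
  qed
qed

text \<open>Used for the functions \<open>flat P\<close> below, whose derivatives are again of this form.\<close>

lemma C_diff_deriv_family:
  fixes F :: "(real \<Rightarrow> real) set"
  assumes "\<And>f. f \<in> F \<Longrightarrow> \<exists>f'\<in>F. \<forall>x. (f has_real_derivative f' x) (at x)"
  shows "f \<in> F \<Longrightarrow> C_diff n f"
proof (induction n arbitrary: f)
  case 0
  then obtain f' where "\<forall>x. (f has_real_derivative f' x) (at x)" using assms by blast
  then show ?case by (auto intro!: continuous_at_imp_continuous_on DERIV_isCont)
next
  case (Suc n)
  then obtain f' where f': "f' \<in> F" "\<And>x. (f has_real_derivative f' x) (at x)" using assms by blast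
  show ?case
    by (rule C_diff_SucI[where D="\<lambda>x v. f' x * v"])
      (use f' Suc.IH in \<open>auto simp: has_field_derivative_def intro: has_derivative_eq_rhs\<close>)
qed

lemma smooth_intros:
  fixes f g :: "'a::euclidean_space \<Rightarrow> real"
  shows "smooth (\<lambda>x::'a. c::real)" "smooth f \<Longrightarrow> smooth g \<Longrightarrow> smooth (\<lambda>x. f x + g x)"
    "smooth f \<Longrightarrow> smooth g \<Longrightarrow> smooth (\<lambda>x. f x * g x)" "smooth f \<Longrightarrow> smooth (\<lambda>x. - f x)"
    "smooth f \<Longrightarrow> smooth g \<Longrightarrow> smooth (\<lambda>x. f x - g x)"
proof -
  show m: "smooth f \<Longrightarrow> smooth (\<lambda>x. - f x)" for f :: "'a::euclidean_space \<Rightarrow> real"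
    unfolding smooth_def using C_diff_linear[OF bounded_linear_minus[OF bounded_linear_ident]] by blast
  show a: "smooth f \<Longrightarrow> smooth g \<Longrightarrow> smooth (\<lambda>x. f x + g x)" for f g :: "'a::euclidean_space \<Rightarrow> real"
    unfolding smooth_def using C_diff_add by blast
  show "smooth f \<Longrightarrow> smooth g \<Longrightarrow> smooth (\<lambda>x. f x - g x)"
    using a[of f "\<lambda>x. - g x"] m[of g] by simp
qed (auto simp: smooth_def C_diff_const C_diff_mult)

lemma smooth_affine1: assumes "smooth f" shows "smooth (\<lambda>x::real. f (a + c * x))"
  using assms unfolding smooth_def using C_diff_affine[OF bounded_linear_mult_right[of c]] by blast

lemma smooth_affine2: assumes "smooth (f :: real \<Rightarrow> real)" shows "smooth (\<lambda>z::real\<times>real. f (a + (c * fst z + d * snd z)))"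
proof -
  have "bounded_linear (\<lambda>z::real\<times>real. c * fst z + d * snd z)"
    by (intro bounded_linear_add bounded_linear_const_mult bounded_linear_fst bounded_linear_snd)
  from C_diff_affine[OF this] show ?thesis using assms unfolding smooth_def by blast
qed

lemma smooth_continuous: "smooth f \<Longrightarrow> continuous_on S f"
  unfolding smooth_def using C_diff.simps(1) continuous_on_subset by blast

lemma C1_real:
  fixes f :: "real \<Rightarrow> 'b::real_normed_vector"
  assumes "smooth f"
  shows "(f has_vector_derivative frechet_derivative f (at x) 1) (at x)"
    and "continuous_on S (\<lambda>x. frechet_derivative f (at x) 1)"
proof -
  have "C_diff (Suc 0) f" using assms unfolding smooth_def by blast
  then have d: "\<And>x. f differentiable (at x)" and c: "continuous_on UNIV (\<lambda>x. frechet_derivative f (at x) 1)" by auto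
  show "continuous_on S (\<lambda>x. frechet_derivative f (at x) 1)" using c by (rule continuous_on_subset) simp
  have h: "(f has_derivative frechet_derivative f (at x)) (at x)" by (rule frechet_works[OF d])
  have "frechet_derivative f (at x) v = v *\<^sub>R frechet_derivative f (at x) 1" for v
    using linear_scale[OF has_derivative_linear[OF h], of v 1] by simp
  then show "(f has_vector_derivative frechet_derivative f (at x) 1) (at x)"
    using h unfolding has_vector_derivative_def by (metis (no_types, lifting) ext)
qed

subsection \<open>A smooth step\<close>

text \<open>For \<open>P = 1\<close> this is \<open>exp (- 1 / x)\<close>, extended by 0.\<close>

definition flat :: "real poly \<Rightarrow> real \<Rightarrow> real" where
  "flat P x = (if x > 0 then poly P (1 / x) * exp (- (1 / x)) else 0)"

lemma poly_exp_limit: "((\<lambda>y. poly P y * exp (- y)) \<longlongrightarrow> (0::real)) at_top"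
proof -
  have "((\<lambda>y. \<Sum>i\<le>degree P. coeff P i * (y ^ i / exp y)) \<longlongrightarrow> (\<Sum>i\<le>degree P. coeff P i * 0)) at_top"
    by (intro tendsto_intros tendsto_power_div_exp_0)
  then show ?thesis by (simp add: poly_altdef sum_distrib_right exp_minus sum_divide_distrib field_simps)
qed

lemma flat_deriv: "(flat P has_real_derivative flat ([:0, 0, 1:] * (P - pderiv P)) x) (at x)"
proof -
  consider "x > 0" | "x < 0" | "x = 0" by linarith
  then show ?thesis
  proof cases
    case 1
    have "((\<lambda>x. poly P (1 / x) * exp (- (1 / x))) has_real_derivative flat ([:0, 0, 1:] * (P - pderiv P)) x) (at x)"
      using 1 unfolding flat_def
      by (auto intro!: derivative_eq_intros DERIV_chain2[OF poly_DERIV] simp: field_simps power2_eq_square)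
    then show ?thesis
      by (rule has_field_derivative_transform_within_open[of _ _ _ "{0<..}"]) (use 1 in \<open>auto simp: flat_def\<close>)
  next
    case 2
    have "((\<lambda>x. 0) has_real_derivative 0) (at x)" by simp
    then have "(flat P has_real_derivative 0) (at x)"
      by (rule has_field_derivative_transform_within_open[of _ _ _ "{..<0}"]) (use 2 in \<open>auto simp: flat_def\<close>)
    then show ?thesis using 2 by (simp add: flat_def)
  next
    case 3
    have "((\<lambda>y. flat P y / y) \<longlongrightarrow> 0) (at_right 0)"
    proof -
      have "((\<lambda>y. poly ([:0, 1:] * P) (inverse y) * exp (- inverse y)) \<longlongrightarrow> 0) (at_right (0::real))"
        by (rule filterlim_compose[OF poly_exp_limit filterlim_inverse_at_top_right])
      moreover have "eventually (\<lambda>y. poly ([:0, 1:] * P) (inverse y) * exp (- inverse y) = flat P y / y) (at_right (0::real))"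
        using eventually_at_right_less[of 0] by eventually_elim (simp add: flat_def field_simps)
      ultimately show ?thesis by (rule Lim_transform_eventually)
    qed
    moreover have "((\<lambda>y. flat P y / y) \<longlongrightarrow> 0) (at_left 0)"
    proof (rule Lim_transform_eventually[OF tendsto_const])
      show "eventually (\<lambda>y. 0 = flat P y / y) (at_left (0::real))"
        unfolding eventually_at_left_field by (auto simp: flat_def intro!: exI[of _ "-1"])
    qed
    ultimately have "((\<lambda>y. flat P y / y) \<longlongrightarrow> 0) (at 0)" by (simp add: filterlim_at_split)
    then have "(flat P has_real_derivative 0) (at 0)"
      by (simp add: has_field_derivative_iff flat_def)
    then show ?thesis using 3 by (simp add: flat_def)
  qed
qed

lemma smooth_flat: "smooth (flat P)"
  unfolding smooth_def using C_diff_deriv_family[of "range flat"] flat_deriv by blast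

text \<open>Supported in \<open>{0..1}\<close> and of integral 1. Hence its primitive \<open>sstep\<close> is a smooth transition from
  0 on \<open>{..0}\<close> to 1 on \<open>{1..}\<close>.\<close>

definition bump :: "real \<Rightarrow> real" where
  "bump x = flat 1 x * flat 1 (1 - x) / integral {-1..1} (\<lambda>x. flat 1 x * flat 1 (1 - x))"

definition sstep :: "real \<Rightarrow> real" where
  "sstep x = integral {-1..x} bump"

lemma bump_smooth: "smooth bump" and bump_nonneg: "0 \<le> bump x"
  and bump_zero: "x \<le> 0 \<or> 1 \<le> x \<Longrightarrow> bump x = 0" and bump_int: "integral {-1..1} bump = 1"
proof -
  let ?f = "\<lambda>x::real. flat 1 x * flat 1 (1 - x)"
  have sf: "smooth ?f" using smooth_affine1[OF smooth_flat[of 1], of 1 "-1"] by (auto intro!: smooth_intros smooth_flat)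
  have nn: "0 \<le> ?f x" for x unfolding flat_def by simp
  have c: "continuous_on S ?f" for S by (rule smooth_continuous[OF sf])
  have pos: "integral {-1..1} ?f > 0"
  proof (rule ccontr)
    assume "\<not> ?thesis"
    moreover have "integral {-1..1} ?f \<ge> 0" using nn by (intro integral_nonneg integrable_continuous_real c) auto
    ultimately have "integral {-1..1} ?f = 0" by simp
    then have "\<And>x. x \<in> {-1..1} \<Longrightarrow> ?f x = 0"
      using integral_eq_0_iff[OF c[of "{-1..1}"]] nn by simp
    from this[of "1/2"] show False by (simp add: flat_def)
  qed
  have be: "bump = (\<lambda>x. inverse (integral {-1..1} ?f) * ?f x)" unfolding bump_def by (auto simp: field_simps)
  show "smooth bump" unfolding be by (rule smooth_intros(3)[OF smooth_intros(1) sf])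
  show "0 \<le> bump x" unfolding bump_def using nn pos by (simp add: less_imp_le)
  show "x \<le> 0 \<or> 1 \<le> x \<Longrightarrow> bump x = 0" unfolding bump_def flat_def by auto
  have "integral {-1..1} bump = integral {-1..1} ?f / integral {-1..1} ?f" unfolding bump_def by simp
  then show "integral {-1..1} bump = 1" using pos by simp
qed

lemma bump_integrable: "bump integrable_on {a..b}"
  by (intro integrable_continuous_real smooth_continuous bump_smooth)

lemma sstep_0: "x \<le> 0 \<Longrightarrow> sstep x = 0"
proof -
  assume "x \<le> 0"
  then have "integral {-1..x} bump = integral {-1..x} (\<lambda>x. 0)" by (intro integral_cong bump_zero) auto
  then show ?thesis unfolding sstep_def by simp
qed

lemma sstep_deriv: "(sstep has_real_derivative bump x) (at x)"
proof (cases "x < 0")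
  case True
  have "((\<lambda>x. 0) has_real_derivative 0) (at x)" by simp
  then have "(sstep has_real_derivative 0) (at x)"
    by (rule has_field_derivative_transform_within_open[of _ _ _ "{..<0}"]) (use True sstep_0 in auto)
  then show ?thesis using True bump_zero by simp
next
  case False
  have "((\<lambda>x. integral {-1..x} bump) has_real_derivative bump x) (at x within {-1..x+1})"
    using False by (intro integral_has_real_derivative smooth_continuous bump_smooth) auto
  moreover have "at x within {-1..x+1} = at x" using False by (intro at_within_interior) auto
  ultimately show ?thesis by (simp add: sstep_def[abs_def])
qed

lemma sstep_smooth: "smooth sstep"
  unfolding smooth_def
proof
  fix n
  show "C_diff n sstep"
  proof (cases n)
    case 0
    then show ?thesis using sstep_deriv by (auto intro!: continuous_at_imp_continuous_on DERIV_isCont)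
  next
    case (Suc m)
    show ?thesis unfolding Suc
      by (rule C_diff_SucI[where D="\<lambda>x v. bump x * v"])
        (use sstep_deriv bump_smooth in \<open>auto simp: has_field_derivative_def smooth_def intro: has_derivative_eq_rhs\<close>)
  qed
qed

lemma sstep_1: "1 \<le> x \<Longrightarrow> sstep x = 1"
proof -
  assume x: "1 \<le> x"
  have "integral {-1..x} bump = integral {-1..1} bump + integral {1..x} bump"
    using x by (intro Henstock_Kurzweil_Integration.integral_combine[symmetric] bump_integrable) auto
  also have "integral {1..x} bump = integral {1..x} (\<lambda>x. 0)" by (intro integral_cong bump_zero) auto
  finally show ?thesis unfolding sstep_def by (simp add: bump_int)
qed

lemma sstep_mono: "x \<le> y \<Longrightarrow> sstep x \<le> sstep y"
  by (rule DERIV_nonneg_imp_nondecreasing[of x y sstep]) (use sstep_deriv bump_nonneg in auto)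

lemma sstep_bounds: "0 \<le> sstep x" "sstep x \<le> 1"
  using sstep_mono[of "min x 0" x] sstep_mono[of x "max x 1"] sstep_0[of "min x 0"] sstep_1[of "max x 1"] by auto

lemma bump_bounded: obtains K where "K > 0" "\<And>x. \<bar>bump x\<bar> \<le> K"
proof -
  have "bounded (bump ` {0..1})"
    by (intro compact_imp_bounded compact_continuous_image smooth_continuous bump_smooth) auto
  then have "\<exists>K. \<forall>y\<in>bump ` {0..1}. norm y \<le> K" by (simp only: bounded_iff)
  then obtain K where K: "\<forall>y\<in>bump ` {0..1}. norm y \<le> K" ..
  have "\<bar>bump x\<bar> \<le> \<bar>K\<bar> + 1" for x
  proof (cases "0 \<le> x \<and> x \<le> 1")
    case True
    then have "norm (bump x) \<le> K" using K by auto
    then show ?thesis by simp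
  next
    case False then show ?thesis using bump_zero[of x] by force
  qed
  then show thesis by (intro that[of "\<bar>K\<bar> + 1"]) auto
qed

section \<open>Integrals over space-time slabs\<close>

lemma AE_snd: assumes "AE x in lborel. P (x::real)" shows "AE z in lborel. P (snd (z::real\<times>real))"
proof -
  obtain N where N: "N \<in> null_sets lborel" "{x. \<not> P x} \<subseteq> N"
    using assms unfolding eventually_ae_filter by auto
  have [measurable]: "N \<in> sets borel" using N by (auto simp: null_sets_def)
  have "emeasure (lborel \<Otimes>\<^sub>M lborel) ((UNIV::real set) \<times> N) = emeasure lborel (UNIV::real set) * emeasure lborel N"
    by (rule lborel.emeasure_pair_measure_Times) auto
  also have "\<dots> = 0" using N by (auto simp: null_sets_def)
  finally have "emeasure lborel ((UNIV::real set) \<times> N) = 0" unfolding lborel_prod .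
  moreover have "(UNIV::real set) \<times> N \<in> sets (lborel \<Otimes>\<^sub>M lborel)" by measurable
  ultimately have "(UNIV::real set) \<times> N \<in> null_sets lborel" unfolding lborel_prod by (auto intro: null_setsI)
  then show ?thesis by (rule AE_I') (use N(2) in auto)
qed

lemma LINT_cong_off_strips:
  fixes f g :: "real \<times> real \<Rightarrow> real"
  assumes "finite N" "S \<in> sets borel" "f \<in> borel_measurable borel" "g \<in> borel_measurable borel"
   "\<And>z. z \<in> S \<Longrightarrow> snd z \<notin> N \<Longrightarrow> f z = g z"
  shows "(LINT x:S|lborel. f x) = (LINT x:S|lborel. g x)"
proof (rule set_lebesgue_integral_cong_AE)
  have "AE x in lborel. x \<notin> N" using assms(1) by (intro AE_not_in) (simp add: finite_imp_null_set_lborel)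
  from AE_snd[OF this] show "AE x\<in>S in lborel. f x = g x" by eventually_elim (use assms(5) in auto)
qed (use assms in auto)

lemma LINT_Ioc_Icc:
  fixes f :: "real \<Rightarrow> real"
  assumes [measurable]: "f \<in> borel_measurable borel"
  shows "(LINT x:{a<..b}|lborel. f x) = (LINT x:{a..b}|lborel. f x)"
  unfolding set_lebesgue_integral_def
proof (rule integral_cong_AE)
  have "AE x in lborel. x \<noteq> a" using AE_not_in[OF finite_imp_null_set_lborel[of "{a}"]] by simp
  then show "AE x in lborel. indicator {a<..b} x *\<^sub>R f x = indicator {a..b} x *\<^sub>R f x"
    by eventually_elim (auto simp: indicator_def)
qed measurable

lemma slab_integral_dt:
  fixes F Ft :: "real \<times> real \<Rightarrow> real"
  assumes "t0 \<le> t1" and A: "A \<in> sets borel" "bounded A"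
    and d: "\<And>t x. x \<in> A \<Longrightarrow> ((\<lambda>t. F (t, x)) has_vector_derivative Ft (t, x)) (at t)"
    and b: "bfun ({t0..t1} \<times> A) Ft"
  shows "(LINT z:{t0<..t1} \<times> A|lborel. Ft z) = (LINT x:A|lborel. F (t1, x) - F (t0, x))"
proof -
  have S: "{t0<..t1} \<times> A \<in> sets borel" "bounded ({t0<..t1} \<times> A)"
    using A by (auto intro!: borel_Times bounded_Times intro: bounded_subset[OF bounded_closed_interval[of t0 t1]])
  have "set_integrable lborel ({t0<..t1} \<times> A) Ft"
    by (rule bfun_integrable[OF bfun_subset[OF b] S]) auto
  then have "(LINT z:{t0<..t1} \<times> A|lborel. Ft z) = (LINT x:A|lborel. LINT t:{t0<..t1}|lborel. Ft (t, x))"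
    by (rule set_fubini_xt)
  also have "\<dots> = (LINT x:A|lborel. F (t1, x) - F (t0, x))"
  proof (rule set_lebesgue_integral_cong)
    show "\<forall>x. x \<in> A \<longrightarrow> (LINT t:{t0<..t1}|lborel. Ft (t, x)) = F (t1, x) - F (t0, x)"
    proof (intro allI impI)
      fix x assume x: "x \<in> A"
      show "(LINT t:{t0<..t1}|lborel. Ft (t, x)) = F (t1, x) - F (t0, x)"
        unfolding LINT_Ioc_Icc[OF bfun_meas[OF bfun_slice2[OF b x]]]
      proof (rule ftc_piecewise[of "{}"])
        show "continuous_on {t0..t1} (\<lambda>t. F (t, x))"
          using d[OF x] by (meson continuous_at_imp_continuous_on has_vector_derivative_continuous)
        show "bfun {t0..t1} (\<lambda>t. Ft (t, x))" by (rule bfun_slice2[OF b x])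
      qed (use assms(1) d x in auto)
    qed
  qed (use A in simp)
  finally show ?thesis .
qed

text \<open>For fixed time this is \<open>ftc_piecewise\<close> with vanishing boundary values.\<close>

lemma slab_integral_dx:
  fixes F Fx :: "real \<times> real \<Rightarrow> real"
  assumes N: "finite N" and ab: "a \<le> b" and I: "I \<in> sets borel" "bounded I"
    and c: "\<And>t. t \<in> I \<Longrightarrow> continuous_on {a..b} (\<lambda>x. F (t, x))"
    and d: "\<And>t x. t \<in> I \<Longrightarrow> x \<in> {a<..<b} - N \<Longrightarrow> ((\<lambda>x. F (t, x)) has_vector_derivative Fx (t, x)) (at x)"
    and b: "bfun (I \<times> {a..b}) Fx"
    and z: "\<And>t. t \<in> I \<Longrightarrow> F (t, a) = 0" "\<And>t. t \<in> I \<Longrightarrow> F (t, b) = 0"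
  shows "(LINT z:I \<times> {a..b}|lborel. Fx z) = 0"
proof -
  have S: "I \<times> {a..b} \<in> sets borel" "bounded (I \<times> {a..b})"
    using I by (auto intro!: borel_Times bounded_Times)
  have "set_integrable lborel (I \<times> {a..b}) Fx"
    by (rule bfun_integrable[OF b S])
  then have "(LINT z:I \<times> {a..b}|lborel. Fx z) = (LINT t:I|lborel. LINT x:{a..b}|lborel. Fx (t, x))"
    by (rule set_fubini_tx)
  also have "\<dots> = (LINT t:I|lborel. 0)"
  proof (rule set_lebesgue_integral_cong)
    show "\<forall>t. t \<in> I \<longrightarrow> (LINT x:{a..b}|lborel. Fx (t, x)) = 0"
    proof (intro allI impI)
      fix t assume t: "t \<in> I"
      have "(LINT x:{a..b}|lborel. Fx (t, x)) = F (t, b) - F (t, a)"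
        by (rule ftc_piecewise[OF N ab c[OF t] d[OF t] bfun_slice[OF b t]])
      then show "(LINT x:{a..b}|lborel. Fx (t, x)) = 0" using z t by simp
    qed
  qed (use I in simp)
  finally show ?thesis by simp
qed

lemma slab_mono:
  fixes f g :: "real \<times> real \<Rightarrow> real"
  assumes "sqi (I \<times> A) f" "sqi (I \<times> A) g"
    and "\<And>t. t \<in> I \<Longrightarrow> (LINT x:A|lborel. (f (t, x))\<^sup>2) \<le> C * (LINT x:A|lborel. (g (t, x))\<^sup>2)"
  shows "(nrm (I \<times> A) f)\<^sup>2 \<le> C * (nrm (I \<times> A) g)\<^sup>2"
proof -
  have i: "set_integrable lborel (I \<times> A) (\<lambda>z. (f z)\<^sup>2)" "set_integrable lborel (I \<times> A) (\<lambda>z. (g z)\<^sup>2)"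
    using assms unfolding sqi_def by auto
  have "(LINT t:I|lborel. LINT x:A|lborel. (f (t, x))\<^sup>2) \<le> (LINT t:I|lborel. C * (LINT x:A|lborel. (g (t, x))\<^sup>2))"
    by (rule set_integral_mono[OF set_fubini_tx_int[OF i(1)] set_integrable_mult_right[OF set_fubini_tx_int[OF i(2)]]])
      (use assms in auto)
  then show ?thesis unfolding nrm_sq set_fubini_tx[OF i(1)] set_fubini_tx[OF i(2)] by simp
qed

context mesh begin

text \<open>A discrete function on a slab is a polynomial in time whose coefficients are continuous piecewise
  polynomials. Its value is \<open>pf c\<close>; \<open>pt c\<close> and \<open>px c\<close> are its derivatives in time and, off the nodes, in space.\<close>

definition pf :: "(nat \<Rightarrow> real \<Rightarrow> real) \<Rightarrow> real \<times> real \<Rightarrow> real" where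
  "pf c z = (\<Sum>i\<le>k. fst z ^ i * c i (snd z))"
definition pt :: "(nat \<Rightarrow> real \<Rightarrow> real) \<Rightarrow> real \<times> real \<Rightarrow> real" where
  "pt c z = (\<Sum>i\<le>k. (real i * fst z ^ (i - 1)) * c i (snd z))"
definition px :: "(nat \<Rightarrow> real \<Rightarrow> real) \<Rightarrow> real \<times> real \<Rightarrow> real" where
  "px c z = (\<Sum>i\<le>k. fst z ^ i * pd (c i) (snd z))"

lemma bfun_tx:
  assumes "bounded I" "bfun A f"
  shows "bfun (I \<times> A) (\<lambda>z::real\<times>real. fst z ^ i * f (snd z))"
    "bfun (I \<times> A) (\<lambda>z::real\<times>real. (real i * fst z ^ (i - 1)) * f (snd z))"
  by (intro bfun_mult bfun_const bfun_power bfun_fst[of I "\<lambda>x. x"] bfun_snd[OF assms(2)] bfun_continuous[OF _ assms(1)] continuous_intros)+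

lemma pf_bfun: assumes "bounded I" "\<forall>i\<le>k. pw (c i)"
  shows "bfun (I \<times> A) (pf c)" "bfun (I \<times> A) (pt c)" "bfun (I \<times> A) (px c)"
  unfolding pf_def pt_def px_def
  by (intro bfun_sum bfun_tx(1,2)[OF assms(1)] pw_bfun pd_bfun; simp add: assms)+

lemma pf_dt: "((\<lambda>t. pf c (t, x)) has_vector_derivative pt c (t, x)) (at t)"
  unfolding pf_def pt_def has_real_derivative_iff_has_vector_derivative[symmetric] fst_conv snd_conv
  by (rule DERIV_sum) (auto intro!: derivative_eq_intros)

lemma pf_cont_x: assumes "\<forall>i\<le>k. pw (c i)" shows "continuous_on {al..be} (\<lambda>x. pf c (t, x))"
  unfolding pf_def fst_conv snd_conv
  by (intro continuous_on_sum continuous_on_mult continuous_on_const pw_cont) (use assms in auto)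

lemma pf_dx: assumes "\<forall>i\<le>k. pw (c i)" "x \<in> {al..be} - nodes"
  shows "((\<lambda>x. pf c (t, x)) has_vector_derivative px c (t, x)) (at x)"
  unfolding pf_def px_def fst_conv snd_conv
  by (intro has_vector_derivative_sum has_vector_derivative_mult_right pd_deriv) (use assms in auto)

lemma pf_zero: "(\<And>i. i \<le> k \<Longrightarrow> c i x = 0) \<Longrightarrow> pf c (t, x) = 0"
  unfolding pf_def by simp

text \<open>The bubble depends linearly on the polynomial. So the bubble of \<open>pf c (t, \<cdot>)\<close> is a polynomial in time,
  and its time derivative is the bubble of \<open>pt c (t, \<cdot>)\<close>.\<close>

lemma bubble_lincomb:
  "bubble (\<lambda>\<tau>. \<Sum>i\<in>I. smult (a i) (G i \<tau>)) x = (\<Sum>i\<in>I. a i * bubble (G i) x)"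
  "bubble_deriv (\<lambda>\<tau>. \<Sum>i\<in>I. smult (a i) (G i \<tau>)) x = (\<Sum>i\<in>I. a i * bubble_deriv (G i) x)"
proof -
  show "bubble (\<lambda>\<tau>. \<Sum>i\<in>I. smult (a i) (G i \<tau>)) x = (\<Sum>i\<in>I. a i * bubble (G i) x)"
    unfolding bubble_def by (cases rule: esum_cases[of x]) (auto simp: bubble_poly_def coeff_sum sum_distrib_right mult.assoc)
  show "bubble_deriv (\<lambda>\<tau>. \<Sum>i\<in>I. smult (a i) (G i \<tau>)) x = (\<Sum>i\<in>I. a i * bubble_deriv (G i) x)"
    unfolding bubble_deriv_def by (cases rule: esum_cases[of x])
      (auto simp: bubble_poly_def coeff_sum pderiv_smult sum_distrib_right mult.assoc)
qed

definition Bf :: "(nat \<Rightarrow> real \<Rightarrow> real) \<Rightarrow> real \<times> real \<Rightarrow> real" where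
  "Bf c z = (\<Sum>i\<le>k. fst z ^ i * bubble (ppoly (c i)) (snd z))"
definition Bt :: "(nat \<Rightarrow> real \<Rightarrow> real) \<Rightarrow> real \<times> real \<Rightarrow> real" where
  "Bt c z = (\<Sum>i\<le>k. (real i * fst z ^ (i - 1)) * bubble (ppoly (c i)) (snd z))"
definition Bx :: "(nat \<Rightarrow> real \<Rightarrow> real) \<Rightarrow> real \<times> real \<Rightarrow> real" where
  "Bx c z = (\<Sum>i\<le>k. fst z ^ i * bubble_deriv (ppoly (c i)) (snd z))"

lemma bubble_time_bfun: assumes "bounded I"
  shows "bfun (I \<times> A) (Bf c)" "bfun (I \<times> A) (Bt c)" "bfun (I \<times> A) (Bx c)"
  unfolding Bf_def Bt_def Bx_def by (intro bfun_sum bfun_tx(1,2)[OF assms] bubble_bfun)+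

lemma esum_ppoly_lincomb:
  assumes "\<forall>i\<le>k. pw (c i)" "x \<in> {al..be} - nodes"
  shows "esum (\<lambda>\<tau>. poly (\<Sum>i\<le>k. smult (a i) (ppoly (c i) \<tau>))) x = (\<Sum>i\<le>k. a i * c i x)"
proof -
  obtain \<tau> where t: "\<tau> \<in> \<T>" "x \<in> interior \<tau>" using off_nodes assms(2) by blast
  then have "x \<in> \<tau>" using interior_subset by blast
  then show ?thesis unfolding esum_in[OF t] poly_sum poly_smult using ppoly(2)[OF _ t(1)] assms(1) by simp
qed

lemma degree_ppoly_lincomb: assumes "\<forall>i\<le>k. pw (c i)" "\<tau> \<in> \<T>"
  shows "degree (\<Sum>i\<le>k. smult (a i) (ppoly (c i) \<tau>)) \<le> k"
  using ppoly(1)[OF _ assms(2)] assms(1) by (intro degree_sum_le order_trans[OF degree_smult_le]) auto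

lemma bubble_slice_bound:
  assumes c: "\<forall>i\<le>k. pw (c i)" and Z: "zone Z"
  shows "(LINT x:Z|lborel. (Bf c (t, x))\<^sup>2) \<le> lead_const k * h\<^sup>2 * (LINT x:Z|lborel. (pf c (t, x))\<^sup>2)"
    and "(LINT x:Z|lborel. (Bx c (t, x))\<^sup>2) \<le> lead_const k * (real (Suc k))\<^sup>2 * (LINT x:Z|lborel. (pf c (t, x))\<^sup>2)"
proof -
  let ?G = "\<lambda>\<tau>. \<Sum>i\<le>k. smult (t ^ i) (ppoly (c i) \<tau>)"
  have e: "bubble ?G x = Bf c (t, x)" "bubble_deriv ?G x = Bx c (t, x)" for x
    unfolding bubble_lincomb Bf_def Bx_def by simp_all
  have Z': "Z \<in> sets borel" "Z \<subseteq> {al..be}" using Z unfolding zone_def by auto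
  have "(LINT x:Z|lborel. (esum (\<lambda>\<tau>. poly (?G \<tau>)) x)\<^sup>2) = (LINT x:Z|lborel. (pf c (t, x))\<^sup>2)"
  proof (rule LINT_cong_off_finite[OF fin_nodes Z'(1)])
    show "(\<lambda>x. (esum (\<lambda>\<tau>. poly (?G \<tau>)) x)\<^sup>2) \<in> borel_measurable borel"
      by (intro borel_measurable_power bfun_meas[of UNIV] esum_bfun) (intro continuous_intros)
    show "(\<lambda>x. (pf c (t, x))\<^sup>2) \<in> borel_measurable borel"
      by (intro borel_measurable_power bfun_meas[OF bfun_slice[of "{t}" UNIV]] pf_bfun c) auto
    show "(esum (\<lambda>\<tau>. poly (?G \<tau>)) x)\<^sup>2 = (pf c (t, x))\<^sup>2" if "x \<in> Z - nodes" for x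
      using esum_ppoly_lincomb[of c x "\<lambda>i. t ^ i", OF c] that Z' by (auto simp: pf_def)
  qed
  then show "(LINT x:Z|lborel. (Bf c (t, x))\<^sup>2) \<le> lead_const k * h\<^sup>2 * (LINT x:Z|lborel. (pf c (t, x))\<^sup>2)"
    and "(LINT x:Z|lborel. (Bx c (t, x))\<^sup>2) \<le> lead_const k * (real (Suc k))\<^sup>2 * (LINT x:Z|lborel. (pf c (t, x))\<^sup>2)"
    using bubble_bound[OF Z, of ?G, OF degree_ppoly_lincomb[OF c]] unfolding e by simp_all
qed

text \<open>A bubble depends on the leading coefficient only, and adding a multiple of the derivative in space, which has
  degree less than \<open>k\<close>, leaves that coefficient unchanged. So \<open>pt c\<close> can be replaced by
  \<open>pt c + s * px c\<close>, which is a residual where the source vanishes. When only this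
  residual is at hand, the time derivative alone is not under control.\<close>

lemma bubble_dt_slice_bound:
  assumes c: "\<forall>i\<le>k. pw (c i)" and Z: "zone Z"
  shows "(LINT x:Z|lborel. (Bt c (t, x))\<^sup>2) \<le> lead_const k * h\<^sup>2 * (LINT x:Z|lborel. (pt c (t, x) + s * px c (t, x))\<^sup>2)"
proof -
  let ?D = "\<lambda>\<tau>. \<Sum>i\<le>k. smult (real i * t ^ (i - 1)) (ppoly (c i) \<tau>)"
  let ?P = "\<lambda>\<tau>. \<Sum>i\<le>k. smult (t ^ i) (ppoly (c i) \<tau>)"
  let ?G = "\<lambda>\<tau>. ?D \<tau> + smult s (pderiv (?P \<tau>))"
  have Z': "Z \<in> sets borel" "Z \<subseteq> {al..be}" using Z unfolding zone_def by auto
  have deg: "degree (?G \<tau>) \<le> k" if "\<tau> \<in> \<T>" for \<tau>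
  proof (rule degree_add_le)
    have "degree (pderiv (?P \<tau>)) \<le> degree (?P \<tau>)" by (simp add: degree_pderiv)
    then have "degree (pderiv (?P \<tau>)) \<le> k" using degree_ppoly_lincomb[OF c that, of "\<lambda>i. t^i"] by linarith
    then show "degree (smult s (pderiv (?P \<tau>))) \<le> k" using order_trans[OF degree_smult_le] by blast
  qed (rule degree_ppoly_lincomb[OF c that])
  have co: "coeff (?G \<tau>) k = coeff (?D \<tau>) k" if "\<tau> \<in> \<T>" for \<tau>
  proof -
    have "coeff (?P \<tau>) (Suc k) = 0" using degree_ppoly_lincomb[OF c that, of "\<lambda>i. t^i"] by (intro coeff_eq_0) simp
    then show ?thesis by (simp only: coeff_add coeff_smult coeff_pderiv)
  qed
  have "bubble ?G x = bubble ?D x" for x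
    unfolding bubble_def bubble_poly_def by (cases rule: esum_cases[of x]) (simp_all only: co)
  then have e: "bubble ?G x = Bt c (t, x)" for x
    unfolding bubble_lincomb Bt_def by simp
  have "(LINT x:Z|lborel. (esum (\<lambda>\<tau>. poly (?G \<tau>)) x)\<^sup>2) = (LINT x:Z|lborel. (pt c (t, x) + s * px c (t, x))\<^sup>2)"
  proof (rule LINT_cong_off_finite[OF fin_nodes Z'(1)])
    show "(\<lambda>x. (esum (\<lambda>\<tau>. poly (?G \<tau>)) x)\<^sup>2) \<in> borel_measurable borel"
      by (intro borel_measurable_power bfun_meas[of UNIV] esum_bfun) (intro continuous_intros)
    show "(\<lambda>x. (pt c (t, x) + s * px c (t, x))\<^sup>2) \<in> borel_measurable borel"
      by (intro borel_measurable_power borel_measurable_add borel_measurable_times borel_measurable_const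
         bfun_meas[OF bfun_slice[of "{t}" UNIV]] pf_bfun c) auto
    show "(esum (\<lambda>\<tau>. poly (?G \<tau>)) x)\<^sup>2 = (pt c (t, x) + s * px c (t, x))\<^sup>2" if "x \<in> Z - nodes" for x
    proof -
      have x: "x \<in> {al..be} - nodes" using that Z' by auto
      obtain \<tau> where t: "\<tau> \<in> \<T>" "x \<in> interior \<tau>" using off_nodes[OF x] by blast
      then have xt: "x \<in> \<tau>" using interior_subset by blast
      have "poly (?D \<tau>) x = pt c (t, x)" unfolding pt_def poly_sum poly_smult using ppoly(2)[OF _ t(1) xt] c by simp
      moreover have "poly (pderiv (?P \<tau>)) x = px c (t, x)"
        unfolding px_def pd_def by (simp add: esum_in[OF t] pderiv_sum pderiv_smult poly_sum)
      ultimately show ?thesis unfolding esum_in[OF t] by simp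
    qed
  qed
  then show ?thesis using bubble_bound(1)[OF Z, of ?G, OF deg] unfolding e by simp
qed

text \<open>For fixed \<open>x\<close> this is the inverse estimate \<open>end_const\<close> for a polynomial in time.\<close>

lemma initial_slice_bound:
  assumes c: "\<forall>i\<le>k. pw (c i)" and "t0 < t1" and A: "A \<in> sets borel" "bounded A"
  shows "(t1 - t0) * (LINT x:A|lborel. (pf c (t0, x))\<^sup>2) \<le> end_const k * (nrm ({t0<..t1} \<times> A) (pf c))\<^sup>2"
proof -
  have b: "bfun ({t0..t1} \<times> A) (pf c)" by (intro pf_bfun c) auto
  have S: "{t0<..t1} \<times> A \<in> sets borel" "bounded ({t0<..t1} \<times> A)"
    using A by (auto intro!: borel_Times bounded_Times intro: bounded_subset[OF bounded_closed_interval[of t0 t1]])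
  have i: "set_integrable lborel ({t0<..t1} \<times> A) (\<lambda>z. (pf c z)\<^sup>2)"
    by (rule bfun_integrable[OF bfun_power[OF bfun_subset[OF b]] S]) auto
  have "(LINT x:A|lborel. (t1 - t0) * (pf c (t0, x))\<^sup>2) \<le> (LINT x:A|lborel. end_const k * (LINT t:{t0<..t1}|lborel. (pf c (t, x))\<^sup>2))"
  proof (rule set_integral_mono)
    show "set_integrable lborel A (\<lambda>x. (t1 - t0) * (pf c (t0, x))\<^sup>2)"
      using assms(2) by (intro bfun_integrable A bfun_mult bfun_const bfun_power bfun_slice[OF b]) auto
    show "set_integrable lborel A (\<lambda>x. end_const k * (LINT t:{t0<..t1}|lborel. (pf c (t, x))\<^sup>2))"
      by (rule set_integrable_mult_right[OF set_fubini_xt_int[OF i]])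
    fix x assume "x \<in> A"
    define q where "q = (\<Sum>i\<le>k. monom (c i x) i)"
    have q: "poly q t = pf c (t, x)" for t unfolding q_def pf_def poly_sum poly_monom by (simp add: mult.commute)
    have d: "degree q \<le> k" unfolding q_def by (intro degree_sum_le order_trans[OF degree_monom_le]) auto
    have "(LINT t:{t0<..t1}|lborel. (pf c (t, x))\<^sup>2) = integral {t0..t1} (\<lambda>t. (poly q t)\<^sup>2)"
    proof -
      have c: "continuous_on UNIV (\<lambda>t. (poly q t)\<^sup>2)" by (intro continuous_intros)
      show ?thesis unfolding q[symmetric] LINT_Ioc_Icc[OF borel_measurable_continuous_onI[OF c]]
        by (rule LINT_continuous(1)[OF c])
    qed
    then show "(t1 - t0) * (pf c (t0, x))\<^sup>2 \<le> end_const k * (LINT t:{t0<..t1}|lborel. (pf c (t, x))\<^sup>2)"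
      using end_const(2)[OF d assms(2)] unfolding q by (simp add: mult.commute)
  qed
  then show ?thesis unfolding nrm_sq set_fubini_xt[OF i] by simp
qed

end

section \<open>A weighted energy estimate at the inflow end\<close>

definition energy_const :: "real \<Rightarrow> nat \<Rightarrow> real" where
  "energy_const c k = 3 * lead_const k + 3 * (c * (1 + sqrt (lead_const k) * real (Suc k)))\<^sup>2
     + 3 * lead_const k * end_const k + c * sqrt (lead_const k)"

lemma young3: "(a::real) * P \<le> P\<^sup>2 / 12 + 3 * a\<^sup>2"
proof -
  have "0 \<le> (P / 6 - a)\<^sup>2" by simp
  then have "P / 3 * a \<le> P\<^sup>2 / 36 + a\<^sup>2" by (simp add: power2_diff power_divide)
  then show ?thesis by (simp add: mult.commute)
qed

context mesh begin

lemma LINT_restrict_zone: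
  fixes g :: "real \<times> real \<Rightarrow> real" and f :: "real \<Rightarrow> real"
  assumes "Z \<subseteq> X"
  shows "(LINT w:I \<times> X|lborel. indicator Z (snd w) * g w) = (LINT w:I \<times> Z|lborel. g w)"
    and "(LINT x:X|lborel. indicator Z x * f x) = (LINT x:Z|lborel. f x)"
  unfolding set_lebesgue_integral_def using assms
  by (auto intro!: Bochner_Integration.integral_cong simp: indicator_def)

end

text \<open>One slab, one scalar component, and a zone that reaches from the inflow end to the node \<open>z\<close>. There the
  source vanishes, so \<open>r\<close> is the residual of a homogeneous equation. In the Galerkin equation, \<open>rt\<close> and \<open>rx\<close> are the factors of the
  time and space derivatives of the test function in the streamline term. The two cases of \<open>mode\<close>
  are those that occur for the Maxwell system: the component \<open>E\<^sub>1\<close> satisfies one equation for each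
  derivative, and the components \<open>E\<^sub>2 \<plusminus> B\<close> satisfy a single transport equation.\<close>

locale energy = mesh al be h \<T> k for al be h \<T> k +
  fixes c :: "nat \<Rightarrow> real \<Rightarrow> real" and J :: "real \<Rightarrow> real" and r rt rx :: "real \<times> real \<Rightarrow> real"
    and t0 t1 z zl zr s de cc :: real
  assumes c: "\<forall>i\<le>k. pw (c i)" and c0: "\<And>i. i \<le> k \<Longrightarrow> c i al = 0" "\<And>i. i \<le> k \<Longrightarrow> c i be = 0"
    and t1: "t1 = t0 + h" and Zend: "end_zone z {zl..zr}" and zlr: "zl \<le> zr"
    and side: "(s = 1 \<and> zl = al \<and> zr = z) \<or> (s = -1 \<and> zl = z \<and> zr = be)"
    and de: "de = cc * h" "cc > 0"
    and sq: "sqi ({t0<..t1} \<times> {al..be}) r" "sqi ({t0<..t1} \<times> {al..be}) rt" "sqi ({t0<..t1} \<times> {al..be}) rx"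
      "sqi {al..be} J"
    and rz: "\<And>w. w \<in> {t0<..t1} \<times> {zl..zr} \<Longrightarrow> r w = - (pt c w + s * px c w)"
    and mode: "(\<forall>w\<in>{t0<..t1} \<times> {zl..zr}. rt w = - pt c w \<and> rx w = - px c w) \<or>
       (\<forall>w\<in>{t0<..t1} \<times> {zl..zr}. rt w = r w \<and> rx w = s * r w)"
    and gal: "\<And>\<gamma>. \<forall>i\<le>k. pw (\<gamma> i) \<and> \<gamma> i al = 0 \<and> \<gamma> i be = 0 \<Longrightarrow>
       (LINT w:{t0<..t1} \<times> {al..be}|lborel. r w * pf \<gamma> w + de * (rt w * pt \<gamma> w + rx w * px \<gamma> w)) =
       (LINT x:{al..be}|lborel. J x * pf \<gamma> (t0, x))"
begin

definition I where "I = {t0<..t1}"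
definition Z where "Z = {zl..zr}"
definition X where "X = {al..be}"
definition om where "om x = s * (z - x)" for x
definition p where "p = pf c"
definition dtp where "dtp = pt c"
definition dxp where "dxp = px c"
definition B where "B = Bf c"
definition DB where "DB = Bt c"
definition XB where "XB = Bx c"

lemmas folds = I_def[symmetric] Z_def[symmetric] X_def[symmetric] p_def[symmetric] dtp_def[symmetric] dxp_def[symmetric]
lemma ss: "s * s = 1" "s = 1 \<or> s = -1" using side by auto
lemma zone: "zone Z" using Zend unfolding end_zone_def Z_def by auto
lemma ZX: "Z \<subseteq> X" "Z \<in> sets borel" "bounded Z" using zone unfolding zone_def X_def Z_def by auto
lemma XB': "X \<in> sets borel" "bounded X" unfolding X_def by auto
lemma I: "I \<in> sets borel" "bounded I" unfolding I_def
    by (auto intro: bounded_subset[OF bounded_closed_interval[of t0 t1]])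
lemma IZ: "I \<times> Z \<in> sets borel" "bounded (I \<times> Z)" "I \<times> Z \<subseteq> I \<times> X" using I ZX by (auto intro!: borel_Times bounded_Times)
lemma om0: "0 \<le> om x" if "x \<in> Z" for x using that side unfolding om_def Z_def by auto
lemma omb: "bfun A om" if "bounded A" unfolding om_def by (intro bfun_continuous that continuous_intros)
lemma om2: "bfun (I \<times> Z) (\<lambda>w. om (snd w))" by (rule bfun_snd[OF omb[OF ZX(3)]])
lemma pb: "bfun (I \<times> A) p" "bfun (I \<times> A) dtp" "bfun (I \<times> A) dxp"
    unfolding p_def dtp_def dxp_def by (intro pf_bfun c I)+
lemma Bb: "bfun (I \<times> A) B" "bfun (I \<times> A) DB" "bfun (I \<times> A) XB"
    unfolding B_def DB_def XB_def by (intro bubble_time_bfun I)+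
lemma sb: "sqi (I \<times> Z) f" if "bfun (I \<times> Z) f" using that IZ(1,2) by (rule bfun_sqi)
lemma sz: "sqi (I \<times> Z) r" "sqi (I \<times> Z) rt" "sqi (I \<times> Z) rx"
    using sq IZ unfolding folds by (auto intro: sqi_subset)
lemma sJ: "sqi Z J" using sq(4) ZX unfolding folds by (auto intro: sqi_subset)
lemma sl: "bfun A (\<lambda>x. p (t, x))" "bfun A (\<lambda>x. B (t, x))"
  proof -
    have "bfun ({t} \<times> A) p" unfolding p_def by (intro pf_bfun c) auto
    then show "bfun A (\<lambda>x. p (t, x))" by (rule bfun_slice) simp
    have "bfun ({t} \<times> A) B" unfolding B_def by (intro bubble_time_bfun) auto
    then show "bfun A (\<lambda>x. B (t, x))" by (rule bfun_slice) simp
  qed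

text \<open>The Galerkin equation for the test function \<open>weighted_test\<close>, that is, \<open>\<omega> p + s B\<close> with the bubble \<open>B\<close> of \<open>p\<close>.\<close>

lemma weighted_galerkin: "(LINT w:I \<times> Z|lborel. r w * (om (snd w) * p w + s * B w) + de * (rt w * (om (snd w) * dtp w + s * DB w) + rx w * (om (snd w) * dxp w - s * p w + s * XB w)))
      = (LINT x:Z|lborel. J x * (om x * p (t0, x) + s * B (t0, x)))"
proof -
  define \<gamma> where "\<gamma> i = weighted_test s z Z (c i)" for i
  have pw\<gamma>: "\<forall>i\<le>k. pw (\<gamma> i) \<and> \<gamma> i al = 0 \<and> \<gamma> i be = 0"
  proof (intro allI impI conjI)
    fix i assume i: "i \<le> k"
    have ci: "pw (c i)" using c i by simp
    show "pw (\<gamma> i)" "\<gamma> i al = 0" "\<gamma> i be = 0"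
      unfolding \<gamma>_def using weighted_test_pw(1)[OF ci Zend[folded Z_def]] weighted_test_pw(3)[OF ci Zend[folded Z_def] c0(1)[OF i]]
        weighted_test_pw(4)[OF ci Zend[folded Z_def] c0(2)[OF i]] by auto
  qed
  have e1: "pf \<gamma> w = indicator Z (snd w) * (om (snd w) * p w + s * B w)" for w
    unfolding pf_def p_def B_def Bf_def \<gamma>_def weighted_test_def om_def sum_distrib_left sum.distrib[symmetric]
    by (rule sum.cong[OF refl]) (simp only: algebra_simps)
  have e2: "pt \<gamma> w = indicator Z (snd w) * (om (snd w) * dtp w + s * DB w)" for w
    unfolding pt_def dtp_def DB_def Bt_def \<gamma>_def weighted_test_def om_def sum_distrib_left sum.distrib[symmetric]
    by (rule sum.cong[OF refl]) (simp only: algebra_simps)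
  have e3: "px \<gamma> w = indicator Z (snd w) * (om (snd w) * dxp w - s * p w + s * XB w)" if "w \<in> I \<times> X" "snd w \<notin> nodes" for w
  proof -
    have "pd (\<gamma> i) (snd w) = indicator Z (snd w) * (s * ((z - snd w) * pd (c i) (snd w) - c i (snd w) + bubble_deriv (ppoly (c i)) (snd w)))" if "i \<le> k" for i
      unfolding \<gamma>_def by (rule weighted_test_pw(2)) (use c that \<open>w \<in> _\<close> \<open>snd w \<notin> _\<close> Zend in \<open>auto simp: Z_def X_def\<close>)
    then have "px \<gamma> w = (\<Sum>i\<le>k. fst w ^ i * (indicator Z (snd w) * (s * ((z - snd w) * pd (c i) (snd w) - c i (snd w) + bubble_deriv (ppoly (c i)) (snd w)))))"
      unfolding px_def by simp
    also have "\<dots> = indicator Z (snd w) * (om (snd w) * dxp w - s * p w + s * XB w)"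
      unfolding pf_def p_def dxp_def px_def XB_def Bx_def om_def sum_distrib_left sum_subtractf[symmetric] sum.distrib[symmetric]
      by (rule sum.cong[OF refl]) (simp only: algebra_simps)
    finally show ?thesis .
  qed
  show ?thesis
  proof -
    have [measurable]: "r \<in> borel_measurable borel" "rt \<in> borel_measurable borel" "rx \<in> borel_measurable borel"
      using sq by (auto dest: sqi_meas)
    have [measurable]: "p \<in> borel_measurable borel" "dtp \<in> borel_measurable borel" "dxp \<in> borel_measurable borel"
      "B \<in> borel_measurable borel" "DB \<in> borel_measurable borel" "XB \<in> borel_measurable borel"
      using pb[of UNIV] Bb[of UNIV] by (auto dest: bfun_meas)
    have bg: "bfun (I \<times> UNIV) (pf \<gamma>)" "bfun (I \<times> UNIV) (pt \<gamma>)" "bfun (I \<times> UNIV) (px \<gamma>)"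
      using pw\<gamma> I(2) by (intro pf_bfun; auto)+
    have [measurable]: "pf \<gamma> \<in> borel_measurable borel" "pt \<gamma> \<in> borel_measurable borel" "px \<gamma> \<in> borel_measurable borel"
      using bg by (auto dest: bfun_meas)
    have [measurable]: "(\<lambda>w::real\<times>real. om (snd w)) \<in> borel_measurable borel" by (rule bfun_meas[OF om2])
    have [measurable]: "(\<lambda>w::real\<times>real. indicator Z (snd w) :: real) \<in> borel_measurable borel"
      using ZX(2) by (intro bfun_meas[OF bfun_snd[of UNIV _ UNIV]] bfunI[of _ _ 1]) (auto simp: indicator_def)
    have "(LINT w:I \<times> Z|lborel. r w * (om (snd w) * p w + s * B w) + de * (rt w * (om (snd w) * dtp w + s * DB w) + rx w * (om (snd w) * dxp w - s * p w + s * XB w)))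
      = (LINT w:I \<times> X|lborel. indicator Z (snd w) * (r w * (om (snd w) * p w + s * B w) + de * (rt w * (om (snd w) * dtp w + s * DB w) + rx w * (om (snd w) * dxp w - s * p w + s * XB w))))"
      by (rule LINT_restrict_zone(1)[OF ZX(1), symmetric])
    also have "\<dots> = (LINT w:I \<times> X|lborel. r w * pf \<gamma> w + de * (rt w * pt \<gamma> w + rx w * px \<gamma> w))"
    proof (rule LINT_cong_off_strips[OF fin_nodes])
      show "I \<times> X \<in> sets borel" using I XB' by (auto intro!: borel_Times)
      show "indicator Z (snd w) * (r w * (om (snd w) * p w + s * B w) + de * (rt w * (om (snd w) * dtp w + s * DB w) + rx w * (om (snd w) * dxp w - s * p w + s * XB w)))
        = r w * pf \<gamma> w + de * (rt w * pt \<gamma> w + rx w * px \<gamma> w)" if "w \<in> I \<times> X" "snd w \<notin> nodes" for w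
        unfolding e1 e2 e3[OF that] by (simp add: algebra_simps)
    qed measurable
    also have "\<dots> = (LINT x:X|lborel. J x * pf \<gamma> (t0, x))" using gal[OF pw\<gamma>] unfolding folds .
    also have "\<dots> = (LINT x:X|lborel. indicator Z x * (J x * (om x * p (t0, x) + s * B (t0, x))))"
      unfolding e1 by (simp add: mult_ac)
    also have "\<dots> = (LINT x:Z|lborel. J x * (om x * p (t0, x) + s * B (t0, x)))"
      by (rule LINT_restrict_zone(2)[OF ZX(1)])
    finally show ?thesis .
  qed
qed

text \<open>The left-hand side of this equation is split. The first two terms give the energies, \<open>iS\<close> has a
  sign, and the others contain a residual and are treated as perturbations.\<close>

definition i1 where "i1 = (LINT w:I \<times> Z|lborel. om (snd w) * (p w * dtp w))"
definition i2 where "i2 = (LINT w:I \<times> Z|lborel. s * om (snd w) * (p w * dxp w))"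
definition iB where "iB = (LINT w:I \<times> Z|lborel. r w * B w)"
definition iS where "iS = (LINT w:I \<times> Z|lborel. om (snd w) * (rt w * dtp w + rx w * dxp w))"
definition iT where "iT = (LINT w:I \<times> Z|lborel. rt w * DB w)"
definition iP where "iP = (LINT w:I \<times> Z|lborel. rx w * p w)"
definition iX where "iX = (LINT w:I \<times> Z|lborel. rx w * XB w)"
lemma ib: "set_integrable lborel (I \<times> Z) f" if "bfun (I \<times> Z) f" for f using that IZ(1,2) by (rule bfun_integrable)
lemma n1: "set_integrable lborel (I \<times> Z) (\<lambda>w. om (snd w) * (p w * dtp w))" by (intro ib bfun_mult om2 pb)
lemma n2: "set_integrable lborel (I \<times> Z) (\<lambda>w. s * om (snd w) * (p w * dxp w))" by (intro ib bfun_mult bfun_const om2 pb)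
lemma nB: "set_integrable lborel (I \<times> Z) (\<lambda>w. r w * B w)" by (intro sqi_mult_integrable sz sb Bb)
lemma nS: "set_integrable lborel (I \<times> Z) (\<lambda>w. om (snd w) * (rt w * dtp w + rx w * dxp w))"
  proof -
    have "set_integrable lborel (I \<times> Z) (\<lambda>w. rt w * (om (snd w) * dtp w) + rx w * (om (snd w) * dxp w))"
      by (intro set_integral_add sqi_mult_integrable sz sb bfun_mult om2 pb)
    then show ?thesis by (simp add: algebra_simps)
  qed
lemma nT: "set_integrable lborel (I \<times> Z) (\<lambda>w. rt w * DB w)" by (intro sqi_mult_integrable sz sb Bb)
lemma nP: "set_integrable lborel (I \<times> Z) (\<lambda>w. rx w * p w)" by (intro sqi_mult_integrable sz sb pb)
lemma nX: "set_integrable lborel (I \<times> Z) (\<lambda>w. rx w * XB w)" by (intro sqi_mult_integrable sz sb Bb)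
lemma weighted_lhs: "(LINT w:I \<times> Z|lborel. r w * (om (snd w) * p w + s * B w) + de * (rt w * (om (snd w) * dtp w + s * DB w) + rx w * (om (snd w) * dxp w - s * p w + s * XB w)))
     = - i1 - i2 + s * iB + de * iS + de * s * iT - de * s * iP + de * s * iX"
  proof -
    have "(LINT w:I \<times> Z|lborel. r w * (om (snd w) * p w + s * B w) + de * (rt w * (om (snd w) * dtp w + s * DB w) + rx w * (om (snd w) * dxp w - s * p w + s * XB w)))
      = (LINT w:I \<times> Z|lborel. ((s * (r w * B w) + de * (om (snd w) * (rt w * dtp w + rx w * dxp w))) + (de * s * (rt w * DB w) + de * s * (rx w * XB w)))
          - ((om (snd w) * (p w * dtp w) + s * om (snd w) * (p w * dxp w)) + de * s * (rx w * p w)))"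
    proof (rule set_lebesgue_integral_cong)
      show "\<forall>w. w \<in> I \<times> Z \<longrightarrow> r w * (om (snd w) * p w + s * B w) + de * (rt w * (om (snd w) * dtp w + s * DB w) + rx w * (om (snd w) * dxp w - s * p w + s * XB w))
       = ((s * (r w * B w) + de * (om (snd w) * (rt w * dtp w + rx w * dxp w))) + (de * s * (rt w * DB w) + de * s * (rx w * XB w)))
          - ((om (snd w) * (p w * dtp w) + s * om (snd w) * (p w * dxp w)) + de * s * (rx w * p w))"
      proof (intro allI impI)
        fix w assume "w \<in> I \<times> Z"
        then have re: "r w = - (dtp w + s * dxp w)" using rz unfolding folds by blast
        have "r w * (om (snd w) * p w) = - (om (snd w) * (p w * dtp w) + s * om (snd w) * (p w * dxp w))"
          unfolding re by (simp add: algebra_simps)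
        then show "r w * (om (snd w) * p w + s * B w) + de * (rt w * (om (snd w) * dtp w + s * DB w) + rx w * (om (snd w) * dxp w - s * p w + s * XB w))
         = ((s * (r w * B w) + de * (om (snd w) * (rt w * dtp w + rx w * dxp w))) + (de * s * (rt w * DB w) + de * s * (rx w * XB w)))
          - ((om (snd w) * (p w * dtp w) + s * om (snd w) * (p w * dxp w)) + de * s * (rx w * p w))"
          by (simp add: algebra_simps)
      qed
    qed (use IZ in simp)
    also have "\<dots> = ((s * iB + de * iS) + (de * s * iT + de * s * iX)) - ((i1 + i2) + de * s * iP)"
      unfolding i1_def i2_def iB_def iS_def iT_def iP_def iX_def
      using n1 n2 nB nS nT nP nX by (simp add: set_integral_add set_integral_diff)
    finally show ?thesis by simp
  qed
definition E0 where "E0 = (LINT x:Z|lborel. om x * (p (t0, x))\<^sup>2)"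
definition E1 where "E1 = (LINT x:Z|lborel. om x * (p (t1, x))\<^sup>2)"
definition EJ where "EJ = (LINT x:Z|lborel. om x * (p (t0, x) - J x)\<^sup>2)"
definition JJ where "JJ = (LINT x:Z|lborel. om x * (J x)\<^sup>2)"
definition JB where "JB = (LINT x:Z|lborel. J x * B (t0, x))"
definition P where "P = nrm (I \<times> Z) p"
lemma t01: "t0 < t1" using t1 h0 by simp
lemma iE: "set_integrable lborel Z (\<lambda>x. om x * (p (t, x))\<^sup>2)"
    by (intro bfun_integrable bfun_mult bfun_power omb sl ZX)
lemma I1: "i1 = (E1 - E0) / 2"
  proof -
    have "(LINT w:{t0<..t1} \<times> Z|lborel. om (snd w) * (p w * dtp w)) =
      (LINT x:Z|lborel. (om x * (p (t1, x))\<^sup>2 / 2) - (om x * (p (t0, x))\<^sup>2 / 2))"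
    proof (rule slab_integral_dt[where F = "\<lambda>w. om (snd w) * (p w)\<^sup>2 / 2" and Ft = "\<lambda>w. om (snd w) * (p w * dtp w)", unfolded snd_conv])
      show "((\<lambda>t. om x * (p (t, x))\<^sup>2 / 2) has_vector_derivative om x * (p (t, x) * dtp (t, x))) (at t)" for t x
        using pf_dt[of c x t] unfolding p_def dtp_def has_real_derivative_iff_has_vector_derivative[symmetric]
        by (auto intro!: derivative_eq_intros)
      show "bfun ({t0..t1} \<times> Z) (\<lambda>w. om (snd w) * (p w * dtp w))"
        unfolding p_def dtp_def by (intro bfun_mult pf_bfun c bfun_snd omb ZX) auto
    qed (use t01 ZX in auto)
    also have "\<dots> = (LINT x:Z|lborel. (1/2) * (om x * (p (t1, x))\<^sup>2) - (1/2) * (om x * (p (t0, x))\<^sup>2))"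
      by simp
    also have "\<dots> = (1/2) * E1 - (1/2) * E0"
      unfolding E1_def E0_def using iE[of t1] iE[of t0]
      by (simp only: set_integral_diff(2) set_integrable_mult_right set_integral_mult_right)
    finally show ?thesis unfolding i1_def I_def by (simp add: diff_divide_distrib)
  qed
text \<open>The boundary terms vanish, since \<open>p\<close> is zero at the inflow end and the weight is zero at \<open>z\<close>. What remains is
  the derivative of the weight, and it yields the norm of \<open>p\<close>.\<close>

lemma I2: "i2 = P\<^sup>2 / 2"
  proof -
    have "(LINT w:I \<times> {zl..zr}|lborel. s * om (snd w) * (p w * dxp w) - (p w)\<^sup>2 / 2) = 0"
    proof (rule slab_integral_dx[OF fin_nodes zlr I, where F = "\<lambda>w. s * om (snd w) * (p w)\<^sup>2 / 2"
        and Fx = "\<lambda>w. s * om (snd w) * (p w * dxp w) - (p w)\<^sup>2 / 2", unfolded snd_conv])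
      have sub: "{zl..zr} \<subseteq> {al..be}" using ZX(1) unfolding Z_def X_def .
      show "continuous_on {zl..zr} (\<lambda>x. s * om x * (p (t, x))\<^sup>2 / 2)" for t
        unfolding om_def p_def by (intro continuous_intros continuous_on_subset[OF pf_cont_x[OF c] sub]) auto
      show "((\<lambda>x. s * om x * (p (t, x))\<^sup>2 / 2) has_vector_derivative s * om x * (p (t, x) * dxp (t, x)) - (p (t, x))\<^sup>2 / 2) (at x)"
        if "x \<in> {zl<..<zr} - nodes" for t x
      proof -
        have "x \<in> {al..be} - nodes" using that sub by auto
        from pf_dx[OF c this, of t] have d: "((\<lambda>x. p (t, x)) has_real_derivative dxp (t, x)) (at x)"
          unfolding p_def dxp_def by (simp add: has_real_derivative_iff_has_vector_derivative)
        have so: "s * om x = z - x" for x unfolding om_def mult.assoc[symmetric] ss(1) by simp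
        have "((\<lambda>x. (z - x) * (p (t, x))\<^sup>2 / 2) has_real_derivative ((z - x) * (2 * p (t, x) * dxp (t, x)) - (p (t, x))\<^sup>2) / 2) (at x)"
          by (auto intro!: derivative_eq_intros d)
        then show ?thesis unfolding so
          by (simp add: has_real_derivative_iff_has_vector_derivative diff_divide_distrib)
      qed
      have "bfun (I \<times> Z) (\<lambda>w. s * om (snd w) * (p w * dxp w) - (p w)\<^sup>2 * (1/2))"
        by (intro bfun_diff bfun_mult bfun_const bfun_power om2 pb)
      then show "bfun (I \<times> {zl..zr}) (\<lambda>w. s * om (snd w) * (p w * dxp w) - (p w)\<^sup>2 / 2)" unfolding Z_def by simp
      have pe: "p (t, al) = 0" "p (t, be) = 0" for t unfolding p_def using c0 by (auto intro!: pf_zero)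
      show "s * om zl * (p (t, zl))\<^sup>2 / 2 = 0" "s * om zr * (p (t, zr))\<^sup>2 / 2 = 0" for t
        using side pe unfolding om_def by auto
    qed
    moreover have "(LINT w:I \<times> {zl..zr}|lborel. s * om (snd w) * (p w * dxp w) - (p w)\<^sup>2 / 2) = i2 - P\<^sup>2 / 2"
    proof -
      have "set_integrable lborel (I \<times> Z) (\<lambda>w. (p w)\<^sup>2 * (1/2))" by (intro ib bfun_mult bfun_const bfun_power pb)
      then have "set_integrable lborel (I \<times> Z) (\<lambda>w. (p w)\<^sup>2 / 2)" by simp
      then show ?thesis unfolding i2_def P_def nrm_sq Z_def[symmetric] using n2 by (simp add: set_integral_diff)
    qed
    ultimately show ?thesis by simp
  qed
text \<open>The streamline term is dissipative: the integrand is minus the weight times a sum of two squares in the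
  first mode, and minus the weight times the square of \<open>r\<close> in the second.\<close>

lemma iS0: "iS \<le> 0"
  proof -
    have "(LINT w:I \<times> Z|lborel. om (snd w) * (rt w * dtp w + rx w * dxp w)) \<le> (LINT w:I \<times> Z|lborel. 0)"
    proof (rule set_integral_mono[OF nS])
      fix w assume w: "w \<in> I \<times> Z"
      have "rt w * dtp w + rx w * dxp w \<le> 0"
        using mode unfolding folds
      proof
        assume "\<forall>w\<in>I \<times> Z. rt w = - dtp w \<and> rx w = - dxp w"
        then have "rt w = - dtp w" "rx w = - dxp w" using w by blast+
        then show ?thesis by (simp add: sum_squares_ge_zero)
      next
        assume "\<forall>w\<in>I \<times> Z. rt w = r w \<and> rx w = s * r w"
        then have "rt w = r w" "rx w = s * r w" using w by blast+
        then have "rt w * dtp w + rx w * dxp w = r w * (dtp w + s * dxp w)" by (simp add: algebra_simps)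
        also have "dtp w + s * dxp w = - r w" using rz w unfolding folds by (metis minus_minus)
        finally show ?thesis by simp
      qed
      then show "om (snd w) * (rt w * dtp w + rx w * dxp w) \<le> 0" using om0 w by (intro mult_nonneg_nonpos) auto
    qed (simp add: set_integrable_def)
    then show ?thesis unfolding iS_def by simp
  qed
lemma sp0: "sqi Z (\<lambda>x. p (t0, x))" "sqi Z (\<lambda>x. B (t0, x))" by (intro bfun_sqi sl ZX)+
lemma weighted_rhs: "(LINT x:Z|lborel. J x * (om x * p (t0, x) + s * B (t0, x))) = (E0 + JJ - EJ) / 2 + s * JB"
  proof -
    have a: "set_integrable lborel Z (\<lambda>x. J x * B (t0, x))" by (intro sqi_mult_integrable sJ sp0)
    have b: "set_integrable lborel Z (\<lambda>x. om x * (f x)\<^sup>2)" if "sqi Z f" for f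
      using sqi_mult_integrable[OF sqi_bmult[OF that omb[OF ZX(3)]] that] by (simp add: power2_eq_square mult.assoc)
    have i: "set_integrable lborel Z (\<lambda>x. om x * (p (t0, x))\<^sup>2)" "set_integrable lborel Z (\<lambda>x. om x * (J x)\<^sup>2)"
      "set_integrable lborel Z (\<lambda>x. om x * (p (t0, x) - J x)\<^sup>2)"
      by (intro b sp0 sJ sqi_diff)+
    have "(\<lambda>x. J x * (om x * p (t0, x) + s * B (t0, x))) =
       (\<lambda>x. (1/2) * ((om x * (p (t0, x))\<^sup>2 + om x * (J x)\<^sup>2) - om x * (p (t0, x) - J x)\<^sup>2) + s * (J x * B (t0, x)))"
      by (auto simp: power2_eq_square algebra_simps)
    then show ?thesis unfolding E0_def JJ_def EJ_def JB_def
      using a i by (simp add: set_integral_add set_integral_diff)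
  qed
lemma JJ0: "0 \<le> JJ" unfolding JJ_def set_lebesgue_integral_def
    using om0 by (intro integral_nonneg_AE AE_I2) (auto simp: indicator_def)
text \<open>Here \<open>EJ\<close> is the weighted energy at the end of the previous slab, as \<open>J\<close> is the jump of \<open>p\<close> at \<open>t0\<close>.\<close>

lemma energy_balance: "P\<^sup>2 / 2 + E1 / 2 \<le> EJ / 2 + (\<bar>iB\<bar> + de * (\<bar>iT\<bar> + \<bar>iP\<bar> + \<bar>iX\<bar>) + \<bar>JB\<bar>)"
proof -
  have e: "P\<^sup>2 / 2 + E1 / 2 + JJ / 2 = EJ / 2 + s * iB + de * iS + de * s * iT - de * s * iP + de * s * iX - s * JB"
    using weighted_galerkin unfolding weighted_lhs weighted_rhs I1 I2 by (simp add: field_simps)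
  have a: "de * iS \<le> 0" using iS0 de h0 by (simp add: mult_nonneg_nonpos)
  have "\<bar>de * y\<bar> = de * \<bar>y\<bar>" for y using de h0 by (simp add: abs_mult)
  then have "de * y \<le> de * \<bar>y\<bar>" "- (de * y) \<le> de * \<bar>y\<bar>" for y by (metis abs_ge_self, metis abs_ge_minus_self)
  note m = this[of iT] this[of iP] this[of iX]
  from ss(2) show ?thesis
  proof
    assume "s = 1"
    then have "P\<^sup>2 / 2 + E1 / 2 + JJ / 2 = EJ / 2 + iB + de * iS + de * iT - de * iP + de * iX - JB" using e by simp
    then show ?thesis using a m JJ0 abs_ge_self[of iB] abs_ge_minus_self[of JB] unfolding distrib_left by linarith
  next
    assume "s = -1"
    then have "P\<^sup>2 / 2 + E1 / 2 + JJ / 2 = EJ / 2 - iB + de * iS - de * iT + de * iP - de * iX + JB" using e by simp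
    then show ?thesis using a m JJ0 abs_ge_minus_self[of iB] abs_ge_self[of JB] unfolding distrib_left by linarith
  qed
qed

definition R where "R = nrm (I \<times> X) r"
definition Rt where "Rt = nrm (I \<times> X) rt"
definition Rx where "Rx = nrm (I \<times> X) rx"
definition Jn where "Jn = nrm X J"
definition b where "b = sqrt (lead_const k)"
definition e where "e = sqrt (end_const k)"
lemma bp: "0 < b" "b\<^sup>2 = lead_const k" "0 < e" "e\<^sup>2 = end_const k"
    unfolding b_def e_def using lead_const(1)[of k] end_const(1)[of k] by auto
lemma nn: "0 \<le> R" "0 \<le> Rt" "0 \<le> Rx" "0 \<le> Jn" "0 \<le> P" unfolding R_def Rt_def Rx_def Jn_def P_def by auto
lemma le: "nrm (I \<times> Z) r \<le> R" "nrm (I \<times> Z) rt \<le> Rt" "nrm (I \<times> Z) rx \<le> Rx" "nrm Z J \<le> Jn"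
    unfolding R_def Rt_def Rx_def Jn_def using sq IZ ZX unfolding folds by (auto intro!: nrm_subset)
lemma nB': "nrm (I \<times> Z) B \<le> b * h * P"
  proof (rule power2_le_imp_le)
    have "(nrm (I \<times> Z) B)\<^sup>2 \<le> (lead_const k * h\<^sup>2) * (nrm (I \<times> Z) p)\<^sup>2"
      unfolding B_def p_def by (intro slab_mono bubble_slice_bound(1)[OF c zone] sb[unfolded folds] pb[unfolded p_def] Bb[unfolded B_def])
    then show "(nrm (I \<times> Z) B)\<^sup>2 \<le> (b * h * P)\<^sup>2" unfolding P_def power_mult_distrib bp .
  qed (use bp h0 nn in auto)
lemma nX': "nrm (I \<times> Z) XB \<le> b * real (Suc k) * P"
  proof (rule power2_le_imp_le)
    have "(nrm (I \<times> Z) XB)\<^sup>2 \<le> (lead_const k * (real (Suc k))\<^sup>2) * (nrm (I \<times> Z) p)\<^sup>2"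
      unfolding XB_def p_def by (intro slab_mono bubble_slice_bound(2)[OF c zone] sb[unfolded folds] pb[unfolded p_def] Bb[unfolded XB_def])
    then show "(nrm (I \<times> Z) XB)\<^sup>2 \<le> (b * real (Suc k) * P)\<^sup>2" unfolding P_def power_mult_distrib bp .
  qed (use bp h0 nn in auto)
text \<open>In either mode \<open>bubble_dt_slice_bound\<close> is available for a multiple \<open>s'\<close> of the space derivative
  for which the bracket is a residual, namely \<open>s' = 0\<close> or \<open>s' = s\<close>.\<close>

lemma nT': "nrm (I \<times> Z) DB \<le> b * h * max R Rt"
  proof -
    obtain s' where s': "nrm (I \<times> Z) (\<lambda>w. dtp w + s' * dxp w) \<le> max R Rt"
      using mode unfolding folds
    proof
      assume a: "\<forall>w\<in>I \<times> Z. rt w = - dtp w \<and> rx w = - dxp w"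
      have "nrm (I \<times> Z) (\<lambda>w. dtp w + 0 * dxp w) \<le> nrm (I \<times> Z) rt"
        using a by (intro nrm_mono sz sb bfun_add bfun_mult bfun_const pb) auto
      then show ?thesis using le that[of 0] by linarith
    next
      have "nrm (I \<times> Z) (\<lambda>w. dtp w + s * dxp w) \<le> nrm (I \<times> Z) r"
        using rz unfolding folds by (intro nrm_mono sz sb bfun_add bfun_mult bfun_const pb) auto
      then show ?thesis using le that[of s] by linarith
    qed
    have "nrm (I \<times> Z) DB \<le> b * h * nrm (I \<times> Z) (\<lambda>w. dtp w + s' * dxp w)"
    proof (rule power2_le_imp_le)
      have "(nrm (I \<times> Z) DB)\<^sup>2 \<le> (lead_const k * h\<^sup>2) * (nrm (I \<times> Z) (\<lambda>w. dtp w + s' * dxp w))\<^sup>2"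
      proof (rule slab_mono)
        show "sqi (I \<times> Z) DB" "sqi (I \<times> Z) (\<lambda>w. dtp w + s' * dxp w)"
          by (intro sb bfun_add bfun_mult bfun_const pb Bb)+
      qed (unfold DB_def dtp_def dxp_def, rule bubble_dt_slice_bound[OF c zone])
      then show "(nrm (I \<times> Z) DB)\<^sup>2 \<le> (b * h * nrm (I \<times> Z) (\<lambda>w. dtp w + s' * dxp w))\<^sup>2" unfolding power_mult_distrib bp .
    qed (use bp h0 in auto)
    also have "\<dots> \<le> b * h * max R Rt" using s' bp h0 by (intro mult_left_mono) auto
    finally show ?thesis .
  qed
lemma nJ': "nrm Z (\<lambda>x. B (t0, x)) \<le> b * (sqrt h * e * P)"
  proof (rule power2_le_imp_le)
    have "(nrm Z (\<lambda>x. B (t0, x)))\<^sup>2 \<le> lead_const k * h\<^sup>2 * (LINT x:Z|lborel. (p (t0, x))\<^sup>2)"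
      unfolding nrm_sq B_def p_def by (rule bubble_slice_bound(1)[OF c zone])
    also have "\<dots> = (lead_const k * h) * ((t1 - t0) * (LINT x:Z|lborel. (p (t0, x))\<^sup>2))"
      using t1 by (simp add: power2_eq_square)
    also have "\<dots> \<le> (lead_const k * h) * (end_const k * P\<^sup>2)"
      unfolding P_def I_def p_def using bp h0 lead_const(1)[of k]
      by (intro mult_left_mono initial_slice_bound[OF c t01 ZX(2,3)]) auto
    also have "\<dots> = (b * (sqrt h * e * P))\<^sup>2" using h0 by (simp add: power_mult_distrib bp)
    finally show "(nrm Z (\<lambda>x. B (t0, x)))\<^sup>2 \<le> (b * (sqrt h * e * P))\<^sup>2" .
  qed (use bp h0 nn in auto)
lemma kB: "\<bar>iB\<bar> \<le> (b * h * R) * P"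
  proof -
    have "\<bar>iB\<bar> \<le> nrm (I \<times> Z) r * nrm (I \<times> Z) B" unfolding iB_def by (intro sqi_cs sz sb Bb)
    also have "\<dots> \<le> R * (b * h * P)" using le nB' nn by (intro mult_mono) auto
    finally show ?thesis by (simp add: mult_ac)
  qed
lemma kP: "\<bar>iP\<bar> \<le> Rx * P"
  proof -
    have "\<bar>iP\<bar> \<le> nrm (I \<times> Z) rx * nrm (I \<times> Z) p" unfolding iP_def by (intro sqi_cs sz sb pb)
    also have "\<dots> \<le> Rx * P" using le nn unfolding P_def[symmetric] by (intro mult_mono) auto
    finally show ?thesis .
  qed
lemma kX: "\<bar>iX\<bar> \<le> Rx * (b * real (Suc k) * P)"
  proof -
    have "\<bar>iX\<bar> \<le> nrm (I \<times> Z) rx * nrm (I \<times> Z) XB" unfolding iX_def by (intro sqi_cs sz sb Bb)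
    also have "\<dots> \<le> Rx * (b * real (Suc k) * P)" using le nn nX' by (intro mult_mono) auto
    finally show ?thesis .
  qed
lemma kT: "\<bar>iT\<bar> \<le> b * h * (R\<^sup>2 + Rt\<^sup>2)"
  proof -
    have "\<bar>iT\<bar> \<le> nrm (I \<times> Z) rt * nrm (I \<times> Z) DB" unfolding iT_def by (intro sqi_cs sz sb Bb)
    also have "\<dots> \<le> Rt * (b * h * max R Rt)" using le nn nT' by (intro mult_mono) auto
    also have "\<dots> = b * h * (Rt * max R Rt)" by simp
    also have "Rt * max R Rt \<le> R\<^sup>2 + Rt\<^sup>2"
    proof (cases "R \<le> Rt")
      case False
      then have "Rt * R \<le> R * R" using nn by (intro mult_right_mono) auto
      then show ?thesis using False by (simp add: max_def power2_eq_square add_increasing2)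
    qed (simp add: max_def power2_eq_square)
    finally show ?thesis using bp h0 by simp
  qed
lemma kJ: "\<bar>JB\<bar> \<le> (b * (sqrt h * e) * Jn) * P"
  proof -
    have "\<bar>JB\<bar> \<le> nrm Z J * nrm Z (\<lambda>x. B (t0, x))" unfolding JB_def by (intro sqi_cs sJ sp0)
    also have "\<dots> \<le> Jn * (b * (sqrt h * e * P))" using le nn nJ' by (intro mult_mono) auto
    finally show ?thesis by (simp add: mult_ac)
  qed
text \<open>In \<open>energy_balance\<close> every perturbation is at most \<open>h\<close> times a residual, or \<open>sqrt h\<close> times the jump, times the norm of \<open>p\<close>, except for
  the one with the time derivative of the bubble, which is quadratic in the residuals. By Young's inequality
  the products cost half of the term \<open>P\<^sup>2 / 2\<close> on the left.\<close>

theorem energy_slab: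
  "(nrm ({t0<..t1} \<times> {zl..zr}) (pf c))\<^sup>2 / 4 + (LINT x:{zl..zr}|lborel. s * (z - x) * (pf c (t1, x))\<^sup>2) / 2
    \<le> (LINT x:{zl..zr}|lborel. s * (z - x) * (pf c (t0, x) - J x)\<^sup>2) / 2 +
      energy_const cc k * (h\<^sup>2 * ((nrm ({t0<..t1} \<times> {al..be}) r)\<^sup>2 + (nrm ({t0<..t1} \<times> {al..be}) rt)\<^sup>2 +
        (nrm ({t0<..t1} \<times> {al..be}) rx)\<^sup>2) + h * (nrm {al..be} J)\<^sup>2)"
proof -
  have "P\<^sup>2 / 2 + E1 / 2 \<le> EJ / 2 + ((b * h * R) * P + de * (b * h * (R\<^sup>2 + Rt\<^sup>2) + Rx * P + Rx * (b * real (Suc k) * P)) + (b * (sqrt h * e) * Jn) * P)"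
  proof -
    have "de * (\<bar>iT\<bar> + \<bar>iP\<bar> + \<bar>iX\<bar>) \<le> de * (b * h * (R\<^sup>2 + Rt\<^sup>2) + Rx * P + Rx * (b * real (Suc k) * P))"
      using de h0 by (intro mult_left_mono add_mono kT kP kX) simp
    then show ?thesis using energy_balance kB kJ by linarith
  qed
  also have "\<dots> = EJ / 2 + ((b * h * R) * P + (h * (cc * (1 + b * real (Suc k))) * Rx) * P + (b * (sqrt h * e) * Jn) * P) + cc * b * h\<^sup>2 * (R\<^sup>2 + Rt\<^sup>2)"
    unfolding de(1) by (simp add: algebra_simps power2_eq_square)
  also have "\<dots> \<le> EJ / 2 + ((P\<^sup>2 / 12 + 3 * (b * h * R)\<^sup>2) + (P\<^sup>2 / 12 + 3 * (h * (cc * (1 + b * real (Suc k))) * Rx)\<^sup>2) + (P\<^sup>2 / 12 + 3 * (b * (sqrt h * e) * Jn)\<^sup>2)) + cc * b * h\<^sup>2 * (R\<^sup>2 + Rt\<^sup>2)"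
    by (intro add_mono young3 order_refl)
  finally have "P\<^sup>2 / 4 + E1 / 2 \<le> EJ / 2 + (3 * (b * h * R)\<^sup>2 + 3 * (h * (cc * (1 + b * real (Suc k))) * Rx)\<^sup>2 + 3 * (b * (sqrt h * e) * Jn)\<^sup>2 + cc * b * h\<^sup>2 * (R\<^sup>2 + Rt\<^sup>2))"
    by simp
  also have "\<dots> \<le> EJ / 2 + energy_const cc k * (h\<^sup>2 * (R\<^sup>2 + Rt\<^sup>2 + Rx\<^sup>2) + h * Jn\<^sup>2)"
  proof -
    define k1' where "k1' = 3 * b\<^sup>2"
    define k2' where "k2' = 3 * (cc * (1 + b * real (Suc k)))\<^sup>2"
    define k3' where "k3' = 3 * b\<^sup>2 * e\<^sup>2"
    define k4' where "k4' = cc * b"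
    have pos: "0 \<le> k1'" "0 \<le> k2'" "0 \<le> k3'" "0 \<le> k4'" unfolding k1'_def k2'_def k3'_def k4'_def using bp(1,3) de by auto
    have ec: "energy_const cc k = k1' + k2' + k3' + k4'"
      unfolding energy_const_def k1'_def k2'_def k3'_def k4'_def bp b_def[symmetric] by simp
    have "3 * (b * h * R)\<^sup>2 + 3 * (h * (cc * (1 + b * real (Suc k))) * Rx)\<^sup>2 + 3 * (b * (sqrt h * e) * Jn)\<^sup>2 + cc * b * h\<^sup>2 * (R\<^sup>2 + Rt\<^sup>2)
      = k1' * (h\<^sup>2 * R\<^sup>2) + k2' * (h\<^sup>2 * Rx\<^sup>2) + k3' * (h * Jn\<^sup>2) + k4' * (h\<^sup>2 * (R\<^sup>2 + Rt\<^sup>2))"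
      unfolding k1'_def k2'_def k3'_def k4'_def using h0 by (simp add: power_mult_distrib)
    also have "\<dots> \<le> k1' * (h\<^sup>2 * (R\<^sup>2 + Rt\<^sup>2 + Rx\<^sup>2) + h * Jn\<^sup>2) + k2' * (h\<^sup>2 * (R\<^sup>2 + Rt\<^sup>2 + Rx\<^sup>2) + h * Jn\<^sup>2)
       + k3' * (h\<^sup>2 * (R\<^sup>2 + Rt\<^sup>2 + Rx\<^sup>2) + h * Jn\<^sup>2) + k4' * (h\<^sup>2 * (R\<^sup>2 + Rt\<^sup>2 + Rx\<^sup>2) + h * Jn\<^sup>2)"
      using pos h0 by (intro add_mono mult_left_mono) (auto simp: distrib_left)
    finally show ?thesis unfolding ec by (simp add: distrib_right)
  qed
  finally show ?thesis unfolding P_def p_def E1_def EJ_def R_def Rt_def Rx_def Jn_def om_def I_def Z_def X_def by (simp add: mult.assoc)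
qed

end

section \<open>Traces of weak solutions of a transport equation\<close>

lemma AE_fst: assumes "AE x in lborel. P (x::real)" shows "AE z in lborel. P (fst (z::real\<times>real))"
proof -
  obtain N where N: "N \<in> null_sets lborel" "{x. \<not> P x} \<subseteq> N"
    using assms unfolding eventually_ae_filter by auto
  have [measurable]: "N \<in> sets borel" using N by (auto simp: null_sets_def)
  have "emeasure (lborel \<Otimes>\<^sub>M lborel) (N \<times> (UNIV::real set)) = emeasure lborel N * emeasure lborel (UNIV::real set)"
    by (rule lborel.emeasure_pair_measure_Times) auto
  also have "\<dots> = 0" using N by (auto simp: null_sets_def)
  finally have "emeasure lborel (N \<times> (UNIV::real set)) = 0" unfolding lborel_prod .
  moreover have "N \<times> (UNIV::real set) \<in> sets (lborel \<Otimes>\<^sub>M lborel)" by measurable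
  ultimately have "N \<times> (UNIV::real set) \<in> null_sets lborel" unfolding lborel_prod by (auto intro: null_setsI)
  then show ?thesis by (rule AE_I') (use N(2) in auto)
qed

lemma integrable_bfun_mult:
  assumes f: "set_integrable lborel S f" and b: "bfun S g" and S[measurable]: "S \<in> sets borel"
    and m[measurable]: "f \<in> borel_measurable borel"
  shows "set_integrable lborel S (\<lambda>x. g x * f x)"
proof -
  obtain C where C: "\<forall>x\<in>S. \<bar>g x\<bar> \<le> C" and [measurable]: "g \<in> borel_measurable borel"
    using b unfolding bfun_def by blast
  have "set_integrable lborel S (\<lambda>x. C * f x)" using f by (intro set_integrable_mult_right) auto
  then show ?thesis
  proof (rule set_integrable_bound)
    show "set_borel_measurable lborel S (\<lambda>x. g x * f x)" unfolding set_borel_measurable_def by measurable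
    show "AE x in lborel. x \<in> S \<longrightarrow> norm (g x * f x) \<le> norm (C * f x)"
    proof (rule AE_I2, rule impI)
      fix x assume "x \<in> S"
      then have "\<bar>g x\<bar> \<le> \<bar>C\<bar>" using C by force
      then show "norm (g x * f x) \<le> norm (C * f x)" by (simp add: abs_mult mult_right_mono)
    qed
  qed
qed

lemma approx_identity:
  fixes F :: "real \<Rightarrow> real" and \<kappa> :: "nat \<Rightarrow> real \<Rightarrow> real"
  assumes F: "continuous_on {0..T} F" and \<tau>: "\<tau> \<in> {0..T}"
    and k: "\<And>n. continuous_on UNIV (\<kappa> n)" "\<And>n t. 0 \<le> \<kappa> n t"
    and k1: "eventually (\<lambda>n. (LINT t:{0..T}|lborel. \<kappa> n t) = 1) sequentially"
    and k0: "\<And>d. d > 0 \<Longrightarrow> eventually (\<lambda>n. \<forall>t\<in>{0..T}. d \<le> \<bar>t - \<tau>\<bar> \<longrightarrow> \<kappa> n t = 0) sequentially"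
  shows "(\<lambda>n. LINT t:{0..T}|lborel. \<kappa> n t * F t) \<longlonglongrightarrow> F \<tau>"
proof (rule tendstoI)
  fix e :: real assume e: "e > 0"
  obtain d where d: "d > 0" "\<And>t. t \<in> {0..T} \<Longrightarrow> \<bar>t - \<tau>\<bar> < d \<Longrightarrow> \<bar>F t - F \<tau>\<bar> < e / 2"
    using F \<tau> e unfolding continuous_on_iff dist_real_def by (meson half_gt_zero)
  have i: "set_integrable lborel {0..T} g" if "continuous_on {0..T} g" for g :: "real \<Rightarrow> real"
    using borel_integrable_atLeastAtMost'[OF that] .
  show "eventually (\<lambda>n. dist (LINT t:{0..T}|lborel. \<kappa> n t * F t) (F \<tau>) < e) sequentially"
    using k1 k0[OF d(1)]
  proof eventually_elim
    case (elim n)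
    have ck: "continuous_on {0..T} (\<kappa> n)" using k(1) by (rule continuous_on_subset) simp
    have i1: "set_integrable lborel {0..T} (\<lambda>t. \<kappa> n t * F t)" "set_integrable lborel {0..T} (\<lambda>t. \<kappa> n t * F \<tau>)"
      "set_integrable lborel {0..T} (\<lambda>t. \<kappa> n t * (F t - F \<tau>))" "set_integrable lborel {0..T} (\<lambda>t. \<kappa> n t * (e / 2))"
      "set_integrable lborel {0..T} (\<lambda>t. \<bar>\<kappa> n t * (F t - F \<tau>)\<bar>)"
      by (intro i continuous_intros ck F)+
    have "(LINT t:{0..T}|lborel. \<kappa> n t * F t) - F \<tau> = (LINT t:{0..T}|lborel. \<kappa> n t * F t) - (LINT t:{0..T}|lborel. \<kappa> n t * F \<tau>)"
      using elim(1) by simp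
    also have "\<dots> = (LINT t:{0..T}|lborel. \<kappa> n t * F t - \<kappa> n t * F \<tau>)"
      by (rule set_integral_diff(2)[OF i1(1,2), symmetric])
    also have "\<dots> = (LINT t:{0..T}|lborel. \<kappa> n t * (F t - F \<tau>))"
      by (simp add: right_diff_distrib)
    also have "\<bar>\<dots>\<bar> \<le> (LINT t:{0..T}|lborel. \<bar>\<kappa> n t * (F t - F \<tau>)\<bar>)"
      using set_integral_norm_bound[OF i1(3)] by simp
    also have "\<dots> \<le> (LINT t:{0..T}|lborel. \<kappa> n t * (e / 2))"
    proof (rule set_integral_mono[OF i1(5,4)])
      fix t assume t: "t \<in> {0..T}"
      show "\<bar>\<kappa> n t * (F t - F \<tau>)\<bar> \<le> \<kappa> n t * (e / 2)"
      proof (cases "\<bar>t - \<tau>\<bar> < d")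
        case True
        have "\<kappa> n t * \<bar>F t - F \<tau>\<bar> \<le> \<kappa> n t * (e / 2)"
          using d(2)[OF t True] k(2)[of n t] by (intro mult_left_mono) auto
        then show ?thesis using k(2)[of n t] by (simp add: abs_mult)
      next
        case False
        then show ?thesis using elim(2) t by auto
      qed
    qed
    also have "\<dots> = e / 2" using elim(1) by simp
    finally show ?case using e by (simp add: dist_real_def)
  qed
qed

lemma step_kernel:
  assumes "n > 0" "sstep (n * 0 + c) = 0" "sstep (n * T + c) = 1" "0 < T"
  shows "(LINT t:{0..T}|lborel. n * bump (n * t + c)) = 1"
proof -
  have "(LINT t:{0..T}|lborel. n * bump (n * t + c)) = sstep (n * T + c) - sstep (n * 0 + c)"
  proof (rule ftc_piecewise[of "{}" 0 T "\<lambda>t. sstep (n * t + c)"])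
    have d: "((\<lambda>t. sstep (n * t + c)) has_real_derivative n * bump (n * t + c)) (at t)" for t
    proof -
      have "((\<lambda>t. n * t + c) has_real_derivative n) (at t)" by (auto intro!: derivative_eq_intros)
      from DERIV_chain2[OF sstep_deriv this] show ?thesis by (simp add: mult.commute)
    qed
    show "continuous_on {0..T} (\<lambda>t. sstep (n * t + c))"
      using d by (meson DERIV_isCont continuous_at_imp_continuous_on)
    show "((\<lambda>t. sstep (n * t + c)) has_vector_derivative n * bump (n * t + c)) (at t)" for t
      using d by (simp add: has_real_derivative_iff_has_vector_derivative)
    show "bfun {0..T} (\<lambda>t. n * bump (n * t + c))"
    proof (intro bfun_continuous)
      show "continuous_on UNIV (\<lambda>t. n * bump (n * t + c))"
        by (intro continuous_intros continuous_on_compose2[OF smooth_continuous[OF bump_smooth, of UNIV]]) auto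
    qed simp
  qed (use assms in auto)
  then show ?thesis using assms by simp
qed

text \<open>The weak equation is tested with \<open>\<eta> \<xi> u\<close>, where \<open>\<xi>(x) = 1\<close> on the support of \<open>w\<close> and \<open>b\<close>, and \<open>\<eta>(t)\<close> rises
  from 0 to 1 near \<open>t = 0\<close> and falls back to 0 near \<open>t = T\<close>. The derivative of \<open>\<eta>\<close> is the difference of two approximate identities, and
  the continuity assumption identifies their limits as the traces at the two times.\<close>

lemma weak_trace_identity:
  fixes w b u ut ux :: "real \<times> real \<Rightarrow> real"
  assumes T: "T > 0" and K: "al < K1" "K1 \<le> K2" "K2 < be"
    and w: "set_integrable lborel ({0..T} \<times> {al..be}) w" "w \<in> borel_measurable borel"
    and b: "set_integrable lborel ({0..T} \<times> {al..be}) b" "b \<in> borel_measurable borel"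
    and w0: "\<And>t x. x \<notin> {K1..K2} \<Longrightarrow> w (t, x) = 0" and b0: "\<And>t x. x \<notin> {K1..K2} \<Longrightarrow> b (t, x) = 0"
    and u: "smooth u" "\<And>t x. ((\<lambda>t. u (t, x)) has_real_derivative ut (t, x)) (at t)"
      "\<And>t x. ((\<lambda>x. u (t, x)) has_real_derivative ux (t, x)) (at x)"
      "continuous_on UNIV ut" "continuous_on UNIV ux"
    and weak: "\<And>y yt yx. smooth y \<Longrightarrow> compact (closure {z. y z \<noteq> 0}) \<Longrightarrow> closure {z. y z \<noteq> 0} \<subseteq> {0<..<T} \<times> {al<..<be} \<Longrightarrow>
      (\<And>t x. ((\<lambda>t. y (t, x)) has_real_derivative yt (t, x)) (at t)) \<Longrightarrow>
      (\<And>t x. ((\<lambda>x. y (t, x)) has_real_derivative yx (t, x)) (at x)) \<Longrightarrow>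
      - (LINT z:{0..T} \<times> {al..be}|lborel. w z * yt z) - s * (LINT z:{0..T} \<times> {al..be}|lborel. w z * yx z)
        = (LINT z:{0..T} \<times> {al..be}|lborel. b z * y z)"
    and F: "continuous_on {0..T} (\<lambda>t. LINT x:{al..be}|lborel. w (t, x) * u (t, x))"
  shows "(LINT x:{al..be}|lborel. w (T, x) * u (T, x)) - (LINT x:{al..be}|lborel. w (0, x) * u (0, x)) =
    (LINT z:{0..T} \<times> {al..be}|lborel. w z * (ut z + s * ux z) + b z * u z)"
proof -
  define Q where "Q = {0..T} \<times> {al..be}"
  have Q: "Q \<in> sets borel" "bounded Q" unfolding Q_def by (auto intro!: borel_Times bounded_Times)
  define G where "G z = w z * (ut z + s * ux z) + b z * u z" for z
  define FF where "FF t = (LINT x:{al..be}|lborel. w (t, x) * u (t, x))" for t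
  have cu: "continuous_on S u" for S using u(1) by (rule smooth_continuous)
  have bu: "bfun Q u" "bfun Q ut" "bfun Q ux"
    using Q cu u by (auto intro!: bfun_continuous)
  have iw: "set_integrable lborel Q (\<lambda>z. g z * w z)" if "bfun Q g" for g
    by (rule integrable_bfun_mult[OF _ that Q(1) w(2)]) (use w Q_def in simp)
  have ib: "set_integrable lborel Q (\<lambda>z. g z * b z)" if "bfun Q g" for g
    by (rule integrable_bfun_mult[OF _ that Q(1) b(2)]) (use b Q_def in simp)
  have iG: "set_integrable lborel Q G"
  proof -
    have "set_integrable lborel Q (\<lambda>z. (ut z + s * ux z) * w z + u z * b z)"
      by (intro set_integral_add iw ib bfun_add bfun_mult bfun_const bu)
    then show ?thesis unfolding G_def by (simp add: mult.commute)
  qed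
  define d1 where "d1 = (K1 - al) / 2" define d2 where "d2 = (be - K2) / 2"
  have d: "d1 > 0" "d2 > 0" "al + 2 * d1 = K1" "be - 2 * d2 = K2" unfolding d1_def d2_def using K by (auto simp: field_simps)
  \<comment> \<open>Equal to 1 on \<open>{K1..K2}\<close> and supported at distance \<open>d1\<close>, \<open>d2\<close> from the end points.\<close>
  define \<xi> where "\<xi> x = sstep ((x - al) / d1 - 1) * sstep ((be - x) / d2 - 1)" for x
  define \<xi>' where "\<xi>' x = bump ((x - al) / d1 - 1) / d1 * sstep ((be - x) / d2 - 1) - sstep ((x - al) / d1 - 1) * (bump ((be - x) / d2 - 1) / d2)" for x
  have \<xi>d: "(\<xi> has_real_derivative \<xi>' x) (at x)" for x
    unfolding \<xi>_def \<xi>'_def using d by (auto intro!: derivative_eq_intros DERIV_chain2[OF sstep_deriv] simp: field_simps)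
  have \<xi>1: "\<xi> x = 1" "\<xi>' x = 0" if "x \<in> {K1..K2}" for x
  proof -
    have "1 \<le> (x - al) / d1 - 1" "1 \<le> (be - x) / d2 - 1" using that d by (auto simp: field_simps)
    then show "\<xi> x = 1" "\<xi>' x = 0" unfolding \<xi>_def \<xi>'_def by (auto simp: sstep_1 bump_zero)
  qed
  have \<xi>0: "\<xi> x = 0" if "x \<notin> {al + d1..be - d2}" for x
  proof -
    have "(x - al) / d1 - 1 \<le> 0 \<or> (be - x) / d2 - 1 \<le> 0" using that d by (auto simp: field_simps)
    then show ?thesis unfolding \<xi>_def by (auto simp: sstep_0)
  qed
  \<comment> \<open>The steps take place in \<open>{1/n..2/n}\<close> and \<open>{T - 2/n..T - 1/n}\<close>. If \<open>n * T > 3\<close>, the second one starts after \<open>1/n\<close> and the first one ends before \<open>T - 1/n\<close>.\<close>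
  define \<eta> where "\<eta> n t = sstep (real n * t + - 1) - sstep (real n * t + (2 - real n * T))" for n t
  define \<kappa>0 where "\<kappa>0 n t = real n * bump (real n * t + - 1)" for n t
  define \<kappa>T where "\<kappa>T n t = real n * bump (real n * t + (2 - real n * T))" for n t
  have \<eta>d: "(\<eta> n has_real_derivative \<kappa>0 n t - \<kappa>T n t) (at t)" for n t
    unfolding \<eta>_def \<kappa>0_def \<kappa>T_def by (auto intro!: derivative_eq_intros DERIV_chain2[OF sstep_deriv])
  have \<eta>c: "continuous_on UNIV (\<eta> n)" for n
    using \<eta>d by (meson DERIV_isCont continuous_at_imp_continuous_on)
  have \<kappa>c: "continuous_on UNIV (\<kappa>0 n)" "continuous_on UNIV (\<kappa>T n)" for n
    unfolding \<kappa>0_def \<kappa>T_def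
    by (intro continuous_intros continuous_on_compose2[OF smooth_continuous[OF bump_smooth, of UNIV]]; simp)+
  obtain n0 :: nat where n0: "real n0 > 3 / T" "n0 > 0" using reals_Archimedean2[of "max (3/T) 0"] by auto
  have big: "real n * T > 3" "n > 0" if "n \<ge> n0" for n
  proof -
    have "3 / T < real n" using n0 that by (meson less_le_trans of_nat_mono)
    then show "real n * T > 3" "n > 0" using T n0 that by (auto simp: field_simps)
  qed
  have \<eta>0: "\<eta> n t = 0" if n: "n \<ge> n0" and t: "t \<notin> {1 / real n..T - 1 / real n}" for n t
  proof -
    from t consider "t < 1 / real n" | "t > T - 1 / real n" by force
    then show ?thesis
    proof cases
      case 1
      then have "real n * t < 1" using big[OF n] by (simp add: field_simps)
      then show ?thesis using big[OF n] unfolding \<eta>_def by (simp add: sstep_0)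
    next
      case 2
      then have "real n * t > real n * T - 1" using big[OF n] by (simp add: field_simps)
      then show ?thesis using big[OF n] unfolding \<eta>_def by (simp add: sstep_1)
    qed
  qed
  have key: "(LINT z:Q|lborel. (\<kappa>0 n (fst z) - \<kappa>T n (fst z)) * (u z * w z)) = - (LINT z:Q|lborel. \<eta> n (fst z) * G z)"
    if n: "n \<ge> n0" for n
  proof -
    define y where "y z = (\<eta> n (fst z) * \<xi> (snd z)) * u z" for z
    define yt where "yt z = ((\<kappa>0 n (fst z) - \<kappa>T n (fst z)) * \<xi> (snd z)) * u z + (\<eta> n (fst z) * \<xi> (snd z)) * ut z" for z
    define yx where "yx z = (\<eta> n (fst z) * \<xi>' (snd z)) * u z + (\<eta> n (fst z) * \<xi> (snd z)) * ux z" for z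
    have sm: "smooth y"
    proof -
      have s1: "smooth (\<lambda>z::real\<times>real. sstep (a + (c * fst z + e * snd z)))" for a c e
        by (rule smooth_affine2[OF sstep_smooth])
      have "smooth (\<lambda>z::real\<times>real. \<eta> n (fst z))"
        using smooth_intros(5)[OF s1[of "-1" "real n" 0] s1[of "2 - real n * T" "real n" 0]] unfolding \<eta>_def by (simp add: add.commute)
      moreover have "smooth (\<lambda>z::real\<times>real. \<xi> (snd z))"
        using smooth_intros(3)[OF s1[of "- al / d1 - 1" 0 "1/d1"] s1[of "be / d2 - 1" 0 "-1/d2"]] d unfolding \<xi>_def
        by (simp add: diff_divide_distrib algebra_simps)
      ultimately show ?thesis unfolding y_def by (intro smooth_intros(3) u(1))
    qed
    have sup: "closure {z. y z \<noteq> 0} \<subseteq> {1 / real n..T - 1 / real n} \<times> {al + d1..be - d2}"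
    proof (rule closure_minimal)
      show "{z. y z \<noteq> 0} \<subseteq> {1 / real n..T - 1 / real n} \<times> {al + d1..be - d2}"
      proof
        fix z assume "z \<in> {z. y z \<noteq> 0}"
        then have "\<eta> n (fst z) \<noteq> 0" "\<xi> (snd z) \<noteq> 0" unfolding y_def by auto
        then show "z \<in> {1 / real n..T - 1 / real n} \<times> {al + d1..be - d2}"
          using \<eta>0[OF n] \<xi>0 by (metis mem_Times_iff)
      qed
    qed (intro closed_Times closed_atLeastAtMost)
    have cm: "compact (closure {z. y z \<noteq> 0})"
      unfolding compact_closure
      by (rule bounded_subset[OF bounded_Times[OF bounded_closed_interval bounded_closed_interval] order_trans[OF closure_subset sup]])
    have "{1 / real n..T - 1 / real n} \<times> {al + d1..be - d2} \<subseteq> {0<..<T} \<times> {al<..<be}"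
      using big[OF n] d by (intro Sigma_mono) (auto simp: less_le_trans[of 0 "1 / real n"] le_less_trans[of _ "T - 1 / real n"])
    then have sup2: "closure {z. y z \<noteq> 0} \<subseteq> {0<..<T} \<times> {al<..<be}" using sup by blast
    have dyt: "((\<lambda>t. y (t, x)) has_real_derivative yt (t, x)) (at t)" for t x
      unfolding y_def yt_def using \<eta>d u(2) by (auto intro!: derivative_eq_intros)
    have dyx: "((\<lambda>x. y (t, x)) has_real_derivative yx (t, x)) (at x)" for t x
      unfolding y_def yx_def using \<xi>d u(3) by (auto intro!: derivative_eq_intros)
    have b1: "bfun Q (\<lambda>z. \<eta> n (fst z))" "bfun Q (\<lambda>z. \<kappa>0 n (fst z))" "bfun Q (\<lambda>z. \<kappa>T n (fst z))"
      unfolding Q_def by (intro bfun_fst bfun_continuous \<eta>c \<kappa>c; simp)+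
    have e1: "w z * yt z = ((\<kappa>0 n (fst z) - \<kappa>T n (fst z)) * u z) * w z + (\<eta> n (fst z) * ut z) * w z"
      "w z * yx z = (\<eta> n (fst z) * ux z) * w z" "b z * y z = (\<eta> n (fst z) * u z) * b z" for z
    proof -
      obtain t x where z: "z = (t, x)" by force
      show "w z * yt z = ((\<kappa>0 n (fst z) - \<kappa>T n (fst z)) * u z) * w z + (\<eta> n (fst z) * ut z) * w z"
        "w z * yx z = (\<eta> n (fst z) * ux z) * w z" "b z * y z = (\<eta> n (fst z) * u z) * b z"
        using w0[of x t] b0[of x t] \<xi>1[of x] unfolding z yt_def yx_def y_def
        by (cases "x \<in> {K1..K2}"; simp add: algebra_simps)+
    qed
    note i = iw[OF bfun_mult[OF bfun_diff[OF b1(2,3)] bu(1)]] iw[OF bfun_mult[OF b1(1) bu(2)]] iw[OF bfun_mult[OF b1(1) bu(3)]]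
      ib[OF bfun_mult[OF b1(1) bu(1)]]
    have "- ((LINT z:Q|lborel. ((\<kappa>0 n (fst z) - \<kappa>T n (fst z)) * u z) * w z) + (LINT z:Q|lborel. (\<eta> n (fst z) * ut z) * w z))
       - s * (LINT z:Q|lborel. (\<eta> n (fst z) * ux z) * w z) = (LINT z:Q|lborel. (\<eta> n (fst z) * u z) * b z)"
      using weak[OF sm cm sup2 dyt dyx] unfolding e1 Q_def[symmetric] set_integral_add(2)[OF i(1,2)] .
    moreover have "(LINT z:Q|lborel. \<eta> n (fst z) * G z) = (LINT z:Q|lborel. (\<eta> n (fst z) * ut z) * w z)
       + s * (LINT z:Q|lborel. (\<eta> n (fst z) * ux z) * w z) + (LINT z:Q|lborel. (\<eta> n (fst z) * u z) * b z)"
    proof -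
      have "(\<lambda>z. \<eta> n (fst z) * G z) = (\<lambda>z. ((\<eta> n (fst z) * ut z) * w z + s * ((\<eta> n (fst z) * ux z) * w z)) + (\<eta> n (fst z) * u z) * b z)"
        unfolding G_def by (auto simp: algebra_simps)
      then show ?thesis using i by (simp only: set_integral_add set_integrable_mult_right set_integral_mult_right)
    qed
    ultimately show ?thesis by (simp add: mult.assoc)
  qed
  have lim1: "(\<lambda>n. LINT t:{0..T}|lborel. \<kappa>0 n t * FF t) \<longlonglongrightarrow> FF 0"
  proof (rule approx_identity)
    show "eventually (\<lambda>n. (LINT t:{0..T}|lborel. \<kappa>0 n t) = 1) sequentially"
      using eventually_ge_at_top[of n0]
    proof eventually_elim
      case (elim n)
      show ?case unfolding \<kappa>0_def using big[OF elim] T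
        by (intro step_kernel) (auto simp: sstep_0 sstep_1)
    qed
    fix d :: real assume d: "d > 0"
    obtain n1 :: nat where n1: "real n1 > 2 / d" using reals_Archimedean2 by blast
    show "eventually (\<lambda>n. \<forall>t\<in>{0..T}. d \<le> \<bar>t - 0\<bar> \<longrightarrow> \<kappa>0 n t = 0) sequentially"
      using eventually_ge_at_top[of n1]
    proof eventually_elim
      case (elim n)
      show ?case
      proof (intro ballI impI)
        fix t assume t: "t \<in> {0..T}" "d \<le> \<bar>t - 0\<bar>"
        have "2 < real n1 * d" using n1 d by (simp add: field_simps)
        also have "\<dots> \<le> real n * t" using elim t d by (intro mult_mono) auto
        finally show "\<kappa>0 n t = 0" unfolding \<kappa>0_def by (simp add: bump_zero)
      qed
    qed
  qed (use F T \<kappa>c bump_nonneg in \<open>auto simp: FF_def \<kappa>0_def\<close>)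
  have lim2: "(\<lambda>n. LINT t:{0..T}|lborel. \<kappa>T n t * FF t) \<longlonglongrightarrow> FF T"
  proof (rule approx_identity)
    show "eventually (\<lambda>n. (LINT t:{0..T}|lborel. \<kappa>T n t) = 1) sequentially"
      using eventually_ge_at_top[of n0]
    proof eventually_elim
      case (elim n)
      show ?case unfolding \<kappa>T_def using big[OF elim] T
        by (intro step_kernel) (auto simp: sstep_0 sstep_1)
    qed
    fix d :: real assume d: "d > 0"
    obtain n1 :: nat where n1: "real n1 > 2 / d" using reals_Archimedean2 by blast
    show "eventually (\<lambda>n. \<forall>t\<in>{0..T}. d \<le> \<bar>t - T\<bar> \<longrightarrow> \<kappa>T n t = 0) sequentially"
      using eventually_ge_at_top[of n1]
    proof eventually_elim
      case (elim n)
      show ?case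
      proof (intro ballI impI)
        fix t assume t: "t \<in> {0..T}" "d \<le> \<bar>t - T\<bar>"
        have "2 < real n1 * d" using n1 d by (simp add: field_simps)
        also have "\<dots> \<le> real n * (T - t)" using elim t d by (intro mult_mono) auto
        finally show "\<kappa>T n t = 0" unfolding \<kappa>T_def by (simp add: bump_zero algebra_simps)
      qed
    qed
  qed (use F T \<kappa>c bump_nonneg in \<open>auto simp: FF_def \<kappa>T_def\<close>)
  have L: "(LINT z:Q|lborel. (\<kappa>0 n (fst z) - \<kappa>T n (fst z)) * (u z * w z)) =
     (LINT t:{0..T}|lborel. \<kappa>0 n t * FF t) - (LINT t:{0..T}|lborel. \<kappa>T n t * FF t)" for n
  proof -
    have bk: "bfun Q (\<lambda>z. (\<kappa>0 n (fst z) - \<kappa>T n (fst z)) * u z)"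
      unfolding Q_def by (intro bfun_mult bfun_diff bfun_fst bfun_continuous \<kappa>c bu[unfolded Q_def]; simp)
    have "set_integrable lborel Q (\<lambda>z. (\<kappa>0 n (fst z) - \<kappa>T n (fst z)) * (u z * w z))"
      using iw[OF bk] by (simp add: mult.assoc)
    then have "(LINT z:Q|lborel. (\<kappa>0 n (fst z) - \<kappa>T n (fst z)) * (u z * w z)) =
      (LINT t:{0..T}|lborel. LINT x:{al..be}|lborel. (\<kappa>0 n t - \<kappa>T n t) * (u (t, x) * w (t, x)))"
      unfolding Q_def by (subst set_fubini_tx) auto
    also have "\<dots> = (LINT t:{0..T}|lborel. \<kappa>0 n t * FF t - \<kappa>T n t * FF t)"
    proof -
      have "(LINT x:{al..be}|lborel. (\<kappa>0 n t - \<kappa>T n t) * (u (t, x) * w (t, x))) = \<kappa>0 n t * FF t - \<kappa>T n t * FF t" for t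
        unfolding set_integral_mult_right FF_def by (simp only: mult.commute[of "u _"] left_diff_distrib)
      then show ?thesis by simp
    qed
    also have "\<dots> = (LINT t:{0..T}|lborel. \<kappa>0 n t * FF t) - (LINT t:{0..T}|lborel. \<kappa>T n t * FF t)"
      by (intro set_integral_diff(2) borel_integrable_atLeastAtMost' continuous_intros continuous_on_subset[OF \<kappa>c(1)]
           continuous_on_subset[OF \<kappa>c(2)]) (use F in \<open>auto simp: FF_def\<close>)
    finally show ?thesis .
  qed
  have lim3: "(\<lambda>n. LINT z:Q|lborel. \<eta> n (fst z) * G z) \<longlonglongrightarrow> (LINT z:Q|lborel. G z)"
    unfolding set_lebesgue_integral_def
  proof (rule integral_dominated_convergence[where w = "\<lambda>z. norm (indicator Q z *\<^sub>R G z)"])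
    have m: "(\<lambda>z. indicator Q z *\<^sub>R G z) \<in> borel_measurable lborel"
      using iG unfolding set_integrable_def by (rule borel_measurable_integrable)
    then show "(\<lambda>z. indicator Q z *\<^sub>R G z) \<in> borel_measurable lborel" .
    have m2: "(\<lambda>z::real\<times>real. \<eta> n (fst z)) \<in> borel_measurable lborel" for n
      using bfun_meas[OF bfun_fst[OF bfun_continuous[OF \<eta>c, of "{0..T}"], of UNIV]] by simp
    have "(\<lambda>z. \<eta> n (fst z) * (indicator Q z *\<^sub>R G z)) \<in> borel_measurable lborel" for n
      by (rule borel_measurable_times[OF m2 m])
    then show "(\<lambda>z. indicator Q z *\<^sub>R (\<eta> n (fst z) * G z)) \<in> borel_measurable lborel" for n
      by (simp add: mult_ac)
    show "integrable lborel (\<lambda>z. norm (indicator Q z *\<^sub>R G z))"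
      using iG unfolding set_integrable_def by (rule integrable_norm)
    show "AE z in lborel. norm (indicator Q z *\<^sub>R (\<eta> n (fst z) * G z)) \<le> norm (indicator Q z *\<^sub>R G z)" for n
    proof (rule AE_I2)
      fix z
      have "\<bar>\<eta> n t\<bar> \<le> 1" for t using sstep_bounds[of "real n * t + - 1"] sstep_bounds[of "real n * t + (2 - real n * T)"]
        unfolding \<eta>_def by linarith
      then show "norm (indicator Q z *\<^sub>R (\<eta> n (fst z) * G z)) \<le> norm (indicator Q z *\<^sub>R G z)"
        by (auto simp: abs_mult indicator_def intro!: mult_left_le_one_le)
    qed
    have "AE t in lborel. t \<notin> {0, T}" by (intro AE_not_in finite_imp_null_set_lborel) simp
    from AE_fst[OF this] show "AE z in lborel. (\<lambda>n. indicator Q z *\<^sub>R (\<eta> n (fst z) * G z)) \<longlonglongrightarrow> indicator Q z *\<^sub>R G z"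
    proof eventually_elim
      case (elim z)
      show ?case
      proof (cases "z \<in> Q")
        case True
        then have t: "0 < fst z" "fst z < T" using elim unfolding Q_def by (auto simp: mem_Times_iff)
        obtain n1 :: nat where n1: "real n1 > max (2 / fst z) (2 / (T - fst z))" using reals_Archimedean2 by blast
        have "eventually (\<lambda>n. indicator Q z *\<^sub>R (\<eta> n (fst z) * G z) = indicator Q z *\<^sub>R G z) sequentially"
          using eventually_ge_at_top[of n1]
        proof eventually_elim
          case (elim n)
          have "real n > 2 / fst z" "real n > 2 / (T - fst z)" using n1 elim by auto
          then have "real n * fst z > 2" "real n * (T - fst z) > 2" using t by (auto simp: field_simps)
          then have "\<eta> n (fst z) = 1" unfolding \<eta>_def by (simp add: sstep_1 sstep_0 algebra_simps)
          then show ?case by simp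
        qed
        then show ?thesis by (rule tendsto_eventually)
      qed simp
    qed
  qed
  have "(\<lambda>n. - (LINT z:Q|lborel. \<eta> n (fst z) * G z)) \<longlonglongrightarrow> FF 0 - FF T"
  proof (rule Lim_transform_eventually[OF tendsto_diff[OF lim1 lim2]])
    show "eventually (\<lambda>n. (LINT t:{0..T}|lborel. \<kappa>0 n t * FF t) - (LINT t:{0..T}|lborel. \<kappa>T n t * FF t)
        = - (LINT z:Q|lborel. \<eta> n (fst z) * G z)) sequentially"
      using eventually_ge_at_top[of n0] by eventually_elim (use key L in simp)
  qed
  from LIMSEQ_unique[OF this tendsto_minus[OF lim3]] show ?thesis
    unfolding FF_def G_def Q_def by linarith
qed

section \<open>The discrete transport problem\<close>

definition bump_bound :: real where "bump_bound = (SOME K. K > 0 \<and> (\<forall>x. \<bar>bump x\<bar> \<le> K))"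

lemma bump_bound: "bump_bound > 0" "\<bar>bump x\<bar> \<le> bump_bound"
proof -
  have "\<exists>K. K > 0 \<and> (\<forall>x. \<bar>bump x\<bar> \<le> K)" using bump_bounded by metis
  from someI_ex[OF this, folded bump_bound_def] show "bump_bound > 0" "\<bar>bump x\<bar> \<le> bump_bound" by auto
qed

lemma sum_sqrt_le:
  fixes y :: "nat \<Rightarrow> real"
  assumes "\<And>m. m \<in> {1..M} \<Longrightarrow> 0 \<le> y m"
  shows "(\<Sum>m=1..M. y m) \<le> sqrt (real M) * sqrt (\<Sum>m=1..M. (y m)\<^sup>2)"
proof -
  have "(\<Sum>m=1..M. y m)\<^sup>2 \<le> (\<Sum>m=1..M. (y m)\<^sup>2) * real (card {1..M})"
    by (rule sum_squared_le_sum_of_squares)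
  then have "sqrt ((\<Sum>m=1..M. y m)\<^sup>2) \<le> sqrt ((\<Sum>m=1..M. (y m)\<^sup>2) * real M)" by (intro real_sqrt_le_mono) simp
  then show ?thesis using assms by (simp add: real_sqrt_mult sum_nonneg mult.commute)
qed

lemma slab_union:
  assumes "h > 0"
  shows "(\<Union>m\<in>{1..M}. {real (m - 1) * h<..real m * h}) = {0<..real M * h}"
proof (induction M)
  case (Suc M)
  have "{1..Suc M} = insert (Suc M) {1..M}" by auto
  then have "(\<Union>m\<in>{1..Suc M}. {real (m - 1) * h<..real m * h}) = {real M * h<..real (Suc M) * h} \<union> {0<..real M * h}"
    using Suc by simp
  also have "\<dots> = {0<..real (Suc M) * h}" using assms by (auto simp: algebra_simps intro: add_nonneg_pos add_nonneg_nonneg order_trans[of _ "real M * h"])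
     (smt (verit) mult_nonneg_nonneg of_nat_0_le_iff)+
  finally show ?case .
qed simp

lemma slab_disjoint:
  assumes "h > 0"
  shows "disjoint_family_on (\<lambda>m. {real (m - 1) * h<..real m * h} \<times> X) {1..M}"
  unfolding disjoint_family_on_def
proof (intro ballI impI)
  fix m n :: nat assume mn: "m \<in> {1..M}" "n \<in> {1..M}" "m \<noteq> n"
  have key: "{real (m - 1) * h<..real m * h} \<inter> {real (n - 1) * h<..real n * h} = {}" if "m < n" for m n :: nat
  proof -
    have "real m \<le> real (n - 1)" using that by simp
    then have "real m * h \<le> real (n - 1) * h" using assms by (intro mult_right_mono) auto
    then show ?thesis by auto
  qed
  from mn(3) have "{real (m - 1) * h<..real m * h} \<inter> {real (n - 1) * h<..real n * h} = {}"
    using key[of m n] key[of n m] by (cases "m < n") auto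
  then show "({real (m - 1) * h<..real m * h} \<times> X) \<inter> ({real (n - 1) * h<..real n * h} \<times> X) = {}" by auto
qed

lemma slab_split:
  fixes f :: "real \<times> real \<Rightarrow> real"
  assumes h: "h > 0" and X: "X \<in> sets borel" and f: "set_integrable lborel ({0..real M * h} \<times> X) f" "f \<in> borel_measurable borel"
  shows "(LINT z:{0..real M * h} \<times> X|lborel. f z) = (\<Sum>m=1..M. LINT z:{real (m - 1) * h<..real m * h} \<times> X|lborel. f z)"
proof -
  have sub: "{real (m - 1) * h<..real m * h} \<times> X \<subseteq> {0..real M * h} \<times> X" if "m \<in> {1..M}" for m
  proof -
    have "{real (m - 1) * h<..real m * h} \<subseteq> {0<..real M * h}" using slab_union[OF h, of M] that by blast
    then show ?thesis by auto
  qed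
  have "(\<Sum>m=1..M. LINT z:{real (m - 1) * h<..real m * h} \<times> X|lborel. f z) = (LINT z:(\<Union>m\<in>{1..M}. {real (m - 1) * h<..real m * h} \<times> X)|lborel. f z)"
  proof (rule set_integral_finite_Union[OF _ slab_disjoint[OF h], symmetric])
    show "set_integrable lborel ({real (m - 1) * h<..real m * h} \<times> X) f" if "m \<in> {1..M}" for m
      by (rule set_integrable_subset[OF f(1) _ sub[OF that]]) (use X in \<open>auto intro!: borel_Times\<close>)
  qed (use X in \<open>auto intro!: borel_Times\<close>)
  also have "(\<Union>m\<in>{1..M}. {real (m - 1) * h<..real m * h} \<times> X) = {0<..real M * h} \<times> X"
    using slab_union[OF h, of M] by auto
  also have "(LINT z:{0<..real M * h} \<times> X|lborel. f z) = (LINT z:{0..real M * h} \<times> X|lborel. f z)"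
    unfolding set_lebesgue_integral_def
  proof (rule integral_cong_AE)
    have [measurable]: "X \<in> sets borel" "f \<in> borel_measurable borel" by fact+
    have b: "{0<..real M * h} \<times> X \<in> sets borel" "{0..real M * h} \<times> X \<in> sets borel" by (auto intro!: borel_Times X)
    then show "(\<lambda>x. indicat_real ({0<..real M * h} \<times> X) x *\<^sub>R f x) \<in> borel_measurable lborel"
      "(\<lambda>x. indicat_real ({0..real M * h} \<times> X) x *\<^sub>R f x) \<in> borel_measurable lborel" by measurable
    have "AE t in lborel. t \<noteq> (0::real)" using AE_not_in[OF finite_imp_null_set_lborel[of "{0::real}"]] by simp
    from AE_fst[OF this] show "AE z in lborel. indicat_real ({0<..real M * h} \<times> X) z *\<^sub>R f z = indicat_real ({0..real M * h} \<times> X) z *\<^sub>R f z"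
      by eventually_elim (auto simp: indicator_def)
  qed
  finally show ?thesis by simp
qed

text \<open>The exact field \<open>w\<close> and the discrete field, given by \<open>pf (c m)\<close> on slab \<open>m\<close>, for the transport
  equation \<open>w\<^sub>t + s w\<^sub>x = b\<close>. All data live in \<open>{K1..K2}\<close>, at distance more than \<open>4 * rho\<close> from the
  end points, which leaves room for the cut-off and the weight. The discrete field starts each slab with a jump; for \<open>m = 1\<close> the
  jump is taken with respect to the initial value.\<close>

locale scheme = mesh al be h \<T> k for al be h \<T> k +
  fixes T :: real and M :: nat and s cc K1 K2 rho :: real
    and c :: "nat \<Rightarrow> nat \<Rightarrow> real \<Rightarrow> real" and w0 wT :: "real \<Rightarrow> real" and w b r rt rx :: "real \<times> real \<Rightarrow> real"
  assumes Mh: "T = real M * h" "T > 0" and s: "s = 1 \<or> s = -1" and cc: "cc > 0"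
    and K: "rho > 0" "al + 4 * rho < K1" "K1 \<le> K2" "K2 < be - 4 * rho"
    and c: "\<And>m. m \<in> {1..M} \<Longrightarrow> \<forall>i\<le>k. pw (c m i)"
    and c0: "\<And>m i. m \<in> {1..M} \<Longrightarrow> i \<le> k \<Longrightarrow> c m i al = 0" "\<And>m i. m \<in> {1..M} \<Longrightarrow> i \<le> k \<Longrightarrow> c m i be = 0"
    and w0: "sqi {al..be} w0" "\<And>x. x \<notin> {K1..K2} \<Longrightarrow> w0 x = 0"
    and wT: "sqi {al..be} wT" "\<And>x. x \<notin> {K1..K2} \<Longrightarrow> wT x = 0"
    and w: "sqi ({0..T} \<times> {al..be}) w" "\<And>t x. x \<notin> {K1..K2} \<Longrightarrow> w (t, x) = 0"
    and b: "sqi ({0..T} \<times> {al..be}) b" "\<And>t x. x \<notin> {K1..K2} \<Longrightarrow> b (t, x) = 0"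
    and sqm: "\<And>m. m \<in> {1..M} \<Longrightarrow> sqi ({real (m - 1) * h<..real m * h} \<times> {al..be}) r"
      "\<And>m. m \<in> {1..M} \<Longrightarrow> sqi ({real (m - 1) * h<..real m * h} \<times> {al..be}) rt"
      "\<And>m. m \<in> {1..M} \<Longrightarrow> sqi ({real (m - 1) * h<..real m * h} \<times> {al..be}) rx"
    and rdef: "\<And>m z. m \<in> {1..M} \<Longrightarrow> z \<in> {real (m - 1) * h<..real m * h} \<times> {al..be} \<Longrightarrow> r z = b z - (pt (c m) z + s * px (c m) z)"
    and mode: "(s = 1 \<and> (\<forall>m\<in>{1..M}. \<forall>z\<in>{real (m - 1) * h<..real m * h} \<times> {al..be}. snd z \<notin> {K1..K2} \<longrightarrow> rt z = - pt (c m) z \<and> rx z = - px (c m) z)) \<or>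
       (\<forall>m\<in>{1..M}. \<forall>z\<in>{real (m - 1) * h<..real m * h} \<times> {al..be}. rt z = r z \<and> rx z = s * r z)"
    and gal: "\<And>m \<gamma>. m \<in> {1..M} \<Longrightarrow> \<forall>i\<le>k. pw (\<gamma> i) \<and> \<gamma> i al = 0 \<and> \<gamma> i be = 0 \<Longrightarrow>
       (LINT z:{real (m - 1) * h<..real m * h} \<times> {al..be}|lborel. r z * pf \<gamma> z + cc * h * (rt z * pt \<gamma> z + rx z * px \<gamma> z)) =
       (LINT x:{al..be}|lborel. (pf (c m) (real (m - 1) * h, x) - (if m = 1 then w0 x else pf (c (m - 1)) (real (m - 1) * h, x))) * pf \<gamma> (real (m - 1) * h, x))"
    and wid: "\<And>u ut ux. smooth u \<Longrightarrow> (\<And>t x. ((\<lambda>t. u (t, x)) has_real_derivative ut (t, x)) (at t)) \<Longrightarrow>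
      (\<And>t x. ((\<lambda>x. u (t, x)) has_real_derivative ux (t, x)) (at x)) \<Longrightarrow> continuous_on UNIV ut \<Longrightarrow> continuous_on UNIV ux \<Longrightarrow>
      (LINT x:{al..be}|lborel. wT x * u (T, x)) - (LINT x:{al..be}|lborel. w0 x * u (0, x)) =
      (LINT z:{0..T} \<times> {al..be}|lborel. w z * (ut z + s * ux z) + b z * u z)"
begin

definition tm :: "nat \<Rightarrow> real" where "tm m = real m * h"
definition I where "I m = {real (m - 1) * h<..real m * h}"
definition X where "X = {al..be}"
definition prev where "prev m x = (if m = 1 then w0 x else pf (c (m - 1)) (tm (m - 1), x))"
definition J where "J m x = pf (c m) (tm (m - 1), x) - prev m x"
definition R2 where "R2 m = (nrm (I m \<times> X) r)\<^sup>2 + (nrm (I m \<times> X) rt)\<^sup>2 + (nrm (I m \<times> X) rx)\<^sup>2"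
definition y2 where "y2 m = h\<^sup>2 * R2 m + h * (nrm X (J m))\<^sup>2"
text \<open>\<open>Y\<close> is the size of the residuals. The jumps have the weight \<open>h\<close> because \<open>h * residual2\<close>
  is a jump, constant in time over a slab of length \<open>h\<close>.\<close>

definition Y where "Y = sqrt (\<Sum>m=1..M. y2 m)"

lemma Xb: "X \<in> sets borel" "bounded X" unfolding X_def by auto

lemma Ib: "I m \<in> sets borel" "bounded (I m)" unfolding I_def
  by (auto intro: bounded_subset[OF bounded_closed_interval])

lemma IXb: "I m \<times> X \<in> sets borel" "bounded (I m \<times> X)" using Ib Xb by (auto intro!: borel_Times bounded_Times)

lemma tm_pred: "m \<in> {1..M} \<Longrightarrow> tm m = tm (m - 1) + h" unfolding tm_def by (cases m) (auto simp: algebra_simps)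

lemma I_tm: "I m = {tm (m - 1)<..tm m}" unfolding I_def tm_def ..

lemma pf_slice_sqi: "m \<in> {1..M} \<Longrightarrow> A \<subseteq> X \<Longrightarrow> A \<in> sets borel \<Longrightarrow> sqi A (\<lambda>x. pf (c m) (t, x))"
  using bfun_slice[OF pf_bfun(1)[of "{t}" "c m" A], of t] c by (intro bfun_sqi bounded_subset[OF Xb(2)]) auto

lemma prev_sqi: "m \<in> {1..M} \<Longrightarrow> sqi X (prev m)"
proof (cases "m = 1")
  case True
  then show ?thesis unfolding prev_def using w0 by (simp add: X_def)
next
  case False
  assume "m \<in> {1..M}"
  then have "m - 1 \<in> {1..M}" using False by auto
  from pf_slice_sqi[OF this, of X] show ?thesis unfolding prev_def using False Xb by simp
qed

lemma J_sqi: "m \<in> {1..M} \<Longrightarrow> sqi X (J m)"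
  unfolding J_def by (intro sqi_diff pf_slice_sqi prev_sqi Xb) auto

lemma M1: "M \<ge> 1" using Mh by (cases M) auto

lemma y2_nonneg: "0 \<le> y2 m" unfolding y2_def R2_def using h0 by simp

lemma Y2: "Y\<^sup>2 = (\<Sum>m=1..M. y2 m)" "0 \<le> Y" unfolding Y_def using y2_nonneg by (auto simp: sum_nonneg)

lemma sqs: "m \<in> {1..M} \<Longrightarrow> sqi (I m \<times> X) r" "m \<in> {1..M} \<Longrightarrow> sqi (I m \<times> X) rt" "m \<in> {1..M} \<Longrightarrow> sqi (I m \<times> X) rx"
  using sqm unfolding I_def X_def by auto

lemma gal': "m \<in> {1..M} \<Longrightarrow> \<forall>i\<le>k. pw (\<gamma> i) \<and> \<gamma> i al = 0 \<and> \<gamma> i be = 0 \<Longrightarrow>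
  (LINT z:I m \<times> X|lborel. r z * pf \<gamma> z + cc * h * (rt z * pt \<gamma> z + rx z * px \<gamma> z)) = (LINT x:X|lborel. J m x * pf \<gamma> (tm (m - 1), x))"
  using gal[of m \<gamma>] unfolding I_def X_def J_def prev_def tm_def by simp

subsection \<open>The error identity\<close>

lemma slab_identity:
  assumes m: "m \<in> {1..M}" and u: "continuous_on UNIV u" "\<And>t x. ((\<lambda>t. u (t, x)) has_real_derivative ut (t, x)) (at t)"
    "\<And>t x. ((\<lambda>x. u (t, x)) has_real_derivative ux (t, x)) (at x)" "continuous_on UNIV ut" "continuous_on UNIV ux"
  shows "(LINT z:I m \<times> X|lborel. (pt (c m) z + s * px (c m) z) * u z + pf (c m) z * (ut z + s * ux z)) =
     (LINT x:X|lborel. pf (c m) (tm m, x) * u (tm m, x)) - (LINT x:X|lborel. pf (c m) (tm (m - 1), x) * u (tm (m - 1), x))"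
proof -
  have bu: "bfun S u" "bfun S ut" "bfun S ux" if "bounded S" for S using that u by (auto intro!: bfun_continuous)
  have p: "bfun (A \<times> X) (pf (c m))" "bfun (A \<times> X) (pt (c m))" "bfun (A \<times> X) (px (c m))" if "bounded A" for A
    using that c[OF m] by (intro pf_bfun; simp)+
  have i: "set_integrable lborel (I m \<times> X) f" if "bfun (I m \<times> X) f" for f using that IXb by (rule bfun_integrable)
  have tt: "tm (m - 1) \<le> tm m" using tm_pred[OF m] h0 by simp
  have "(LINT z:I m \<times> X|lborel. pt (c m) z * u z + pf (c m) z * ut z) = (LINT x:X|lborel. pf (c m) (tm m, x) * u (tm m, x) - pf (c m) (tm (m - 1), x) * u (tm (m - 1), x))"
    unfolding I_tm
  proof (rule slab_integral_dt[OF tt Xb, where F = "\<lambda>z. pf (c m) z * u z" and Ft = "\<lambda>z. pt (c m) z * u z + pf (c m) z * ut z"])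
    show "((\<lambda>t. pf (c m) (t, x) * u (t, x)) has_vector_derivative pt (c m) (t, x) * u (t, x) + pf (c m) (t, x) * ut (t, x)) (at t)" for t x
      using DERIV_mult[OF pf_dt[of "c m" x t, unfolded has_real_derivative_iff_has_vector_derivative[symmetric]] u(2)[of x t]]
      by (simp add: has_real_derivative_iff_has_vector_derivative mult.commute add.commute)
    have "bounded ({tm (m - 1)..tm m} \<times> X)" using Xb by (auto intro: bounded_Times)
    then show "bfun ({tm (m - 1)..tm m} \<times> X) (\<lambda>z. pt (c m) z * u z + pf (c m) z * ut z)"
      by (intro bfun_add bfun_mult p bu) auto
  qed
  also have "\<dots> = (LINT x:X|lborel. pf (c m) (tm m, x) * u (tm m, x)) - (LINT x:X|lborel. pf (c m) (tm (m - 1), x) * u (tm (m - 1), x))"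
  proof (rule set_integral_diff(2))
    have "bfun X (\<lambda>x. pf (c m) (t, x) * u (t, x))" for t
    proof -
      have "bounded ({t} \<times> X)" using Xb by (auto intro: bounded_Times)
      then have "bfun ({t} \<times> X) (\<lambda>z. pf (c m) z * u z)" by (intro bfun_mult p bu) auto
      then show ?thesis by (rule bfun_slice) simp
    qed
    then show "set_integrable lborel X (\<lambda>x. pf (c m) (tm m, x) * u (tm m, x))" "set_integrable lborel X (\<lambda>x. pf (c m) (tm (m - 1), x) * u (tm (m - 1), x))"
      using Xb by (auto intro!: bfun_integrable)
  qed
  finally have t: "(LINT z:I m \<times> X|lborel. pt (c m) z * u z + pf (c m) z * ut z) =
    (LINT x:X|lborel. pf (c m) (tm m, x) * u (tm m, x)) - (LINT x:X|lborel. pf (c m) (tm (m - 1), x) * u (tm (m - 1), x))" .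
  have x: "(LINT z:I m \<times> X|lborel. px (c m) z * u z + pf (c m) z * ux z) = 0"
    unfolding X_def
  proof (rule slab_integral_dx[OF fin_nodes less_imp_le[OF ab] Ib, where F = "\<lambda>z. pf (c m) z * u z" and Fx = "\<lambda>z. px (c m) z * u z + pf (c m) z * ux z"])
    have cx: "continuous_on S (\<lambda>x. u (t, x))" for S t using u(3) by (meson DERIV_isCont continuous_at_imp_continuous_on)
    show "continuous_on {al..be} (\<lambda>x. pf (c m) (t, x) * u (t, x))" for t
      by (intro continuous_intros pf_cont_x c m cx)
    show "((\<lambda>x. pf (c m) (t, x) * u (t, x)) has_vector_derivative px (c m) (t, x) * u (t, x) + pf (c m) (t, x) * ux (t, x)) (at x)"
      if "x \<in> {al<..<be} - nodes" for t x
    proof -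
      have "x \<in> {al..be} - nodes" using that by auto
      from DERIV_mult[OF pf_dx[OF c[OF m] this, of t, unfolded has_real_derivative_iff_has_vector_derivative[symmetric]] u(3)[of t x]]
      show ?thesis by (simp add: has_real_derivative_iff_has_vector_derivative mult.commute add.commute)
    qed
    show "bfun (I m \<times> {al..be}) (\<lambda>z. px (c m) z * u z + pf (c m) z * ux z)"
      using p[OF Ib(2)] bu[OF IXb(2)] unfolding X_def by (intro bfun_add bfun_mult)
    show "pf (c m) (t, al) * u (t, al) = 0" "pf (c m) (t, be) * u (t, be) = 0" for t
      using c0[OF m] by (auto simp: pf_zero)
  qed
  have "(LINT z:I m \<times> X|lborel. (pt (c m) z + s * px (c m) z) * u z + pf (c m) z * (ut z + s * ux z)) =
    (LINT z:I m \<times> X|lborel. (pt (c m) z * u z + pf (c m) z * ut z) + s * (px (c m) z * u z + pf (c m) z * ux z))"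
    by (simp add: algebra_simps)
  also have "\<dots> = (LINT z:I m \<times> X|lborel. pt (c m) z * u z + pf (c m) z * ut z) + s * (LINT z:I m \<times> X|lborel. px (c m) z * u z + pf (c m) z * ux z)"
    using i[OF bfun_add[OF bfun_mult[OF p(2)[OF Ib(2)] bu(1)[OF IXb(2)]] bfun_mult[OF p(1)[OF Ib(2)] bu(2)[OF IXb(2)]]]]
      i[OF bfun_add[OF bfun_mult[OF p(3)[OF Ib(2)] bu(1)[OF IXb(2)]] bfun_mult[OF p(1)[OF Ib(2)] bu(3)[OF IXb(2)]]]]
    by (simp only: set_integral_add set_integrable_mult_right set_integral_mult_right)
  finally show ?thesis unfolding x t by simp
qed

lemma slab_subset: "m \<in> {1..M} \<Longrightarrow> I m \<times> X \<subseteq> {0..T} \<times> X"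
proof -
  assume "m \<in> {1..M}"
  then have "I m \<subseteq> {0<..real M * h}" using slab_union[OF h0, of M] unfolding I_def by blast
  then show ?thesis using Mh by auto
qed

text \<open>The identity for \<open>w\<close> minus the sum over all slabs of the integration by parts for the discrete field. The boundary
  terms of the latter do not cancel at the times between two slabs; they leave the jumps.\<close>

lemma error_identity:
  assumes u: "smooth u" "\<And>t x. ((\<lambda>t. u (t, x)) has_real_derivative ut (t, x)) (at t)"
    "\<And>t x. ((\<lambda>x. u (t, x)) has_real_derivative ux (t, x)) (at x)" "continuous_on UNIV ut" "continuous_on UNIV ux"
  shows "(LINT x:X|lborel. (wT x - pf (c M) (T, x)) * u (T, x)) =
     (\<Sum>m=1..M. (LINT z:I m \<times> X|lborel. (w z - pf (c m) z) * (ut z + s * ux z)) + ((LINT z:I m \<times> X|lborel. r z * u z)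
        - (LINT x:X|lborel. J m x * u (tm (m - 1), x))))"
proof -
  have cu: "continuous_on UNIV u" using u(1) by (rule smooth_continuous)
  have bu: "bfun S u" "bfun S ut" "bfun S ux" if "bounded S" for S using that u cu by (auto intro!: bfun_continuous)
  have su: "sqi X (\<lambda>x. u (t, x))" for t
  proof -
    have "bounded ({t} \<times> X)" using Xb by (auto intro: bounded_Times)
    then have "bfun ({t} \<times> X) u" by (rule bu)
    from bfun_slice[OF this, of t] show ?thesis using Xb by (intro bfun_sqi) auto
  qed
  have QX: "{0..T} \<times> X \<in> sets borel" "bounded ({0..T} \<times> X)" using Xb by (auto intro!: borel_Times bounded_Times)
  have wb: "sqi ({0..T} \<times> X) w" "sqi ({0..T} \<times> X) b" using w b unfolding X_def by auto
  define G where "G z = w z * (ut z + s * ux z) + b z * u z" for z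
  have bfs: "sqi S g" if "bfun S g" "S \<in> sets borel" "bounded S" for S g using that by (rule bfun_sqi)
  have iw: "set_integrable lborel ({0..T} \<times> X) (\<lambda>z. w z * (ut z + s * ux z))"
    "set_integrable lborel ({0..T} \<times> X) (\<lambda>z. b z * u z)"
    by (intro sqi_mult_integrable wb bfs bfun_add bfun_mult bfun_const bu QX)+
  then have iG: "set_integrable lborel ({0..T} \<times> X) G" unfolding G_def by (rule set_integral_add(1))
  have mG: "G \<in> borel_measurable borel"
  proof -
    have "ut \<in> borel_measurable borel" "ux \<in> borel_measurable borel" "u \<in> borel_measurable borel"
      using bu[of "{}"] by (auto dest: bfun_meas)
    moreover have "w \<in> borel_measurable borel" "b \<in> borel_measurable borel" using wb by (auto dest: sqi_meas)
    ultimately show ?thesis unfolding G_def by measurable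
  qed
  have W: "(LINT x:X|lborel. wT x * u (T, x)) - (LINT x:X|lborel. w0 x * u (0, x)) = (\<Sum>m=1..M. LINT z:I m \<times> X|lborel. G z)"
    using wid[OF u] slab_split[OF h0 Xb(1), of M G] iG mG unfolding Mh(1) X_def I_def G_def by simp
  define p where "p m t = (LINT x:X|lborel. pf (c m) (t, x) * u (t, x))" for m t
  have slab: "(LINT z:I m \<times> X|lborel. G z) - (p m (tm m) - p m (tm (m - 1))) =
     (LINT z:I m \<times> X|lborel. (w z - pf (c m) z) * (ut z + s * ux z)) + (LINT z:I m \<times> X|lborel. r z * u z)" if m: "m \<in> {1..M}" for m
  proof -
    have pb: "bfun (I m \<times> X) (pf (c m))" "bfun (I m \<times> X) (pt (c m))" "bfun (I m \<times> X) (px (c m))"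
      using c[OF m] Ib by (intro pf_bfun; simp)+
    note bu' = bu[OF IXb(2)[of m]]
    have w': "sqi (I m \<times> X) w" by (rule sqi_subset[OF wb(1) slab_subset[OF m] IXb(1)])
    have i1: "set_integrable lborel (I m \<times> X) G" by (rule set_integrable_subset[OF iG _ slab_subset[OF m]]) (use IXb in simp)
    have i2: "set_integrable lborel (I m \<times> X) (\<lambda>z. (pt (c m) z + s * px (c m) z) * u z + pf (c m) z * (ut z + s * ux z))"
      by (intro bfun_integrable bfun_add bfun_mult bfun_const pb bu' IXb)
    have i3: "set_integrable lborel (I m \<times> X) (\<lambda>z. (w z - pf (c m) z) * (ut z + s * ux z))"
      by (intro sqi_mult_integrable sqi_diff w' bfs pb bfun_add bfun_mult bfun_const bu' IXb)
    have i4: "set_integrable lborel (I m \<times> X) (\<lambda>z. r z * u z)" by (intro sqi_mult_integrable sqs m bfs bu' IXb)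
    have "(LINT z:I m \<times> X|lborel. G z) - (p m (tm m) - p m (tm (m - 1))) =
      (LINT z:I m \<times> X|lborel. G z - ((pt (c m) z + s * px (c m) z) * u z + pf (c m) z * (ut z + s * ux z)))"
      unfolding p_def slab_identity[OF m cu u(2-5), symmetric] by (rule set_integral_diff(2)[OF i1 i2, symmetric])
    also have "\<dots> = (LINT z:I m \<times> X|lborel. (w z - pf (c m) z) * (ut z + s * ux z) + r z * u z)"
    proof (rule set_lebesgue_integral_cong)
      show "\<forall>z. z \<in> I m \<times> X \<longrightarrow> G z - ((pt (c m) z + s * px (c m) z) * u z + pf (c m) z * (ut z + s * ux z)) = (w z - pf (c m) z) * (ut z + s * ux z) + r z * u z"
      proof (intro allI impI)
        fix z assume "z \<in> I m \<times> X"
        then have e: "r z = b z - (pt (c m) z + s * px (c m) z)" using rdef[OF m] unfolding I_def X_def by blast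
        show "G z - ((pt (c m) z + s * px (c m) z) * u z + pf (c m) z * (ut z + s * ux z)) = (w z - pf (c m) z) * (ut z + s * ux z) + r z * u z"
          unfolding G_def e by (simp add: algebra_simps)
      qed
    qed (use IXb in simp)
    also have "\<dots> = (LINT z:I m \<times> X|lborel. (w z - pf (c m) z) * (ut z + s * ux z)) + (LINT z:I m \<times> X|lborel. r z * u z)"
      by (rule set_integral_add(2)[OF i3 i4])
    finally show ?thesis .
  qed
  define q where "q n = (if n = 0 then (LINT x:X|lborel. w0 x * u (0, x)) else p n (tm n))" for n
  have jump: "(LINT x:X|lborel. J m x * u (tm (m - 1), x)) = p m (tm (m - 1)) - q (m - 1)" if m: "m \<in> {1..M}" for m
  proof -
    have "(LINT x:X|lborel. J m x * u (tm (m - 1), x)) = (LINT x:X|lborel. pf (c m) (tm (m - 1), x) * u (tm (m - 1), x) - prev m x * u (tm (m - 1), x))"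
      unfolding J_def by (simp add: left_diff_distrib)
    also have "\<dots> = p m (tm (m - 1)) - (LINT x:X|lborel. prev m x * u (tm (m - 1), x))"
      unfolding p_def by (intro set_integral_diff(2) sqi_mult_integrable su pf_slice_sqi prev_sqi m Xb) simp
    also have "(LINT x:X|lborel. prev m x * u (tm (m - 1), x)) = q (m - 1)"
      using m unfolding q_def prev_def p_def by (auto simp: tm_def)
    finally show ?thesis .
  qed
  have tel: "(\<Sum>m=1..M. q m - q (m - 1)) = q M - q 0"
    by (induction M) (auto simp: atLeastAtMostSuc_conv)
  have "(\<Sum>m=1..M. (LINT z:I m \<times> X|lborel. (w z - pf (c m) z) * (ut z + s * ux z)) + ((LINT z:I m \<times> X|lborel. r z * u z)
        - (LINT x:X|lborel. J m x * u (tm (m - 1), x)))) = (\<Sum>m=1..M. (LINT z:I m \<times> X|lborel. G z) - (q m - q (m - 1)))"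
  proof (rule sum.cong[OF refl])
    fix m assume m: "m \<in> {1..M}"
    then have "q m = p m (tm m)" unfolding q_def by auto
    then show "(LINT z:I m \<times> X|lborel. (w z - pf (c m) z) * (ut z + s * ux z)) + ((LINT z:I m \<times> X|lborel. r z * u z)
        - (LINT x:X|lborel. J m x * u (tm (m - 1), x))) = (LINT z:I m \<times> X|lborel. G z) - (q m - q (m - 1))"
      using slab[OF m] jump[OF m] by simp
  qed
  also have "\<dots> = (\<Sum>m=1..M. LINT z:I m \<times> X|lborel. G z) - (q M - q 0)" using tel unfolding sum_subtractf by linarith
  also have "\<dots> = (LINT x:X|lborel. wT x * u (T, x)) - p M T"
    unfolding W[symmetric] q_def using M1 Mh(1) by (simp add: tm_def)
  also have "\<dots> = (LINT x:X|lborel. wT x * u (T, x) - pf (c M) (T, x) * u (T, x))"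
    unfolding p_def using wT(1) M1 unfolding X_def[symmetric]
    by (intro set_integral_diff(2)[symmetric] sqi_mult_integrable su pf_slice_sqi Xb) auto
  finally show ?thesis by (simp add: left_diff_distrib)
qed

end

section \<open>The dual estimate\<close>

lemma cont_comp:
  fixes f :: "'b::topological_space \<Rightarrow> 'c::topological_space"
  assumes "continuous_on UNIV f" "continuous_on S g" shows "continuous_on S (\<lambda>x. f (g x))"
  by (rule continuous_on_compose2[OF assms]) simp

context scheme begin

definition inflow where "inflow = (if s = 1 then al else be)"
definition depth where "depth x = s * (x - inflow)"

text \<open>The zone has to stay away from the support of the data, and the weight \<open>s * (z - x)\<close> has to be at least
  \<open>rho\<close> where the cut-off varies, that is, at depths up to \<open>2 * rho\<close>. The range from \<open>3 * rho\<close> to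
  \<open>4 * rho\<close> for the depth of \<open>z\<close> allows both, and contains a node if \<open>h \<le> rho\<close>.\<close>

definition good_zone where
  "good_zone z zl zr \<longleftrightarrow> end_zone z {zl..zr} \<and> zl \<le> zr \<and> ((s = 1 \<and> zl = al \<and> zr = z) \<or> (s = -1 \<and> zl = z \<and> zr = be)) \<and>
     3 * rho \<le> depth z \<and> depth z \<le> 4 * rho"

lemma node_end_zone: assumes "z \<in> nodes" "z \<in> X" shows "end_zone z {al..z}" "end_zone z {z..be}"
proof -
  have alt: "hi \<tau> \<le> z \<or> z \<le> lo \<tau>" if "\<tau> \<in> \<T>" for \<tau>
    using node_not_int[OF assms(1) that] elem(6)[OF that] by auto
  have e: "\<tau> \<subseteq> {al..z} \<or> \<tau> \<inter> {al..z} \<subseteq> {z} \<and> interior \<tau> \<inter> {al..z} = {}"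
    "\<tau> \<subseteq> {z..be} \<or> \<tau> \<inter> {z..be} \<subseteq> {z} \<and> interior \<tau> \<inter> {z..be} = {}" if t: "\<tau> \<in> \<T>" for \<tau>
  proof -
    have i: "x \<in> \<tau> \<Longrightarrow> lo \<tau> \<le> x \<and> x \<le> hi \<tau>" for x using elem(1)[OF t] by auto
    have j: "x \<in> interior \<tau> \<Longrightarrow> lo \<tau> < x \<and> x < hi \<tau>" for x using elem(6)[OF t] by auto
    show "\<tau> \<subseteq> {al..z} \<or> \<tau> \<inter> {al..z} \<subseteq> {z} \<and> interior \<tau> \<inter> {al..z} = {}"
      "\<tau> \<subseteq> {z..be} \<or> \<tau> \<inter> {z..be} \<subseteq> {z} \<and> interior \<tau> \<inter> {z..be} = {}"
      using alt[OF t] i j elem(4,5)[OF t] by force+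
  qed
  have gen: "end_zone z S" if "S \<in> sets borel" "S \<subseteq> {al..be}" "\<forall>\<tau>\<in>\<T>. \<tau> \<subseteq> S \<or> \<tau> \<inter> S \<subseteq> {z} \<and> interior \<tau> \<inter> S = {}" for S
    using that assms(1) unfolding end_zone_def zone_def by blast
  have sub: "{al..z} \<subseteq> {al..be}" "{z..be} \<subseteq> {al..be}" using assms(2) unfolding X_def by auto
  show "end_zone z {al..z}" by (rule gen[OF _ sub(1)]) (use e(1) in \<open>simp, blast\<close>)
  show "end_zone z {z..be}" by (rule gen[OF _ sub(2)]) (use e(2) in \<open>simp, blast\<close>)
qed

lemma good_zone_exists: assumes "h \<le> rho" shows "\<exists>z zl zr. good_zone z zl zr"
  using s
proof
  assume s1: "s = 1"
  have "al + 3 * rho \<in> {al..be}" using K by auto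
  then obtain \<tau> where t: "\<tau> \<in> \<T>" "al + 3 * rho \<in> \<tau>" using cover by blast
  have "al + 3 * rho \<in> {lo \<tau>..hi \<tau>}" using t elem(1)[OF t(1)] by blast
  then have z: "al + 3 * rho \<le> hi \<tau>" "hi \<tau> \<le> al + 4 * rho" using elem(3)[OF t(1)] assms by auto
  have n: "hi \<tau> \<in> nodes" "hi \<tau> \<in> X" using t z K unfolding nodes_def X_def by auto
  have "good_zone (hi \<tau>) al (hi \<tau>)" unfolding good_zone_def depth_def inflow_def
    using node_end_zone(1)[OF n] z K s1 by auto
  then show ?thesis by blast
next
  assume s1: "s = -1"
  have "be - 3 * rho \<in> {al..be}" using K by auto
  then obtain \<tau> where t: "\<tau> \<in> \<T>" "be - 3 * rho \<in> \<tau>" using cover by blast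
  have "be - 3 * rho \<in> {lo \<tau>..hi \<tau>}" using t elem(1)[OF t(1)] by blast
  then have z: "be - 4 * rho \<le> lo \<tau>" "lo \<tau> \<le> be - 3 * rho" using elem(3)[OF t(1)] assms by auto
  have n: "lo \<tau> \<in> nodes" "lo \<tau> \<in> X" using t z K unfolding nodes_def X_def by auto
  have "good_zone (lo \<tau>) (lo \<tau>) be" unfolding good_zone_def depth_def inflow_def
    using node_end_zone(2)[OF n] z K s1 by auto
  then show ?thesis by blast
qed

lemma good_zone_props: assumes "good_zone z zl zr"
  shows "{zl..zr} \<subseteq> X" "\<And>x. x \<in> {zl..zr} \<Longrightarrow> x \<notin> {K1..K2}"
    "\<And>x. x \<in> {zl..zr} \<Longrightarrow> 0 \<le> s * (z - x)"
    "\<And>x. x \<in> X \<Longrightarrow> depth x \<le> 2 * rho \<Longrightarrow> x \<in> {zl..zr} \<and> rho \<le> s * (z - x)"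
proof -
  have side: "(s = 1 \<and> zl = al \<and> zr = z) \<or> (s = -1 \<and> zl = z \<and> zr = be)"
    and dz: "3 * rho \<le> depth z" "depth z \<le> 4 * rho" and sub: "{zl..zr} \<subseteq> {al..be}"
    using assms unfolding good_zone_def end_zone_def zone_def by simp_all
  show "{zl..zr} \<subseteq> X" using sub unfolding X_def .
  from side have "(\<forall>x. x \<in> {zl..zr} \<longrightarrow> x \<notin> {K1..K2} \<and> 0 \<le> s * (z - x)) \<and>
      (\<forall>x. x \<in> X \<longrightarrow> depth x \<le> 2 * rho \<longrightarrow> x \<in> {zl..zr} \<and> rho \<le> s * (z - x))"
  proof
    assume a: "s = 1 \<and> zl = al \<and> zr = z"
    then have "al + 3 * rho \<le> z" "z \<le> al + 4 * rho" "depth x = x - al" for x using dz unfolding depth_def inflow_def by simp_all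
    then show ?thesis using a K unfolding X_def by simp
  next
    assume a: "s = -1 \<and> zl = z \<and> zr = be"
    then have "z \<le> be - 3 * rho" "be - 4 * rho \<le> z" "depth x = be - x" for x using dz unfolding depth_def inflow_def by simp_all
    then show ?thesis using a K unfolding X_def by simp
  qed
  then show "\<And>x. x \<in> {zl..zr} \<Longrightarrow> x \<notin> {K1..K2}"
    "\<And>x. x \<in> {zl..zr} \<Longrightarrow> 0 \<le> s * (z - x)"
    "\<And>x. x \<in> X \<Longrightarrow> depth x \<le> 2 * rho \<Longrightarrow> x \<in> {zl..zr} \<and> rho \<le> s * (z - x)"
    by blast+
qed

text \<open>The estimates of the single slabs telescope, and the initial energy is zero because \<open>w0\<close> vanishes on the zone.\<close>

lemma energy_sum:
  assumes gz: "good_zone z zl zr" and n: "n \<le> M"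
  shows "(\<Sum>m=1..n. (nrm (I m \<times> {zl..zr}) (pf (c m)))\<^sup>2) / 4 + (LINT x:{zl..zr}|lborel. s * (z - x) * (prev (Suc n) x)\<^sup>2) / 2
     \<le> energy_const cc k * (\<Sum>m=1..n. y2 m)"
  using n
proof (induction n)
  case 0
  have "(LINT x:{zl..zr}|lborel. s * (z - x) * (prev (Suc 0) x)\<^sup>2) = (LINT x:{zl..zr}|lborel. 0)"
    using good_zone_props(2)[OF gz] w0(2) by (intro set_lebesgue_integral_cong) (auto simp: prev_def)
  then show ?case by simp
next
  case (Suc n)
  let ?m = "Suc n"
  have m: "?m \<in> {1..M}" using Suc.prems by auto
  interpret E: energy al be h \<T> k "c ?m" "J ?m" r rt rx "tm n" "tm ?m" z zl zr s "cc * h" cc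
  proof
    show "\<forall>i\<le>k. pw (c ?m i)" by (rule c[OF m])
    show "c ?m i al = 0" "c ?m i be = 0" if "i \<le> k" for i using c0[OF m that] .
    show "tm ?m = tm n + h" using tm_pred[OF m] by simp
    show "end_zone z {zl..zr}" "zl \<le> zr" "(s = 1 \<and> zl = al \<and> zr = z) \<or> (s = -1 \<and> zl = z \<and> zr = be)"
      using gz unfolding good_zone_def by auto
    show "sqi ({tm n<..tm ?m} \<times> {al..be}) r" "sqi ({tm n<..tm ?m} \<times> {al..be}) rt" "sqi ({tm n<..tm ?m} \<times> {al..be}) rx"
      using sqs[OF m] unfolding I_tm X_def by auto
    show "sqi {al..be} (J ?m)" using J_sqi[OF m] unfolding X_def .
    have sub: "{tm n<..tm ?m} \<times> {zl..zr} \<subseteq> {real (?m - 1) * h<..real ?m * h} \<times> {al..be}"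
      using good_zone_props(1)[OF gz] unfolding tm_def X_def by auto
    have sn: "snd v \<notin> {K1..K2}" if "v \<in> {tm n<..tm ?m} \<times> {zl..zr}" for v
      using good_zone_props(2)[OF gz] that by (metis mem_Times_iff)
    show "r v = - (pt (c ?m) v + s * px (c ?m) v)" if v: "v \<in> {tm n<..tm ?m} \<times> {zl..zr}" for v
    proof -
      have "b v = 0" using b(2)[of "snd v" "fst v"] sn[OF v] by simp
      moreover have "r v = b v - (pt (c ?m) v + s * px (c ?m) v)" using rdef[OF m] sub v by blast
      ultimately show ?thesis by simp
    qed
    show "(\<forall>w\<in>{tm n<..tm ?m} \<times> {zl..zr}. rt w = - pt (c ?m) w \<and> rx w = - px (c ?m) w) \<or>
       (\<forall>w\<in>{tm n<..tm ?m} \<times> {zl..zr}. rt w = r w \<and> rx w = s * r w)"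
      using mode
    proof
      assume "s = 1 \<and> (\<forall>m\<in>{1..M}. \<forall>z\<in>{real (m - 1) * h<..real m * h} \<times> {al..be}. snd z \<notin> {K1..K2} \<longrightarrow> rt z = - pt (c m) z \<and> rx z = - px (c m) z)"
      then have "\<forall>w\<in>{tm n<..tm ?m} \<times> {zl..zr}. rt w = - pt (c ?m) w \<and> rx w = - px (c ?m) w"
        using m sub sn by blast
      then show ?thesis ..
    next
      assume "\<forall>m\<in>{1..M}. \<forall>z\<in>{real (m - 1) * h<..real m * h} \<times> {al..be}. rt z = r z \<and> rx z = s * r z"
      then have "\<forall>w\<in>{tm n<..tm ?m} \<times> {zl..zr}. rt w = r w \<and> rx w = s * r w" using m sub by blast
      then show ?thesis ..
    qed
    show "(LINT w:{tm n<..tm ?m} \<times> {al..be}|lborel. r w * pf \<gamma> w + cc * h * (rt w * pt \<gamma> w + rx w * px \<gamma> w)) =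
       (LINT x:{al..be}|lborel. J ?m x * pf \<gamma> (tm n, x))" if "\<forall>i\<le>k. pw (\<gamma> i) \<and> \<gamma> i al = 0 \<and> \<gamma> i be = 0" for \<gamma>
      using gal'[OF m that] unfolding I_tm X_def by simp
  qed (use cc in auto)
  have "(nrm (I ?m \<times> {zl..zr}) (pf (c ?m)))\<^sup>2 / 4 + (LINT x:{zl..zr}|lborel. s * (z - x) * (prev (Suc ?m) x)\<^sup>2) / 2
    \<le> (LINT x:{zl..zr}|lborel. s * (z - x) * (prev ?m x)\<^sup>2) / 2 + energy_const cc k * y2 ?m"
    using E.energy_slab unfolding y2_def R2_def J_def I_tm X_def by (simp add: prev_def)
  moreover have "(\<Sum>m=1..n. (nrm (I m \<times> {zl..zr}) (pf (c m)))\<^sup>2) / 4 + (LINT x:{zl..zr}|lborel. s * (z - x) * (prev ?m x)\<^sup>2) / 2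
     \<le> energy_const cc k * (\<Sum>m=1..n. y2 m)" using Suc by simp
  moreover have "(\<Sum>m=1..?m. g m) = (\<Sum>m=1..n. g m) + g ?m" for g :: "nat \<Rightarrow> real" by simp
  ultimately show ?case by (simp only: distrib_left add_divide_distrib)
qed

lemma energy_bounds:
  assumes gz: "good_zone z zl zr"
  shows "(\<Sum>m=1..M. (nrm (I m \<times> {zl..zr}) (pf (c m)))\<^sup>2) \<le> 4 * energy_const cc k * Y\<^sup>2"
    and "(LINT x:{zl..zr}|lborel. s * (z - x) * (pf (c M) (T, x))\<^sup>2) \<le> 2 * energy_const cc k * Y\<^sup>2"
proof -
  have p: "prev (Suc M) x = pf (c M) (T, x)" for x using M1 Mh unfolding prev_def tm_def by simp
  have "0 \<le> (LINT x:{zl..zr}|lborel. s * (z - x) * (pf (c M) (T, x))\<^sup>2)"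
    unfolding set_lebesgue_integral_def using good_zone_props(3)[OF gz]
    by (intro integral_nonneg_AE AE_I2) (auto simp: indicator_def)
  moreover have "0 \<le> (\<Sum>m=1..M. (nrm (I m \<times> {zl..zr}) (pf (c m)))\<^sup>2)" by (intro sum_nonneg) auto
  ultimately show "(\<Sum>m=1..M. (nrm (I m \<times> {zl..zr}) (pf (c m)))\<^sup>2) \<le> 4 * energy_const cc k * Y\<^sup>2"
    "(LINT x:{zl..zr}|lborel. s * (z - x) * (pf (c M) (T, x))\<^sup>2) \<le> 2 * energy_const cc k * Y\<^sup>2"
    using energy_sum[OF gz order_refl] unfolding p Y2(1)[symmetric] by linarith+
qed

subsection \<open>Transported test functions\<close>

lemma slab_norm:
  fixes f :: "real \<times> real \<Rightarrow> real"
  assumes f: "bfun (I m \<times> A) f" "A \<in> sets borel" "bounded A" and m: "m \<in> {1..M}"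
    and B: "\<And>t. t \<in> I m \<Longrightarrow> nrm A (\<lambda>x. f (t, x)) \<le> B" "0 \<le> B"
  shows "nrm (I m \<times> A) f \<le> sqrt h * B"
proof (rule power2_le_imp_le)
  have IA: "I m \<times> A \<in> sets borel" "bounded (I m \<times> A)" using f Ib by (auto intro!: borel_Times bounded_Times)
  have i: "set_integrable lborel (I m \<times> A) (\<lambda>z. (f z)\<^sup>2)" by (intro bfun_integrable bfun_power f IA)
  have "(nrm (I m \<times> A) f)\<^sup>2 = (LINT t:I m|lborel. LINT x:A|lborel. (f (t, x))\<^sup>2)"
    unfolding nrm_sq by (rule set_fubini_tx[OF i])
  also have "\<dots> \<le> (LINT t:I m|lborel. B\<^sup>2)"
  proof (rule set_integral_mono[OF set_fubini_tx_int[OF i]])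
    show "set_integrable lborel (I m) (\<lambda>t. B\<^sup>2)" by (intro bfun_integrable bfun_const Ib)
    show "(LINT x:A|lborel. (f (t, x))\<^sup>2) \<le> B\<^sup>2" if "t \<in> I m" for t
      unfolding nrm_sq[symmetric] using B(1)[OF that] by (intro power_mono) auto
  qed
  also have "\<dots> = h * B\<^sup>2"
  proof -
    have "(LINT t:I m|lborel. B\<^sup>2) = (LINT t:{tm (m - 1)..tm m}|lborel. B\<^sup>2)" unfolding I_tm by (rule LINT_Ioc_Icc) simp
    also have "\<dots> = integral {tm (m - 1)..tm m} (\<lambda>t. B\<^sup>2)" by (rule LINT_continuous(1)) simp
    also have "\<dots> = h * B\<^sup>2" using tm_pred[OF m] h0 by simp
    finally show ?thesis .
  qed
  finally show "(nrm (I m \<times> A) f)\<^sup>2 \<le> (sqrt h * B)\<^sup>2" using h0 by (simp add: power_mult_distrib)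
qed (use B h0 in auto)

text \<open>The shifted function may leave the interval, but nothing can enter.\<close>

lemma shift_norm:
  fixes \<phi> :: "real \<Rightarrow> real"
  assumes f: "continuous_on UNIV \<phi>" "\<And>x. x \<notin> X \<Longrightarrow> \<phi> x = 0" shows "nrm X (\<lambda>x. \<phi> (x + a)) \<le> nrm X \<phi>"
proof -
  have i: "integrable lborel (\<lambda>x. (\<phi> x)\<^sup>2)"
  proof -
    have "set_integrable lborel X (\<lambda>x. (\<phi> x)\<^sup>2)" by (intro bfun_integrable bfun_power bfun_continuous f Xb)
    moreover have "(\<lambda>x. indicator X x *\<^sub>R (\<phi> x)\<^sup>2) = (\<lambda>x. (\<phi> x)\<^sup>2)" using f(2) by (intro ext) (auto simp: indicator_def)
    ultimately show ?thesis unfolding set_integrable_def by simp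
  qed
  have e: "(LINT x|lborel. (\<phi> x)\<^sup>2) = (LINT x:X|lborel. (\<phi> x)\<^sup>2)"
    unfolding set_lebesgue_integral_def using f(2) by (intro Bochner_Integration.integral_cong) (auto simp: indicator_def)
  have i2: "integrable lborel (\<lambda>x. (\<phi> (x + a))\<^sup>2)"
    using lborel_integrable_real_affine[OF i, of 1 a] by (simp add: add.commute)
  have "(LINT x:X|lborel. (\<phi> (x + a))\<^sup>2) \<le> (LINT x|lborel. (\<phi> (x + a))\<^sup>2)"
    unfolding set_lebesgue_integral_def
  proof (rule integral_mono[OF _ i2])
    show "integrable lborel (\<lambda>x. indicator X x *\<^sub>R (\<phi> (x + a))\<^sup>2)"
      using integrable_mult_indicator[OF _ i2, of X] Xb by simp
  qed (auto simp: indicator_def)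
  also have "\<dots> = (LINT x|lborel. (\<phi> x)\<^sup>2)"
    using lborel_integral_real_affine[of 1 "\<lambda>x. (\<phi> x)\<^sup>2" a] by (simp add: add.commute)
  finally show ?thesis unfolding nrm_def e by (rule real_sqrt_le_mono)
qed

lemma time_shift_norm:
  assumes m: "m \<in> {1..M}" and u: "continuous_on UNIV u" "\<And>t x. ((\<lambda>t. u (t, x)) has_real_derivative ut (t, x)) (at t)" "continuous_on UNIV ut"
  shows "nrm (I m \<times> X) (\<lambda>z. u z - u (tm (m - 1), snd z)) \<le> h * nrm (I m \<times> X) ut"
proof (rule power2_le_imp_le)
  define f where "f z = u z - u (tm (m - 1), snd z)" for z
  have b: "bfun (I m \<times> X) f" "bfun (I m \<times> X) ut"
    unfolding f_def by (intro bfun_continuous continuous_intros cont_comp[OF u(1)] u(1,3) IXb)+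
  have i: "set_integrable lborel (I m \<times> X) (\<lambda>z. (f z)\<^sup>2)" "set_integrable lborel (I m \<times> X) (\<lambda>z. (ut z)\<^sup>2)"
    by (intro bfun_integrable bfun_power b IXb)+
  have "(nrm (I m \<times> X) f)\<^sup>2 = (LINT x:X|lborel. LINT t:I m|lborel. (f (t, x))\<^sup>2)"
    unfolding nrm_sq by (rule set_fubini_xt[OF i(1)])
  also have "\<dots> \<le> (LINT x:X|lborel. h\<^sup>2 * (LINT t:I m|lborel. (ut (t, x))\<^sup>2))"
  proof (rule set_integral_mono[OF set_fubini_xt_int[OF i(1)] set_integrable_mult_right[OF set_fubini_xt_int[OF i(2)]]])
    fix x assume x: "x \<in> X"
    define a where "a = tm (m - 1)"
    have tm: "tm m = a + h" using tm_pred[OF m] a_def by simp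
    have cu: "continuous_on UNIV (\<lambda>t. ut (t, x))" "continuous_on UNIV (\<lambda>t. u (t, x))"
      by (intro cont_comp[OF u(3)] cont_comp[OF u(1)] continuous_intros)+
    let ?S = "integral {a..a+h} (\<lambda>t. (ut (t, x))\<^sup>2)"
    have ft: "(f (t, x))\<^sup>2 \<le> h * ?S" if t: "t \<in> {a..a+h}" for t
    proof -
      have ci: "(\<lambda>t. \<bar>ut (t, x)\<bar>) integrable_on {c..d}" for c d
        by (intro integrable_continuous_real continuous_intros continuous_on_subset[OF cu(1)]) auto
      have "((\<lambda>t. ut (t, x)) has_integral (u (t, x) - u (a, x))) {a..t}"
        using u(2) t by (intro fundamental_theorem_of_calculus)
          (auto simp: has_real_derivative_iff_has_vector_derivative[symmetric] intro: DERIV_subset)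
      then have "\<bar>f (t, x)\<bar> \<le> integral {a..t} (\<lambda>t. \<bar>ut (t, x)\<bar>)"
        using integral_norm_bound_integral[of "\<lambda>t. ut (t, x)" "{a..t}" "\<lambda>t. \<bar>ut (t, x)\<bar>"] ci
        by (auto simp: integrable_on_def integral_unique f_def a_def)
      also have "\<dots> \<le> integral {a..a+h} (\<lambda>t. \<bar>ut (t, x)\<bar>)" using t ci by (intro integral_subset_le) auto
      finally have "(f (t, x))\<^sup>2 \<le> (integral {a..a+h} (\<lambda>t. \<bar>ut (t, x)\<bar>))\<^sup>2" by (metis abs_ge_zero power2_abs power_mono)
      also have "\<dots> \<le> h * ?S" using sq_integral_abs[OF cu(1), of a "a+h"] h0 by simp
      finally show ?thesis .
    qed
    have cf: "continuous_on UNIV (\<lambda>t. (f (t, x))\<^sup>2)" unfolding f_def snd_conv by (intro continuous_intros cu)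
    have c2: "continuous_on UNIV (\<lambda>t. (ut (t, x))\<^sup>2)" by (intro continuous_intros cu)
    have "(LINT t:I m|lborel. (f (t, x))\<^sup>2) = integral {a..a+h} (\<lambda>t. (f (t, x))\<^sup>2)"
      unfolding I_tm tm a_def[symmetric] LINT_Ioc_Icc[OF borel_measurable_continuous_onI[OF cf]] by (rule LINT_continuous(1)[OF cf])
    also have "\<dots> \<le> integral {a..a+h} (\<lambda>t. h * ?S)"
      by (intro integral_le integrable_continuous_real continuous_on_subset[OF cf] continuous_intros ft) auto
    also have "\<dots> = h\<^sup>2 * ?S" using h0 by (simp add: power2_eq_square)
    also have "?S = (LINT t:I m|lborel. (ut (t, x))\<^sup>2)"
      unfolding I_tm tm a_def[symmetric] LINT_Ioc_Icc[OF borel_measurable_continuous_onI[OF c2]] by (rule LINT_continuous(1)[OF c2, symmetric])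
    finally show "(LINT t:I m|lborel. (f (t, x))\<^sup>2) \<le> h\<^sup>2 * (LINT t:I m|lborel. (ut (t, x))\<^sup>2)" .
  qed
  also have "\<dots> = (h * nrm (I m \<times> X) ut)\<^sup>2" unfolding power_mult_distrib nrm_sq set_fubini_xt[OF i(2)] by simp
  finally show "(nrm (I m \<times> X) (\<lambda>z. u z - u (tm (m - 1), snd z)))\<^sup>2 \<le> (h * nrm (I m \<times> X) ut)\<^sup>2" unfolding f_def .
qed (use h0 in simp)

lemma root_y2:
  shows "h * nrm (I m \<times> X) r \<le> sqrt (y2 m)" "h * nrm (I m \<times> X) rx \<le> sqrt (y2 m)" "sqrt h * nrm X (J m) \<le> sqrt (y2 m)"
proof -
  have "(h * nrm (I m \<times> X) r)\<^sup>2 \<le> y2 m" "(h * nrm (I m \<times> X) rx)\<^sup>2 \<le> y2 m" "(sqrt h * nrm X (J m))\<^sup>2 \<le> y2 m"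
    unfolding y2_def R2_def using h0 by (auto simp: power_mult_distrib distrib_left add_nonneg_nonneg)
  then show "h * nrm (I m \<times> X) r \<le> sqrt (y2 m)" "h * nrm (I m \<times> X) rx \<le> sqrt (y2 m)" "sqrt h * nrm X (J m) \<le> sqrt (y2 m)"
    by (simp_all add: real_le_rsqrt)
qed

end

text \<open>The test function is transported backwards from \<open>\<phi>\<close> at time \<open>T\<close>, and multiplied by the cut-off \<open>lam\<close>.\<close>

locale dual = scheme +
  fixes \<phi> \<phi>' lam lam' :: "real \<Rightarrow> real" and L :: real
  assumes ph: "smooth \<phi>" "\<And>x. (\<phi> has_real_derivative \<phi>' x) (at x)" "continuous_on UNIV \<phi>'"
    "\<And>x. x \<notin> {al<..<be} \<Longrightarrow> \<phi> x = 0" "\<And>x. x \<notin> {al<..<be} \<Longrightarrow> \<phi>' x = 0"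
    and lam: "smooth lam" "\<And>x. (lam has_real_derivative lam' x) (at x)" "continuous_on UNIV lam'"
    "\<And>x. \<bar>lam x\<bar> \<le> 1" "\<And>x. \<bar>lam' x\<bar> \<le> L"
begin

definition u where "u z = \<phi> (snd z + s * (T - fst z)) * lam (snd z)"
definition ut where "ut z = - s * \<phi>' (snd z + s * (T - fst z)) * lam (snd z)"
definition ux where "ux z = \<phi>' (snd z + s * (T - fst z)) * lam (snd z) + \<phi> (snd z + s * (T - fst z)) * lam' (snd z)"
definition N0 where "N0 = nrm X \<phi>"
definition N1 where "N1 = nrm X \<phi>'"

lemma L0: "0 \<le> L" using lam(5)[of 0] abs_ge_zero[of "lam' 0"] by linarith

lemma cph: "continuous_on S \<phi>" using ph(1) by (rule smooth_continuous)
lemma clam: "continuous_on S lam" using lam(1) by (rule smooth_continuous)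

lemma u_smooth: "smooth u"
proof -
  have "smooth (\<lambda>z::real\<times>real. \<phi> (s * T + (- s * fst z + 1 * snd z)))" by (rule smooth_affine2[OF ph(1)])
  moreover have "smooth (\<lambda>z::real\<times>real. lam (0 + (0 * fst z + 1 * snd z)))" by (rule smooth_affine2[OF lam(1)])
  ultimately have "smooth (\<lambda>z::real\<times>real. \<phi> (s * T + (- s * fst z + 1 * snd z)) * lam (0 + (0 * fst z + 1 * snd z)))"
    by (rule smooth_intros(3))
  then show ?thesis unfolding u_def by (simp add: algebra_simps)
qed

lemma u_dt: "((\<lambda>t. u (t, x)) has_real_derivative ut (t, x)) (at t)"
proof -
  have a: "((\<lambda>t. x + s * (T - t)) has_real_derivative - s) (at t)" by (auto intro!: derivative_eq_intros)
  show ?thesis unfolding u_def ut_def using DERIV_cmult_right[OF DERIV_chain2[OF ph(2) a], of "lam x"] by (simp add: mult.commute)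
qed

lemma u_dx: "((\<lambda>x. u (t, x)) has_real_derivative ux (t, x)) (at x)"
proof -
  have a: "((\<lambda>x. x + s * (T - t)) has_real_derivative 1) (at x)" by (auto intro!: derivative_eq_intros)
  show ?thesis unfolding u_def ux_def using DERIV_mult[OF DERIV_chain2[OF ph(2) a] lam(2)] by (simp add: mult.commute)
qed

lemma u_cont: "continuous_on S u" "continuous_on S ut" "continuous_on S ux"
proof -
  have c: "continuous_on S (\<lambda>z::real\<times>real. snd z + s * (T - fst z))" for S by (intro continuous_intros)
  have d: "continuous_on S (\<lambda>z::real\<times>real. f (snd z + s * (T - fst z)))" "continuous_on S (\<lambda>z::real\<times>real. f (snd z))"
    if "continuous_on UNIV f" for f :: "real \<Rightarrow> real" and S
    by (intro cont_comp[OF that] continuous_intros)+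
  show "continuous_on S u" "continuous_on S ut" "continuous_on S ux"
    unfolding u_def ut_def ux_def by (intro continuous_intros d cph clam lam(3) ph(3))+
qed

lemma u_slice_norm: "nrm X (\<lambda>x. u (t, x)) \<le> N0" "nrm X (\<lambda>x. ut (t, x)) \<le> N1" "nrm X (\<lambda>x. ux (t, x)) \<le> N1 + L * N0"
  "nrm X (\<lambda>x. \<phi> (x + s * (T - t)) * lam' x) \<le> L * N0"
proof -
  have sq: "sqi X f" if "continuous_on UNIV f" for f using that Xb by (intro bfun_sqi bfun_continuous) auto
  have cs: "continuous_on UNIV (\<lambda>x. \<phi> (x + a))" "continuous_on UNIV (\<lambda>x. \<phi>' (x + a))" for a
    by (intro cont_comp[OF cph] cont_comp[OF ph(3)] continuous_intros)+
  have X0: "x \<notin> X \<Longrightarrow> \<phi> x = 0" "x \<notin> X \<Longrightarrow> \<phi>' x = 0" for x using ph(4,5)[of x] unfolding X_def by auto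
  have s0: "nrm X (\<lambda>x. \<phi> (x + a)) \<le> N0" "nrm X (\<lambda>x. \<phi>' (x + a)) \<le> N1" for a
    unfolding N0_def N1_def by (rule shift_norm[OF cph X0(1)], assumption, rule shift_norm[OF ph(3) X0(2)])
  let ?a = "s * (T - t)"
  have q: "sqi X (\<lambda>x. \<phi> (x + ?a))" "sqi X (\<lambda>x. \<phi>' (x + ?a))" "sqi X (\<lambda>x. \<phi> (x + ?a) * lam x)" "sqi X (\<lambda>x. \<phi>' (x + ?a) * lam x)"
    "sqi X (\<lambda>x. \<phi> (x + ?a) * lam' x)" "sqi X (\<lambda>x. - s * \<phi>' (x + ?a) * lam x)"
    by (intro sq continuous_intros cs clam lam(3))+
  have "nrm X (\<lambda>x. u (t, x)) \<le> nrm X (\<lambda>x. \<phi> (x + ?a))" unfolding u_def fst_conv snd_conv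
    using lam(4) by (intro nrm_mono q) (simp add: abs_mult mult_left_le)
  then show "nrm X (\<lambda>x. u (t, x)) \<le> N0" using s0(1)[of ?a] by linarith
  have "nrm X (\<lambda>x. ut (t, x)) \<le> nrm X (\<lambda>x. \<phi>' (x + ?a))" unfolding ut_def fst_conv snd_conv
    using lam(4) s by (intro nrm_mono q) (auto simp: abs_mult mult_left_le)
  then show "nrm X (\<lambda>x. ut (t, x)) \<le> N1" using s0(2)[of ?a] by linarith
  have l1: "nrm X (\<lambda>x. \<phi> (x + ?a) * lam' x) \<le> L * nrm X (\<lambda>x. \<phi> (x + ?a))"
    using lam(5) L0 by (intro nrm_mono2 q) (simp_all add: abs_mult mult.commute[of L] mult_left_mono)
  also have "\<dots> \<le> L * N0" using s0(1)[of ?a] L0 by (rule mult_left_mono)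
  finally show l2: "nrm X (\<lambda>x. \<phi> (x + ?a) * lam' x) \<le> L * N0" .
  have "nrm X (\<lambda>x. \<phi>' (x + ?a) * lam x) \<le> nrm X (\<lambda>x. \<phi>' (x + ?a))"
    using lam(4) by (intro nrm_mono q) (simp add: abs_mult mult_left_le)
  then have l3: "nrm X (\<lambda>x. \<phi>' (x + ?a) * lam x) \<le> N1" using s0(2)[of ?a] by linarith
  have "nrm X (\<lambda>x. ux (t, x)) \<le> nrm X (\<lambda>x. \<phi>' (x + ?a) * lam x) + nrm X (\<lambda>x. \<phi> (x + ?a) * lam' x)"
    unfolding ux_def fst_conv snd_conv by (rule nrm_triangle[OF q(4,5)])
  then show "nrm X (\<lambda>x. ux (t, x)) \<le> N1 + L * N0" using l2 l3 by linarith
qed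

lemma N_nonneg: "0 \<le> N0" "0 \<le> N1" unfolding N0_def N1_def by auto

lemma ubf: "bounded S \<Longrightarrow> bfun S u" "bounded S \<Longrightarrow> bfun S ut" "bounded S \<Longrightarrow> bfun S ux"
  by (intro bfun_continuous u_cont; simp)+

lemma u_slice_bfun: "bfun X (\<lambda>x. u (t, x))"
proof -
  have "bounded ({t} \<times> X)" using Xb by (auto intro: bounded_Times)
  then show ?thesis by (intro bfun_slice[OF ubf(1)]) auto
qed

text \<open>If \<open>h\<close> is larger than \<open>rho\<close>, the factor \<open>h\<close> is not a gain, and Cauchy-Schwarz suffices.\<close>

lemma slab_bound_coarse:
  assumes m: "m \<in> {1..M}" and hr: "rho < h"
  shows "\<bar>(LINT z:I m \<times> X|lborel. r z * u z) - (LINT x:X|lborel. J m x * u (tm (m - 1), x))\<bar> \<le> sqrt h * sqrt (y2 m) * (2 / rho * N0)"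
proof -
  have q: "sqi (I m \<times> X) u" "sqi X (\<lambda>x. u (tm (m - 1), x))" by (intro bfun_sqi ubf u_slice_bfun IXb Xb)+
  have "\<bar>LINT z:I m \<times> X|lborel. r z * u z\<bar> \<le> nrm (I m \<times> X) r * nrm (I m \<times> X) u" by (rule sqi_cs[OF sqs(1)[OF m] q(1)])
  also have "\<dots> \<le> nrm (I m \<times> X) r * (sqrt h * N0)"
    using slab_norm[OF ubf(1)[OF IXb(2)] Xb m u_slice_norm(1) N_nonneg(1)] by (intro mult_left_mono) auto
  also have "\<dots> = (h * nrm (I m \<times> X) r) * (sqrt h * N0 / h)" using h0 by simp
  also have "\<dots> \<le> sqrt (y2 m) * (sqrt h * N0 / rho)"
    using hr K(1) h0 N_nonneg y2_nonneg by (intro mult_mono root_y2 divide_left_mono) auto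
  finally have 1: "\<bar>LINT z:I m \<times> X|lborel. r z * u z\<bar> \<le> sqrt (y2 m) * (sqrt h * N0 / rho)" .
  have "\<bar>LINT x:X|lborel. J m x * u (tm (m - 1), x)\<bar> \<le> nrm X (J m) * nrm X (\<lambda>x. u (tm (m - 1), x))" by (rule sqi_cs[OF J_sqi[OF m] q(2)])
  also have "\<dots> \<le> nrm X (J m) * N0" using u_slice_norm(1) by (intro mult_left_mono) auto
  also have "\<dots> = (sqrt h * nrm X (J m)) * (sqrt h * N0 / h)" using h0 by (simp add: real_div_sqrt field_simps)
  also have "\<dots> \<le> sqrt (y2 m) * (sqrt h * N0 / rho)"
    using hr K(1) h0 N_nonneg y2_nonneg by (intro mult_mono root_y2 divide_left_mono) auto
  finally have 2: "\<bar>LINT x:X|lborel. J m x * u (tm (m - 1), x)\<bar> \<le> sqrt (y2 m) * (sqrt h * N0 / rho)" .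
  have "sqrt h * sqrt (y2 m) * (2 / rho * N0) = 2 * (sqrt (y2 m) * (sqrt h * N0 / rho))" by simp
  then show ?thesis using 1 2 by linarith
qed

text \<open>The interpolant of \<open>u\<close> at the beginning of the slab, constant in time, is an admissible test function: at the
  inflow end \<open>u\<close> vanishes by the cut-off, and at the outflow end because the characteristic through it
  has left the support of \<open>\<phi>\<close>. After subtracting its Galerkin equation, \<open>r\<close> is paired with a change of \<open>u\<close>
  in time and an interpolation error, both of order \<open>h\<close>, and the jump with an interpolation error.\<close>

lemma slab_bound_fine:
  assumes m: "m \<in> {1..M}" and l0: "lam inflow = 0"
  shows "\<bar>(LINT z:I m \<times> X|lborel. r z * u z) - (LINT x:X|lborel. J m x * u (tm (m - 1), x))\<bar>
    \<le> sqrt h * sqrt (y2 m) * ((1 + (1 + L) * (2 + cc)) * (N0 + N1))"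
proof -
  define t0 where "t0 = tm (m - 1)"
  have tT: "t0 \<le> T" using m h0 Mh unfolding t0_def tm_def by (auto intro!: mult_right_mono)
  define v where "v x = u (t0, x)" for x
  define v' where "v' x = ux (t0, x)" for x
  have cv': "continuous_on UNIV v'" unfolding v'_def by (intro cont_comp[OF u_cont(3)] continuous_intros)
  have dv: "(v has_real_derivative v' x) (at x)" for x unfolding v_def v'_def by (rule u_dx)
  have v0: "v al = 0" "v be = 0"
    using s l0 tT ph(4)[of "be + (T - t0)"] ph(4)[of "al + (t0 - T)"] ab unfolding v_def u_def inflow_def by auto
  define \<gamma> where "\<gamma> i = (if i = 0 then interp v else (\<lambda>x. 0))" for i :: nat
  have pwg: "\<forall>i\<le>k. pw (\<gamma> i) \<and> \<gamma> i al = 0 \<and> \<gamma> i be = 0"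
    unfolding \<gamma>_def using interp_pw interp_ends v0 pw_zero by auto
  have pd0: "pd (\<lambda>x. 0) x = 0" for x using pd_lincomb[of "{}" "\<lambda>_ _. 0" "\<lambda>_. 0" x] by simp
  have g: "pf \<gamma> z = interp v (snd z)" "pt \<gamma> z = 0" "px \<gamma> z = pd (interp v) (snd z)" for z
  proof -
    have "pf \<gamma> z = (\<Sum>i\<le>k. if i = 0 then interp v (snd z) else 0)" unfolding pf_def \<gamma>_def by (intro sum.cong) auto
    then show "pf \<gamma> z = interp v (snd z)" by simp
    show "pt \<gamma> z = 0" unfolding pt_def \<gamma>_def by (intro sum.neutral) auto
    have "px \<gamma> z = (\<Sum>i\<le>k. if i = 0 then pd (interp v) (snd z) else 0)" unfolding px_def \<gamma>_def by (intro sum.cong) (auto simp: pd0)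
    then show "px \<gamma> z = pd (interp v) (snd z)" by simp
  qed
  define V where "V = nrm X v'"
  have V: "0 \<le> V" "V \<le> N1 + L * N0" unfolding V_def v'_def using u_slice_norm(3) by auto
  have ib: "nrm X (\<lambda>x. v x - interp v x) \<le> h * V" "nrm X (pd (interp v)) \<le> V"
  proof -
    have "(nrm X (\<lambda>x. v x - interp v x))\<^sup>2 \<le> (h * V)\<^sup>2"
      using interp_bounds(1)[OF dv cv'] unfolding power_mult_distrib V_def nrm_sq X_def .
    then show "nrm X (\<lambda>x. v x - interp v x) \<le> h * V" by (rule power2_le_imp_le) (use h0 V in auto)
    have "(nrm X (pd (interp v)))\<^sup>2 \<le> V\<^sup>2"
      using interp_bounds(2)[OF dv cv'] unfolding V_def nrm_sq X_def .
    then show "nrm X (pd (interp v)) \<le> V" by (rule power2_le_imp_le) (use V in auto)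
  qed
  have bv: "bfun X v" unfolding v_def by (rule u_slice_bfun)
  have bi: "bfun X (interp v)" "bfun X (pd (interp v))" by (intro pw_bfun interp_pw pd_bfun)+
  have bf: "bfun (I m \<times> X) (\<lambda>z. f (snd z))" if "bfun X f" for f using that by (rule bfun_snd)
  have q: "sqi (I m \<times> X) f" if "bfun (I m \<times> X) f" for f using that IXb by (rule bfun_sqi)
  have q1: "sqi X f" if "bfun X f" for f using that Xb by (rule bfun_sqi)
  have n1: "nrm (I m \<times> X) (\<lambda>z. u z - interp v (snd z)) \<le> sqrt h * (h * (N1 + V))"
  proof -
    have "nrm (I m \<times> X) (\<lambda>z. u z - interp v (snd z)) = nrm (I m \<times> X) (\<lambda>z. (u z - v (snd z)) + (v (snd z) - interp v (snd z)))" by simp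
    also have "\<dots> \<le> nrm (I m \<times> X) (\<lambda>z. u z - v (snd z)) + nrm (I m \<times> X) (\<lambda>z. v (snd z) - interp v (snd z))"
      by (intro nrm_triangle q bfun_diff bf bv bi ubf IXb)
    also have "nrm (I m \<times> X) (\<lambda>z. u z - v (snd z)) \<le> h * nrm (I m \<times> X) ut"
      unfolding v_def t0_def by (rule time_shift_norm[OF m u_cont(1) u_dt u_cont(2)])
    also have "nrm (I m \<times> X) ut \<le> sqrt h * N1"
      by (rule slab_norm[OF ubf(2)[OF IXb(2)] Xb m u_slice_norm(2) N_nonneg(2)])
    also have "nrm (I m \<times> X) (\<lambda>z. v (snd z) - interp v (snd z)) \<le> sqrt h * (h * V)"
      using ib(1) h0 V by (intro slab_norm[OF _ Xb m] bfun_diff bf bv bi) auto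
    finally show ?thesis using h0 by (simp add: algebra_simps)
  qed
  have n2: "nrm (I m \<times> X) (\<lambda>z. pd (interp v) (snd z)) \<le> sqrt h * V"
    using ib(2) V by (intro slab_norm[OF _ Xb m] bf bi) auto
  have i: "set_integrable lborel (I m \<times> X) (\<lambda>z. r z * u z)" "set_integrable lborel (I m \<times> X) (\<lambda>z. r z * interp v (snd z))"
    "set_integrable lborel (I m \<times> X) (\<lambda>z. rx z * pd (interp v) (snd z))"
    by (intro sqi_mult_integrable sqs m q ubf IXb bf bi)+
  have j: "set_integrable lborel X (\<lambda>x. J m x * v x)" "set_integrable lborel X (\<lambda>x. J m x * interp v x)"
    by (intro sqi_mult_integrable J_sqi m q1 bv bi)+
  define i1 where "i1 = (LINT z:I m \<times> X|lborel. r z * (u z - interp v (snd z)))"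
  define i2 where "i2 = (LINT z:I m \<times> X|lborel. rx z * pd (interp v) (snd z))"
  define i3 where "i3 = (LINT x:X|lborel. J m x * (v x - interp v x))"
  have G: "(LINT z:I m \<times> X|lborel. r z * interp v (snd z)) + cc * h * i2 = (LINT x:X|lborel. J m x * interp v x)"
  proof -
    have "(LINT z:I m \<times> X|lborel. r z * interp v (snd z) + cc * h * (rx z * pd (interp v) (snd z))) = (LINT x:X|lborel. J m x * interp v x)"
      using gal'[OF m pwg] unfolding g by simp
    then show ?thesis unfolding i2_def using i(2,3) by (simp only: set_integral_add set_integrable_mult_right set_integral_mult_right)
  qed
  have "i1 = (LINT z:I m \<times> X|lborel. r z * u z) - (LINT z:I m \<times> X|lborel. r z * interp v (snd z))"
    unfolding i1_def right_diff_distrib by (rule set_integral_diff(2)[OF i(1,2)])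
  moreover have "i3 = (LINT x:X|lborel. J m x * v x) - (LINT x:X|lborel. J m x * interp v x)"
    unfolding i3_def right_diff_distrib by (rule set_integral_diff(2)[OF j])
  ultimately have e: "(LINT z:I m \<times> X|lborel. r z * u z) - (LINT x:X|lborel. J m x * u (tm (m - 1), x)) = i1 - cc * h * i2 - i3"
    using G unfolding v_def t0_def by linarith
  have b1: "\<bar>i1\<bar> \<le> sqrt (y2 m) * (sqrt h * (N1 + V))"
  proof -
    have "\<bar>i1\<bar> \<le> nrm (I m \<times> X) r * nrm (I m \<times> X) (\<lambda>z. u z - interp v (snd z))"
      unfolding i1_def by (intro sqi_cs sqs m q bfun_diff ubf IXb bf bi)
    also have "\<dots> \<le> nrm (I m \<times> X) r * (sqrt h * (h * (N1 + V)))" using n1 by (intro mult_left_mono) auto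
    also have "\<dots> = (h * nrm (I m \<times> X) r) * (sqrt h * (N1 + V))" by simp
    also have "\<dots> \<le> sqrt (y2 m) * (sqrt h * (N1 + V))" using h0 V N_nonneg by (intro mult_right_mono root_y2) auto
    finally show ?thesis .
  qed
  have b2: "\<bar>h * i2\<bar> \<le> sqrt (y2 m) * (sqrt h * V)"
  proof -
    have "\<bar>i2\<bar> \<le> nrm (I m \<times> X) rx * nrm (I m \<times> X) (\<lambda>z. pd (interp v) (snd z))"
      unfolding i2_def by (intro sqi_cs sqs m q bf bi)
    also have "\<dots> \<le> nrm (I m \<times> X) rx * (sqrt h * V)" using n2 by (intro mult_left_mono) auto
    finally have "h * \<bar>i2\<bar> \<le> h * (nrm (I m \<times> X) rx * (sqrt h * V))" using h0 by (intro mult_left_mono) auto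
    also have "\<dots> = (h * nrm (I m \<times> X) rx) * (sqrt h * V)" by simp
    also have "\<dots> \<le> sqrt (y2 m) * (sqrt h * V)" using h0 V by (intro mult_right_mono root_y2) auto
    finally show ?thesis using h0 by (simp add: abs_mult)
  qed
  have b3: "\<bar>i3\<bar> \<le> sqrt (y2 m) * (sqrt h * V)"
  proof -
    have "\<bar>i3\<bar> \<le> nrm X (J m) * nrm X (\<lambda>x. v x - interp v x)"
      unfolding i3_def by (intro sqi_cs J_sqi m q1 bfun_diff bv bi)
    also have "\<dots> \<le> nrm X (J m) * (h * V)" using ib(1) by (intro mult_left_mono) auto
    also have "\<dots> = (sqrt h * nrm X (J m)) * (sqrt h * V)" using h0 by (simp add: algebra_simps)
    also have "\<dots> \<le> sqrt (y2 m) * (sqrt h * V)" using h0 V by (intro mult_right_mono root_y2) auto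
    finally show ?thesis .
  qed
  have "\<bar>i1 - cc * h * i2 - i3\<bar> \<le> \<bar>i1\<bar> + cc * \<bar>h * i2\<bar> + \<bar>i3\<bar>"
  proof -
    have "\<bar>cc * h * i2\<bar> = cc * \<bar>h * i2\<bar>" using cc by (simp add: abs_mult)
    then show ?thesis by linarith
  qed
  also have "\<dots> \<le> sqrt (y2 m) * (sqrt h * (N1 + V)) + cc * (sqrt (y2 m) * (sqrt h * V)) + sqrt (y2 m) * (sqrt h * V)"
    using b1 b2 b3 cc by (intro add_mono mult_left_mono) auto
  also have "\<dots> = sqrt h * sqrt (y2 m) * (N1 + V * (2 + cc))" by (simp add: algebra_simps)
  also have "\<dots> \<le> sqrt h * sqrt (y2 m) * ((1 + (1 + L) * (2 + cc)) * (N0 + N1))"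
  proof (rule mult_left_mono)
    have "V \<le> (1 + L) * (N0 + N1)" using V N_nonneg mult_nonneg_nonneg[OF L0 N_nonneg(2)] by (simp add: algebra_simps)
    then have "V * (2 + cc) \<le> (1 + L) * (N0 + N1) * (2 + cc)" using cc by (intro mult_right_mono) auto
    then show "N1 + V * (2 + cc) \<le> (1 + (1 + L) * (2 + cc)) * (N0 + N1)" using N_nonneg by (simp add: algebra_simps)
  qed (use h0 y2_nonneg in simp)
  finally show ?thesis unfolding e .
qed

text \<open>\<open>ut + s * ux\<close> contains only the derivative of the cut-off. It lives in the zone, where \<open>w\<close> is zero.\<close>

lemma inflow_term_bound:
  assumes m: "m \<in> {1..M}" and gz: "good_zone z zl zr"
    and far: "\<And>x. x \<in> X \<Longrightarrow> 2 * rho < depth x \<Longrightarrow> lam' x = 0"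
  shows "\<bar>LINT v:I m \<times> X|lborel. (w v - pf (c m) v) * (ut v + s * ux v)\<bar> \<le> sqrt h * nrm (I m \<times> {zl..zr}) (pf (c m)) * (L * N0)"
proof -
  define Z where "Z = {zl..zr}"
  have ZX: "Z \<subseteq> X" "Z \<in> sets borel" "bounded Z" unfolding Z_def using good_zone_props(1)[OF gz] by auto
  define f where "f v = s * (\<phi> (snd v + s * (T - fst v)) * lam' (snd v))" for v
  have uf: "ut v + s * ux v = f v" for v unfolding f_def ut_def ux_def by (simp add: algebra_simps)
  have cf: "continuous_on UNIV f" unfolding f_def by (intro continuous_intros cont_comp[OF cph] cont_comp[OF lam(3)])
  have IZ: "I m \<times> Z \<in> sets borel" "bounded (I m \<times> Z)" using ZX Ib by (auto intro!: borel_Times bounded_Times)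
  have bf: "bfun (I m \<times> Z) f" by (intro bfun_continuous cf IZ)
  have bp: "bfun (I m \<times> Z) (pf (c m))" using c[OF m] Ib by (intro pf_bfun) auto
  have "(LINT v:I m \<times> X|lborel. (w v - pf (c m) v) * (ut v + s * ux v)) = (LINT v:I m \<times> X|lborel. indicator Z (snd v) * - (pf (c m) v * f v))"
  proof (rule set_lebesgue_integral_cong)
    show "\<forall>v. v \<in> I m \<times> X \<longrightarrow> (w v - pf (c m) v) * (ut v + s * ux v) = indicator Z (snd v) * - (pf (c m) v * f v)"
    proof (intro allI impI)
      fix v assume v: "v \<in> I m \<times> X"
      then have x: "snd v \<in> X" by auto
      show "(w v - pf (c m) v) * (ut v + s * ux v) = indicator Z (snd v) * - (pf (c m) v * f v)"
      proof (cases "snd v \<in> Z")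
        case True
        then have "snd v \<notin> {K1..K2}" using good_zone_props(2)[OF gz] unfolding Z_def by blast
        then have "w v = 0" using w(2)[of "snd v" "fst v"] by simp
        then show ?thesis using True uf by simp
      next
        case False
        then have "2 * rho < depth (snd v)" using good_zone_props(4)[OF gz x] unfolding Z_def by force
        then have "f v = 0" using far[OF x] unfolding f_def by simp
        then show ?thesis using uf by simp
      qed
    qed
  qed (use IXb in simp)
  also have "\<dots> = (LINT v:I m \<times> Z|lborel. - (pf (c m) v * f v))" by (rule LINT_restrict_zone(1)[OF ZX(1)])
  also have "\<bar>\<dots>\<bar> = \<bar>LINT v:I m \<times> Z|lborel. pf (c m) v * f v\<bar>" by (simp add: set_lebesgue_integral_def)
  also have "\<dots> \<le> nrm (I m \<times> Z) (pf (c m)) * nrm (I m \<times> Z) f" by (intro sqi_cs bfun_sqi bp bf IZ)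
  also have "\<dots> \<le> nrm (I m \<times> Z) (pf (c m)) * (sqrt h * (L * N0))"
  proof (rule mult_left_mono[OF slab_norm[OF bf ZX(2,3) m]])
    fix t
    have q: "sqi X (\<lambda>x. f (t, x))" "sqi X (\<lambda>x. \<phi> (x + s * (T - t)) * lam' x)"
      using Xb by (intro bfun_sqi bfun_continuous cont_comp[OF cf] continuous_intros cont_comp[OF cph] lam(3); simp)+
    have "nrm Z (\<lambda>x. f (t, x)) \<le> nrm X (\<lambda>x. f (t, x))" by (rule nrm_subset[OF q(1) ZX(1,2)])
    also have "\<dots> \<le> nrm X (\<lambda>x. \<phi> (x + s * (T - t)) * lam' x)"
      using s by (intro nrm_mono q) (auto simp: f_def)
    also have "\<dots> \<le> L * N0" by (rule u_slice_norm(4))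
    finally show "nrm Z (\<lambda>x. f (t, x)) \<le> L * N0" .
  qed (use L0 N_nonneg in auto)
  finally show ?thesis unfolding Z_def by (simp add: mult_ac)
qed

text \<open>Cauchy-Schwarz over the slabs; the number of slabs times \<open>h\<close> is \<open>T\<close>.\<close>

lemma sum_slabs:
  assumes "\<And>m. m \<in> {1..M} \<Longrightarrow> \<bar>a m\<bar> \<le> sqrt h * y m * C" "\<And>m. m \<in> {1..M} \<Longrightarrow> 0 \<le> y m" "0 \<le> C" "(\<Sum>m=1..M. (y m)\<^sup>2) \<le> D\<^sup>2" "0 \<le> D"
  shows "\<bar>\<Sum>m=1..M. a m\<bar> \<le> sqrt T * D * C"
proof -
  have "\<bar>\<Sum>m=1..M. a m\<bar> \<le> (\<Sum>m=1..M. sqrt h * y m * C)"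
    by (intro order_trans[OF sum_abs] sum_mono assms(1))
  also have "\<dots> = sqrt h * (\<Sum>m=1..M. y m) * C" by (simp add: sum_distrib_left sum_distrib_right)
  also have "\<dots> \<le> sqrt h * (sqrt (real M) * D) * C"
  proof (intro mult_right_mono mult_left_mono)
    have "sqrt (\<Sum>m=1..M. (y m)\<^sup>2) \<le> D" using real_sqrt_le_mono[OF assms(4)] assms(5) by simp
    then show "(\<Sum>m=1..M. y m) \<le> sqrt (real M) * D"
      using sum_sqrt_le[of M y, OF assms(2)] by (meson mult_left_mono order_trans real_sqrt_ge_zero of_nat_0_le_iff)
  qed (use assms h0 in auto)
  also have "\<dots> = sqrt T * D * C" unfolding Mh(1) by (simp add: real_sqrt_mult mult_ac)
  finally show ?thesis .
qed

lemma sum_y2: "(\<Sum>m=1..M. (sqrt (y2 m))\<^sup>2) \<le> Y\<^sup>2"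
  unfolding Y2(1) by (simp add: y2_nonneg)

lemma identity: "(LINT x:X|lborel. (wT x - pf (c M) (T, x)) * (\<phi> x * lam x)) =
     (\<Sum>m=1..M. LINT z:I m \<times> X|lborel. (w z - pf (c m) z) * (ut z + s * ux z)) + (\<Sum>m=1..M. (LINT z:I m \<times> X|lborel. r z * u z)
        - (LINT x:X|lborel. J m x * u (tm (m - 1), x)))"
proof -
  have uT: "u (T, x) = \<phi> x * lam x" for x by (simp add: u_def)
  show ?thesis using error_identity[OF u_smooth u_dt u_dx u_cont(2,3)] unfolding sum.distrib uT .
qed

lemma coarse_bound:
  assumes hr: "rho < h" and l: "lam = (\<lambda>x. 1)" "lam' = (\<lambda>x. 0)"
  shows "\<bar>LINT x:X|lborel. (wT x - pf (c M) (T, x)) * \<phi> x\<bar> \<le> sqrt T * Y * (2 / rho * N0)"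
proof -
  have z: "ut z + s * ux z = 0" for z unfolding ut_def ux_def by (simp add: l)
  have l1: "lam x = 1" for x by (simp add: l)
  have eq: "(LINT x:X|lborel. (wT x - pf (c M) (T, x)) * \<phi> x) = (\<Sum>m=1..M. (LINT z:I m \<times> X|lborel. r z * u z)
        - (LINT x:X|lborel. J m x * u (tm (m - 1), x)))"
    using identity unfolding z l1 by simp
  show ?thesis unfolding eq
    by (rule sum_slabs[where y = "\<lambda>m. sqrt (y2 m)"])
      (use slab_bound_coarse[OF _ hr] sum_y2 y2_nonneg Y2(2) K(1) N_nonneg in auto)
qed

text \<open>\<open>\<phi> = \<phi> lam + \<phi> (1 - lam)\<close>. The first part is the value at time \<open>T\<close> of the test function \<open>u\<close>. The second
  part lives at depths up to \<open>2 * rho\<close>, where \<open>wT\<close> is zero and the weighted energy at time \<open>T\<close> controls the discrete field.\<close>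

lemma fine_bound:
  assumes gz: "good_zone z zl zr" and l0: "lam inflow = 0"
    and far: "\<And>x. x \<in> X \<Longrightarrow> 2 * rho < depth x \<Longrightarrow> lam' x = 0" "\<And>x. x \<in> X \<Longrightarrow> 2 * rho < depth x \<Longrightarrow> lam x = 1"
    and l1: "\<And>x. 0 \<le> lam x"
  shows "\<bar>LINT x:X|lborel. (wT x - pf (c M) (T, x)) * \<phi> x\<bar> \<le>
    (sqrt T * sqrt (4 * energy_const cc k) * L + sqrt T * (1 + (1 + L) * (2 + cc)) + sqrt (2 * energy_const cc k / rho)) * Y * (N0 + N1)"
proof -
  define Z where "Z = {zl..zr}"
  have ZX: "Z \<subseteq> X" "Z \<in> sets borel" "bounded Z" unfolding Z_def using good_zone_props(1)[OF gz] by auto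
  let ?E = "energy_const cc k"
  have E0: "0 \<le> ?E" unfolding energy_const_def using lead_const(1)[of k] end_const(1)[of k] cc by (simp add: add_nonneg_nonneg)
  let ?e = "\<lambda>x. wT x - pf (c M) (T, x)"
  have MM: "M \<in> {1..M}" using M1 by auto
  have sp: "sqi X (\<lambda>x. pf (c M) (T, x))" by (intro pf_slice_sqi MM Xb order_refl)
  have se: "sqi X ?e" using wT(1) unfolding X_def[symmetric] by (intro sqi_diff sp)
  have q: "sqi X (\<lambda>x. \<phi> x * lam x)" "sqi X (\<lambda>x. \<phi> x * (1 - lam x))" "sqi X \<phi>"
    by (intro bfun_sqi bfun_continuous continuous_intros cph clam Xb)+
  have split: "(LINT x:X|lborel. ?e x * \<phi> x) = (LINT x:X|lborel. ?e x * (\<phi> x * lam x)) + (LINT x:X|lborel. ?e x * (\<phi> x * (1 - lam x)))"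
    using set_integral_add(2)[OF sqi_mult_integrable[OF se q(1)] sqi_mult_integrable[OF se q(2)]] by (simp add: algebra_simps)
  have b1: "\<bar>\<Sum>m=1..M. LINT z:I m \<times> X|lborel. (w z - pf (c m) z) * (ut z + s * ux z)\<bar> \<le> sqrt T * (sqrt (4 * ?E) * Y) * (L * N0)"
    by (rule sum_slabs[where y = "\<lambda>m. nrm (I m \<times> {zl..zr}) (pf (c m))"])
      (use inflow_term_bound[OF _ gz far(1)] energy_bounds(1)[OF gz] E0 Y2(2) L0 N_nonneg in \<open>auto simp: power_mult_distrib\<close>)
  have b2: "\<bar>\<Sum>m=1..M. (LINT z:I m \<times> X|lborel. r z * u z) - (LINT x:X|lborel. J m x * u (tm (m - 1), x))\<bar>
      \<le> sqrt T * Y * ((1 + (1 + L) * (2 + cc)) * (N0 + N1))"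
    by (rule sum_slabs[where y = "\<lambda>m. sqrt (y2 m)"])
      (use slab_bound_fine[OF _ l0] sum_y2 y2_nonneg Y2(2) N_nonneg L0 cc in auto)
  have b3: "\<bar>LINT x:X|lborel. ?e x * (\<phi> x * (1 - lam x))\<bar> \<le> sqrt (2 * ?E / rho) * Y * N0"
  proof -
    define g where "g x = pf (c M) (T, x) * (1 - lam x)" for x
    have "bfun ({T} \<times> Z) (pf (c M))" using c[OF MM] by (intro pf_bfun) auto
    then have bpT: "bfun Z (\<lambda>x. pf (c M) (T, x))" by (rule bfun_slice) simp
    have bg: "bfun Z g"
    proof -
      have "bfun Z (\<lambda>x. 1 - lam x)" by (intro bfun_continuous continuous_intros clam ZX)
      then show ?thesis unfolding g_def by (rule bfun_mult[OF bpT])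
    qed
    have "(LINT x:X|lborel. ?e x * (\<phi> x * (1 - lam x))) = (LINT x:X|lborel. indicator Z x * - (g x * \<phi> x))"
    proof (rule set_lebesgue_integral_cong)
      show "\<forall>x. x \<in> X \<longrightarrow> ?e x * (\<phi> x * (1 - lam x)) = indicator Z x * - (g x * \<phi> x)"
      proof (intro allI impI)
        fix x assume x: "x \<in> X"
        show "?e x * (\<phi> x * (1 - lam x)) = indicator Z x * - (g x * \<phi> x)"
        proof (cases "x \<in> Z")
          case True
          then have "wT x = 0" using wT(2) good_zone_props(2)[OF gz] unfolding Z_def by blast
          then show ?thesis using True by (simp add: g_def)
        next
          case False
          then have "2 * rho < depth x" using good_zone_props(4)[OF gz x] unfolding Z_def by force
          then show ?thesis using False far(2)[OF x] by simp
        qed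
      qed
    qed (use Xb in simp)
    also have "\<dots> = (LINT x:Z|lborel. - (g x * \<phi> x))" by (rule LINT_restrict_zone(2)[OF ZX(1)])
    also have "\<bar>\<dots>\<bar> = \<bar>LINT x:Z|lborel. g x * \<phi> x\<bar>" by (simp add: set_lebesgue_integral_def)
    also have "\<dots> \<le> nrm Z g * nrm Z \<phi>" by (intro sqi_cs bfun_sqi bg bfun_continuous cph ZX)
    also have "\<dots> \<le> (sqrt (2 * ?E / rho) * Y) * N0"
    proof (rule mult_mono)
      show "nrm Z \<phi> \<le> N0" unfolding N0_def by (rule nrm_subset[OF q(3) ZX(1,2)])
      have "rho * (nrm Z g)\<^sup>2 = (LINT x:Z|lborel. rho * (g x)\<^sup>2)" unfolding nrm_sq by simp
      also have "\<dots> \<le> (LINT x:Z|lborel. s * (z - x) * (pf (c M) (T, x))\<^sup>2)"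
      proof (rule set_integral_mono)
        show "set_integrable lborel Z (\<lambda>x. rho * (g x)\<^sup>2)" by (intro bfun_integrable bfun_mult bfun_const bfun_power bg ZX)
        have "bfun Z (\<lambda>x. s * (z - x))" by (intro bfun_continuous continuous_intros ZX)
        then show "set_integrable lborel Z (\<lambda>x. s * (z - x) * (pf (c M) (T, x))\<^sup>2)"
          by (intro bfun_integrable bfun_mult[of Z "\<lambda>x. s * (z - x)"] bfun_power bpT ZX)
        fix x assume x: "x \<in> Z"
        show "rho * (g x)\<^sup>2 \<le> s * (z - x) * (pf (c M) (T, x))\<^sup>2"
        proof (cases "depth x \<le> 2 * rho")
          case True
          have "(1 - lam x)\<^sup>2 \<le> 1" using l1[of x] lam(4)[of x] by (intro power_le_one) auto
          then have "(pf (c M) (T, x))\<^sup>2 * (1 - lam x)\<^sup>2 \<le> (pf (c M) (T, x))\<^sup>2" by (simp add: mult_left_le)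
          then have "rho * (g x)\<^sup>2 \<le> rho * (pf (c M) (T, x))\<^sup>2"
            using K(1) unfolding g_def power_mult_distrib by (intro mult_left_mono) auto
          also have "\<dots> \<le> s * (z - x) * (pf (c M) (T, x))\<^sup>2"
            using good_zone_props(4)[OF gz _ True] x ZX by (intro mult_right_mono) auto
          finally show ?thesis .
        next
          case False
          then have "g x = 0" using far(2)[of x] x ZX unfolding g_def by auto
          then show ?thesis using good_zone_props(3)[OF gz] x unfolding Z_def by simp
        qed
      qed
      also have "\<dots> \<le> 2 * ?E * Y\<^sup>2" unfolding Z_def by (rule energy_bounds(2)[OF gz])
      finally have "(nrm Z g)\<^sup>2 \<le> (2 * ?E / rho) * Y\<^sup>2" using K(1) by (simp add: field_simps)
      also have "\<dots> = (sqrt (2 * ?E / rho) * Y)\<^sup>2" using E0 K(1) by (simp add: power_mult_distrib)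
      finally show "nrm Z g \<le> sqrt (2 * ?E / rho) * Y" by (rule power2_le_imp_le) (use E0 K Y2 in auto)
    qed (use E0 K Y2 in auto)
    finally show ?thesis .
  qed
  have "\<bar>LINT x:X|lborel. ?e x * \<phi> x\<bar> \<le> sqrt T * (sqrt (4 * ?E) * Y) * (L * N0) + sqrt T * Y * ((1 + (1 + L) * (2 + cc)) * (N0 + N1)) + sqrt (2 * ?E / rho) * Y * N0"
    unfolding split identity using b1 b2 b3 by linarith
  also have "\<dots> \<le> sqrt T * (sqrt (4 * ?E) * Y) * (L * (N0 + N1)) + sqrt T * Y * ((1 + (1 + L) * (2 + cc)) * (N0 + N1)) + sqrt (2 * ?E / rho) * Y * (N0 + N1)"
  proof -
    have "0 \<le> 1 + (1 + L) * (2 + cc)" using L0 cc by (intro add_nonneg_nonneg mult_nonneg_nonneg) auto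
    then show ?thesis using E0 K Y2(2) N_nonneg L0 Mh(2) by (intro add_mono mult_left_mono) auto
  qed
  also have "\<dots> = (sqrt T * sqrt (4 * ?E) * L + sqrt T * (1 + (1 + L) * (2 + cc)) + sqrt (2 * ?E / rho)) * Y * (N0 + N1)"
    by (simp add: algebra_simps)
  finally show ?thesis .
qed

end

definition dual_const :: "real \<Rightarrow> real \<Rightarrow> nat \<Rightarrow> real \<Rightarrow> real" where
  "dual_const T cc k rho = sqrt T * sqrt (4 * energy_const cc k) * (bump_bound / rho) + sqrt T * (1 + (1 + bump_bound / rho) * (2 + cc))
     + sqrt (2 * energy_const cc k / rho) + sqrt T * (2 / rho)"

context scheme begin

text \<open>The cut-off is used for \<open>h \<le> rho\<close> only, when the mesh is fine enough to have a node in the required range.\<close>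

theorem dual_estimate:
  assumes ph: "smooth \<phi>" "\<And>x. (\<phi> has_real_derivative \<phi>' x) (at x)" "continuous_on UNIV \<phi>'"
    "\<And>x. x \<notin> {al<..<be} \<Longrightarrow> \<phi> x = 0" "\<And>x. x \<notin> {al<..<be} \<Longrightarrow> \<phi>' x = 0"
  shows "\<bar>LINT x:X|lborel. (wT x - pf (c M) (T, x)) * \<phi> x\<bar> \<le> dual_const T cc k rho * Y * (nrm X \<phi> + nrm X \<phi>')"
proof -
  have E0: "0 \<le> energy_const cc k" unfolding energy_const_def using lead_const(1)[of k] end_const(1)[of k] cc by (simp add: add_nonneg_nonneg)
  let ?A = "sqrt T * sqrt (4 * energy_const cc k) * (bump_bound / rho) + sqrt T * (1 + (1 + bump_bound / rho) * (2 + cc)) + sqrt (2 * energy_const cc k / rho)"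
  have A0: "0 \<le> ?A" using E0 K(1) bump_bound(1) cc Mh(2) by (intro add_nonneg_nonneg mult_nonneg_nonneg) auto
  have B0: "0 \<le> sqrt T * (2 / rho)" using K(1) Mh(2) by simp
  have dc: "?A \<le> dual_const T cc k rho" "sqrt T * (2 / rho) \<le> dual_const T cc k rho"
    unfolding dual_const_def using A0 B0 by linarith+
  have n: "0 \<le> nrm X \<phi>" "0 \<le> nrm X \<phi>'" by auto
  show ?thesis
  proof (cases "h \<le> rho")
    case False
    interpret D: dual al be h \<T> k T M s cc K1 K2 rho c w0 wT w b r rt rx \<phi> \<phi>' "\<lambda>x. 1" "\<lambda>x. 0" 0
    proof (intro dual.intro scheme_axioms dual_axioms.intro)
      show "smooth (\<lambda>x. 1 :: real)" by (rule smooth_intros(1))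
    qed (use ph(1-3) in \<open>simp_all add: ph(4,5)\<close>)
    have "\<bar>LINT x:X|lborel. (wT x - pf (c M) (T, x)) * \<phi> x\<bar> \<le> sqrt T * Y * (2 / rho * nrm X \<phi>)"
      using D.coarse_bound False unfolding D.N0_def by simp
    also have "\<dots> = (sqrt T * (2 / rho)) * Y * nrm X \<phi>" by simp
    also have "\<dots> \<le> dual_const T cc k rho * Y * (nrm X \<phi> + nrm X \<phi>')"
      using dc n Y2(2) A0 B0 by (intro mult_mono mult_right_mono) auto
    finally show ?thesis .
  next
    case True
    obtain z zl zr where gz: "good_zone z zl zr" using good_zone_exists[OF True] by blast
    \<comment> \<open>Varies at depths between \<open>rho\<close> and \<open>2 * rho\<close>.\<close>
    define lam where "lam x = sstep (s * (x - inflow) / rho - 1)" for x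
    define lam' where "lam' x = s / rho * bump (s * (x - inflow) / rho - 1)" for x
    have sm: "smooth lam"
      using smooth_affine1[OF sstep_smooth, of "- s * inflow / rho - 1" "s / rho"] unfolding lam_def
      by (simp add: algebra_simps diff_divide_distrib)
    have d: "(lam has_real_derivative lam' x) (at x)" for x
    proof -
      have "((\<lambda>x. s * (x - inflow) / rho - 1) has_real_derivative s / rho) (at x)"
        using K(1) by (auto intro!: derivative_eq_intros)
      from DERIV_chain2[OF sstep_deriv this] show ?thesis unfolding lam_def lam'_def by (simp add: mult.commute)
    qed
    have cl: "continuous_on UNIV lam'" unfolding lam'_def
      using K(1) by (intro continuous_intros cont_comp[OF smooth_continuous[OF bump_smooth]]) auto
    have bl: "\<bar>lam' x\<bar> \<le> bump_bound / rho" for x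
    proof -
      have "\<bar>lam' x\<bar> = \<bar>bump (s * (x - inflow) / rho - 1)\<bar> / rho"
        unfolding lam'_def using s K(1) by (auto simp: abs_mult)
      then show ?thesis using bump_bound(2) K(1) by (simp add: divide_right_mono)
    qed
    interpret D: dual al be h \<T> k T M s cc K1 K2 rho c w0 wT w b r rt rx \<phi> \<phi>' lam lam' "bump_bound / rho"
    proof (intro dual.intro scheme_axioms dual_axioms.intro)
      show "\<bar>lam x\<bar> \<le> 1" for x unfolding lam_def using sstep_bounds[of "s * (x - inflow) / rho - 1"] by simp
    qed (use ph(1-3) sm d cl bl in \<open>simp_all add: ph(4,5)\<close>)
    have far: "1 \<le> s * (x - inflow) / rho - 1" if "2 * rho < depth x" for x
      using that K(1) unfolding depth_def by (simp add: field_simps)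
    have "\<bar>LINT x:X|lborel. (wT x - pf (c M) (T, x)) * \<phi> x\<bar> \<le> ?A * Y * (nrm X \<phi> + nrm X \<phi>')"
      unfolding D.N0_def[symmetric] D.N1_def[symmetric]
    proof (rule D.fine_bound[OF gz])
      show "lam inflow = 0" by (simp add: lam_def sstep_0)
      show "lam' x = 0" "lam x = 1" if "2 * rho < depth x" for x
        using far[OF that] by (simp_all add: lam_def lam'_def bump_zero sstep_1)
      show "0 \<le> lam x" for x unfolding lam_def by (rule sstep_bounds)
    qed
    also have "\<dots> \<le> dual_const T cc k rho * Y * (nrm X \<phi> + nrm X \<phi>')"
      using dc n Y2(2) by (intro mult_right_mono) auto
    finally show ?thesis .
  qed
qed

end

section \<open>Lebesgue integrals and Borel representatives\<close>

text \<open>Pointwise derivatives of discrete functions are known off a null set only. As the Lebesgue measure is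
  complete, they may be replaced by Borel functions under the integral.\<close>

lemma lebesgue_measurable_AE:
  fixes f g :: "'a::euclidean_space \<Rightarrow> 'b::euclidean_space"
  assumes g: "g \<in> borel_measurable borel" and ae: "AE x in lborel. f x = g x"
  shows "f \<in> borel_measurable lebesgue"
proof (rule measurableI)
  fix A :: "'b set" assume A: "A \<in> sets borel"
  have ae': "AE x in lebesgue. f x = g x" using ae by (rule AE_completion)
  show "f -` A \<inter> space lebesgue \<in> sets lebesgue"
  proof (rule completion.in_sets_AE)
    have "g -` A \<inter> space lborel \<in> sets lborel" using g A by (intro measurable_sets[of g lborel borel]) auto
    then show "g -` A \<inter> space lborel \<in> sets lebesgue" by auto
    show "AE x in lebesgue. (x \<in> g -` A \<inter> space lborel) = (x \<in> f -` A \<inter> space lebesgue)"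
      using ae' by eventually_elim auto
  qed auto
qed auto

lemma LINT_lebesgue_Borel:
  fixes f g :: "'a::euclidean_space \<Rightarrow> 'b::euclidean_space"
  assumes S[measurable]: "S \<in> sets borel" and g[measurable]: "g \<in> borel_measurable borel"
    and ae: "AE x in lborel. x \<in> S \<longrightarrow> f x = g x"
  shows "(LINT x:S|lebesgue. f x) = (LINT x:S|lborel. g x)"
proof -
  have m: "(\<lambda>x. indicat_real S x *\<^sub>R g x) \<in> borel_measurable borel" by measurable
  have ae2: "AE x in lborel. indicat_real S x *\<^sub>R f x = indicat_real S x *\<^sub>R g x"
    using ae by eventually_elim (auto simp: indicator_def)
  have "(LINT x:S|lebesgue. f x) = (LINT x|lebesgue. indicat_real S x *\<^sub>R g x)"
    unfolding set_lebesgue_integral_def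
  proof (rule integral_cong_AE)
    show "(\<lambda>x. indicat_real S x *\<^sub>R f x) \<in> borel_measurable lebesgue" by (rule lebesgue_measurable_AE[OF m ae2])
    show "(\<lambda>x. indicat_real S x *\<^sub>R g x) \<in> borel_measurable lebesgue" using m by (simp add: measurable_completion)
    show "AE x in lebesgue. indicat_real S x *\<^sub>R f x = indicat_real S x *\<^sub>R g x" by (rule AE_completion[OF ae2])
  qed
  also have "\<dots> = (LINT x|lborel. indicat_real S x *\<^sub>R g x)" using m by (intro integral_completion) simp
  finally show ?thesis unfolding set_lebesgue_integral_def .
qed

lemma bounded_domain_real:
  assumes "bounded_domain (G :: real set)" obtains al be where "al < be" "G = {al<..<be}"
proof -
  have G: "open G" "connected G" "G \<noteq> {}" "bounded G" using assms unfolding bounded_domain_def by auto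
  have bd: "bdd_above G" "bdd_below G" using G(4) by (auto intro: bounded_imp_bdd_above bounded_imp_bdd_below)
  have G_eq: "G = {Inf G<..<Sup G}"
  proof (intro set_eqI iffI)
    fix x assume x: "x \<in> G"
    obtain e where e: "e > 0" "ball x e \<subseteq> G" using G(1) x openE by blast
    have "x - e / 2 \<in> G" "x + e / 2 \<in> G" using e by (auto simp: subset_eq dist_real_def)
    then have "Inf G \<le> x - e / 2" "x + e / 2 \<le> Sup G" using bd by (auto intro: cInf_lower cSup_upper)
    then show "x \<in> {Inf G<..<Sup G}" using e by auto
  next
    fix x assume "x \<in> {Inf G<..<Sup G}"
    then obtain y z where "y \<in> G" "y < x" "z \<in> G" "x < z"
      using G(3) bd by (metis greaterThanLessThan_iff cInf_less_iff less_cSup_iff)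
    then show "x \<in> G" using connectedD_interval[OF G(2), of y z x] by simp
  qed
  moreover from G_eq G(3) have "Inf G < Sup G" by (metis greaterThanLessThan_empty not_le_imp_less)
  ultimately show thesis using that by blast
qed

lemma poly_coeff_uniq:
  fixes a b :: "nat \<Rightarrow> real"
  assumes "infinite I" "\<And>s. s \<in> I \<Longrightarrow> (\<Sum>i\<le>k. s ^ i * a i) = (\<Sum>i\<le>k. s ^ i * b i)" "i \<le> k"
  shows "a i = b i"
proof -
  define P where "P = (\<Sum>i\<le>k. monom (a i - b i) i)"
  have "poly P s = 0" if "s \<in> I" for s
  proof -
    have "poly P s = (\<Sum>i\<le>k. s ^ i * a i - s ^ i * b i)"
      unfolding P_def poly_sum poly_monom by (intro sum.cong refl) (simp add: algebra_simps)
    then show ?thesis using assms(2)[OF that] by (simp only: sum_subtractf diff_self)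
  qed
  then have "I \<subseteq> {s. poly P s = 0}" by auto
  then have "P = 0" using assms(1) poly_roots_finite[of P] finite_subset by blast
  then have "coeff P i = 0" by simp
  moreover have "coeff P i = a i - b i" using assms(3) unfolding P_def by (simp add: coeff_sum)
  ultimately show ?thesis by simp
qed

section \<open>The finite element space\<close>

lemma test_function_zero:
  fixes \<psi> :: "'a::euclidean_space \<Rightarrow> 'b::real_normed_vector"
  assumes tf: "test_function G \<psi>" and z: "z \<notin> G"
  shows "\<psi> z = 0" "frechet_derivative \<psi> (at z) v = 0"
proof -
  have sup: "closure {x. \<psi> x \<noteq> 0} \<subseteq> G" using tf unfolding test_function_def by blast
  then show "\<psi> z = 0" using z closure_subset[of "{x. \<psi> x \<noteq> 0}"] by blast
  have "(\<psi> has_derivative (\<lambda>x. 0)) (at z)"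
  proof (rule has_derivative_transform_within_open[of "\<lambda>x. 0" _ z UNIV "- closure {x. \<psi> x \<noteq> 0}"])
    show "\<And>x. x \<in> - closure {x. \<psi> x \<noteq> 0} \<Longrightarrow> 0 = \<psi> x" using closure_subset[of "{x. \<psi> x \<noteq> 0}"] by fastforce
  qed (use z sup in auto)
  from frechet_eq[OF this] show "frechet_derivative \<psi> (at z) v = 0" by simp
qed

lemma test_function_partials:
  fixes \<psi> :: "real \<times> real \<Rightarrow> real"
  assumes "test_function G \<psi>"
  shows "((\<lambda>t. \<psi> (t, x)) has_real_derivative frechet_derivative \<psi> (at (t, x)) (1, 0)) (at t)"
    and "((\<lambda>x. \<psi> (t, x)) has_real_derivative frechet_derivative \<psi> (at (t, x)) (0, 1)) (at x)"
    and "continuous_on S \<psi>" "continuous_on S (\<lambda>z. frechet_derivative \<psi> (at z) (1, 0))" "continuous_on S (\<lambda>z. frechet_derivative \<psi> (at z) (0, 1))"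
proof -
  have s: "C_diff 0 \<psi>" "C_diff (Suc 0) \<psi>" using assms unfolding test_function_def by blast+
  have d: "\<psi> differentiable (at z)" for z using s(2) unfolding C_diff.simps by blast
  note h = frechet_works[OF d]
  have lin: "frechet_derivative \<psi> (at z) (c *\<^sub>R w) = c *\<^sub>R frechet_derivative \<psi> (at z) w" for z c w
    using has_derivative_linear[OF h] by (rule linear_scale)
  have "((\<lambda>t. (t, x)) has_derivative (\<lambda>d. (d, 0))) (at t)"
    by (intro has_derivative_Pair has_derivative_ident has_derivative_const)
  from has_derivative_compose[OF this h] have "((\<lambda>t. \<psi> (t, x)) has_derivative (\<lambda>d. frechet_derivative \<psi> (at (t, x)) (d, 0))) (at t)" .
  moreover have "(\<lambda>d. frechet_derivative \<psi> (at (t, x)) (d, 0)) = (\<lambda>d. frechet_derivative \<psi> (at (t, x)) (1, 0) * d)"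
  proof
    fix d show "frechet_derivative \<psi> (at (t, x)) (d, 0) = frechet_derivative \<psi> (at (t, x)) (1, 0) * d"
      using lin[of "(t, x)" d "(1, 0)"] by (simp add: mult.commute)
  qed
  ultimately show "((\<lambda>t. \<psi> (t, x)) has_real_derivative frechet_derivative \<psi> (at (t, x)) (1, 0)) (at t)"
    unfolding has_field_derivative_def by simp
  have "((\<lambda>x. (t, x)) has_derivative (\<lambda>d. (0, d))) (at x)"
    by (intro has_derivative_Pair has_derivative_ident has_derivative_const)
  from has_derivative_compose[OF this h] have "((\<lambda>x. \<psi> (t, x)) has_derivative (\<lambda>d. frechet_derivative \<psi> (at (t, x)) (0, d))) (at x)" .
  moreover have "(\<lambda>d. frechet_derivative \<psi> (at (t, x)) (0, d)) = (\<lambda>d. frechet_derivative \<psi> (at (t, x)) (0, 1) * d)"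
  proof
    fix d show "frechet_derivative \<psi> (at (t, x)) (0, d) = frechet_derivative \<psi> (at (t, x)) (0, 1) * d"
      using lin[of "(t, x)" d "(0, 1)"] by (simp add: mult.commute)
  qed
  ultimately show "((\<lambda>x. \<psi> (t, x)) has_real_derivative frechet_derivative \<psi> (at (t, x)) (0, 1)) (at x)"
    unfolding has_field_derivative_def by simp
  show "continuous_on S \<psi>" using s(1) continuous_on_subset[of UNIV \<psi> S] unfolding C_diff.simps by blast
  have B: "(1, 0) \<in> (Basis :: (real \<times> real) set)" "(0, 1) \<in> (Basis :: (real \<times> real) set)" by (auto simp: Basis_prod_def)
  have c: "\<forall>b\<in>Basis. continuous_on UNIV (\<lambda>z. frechet_derivative \<psi> (at z) b)" using s(2) unfolding C_diff.simps by blast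
  show "continuous_on S (\<lambda>z. frechet_derivative \<psi> (at z) (1, 0))" using bspec[OF c B(1)] by (rule continuous_on_subset) simp
  show "continuous_on S (\<lambda>z. frechet_derivative \<psi> (at z) (0, 1))" using bspec[OF c B(2)] by (rule continuous_on_subset) simp
qed

lemma L2_on_bfun:
  fixes f :: "'a::euclidean_space \<Rightarrow> real"
  assumes "bfun S f" "S \<in> sets borel" "bounded S" shows "L2_on S f"
proof -
  have [measurable]: "f \<in> borel_measurable borel" "S \<in> sets borel" using assms by (auto dest: bfun_meas)
  have "set_integrable lborel S (\<lambda>x. (f x)\<^sup>2)" by (intro bfun_integrable bfun_power assms)
  then show ?thesis unfolding L2_on_def set_borel_measurable_def by simp
qed

context mesh begin

text \<open>The representations as polynomials in time on two elements agree at a common node for infinitely many times, so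
  their coefficients agree there. Therefore the coefficients are continuous functions of \<open>x\<close>.\<close>

lemma fe_slab_representation:
  fixes g :: "real \<times> real \<Rightarrow> real"
  assumes I: "infinite I" and rep: "\<forall>\<tau>\<in>\<T>. \<exists>a. \<forall>s\<in>I. \<forall>x\<in>\<tau>. g (s, x) = (\<Sum>p\<le>k. \<Sum>q\<le>k. a p q * s ^ p * x ^ q)"
    and z: "\<forall>s\<in>I. g (s, al) = 0 \<and> g (s, be) = 0"
  shows "\<exists>c. (\<forall>i\<le>k. pw (c i) \<and> c i al = 0 \<and> c i be = 0) \<and> (\<forall>s\<in>I. \<forall>x\<in>{al..be}. g (s, x) = pf c (s, x))"
proof -
  obtain A where A: "\<forall>\<tau>\<in>\<T>. \<forall>s\<in>I. \<forall>x\<in>\<tau>. g (s, x) = (\<Sum>p\<le>k. \<Sum>q\<le>k. A \<tau> p q * s ^ p * x ^ q)"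
    using bchoice[OF rep] by blast
  define B where "B \<tau> p x = (\<Sum>q\<le>k. A \<tau> p q * x ^ q)" for \<tau> p and x :: real
  have gB: "g (s, x) = (\<Sum>p\<le>k. s ^ p * B \<tau> p x)" if "\<tau> \<in> \<T>" "s \<in> I" "x \<in> \<tau>" for \<tau> s x
    using A that unfolding B_def by (simp add: sum_distrib_left mult_ac)
  define c where "c p x = (if x \<in> {al..be} then B (SOME \<tau>. \<tau> \<in> \<T> \<and> x \<in> \<tau>) p x else 0)" for p and x :: real
  have cB: "c p x = B \<tau> p x" if t: "\<tau> \<in> \<T>" "x \<in> \<tau>" and p: "p \<le> k" for \<tau> p x
  proof -
    define \<tau>' where "\<tau>' = (SOME \<tau>. \<tau> \<in> \<T> \<and> x \<in> \<tau>)"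
    have "\<tau>' \<in> \<T> \<and> x \<in> \<tau>'" unfolding \<tau>'_def by (rule someI[of _ \<tau>]) (use t in auto)
    then have t': "\<tau>' \<in> \<T>" "x \<in> \<tau>'" by auto
    have "B \<tau>' p x = B \<tau> p x"
      using gB[OF t(1) _ t(2)] gB[OF t'(1) _ t'(2)] by (intro poly_coeff_uniq[OF I _ p, of "\<lambda>p. B \<tau>' p x" "\<lambda>p. B \<tau> p x"]) metis
    moreover have "x \<in> {al..be}" using t sub by blast
    ultimately show ?thesis unfolding c_def \<tau>'_def by simp
  qed
  have gc: "g (s, x) = pf c (s, x)" if "s \<in> I" "x \<in> {al..be}" for s x
  proof -
    obtain \<tau> where t: "\<tau> \<in> \<T>" "x \<in> \<tau>" using cover \<open>x \<in> _\<close> by blast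
    show ?thesis unfolding gB[OF t(1) \<open>s \<in> I\<close> t(2)] pf_def using cB[OF t] by simp
  qed
  have "pw (c p)" if p: "p \<le> k" for p unfolding pw_def
  proof (intro conjI allI impI ballI)
    fix \<tau> assume t: "\<tau> \<in> \<T>"
    define q where "q = (\<Sum>q\<le>k. monom (A \<tau> p q) q)"
    have "degree q \<le> k" unfolding q_def by (intro degree_sum_le order_trans[OF degree_monom_le]) auto
    moreover have "\<forall>x\<in>\<tau>. c p x = poly q x" unfolding q_def poly_sum poly_monom using cB[OF t _ p] by (simp add: B_def)
    ultimately show "\<exists>q. degree q \<le> k \<and> (\<forall>x\<in>\<tau>. c p x = poly q x)" by blast
  qed (auto simp: c_def)
  moreover have "c p y = 0" if p: "p \<le> k" and y: "y = al \<or> y = be" for p y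
  proof -
    have y': "y \<in> {al..be}" using y ab by auto
    have "(\<Sum>i\<le>k. s ^ i * c i y) = (\<Sum>i\<le>k. s ^ i * 0)" if "s \<in> I" for s
      using gc[OF that y'] z that y unfolding pf_def by auto
    then show ?thesis by (intro poly_coeff_uniq[OF I _ p, of "\<lambda>i. c i y" "\<lambda>i. 0"]) blast
  qed
  ultimately show ?thesis using gc by blast
qed

text \<open>No boundary terms arise at the nodes, because \<open>pf \<gamma>\<close> is continuous in \<open>x\<close>. So \<open>pt \<gamma>\<close> and \<open>px \<gamma>\<close> are
  the weak derivatives.\<close>

lemma H1_pf:
  assumes \<gamma>: "\<forall>i\<le>k. pw (\<gamma> i)" "\<And>i. i \<le> k \<Longrightarrow> \<gamma> i al = 0" "\<And>i. i \<le> k \<Longrightarrow> \<gamma> i be = 0" and t01: "t0 < t1"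
  shows "H1_on ({t0<..<t1} \<times> {al<..<be}) (\<lambda>z. d * pf \<gamma> z)"
proof -
  let ?G = "{t0<..<t1} \<times> {al<..<be}" let ?S = "{t0<..t1} \<times> {al..be}"
  have G: "?G \<in> sets borel" "bounded ?G" "?S \<in> sets borel" "bounded ?S"
    by (auto intro!: borel_Times bounded_Times bounded_Ioo intro: bounded_subset[OF bounded_closed_interval])
  have IB: "bounded {t0<..t1}" "{t0<..t1} \<in> sets borel" by (auto intro: bounded_subset[OF bounded_closed_interval])
  have b: "bfun (A \<times> B) (pf \<gamma>)" "bfun (A \<times> B) (pt \<gamma>)" "bfun (A \<times> B) (px \<gamma>)" if "bounded A" for A B
    using that \<gamma>(1) by (intro pf_bfun; simp)+
  have l2: "L2_on ?G (\<lambda>z. d * f z)" if "bfun ?G f" for f using that G by (intro L2_on_bfun bfun_mult bfun_const)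
  have conv: "L2_inner ?G (\<lambda>z. d * f z) \<psi> = d * (LINT z:?S|lborel. f z * \<psi> z)"
    if f: "f \<in> borel_measurable borel" and p: "continuous_on UNIV \<psi>" "\<And>z. z \<notin> ?G \<Longrightarrow> \<psi> z = 0" for f \<psi> :: "real \<times> real \<Rightarrow> real"
  proof -
    have [measurable]: "f \<in> borel_measurable borel" "\<psi> \<in> borel_measurable borel"
      using f borel_measurable_continuous_onI[OF p(1)] by auto
    have "L2_inner ?G (\<lambda>z. d * f z) \<psi> = (LINT z:?G|lborel. d * (f z * \<psi> z))"
      unfolding L2_inner_def using G by (intro LINT_lebesgue_Borel) auto
    also have "\<dots> = d * (LINT z:?G|lborel. f z * \<psi> z)" by simp
    also have "(LINT z:?G|lborel. f z * \<psi> z) = (LINT z:?S|lborel. f z * \<psi> z)"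
      unfolding set_lebesgue_integral_def
    proof (rule Bochner_Integration.integral_cong[OF refl])
      fix z show "indicat_real ?G z *\<^sub>R (f z * \<psi> z) = indicat_real ?S z *\<^sub>R (f z * \<psi> z)"
        using p(2)[of z] by (cases "z \<in> ?G") (auto simp: indicator_def)
    qed
    finally show ?thesis .
  qed
  have mb: "pf \<gamma> \<in> borel_measurable borel" "pt \<gamma> \<in> borel_measurable borel" "px \<gamma> \<in> borel_measurable borel"
    using b[of "{}" UNIV] by (auto dest: bfun_meas)
  show ?thesis unfolding H1_on_def
  proof (intro conjI ballI)
    show "L2_on ?G (\<lambda>z. d * pf \<gamma> z)" by (intro l2 b bounded_Ioo)
    fix e :: "real \<times> real" assume "e \<in> Basis"
    then have e: "e = (1, 0) \<or> e = (0, 1)" by (auto simp: Basis_prod_def)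
    show "\<exists>u'. L2_on ?G u' \<and> (\<forall>\<psi>. test_function ?G \<psi> \<longrightarrow>
        L2_inner ?G (\<lambda>z. d * pf \<gamma> z) (\<lambda>x. frechet_derivative \<psi> (at x) e) = - L2_inner ?G u' \<psi>)"
      using e
    proof
      assume e: "e = (1, 0)"
      show ?thesis
      proof (intro exI[of _ "\<lambda>z. d * pt \<gamma> z"] conjI allI impI)
        show "L2_on ?G (\<lambda>z. d * pt \<gamma> z)" by (intro l2 b bounded_Ioo)
        fix \<psi> :: "real \<times> real \<Rightarrow> real" assume tf: "test_function ?G \<psi>"
        note p = test_function_partials[OF tf] test_function_zero[OF tf]
        let ?D = "\<lambda>z. frechet_derivative \<psi> (at z) (1, 0)"
        have bb: "bfun ({t0..t1} \<times> {al..be}) \<psi>" "bfun ({t0..t1} \<times> {al..be}) ?D"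
          by (intro bfun_continuous p(3,4) bounded_Times bounded_closed_interval)+
        have int: "set_integrable lborel ?S (\<lambda>z. pt \<gamma> z * \<psi> z)" "set_integrable lborel ?S (\<lambda>z. pf \<gamma> z * ?D z)"
          by (intro bfun_integrable bfun_mult b IB G bfun_continuous p(3,4))+
        have "(LINT z:?S|lborel. pt \<gamma> z * \<psi> z + pf \<gamma> z * ?D z) = (LINT x:{al..be}|lborel. pf \<gamma> (t1, x) * \<psi> (t1, x) - pf \<gamma> (t0, x) * \<psi> (t0, x))"
        proof (rule slab_integral_dt[where F = "\<lambda>z. pf \<gamma> z * \<psi> z" and Ft = "\<lambda>z. pt \<gamma> z * \<psi> z + pf \<gamma> z * ?D z"])
          show "((\<lambda>t. pf \<gamma> (t, x) * \<psi> (t, x)) has_vector_derivative pt \<gamma> (t, x) * \<psi> (t, x) + pf \<gamma> (t, x) * ?D (t, x)) (at t)" for t x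
            using DERIV_mult[OF pf_dt[of \<gamma> x t, unfolded has_real_derivative_iff_has_vector_derivative[symmetric]] p(1)[of x t]]
            by (simp add: has_real_derivative_iff_has_vector_derivative mult.commute add.commute)
          show "bfun ({t0..t1} \<times> {al..be}) (\<lambda>z. pt \<gamma> z * \<psi> z + pf \<gamma> z * ?D z)" by (intro bfun_add bfun_mult b bb) auto
        qed (use t01 in auto)
        also have "\<dots> = 0" using p(6)[of "(t1, _)"] p(6)[of "(t0, _)"] by simp
        finally have "(LINT z:?S|lborel. pt \<gamma> z * \<psi> z) + (LINT z:?S|lborel. pf \<gamma> z * ?D z) = 0"
          using set_integral_add(2)[of lborel ?S "\<lambda>z. pt \<gamma> z * \<psi> z" "\<lambda>z. pf \<gamma> z * ?D z"] int by simp
        then have "(LINT z:?S|lborel. pf \<gamma> z * ?D z) = - (LINT z:?S|lborel. pt \<gamma> z * \<psi> z)" by linarith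
        then show "L2_inner ?G (\<lambda>z. d * pf \<gamma> z) (\<lambda>x. frechet_derivative \<psi> (at x) e) = - L2_inner ?G (\<lambda>z. d * pt \<gamma> z) \<psi>"
          unfolding e using conv[OF mb(1) p(4) p(7)]
            conv[OF mb(2) p(3) p(6)] by simp
      qed
    next
      assume e: "e = (0, 1)"
      show ?thesis
      proof (intro exI[of _ "\<lambda>z. d * px \<gamma> z"] conjI allI impI)
        show "L2_on ?G (\<lambda>z. d * px \<gamma> z)" by (intro l2 b bounded_Ioo)
        fix \<psi> :: "real \<times> real \<Rightarrow> real" assume tf: "test_function ?G \<psi>"
        note p = test_function_partials[OF tf] test_function_zero[OF tf]
        let ?D = "\<lambda>z. frechet_derivative \<psi> (at z) (0, 1)"
        have int: "set_integrable lborel ?S (\<lambda>z. px \<gamma> z * \<psi> z)" "set_integrable lborel ?S (\<lambda>z. pf \<gamma> z * ?D z)"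
          by (intro bfun_integrable bfun_mult b IB G bfun_continuous p(3,5))+
        have "(LINT z:?S|lborel. px \<gamma> z * \<psi> z + pf \<gamma> z * ?D z) = 0"
        proof (rule slab_integral_dx[OF fin_nodes less_imp_le[OF ab] IB(2,1), where F = "\<lambda>z. pf \<gamma> z * \<psi> z" and Fx = "\<lambda>z. px \<gamma> z * \<psi> z + pf \<gamma> z * ?D z"])
          have cx: "continuous_on A (\<lambda>x. \<psi> (t, x))" for A t using p(2) by (meson DERIV_isCont continuous_at_imp_continuous_on)
          show "continuous_on {al..be} (\<lambda>x. pf \<gamma> (t, x) * \<psi> (t, x))" for t
            by (intro continuous_intros pf_cont_x \<gamma> cx)
          show "((\<lambda>x. pf \<gamma> (t, x) * \<psi> (t, x)) has_vector_derivative px \<gamma> (t, x) * \<psi> (t, x) + pf \<gamma> (t, x) * ?D (t, x)) (at x)"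
            if "x \<in> {al<..<be} - nodes" for t x
          proof -
            have "x \<in> {al..be} - nodes" using that by auto
            from DERIV_mult[OF pf_dx[OF \<gamma>(1) this, of t, unfolded has_real_derivative_iff_has_vector_derivative[symmetric]] p(2)[of t x]]
            show ?thesis by (simp add: has_real_derivative_iff_has_vector_derivative mult.commute add.commute)
          qed
          show "bfun ?S (\<lambda>z. px \<gamma> z * \<psi> z + pf \<gamma> z * ?D z)" by (intro bfun_add bfun_mult b bfun_continuous p(3,5) G IB)
          show "pf \<gamma> (t, al) * \<psi> (t, al) = 0" "pf \<gamma> (t, be) * \<psi> (t, be) = 0" for t
            using \<gamma>(2,3) by (auto simp: pf_zero)
        qed
        then have "(LINT z:?S|lborel. px \<gamma> z * \<psi> z) + (LINT z:?S|lborel. pf \<gamma> z * ?D z) = 0"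
          using set_integral_add(2)[of lborel ?S "\<lambda>z. px \<gamma> z * \<psi> z" "\<lambda>z. pf \<gamma> z * ?D z"] int by simp
        then have "(LINT z:?S|lborel. pf \<gamma> z * ?D z) = - (LINT z:?S|lborel. px \<gamma> z * \<psi> z)" by linarith
        then show "L2_inner ?G (\<lambda>z. d * pf \<gamma> z) (\<lambda>x. frechet_derivative \<psi> (at x) e) = - L2_inner ?G (\<lambda>z. d * px \<gamma> z) \<psi>"
          unfolding e using conv[OF mb(1) p(5) p(7)]
            conv[OF mb(3) p(3) p(6)] by simp
      qed
    qed
  qed
qed

lemma pf_in_fe_space:
  fixes v :: "real^3"
  assumes \<gamma>: "\<forall>i\<le>k. pw (\<gamma> i) \<and> \<gamma> i al = 0 \<and> \<gamma> i be = 0" and t: "\<And>m. m \<in> {1..M} \<Longrightarrow> t (m - 1) < t m"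
  shows "(\<lambda>z. pf \<gamma> z *\<^sub>R v) \<in> fe_space {al<..<be} M t \<T> k"
  unfolding fe_space_def
proof (rule CollectI, intro ballI allI conjI)
  fix m l assume m: "m \<in> {1..M}"
  show "H1_on ({t (m - 1)<..<t m} \<times> {al<..<be}) (\<lambda>z. (pf \<gamma> z *\<^sub>R v) $ l)"
    using H1_pf[of \<gamma> "t (m - 1)" "t m" "v $ l"] \<gamma> t[OF m] by (simp add: mult.commute)
  show "(pf \<gamma> (s, x) *\<^sub>R v) $ l = 0" if "x \<in> frontier {al<..<be}" for s x
  proof -
    have "x = al \<or> x = be" using that ab by (auto simp: frontier_def interior_open)
    then have "pf \<gamma> (s, x) = 0" using \<gamma> by (auto intro!: pf_zero)
    then show ?thesis by simp
  qed
  fix \<tau> assume ta: "\<tau> \<in> \<T>"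
  have "(pf \<gamma> (s, x) *\<^sub>R v) $ l = (\<Sum>p\<le>k. \<Sum>q\<le>k. (v $ l * coeff (ppoly (\<gamma> p) \<tau>) q) * s ^ p * x ^ q)" if "x \<in> \<tau>" for s x
  proof -
    have "\<gamma> p x = (\<Sum>q\<le>k. coeff (ppoly (\<gamma> p) \<tau>) q * x ^ q)" if p: "p \<le> k" for p
    proof -
      have pp: "pw (\<gamma> p)" using \<gamma> p by simp
      have "\<gamma> p x = poly (ppoly (\<gamma> p) \<tau>) x" by (rule ppoly(2)[OF pp ta \<open>x \<in> \<tau>\<close>])
      also have "\<dots> = (\<Sum>q\<le>degree (ppoly (\<gamma> p) \<tau>). coeff (ppoly (\<gamma> p) \<tau>) q * x ^ q)" by (rule poly_altdef)
      also have "\<dots> = (\<Sum>q\<le>k. coeff (ppoly (\<gamma> p) \<tau>) q * x ^ q)"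
        using ppoly(1)[OF pp ta] by (intro sum.mono_neutral_left) (auto simp: coeff_eq_0)
      finally show ?thesis .
    qed
    then have "pf \<gamma> (s, x) = (\<Sum>p\<le>k. s ^ p * (\<Sum>q\<le>k. coeff (ppoly (\<gamma> p) \<tau>) q * x ^ q))" unfolding pf_def by simp
    then show ?thesis by (simp add: sum_distrib_left sum_distrib_right mult_ac)
  qed
  then show "\<exists>a. \<forall>s\<in>{t (m - 1)<..t m}. \<forall>x\<in>\<tau>. (pf \<gamma> (s, x) *\<^sub>R v) $ l = (\<Sum>p\<le>k. \<Sum>q\<le>k. a p q * s ^ p * x ^ q)"
    by (intro exI[of _ "\<lambda>p q. v $ l * coeff (ppoly (\<gamma> p) \<tau>) q"]) blast
qed

end

section \<open>Square integrable vector fields\<close>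

definition sqv :: "'a::euclidean_space set \<Rightarrow> ('a \<Rightarrow> 'b::euclidean_space) \<Rightarrow> bool" where
  "sqv S f \<longleftrightarrow> f \<in> borel_measurable borel \<and> sqi S (\<lambda>x. norm (f x))"

lemma sqi_dominated:
  assumes g: "sqi S g" and [measurable]: "f \<in> borel_measurable borel" and le: "\<And>x. x \<in> S \<Longrightarrow> \<bar>f x\<bar> \<le> C * \<bar>g x\<bar>"
  shows "sqi S f"
proof -
  have S[measurable]: "S \<in> sets borel" and [measurable]: "g \<in> borel_measurable borel" and gi: "set_integrable lborel S (\<lambda>x. (g x)\<^sup>2)"
    using g unfolding sqi_def by auto
  have "set_integrable lborel S (\<lambda>x. (f x)\<^sup>2)"
  proof (rule set_integrable_bound[OF set_integrable_mult_right[of "C\<^sup>2", OF gi]])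
    show "set_borel_measurable lborel S (\<lambda>x. (f x)\<^sup>2)" unfolding set_borel_measurable_def by simp
    have "(f x)\<^sup>2 \<le> C\<^sup>2 * (g x)\<^sup>2" if "x \<in> S" for x
      using power_mono[OF le[OF that], of 2] by (simp add: power_mult_distrib)
    then show "AE x in lborel. x \<in> S \<longrightarrow> norm ((f x)\<^sup>2) \<le> norm (C\<^sup>2 * (g x)\<^sup>2)" by simp
  qed
  then show ?thesis unfolding sqi_def by simp
qed

lemma sqi_integrable:
  assumes f: "f \<in> borel_measurable borel" and i: "integrable lborel (\<lambda>x. (f x)\<^sup>2)" and S: "S \<in> sets borel"
  shows "sqi S f"
proof -
  have "S \<in> sets lborel" using S by simp
  from integrable_mult_indicator[OF this i] show ?thesis unfolding sqi_def set_integrable_def using f S by blast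
qed

lemma sqi_extend:
  assumes f: "sqi S f" and z: "\<And>x. x \<notin> S \<Longrightarrow> f x = 0" and S': "S' \<in> sets borel" "S \<subseteq> S'"
  shows "sqi S' f"
proof -
  have "(\<lambda>x. indicat_real S' x *\<^sub>R (f x)\<^sup>2) = (\<lambda>x. indicat_real S x *\<^sub>R (f x)\<^sup>2)"
  proof
    fix x show "indicat_real S' x *\<^sub>R (f x)\<^sup>2 = indicat_real S x *\<^sub>R (f x)\<^sup>2"
      using z[of x] S'(2) by (cases "x \<in> S") (auto simp: indicator_def)
  qed
  then show ?thesis using f S' unfolding sqi_def set_integrable_def by simp
qed

lemma sqv_meas[measurable_dest]: "sqv S f \<Longrightarrow> f \<in> borel_measurable borel"
  unfolding sqv_def by simp

lemma sqv_norm: "sqv S f \<Longrightarrow> sqi S (\<lambda>x. norm (f x))"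
  unfolding sqv_def by simp

lemma sqvI: "f \<in> borel_measurable borel \<Longrightarrow> sqi S g \<Longrightarrow> (\<And>x. x \<in> S \<Longrightarrow> norm (f x) \<le> C * \<bar>g x\<bar>) \<Longrightarrow> sqv S f"
  unfolding sqv_def by (auto intro!: sqi_dominated[of S g _ C])

lemma sqv_add: "sqv S f \<Longrightarrow> sqv S g \<Longrightarrow> sqv S (\<lambda>x. f x + g x)"
proof (rule sqvI[of _ S "\<lambda>x. norm (f x) + norm (g x)" 1])
  assume f: "sqv S f" and g: "sqv S g"
  show "(\<lambda>x. f x + g x) \<in> borel_measurable borel" by (rule borel_measurable_add[OF sqv_meas[OF f] sqv_meas[OF g]])
  show "sqi S (\<lambda>x. norm (f x) + norm (g x))" by (rule sqi_add[OF sqv_norm[OF f] sqv_norm[OF g]])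
  show "norm (f x + g x) \<le> 1 * \<bar>norm (f x) + norm (g x)\<bar>" for x using norm_triangle_ineq[of "f x" "g x"] by simp
qed

lemma sqv_linear:
  assumes L: "bounded_linear L" and f: "sqv S f" shows "sqv S (\<lambda>x. L (f x))"
proof -
  obtain K where K: "\<And>y. norm (L y) \<le> norm y * K" using bounded_linear.bounded[OF L] by blast
  have [measurable]: "f \<in> borel_measurable borel" "L \<in> borel_measurable borel"
    using f L linear_continuous_on[of L UNIV] by (auto intro: sqv_meas borel_measurable_continuous_onI)
  show ?thesis by (rule sqvI[OF _ sqv_norm[OF f], of _ K]) (use K in \<open>simp_all add: mult.commute\<close>)
qed

lemma sqv_diff: "sqv S f \<Longrightarrow> sqv S g \<Longrightarrow> sqv S (\<lambda>x. f x - g x)"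
  using sqv_add[of S f "\<lambda>x. - g x"] sqv_linear[of uminus S g] by (simp add: bounded_linear_minus bounded_linear_ident)

lemma sqv_matrix: "sqv S f \<Longrightarrow> sqv S (\<lambda>x. (A :: real^'n^'m) *v f x)"
  by (rule sqv_linear[OF matrix_vector_mul_bounded_linear])

lemma sqv_inner: "sqv S f \<Longrightarrow> sqi S (\<lambda>x. f x \<bullet> u)"
proof (rule sqi_dominated[OF sqv_norm, of S f _ "norm u"])
  assume f: "sqv S f"
  have [measurable]: "f \<in> borel_measurable borel" using f by (rule sqv_meas)
  show "(\<lambda>x. f x \<bullet> u) \<in> borel_measurable borel" by measurable
  show "\<bar>f x \<bullet> u\<bar> \<le> norm u * \<bar>norm (f x)\<bar>" for x
    using Cauchy_Schwarz_ineq2[of "f x" u] by (simp add: mult.commute)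
qed

lemma sqv_subset: "sqv S f \<Longrightarrow> S' \<subseteq> S \<Longrightarrow> S' \<in> sets borel \<Longrightarrow> sqv S' f"
  unfolding sqv_def by (auto intro: sqi_subset)

lemma nrm_inner_le: "sqv S f \<Longrightarrow> nrm S (\<lambda>x. f x \<bullet> u) \<le> norm u * nrm S (\<lambda>x. norm (f x))"
proof (rule nrm_mono2)
  assume f: "sqv S f"
  show "sqi S (\<lambda>x. f x \<bullet> u)" "sqi S (\<lambda>x. norm (f x))" using f by (rule sqv_inner, rule sqv_norm)
  show "\<bar>f x \<bullet> u\<bar> \<le> norm u * \<bar>norm (f x)\<bar>" for x
    using Cauchy_Schwarz_ineq2[of "f x" u] by (simp add: mult.commute)
qed simp

lemma sqv_vec:
  fixes f :: "'a::euclidean_space \<Rightarrow> real^'n"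
  assumes "\<And>j. sqi S (\<lambda>x. f x $ j)" shows "sqv S f"
proof (rule sqvI[of _ S "\<lambda>x. \<Sum>j\<in>UNIV. \<bar>f x $ j\<bar>" 1])
  have m: "(\<lambda>x. f x $ j) \<in> borel_measurable borel" for j using assms by (rule sqi_meas)
  have "(\<lambda>x. \<Sum>j\<in>UNIV. (f x $ j) *\<^sub>R (axis j 1 :: real^'n)) \<in> borel_measurable borel"
    using m by (intro borel_measurable_sum borel_measurable_scaleR borel_measurable_const) auto
  moreover have "(\<Sum>j\<in>UNIV. (f x $ j) *\<^sub>R (axis j 1 :: real^'n)) = f x" for x
    using basis_expansion[of "f x"] by (simp add: scalar_mult_eq_scaleR)
  ultimately show "f \<in> borel_measurable borel" by simp
  have a: "sqi S (\<lambda>x. \<bar>f x $ j\<bar>)" for j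
    by (rule sqi_dominated[OF assms[of j], of _ 1]) (use m[of j] in auto)
  have "sqi S (\<lambda>x. \<Sum>j\<in>J. \<bar>f x $ j\<bar>)" if "finite J" for J using that
  proof (induction J)
    case empty show ?case by (rule sqi_dominated[OF assms, of _ 0]) auto
  next
    case (insert j J) then show ?case using sqi_add[OF a[of j]] by simp
  qed
  then show "sqi S (\<lambda>x. \<Sum>j\<in>UNIV. \<bar>f x $ j\<bar>)" by simp
  show "norm (f x) \<le> 1 * \<bar>\<Sum>j\<in>UNIV. \<bar>f x $ j\<bar>\<bar>" for x
    using norm_le_l1_cart[of "f x"] by (simp add: abs_of_nonneg sum_nonneg)
qed

lemma L2_on_sqv:
  assumes f: "L2_on S f" and S: "S \<in> sets borel" shows "sqv S (\<lambda>x. indicat_real S x *\<^sub>R f x)"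
proof -
  have "(\<lambda>x. indicat_real S x *\<^sub>R f x) \<in> borel_measurable borel"
    using f unfolding L2_on_def set_borel_measurable_def by simp
  moreover from this have "(\<lambda>x. norm (indicat_real S x *\<^sub>R f x)) \<in> borel_measurable borel" by measurable
  moreover have "(\<lambda>x. indicat_real S x *\<^sub>R (norm (indicat_real S x *\<^sub>R f x))\<^sup>2) = (\<lambda>x. indicat_real S x *\<^sub>R (norm (f x))\<^sup>2)"
    by (auto simp: indicator_def)
  ultimately show ?thesis using f S unfolding sqv_def sqi_def L2_on_def set_integrable_def by (simp only: conj_assoc)
qed

lemma LINT_lebesgue_Borel2:
  fixes f g :: "'a::euclidean_space \<Rightarrow> 'b::euclidean_space"
  assumes [measurable]: "S \<in> sets borel" "S' \<in> sets borel" "g \<in> borel_measurable borel"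
    and ae: "AE x in lborel. x \<in> S \<longrightarrow> f x = g x" "AE x in lborel. x \<in> S \<longleftrightarrow> x \<in> S'"
  shows "(LINT x:S|lebesgue. f x) = (LINT x:S'|lborel. g x)"
proof -
  have "(LINT x:S|lebesgue. f x) = (LINT x:S|lborel. g x)" by (rule LINT_lebesgue_Borel) (use ae(1) in simp_all)
  also have "\<dots> = (LINT x:S'|lborel. g x)" unfolding set_lebesgue_integral_def
    by (rule integral_cong_AE) (use ae(2) in \<open>auto simp: indicator_def elim: eventually_mono\<close>)
  finally show ?thesis .
qed

lemma AE_Ioo_Icc: "AE x in lborel. x \<in> {a<..<b} \<longleftrightarrow> x \<in> {a..b :: real}"
proof -
  have "AE x in lborel. x \<notin> {a, b}" by (intro AE_not_in finite_imp_null_set_lborel) simp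
  then show ?thesis by eventually_elim auto
qed

lemma L2_inner_interval:
  fixes f1 f2 g1 g2 :: "real \<Rightarrow> 'b::euclidean_space"
  assumes [measurable]: "g1 \<in> borel_measurable borel" "g2 \<in> borel_measurable borel"
    and ae: "AE x in lborel. x \<in> {a<..<b} \<longrightarrow> f1 x = g1 x" "AE x in lborel. x \<in> {a<..<b} \<longrightarrow> f2 x = g2 x"
  shows "L2_inner {a<..<b} f1 f2 = (LINT x:{a..b}|lborel. g1 x \<bullet> g2 x)"
  unfolding L2_inner_def
proof (rule LINT_lebesgue_Borel2[OF _ _ _ _ AE_Ioo_Icc])
  show "AE x in lborel. x \<in> {a<..<b} \<longrightarrow> f1 x \<bullet> f2 x = g1 x \<bullet> g2 x" using ae by eventually_elim simp
qed auto

lemma L2_inner_cylinder: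
  fixes f1 f2 g1 g2 :: "real \<times> real \<Rightarrow> 'b::euclidean_space"
  assumes [measurable]: "A \<in> sets borel" "g1 \<in> borel_measurable borel" "g2 \<in> borel_measurable borel"
    and ae: "AE z in lborel. z \<in> A \<times> {a<..<b} \<longrightarrow> f1 z = g1 z" "AE z in lborel. z \<in> A \<times> {a<..<b} \<longrightarrow> f2 z = g2 z"
  shows "L2_inner (A \<times> {a<..<b}) f1 f2 = (LINT z:A \<times> {a..b}|lborel. g1 z \<bullet> g2 z)"
  unfolding L2_inner_def
proof (rule LINT_lebesgue_Borel2)
  show "AE x in lborel. x \<in> A \<times> {a<..<b} \<longrightarrow> f1 x \<bullet> f2 x = g1 x \<bullet> g2 x" using ae by eventually_elim simp
  show "AE z in lborel. z \<in> A \<times> {a<..<b} \<longleftrightarrow> z \<in> A \<times> {a..b}"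
    using AE_snd[OF AE_Ioo_Icc[of a b]] by eventually_elim (simp add: mem_Times_iff)
qed (auto intro!: borel_Times)

section \<open>The sources and the exact fields\<close>

text \<open>Cauchy-Schwarz in the velocity, on a domain of finite measure, and Fubini's theorem.\<close>

lemma velocity_moment_sqi:
  fixes F :: "real \<times> real \<Rightarrow> real^2 \<Rightarrow> real"
  assumes L2: "L2_on (Q \<times> V) (\<lambda>(z, v). F z v)" and Q: "Q \<in> sets borel" and V: "open V" "bounded V"
    and \<omega>[measurable]: "\<omega> \<in> borel_measurable borel" and \<omega>1: "\<And>v. \<bar>\<omega> v\<bar> \<le> 1"
    and zero: "\<And>z v. z \<in> Q \<Longrightarrow> v \<notin> V \<Longrightarrow> F z v = 0"
  shows "sqi Q (\<lambda>z. indicat_real Q z * (LINT v|lborel. \<omega> v * F z v))"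
proof -
  define G where "G p = indicat_real (Q \<times> V) p * (case p of (z, v) \<Rightarrow> F z v)" for p
  define \<mu> where "\<mu> z = (LINT v|lborel. \<omega> v * G (z, v))" for z
  have Vb: "V \<in> sets borel" using V(1) by simp
  have G[measurable]: "G \<in> borel_measurable (lborel \<Otimes>\<^sub>M lborel)"
    using L2 unfolding L2_on_def set_borel_measurable_def G_def lborel_prod by simp
  have int: "integrable (lborel \<Otimes>\<^sub>M lborel) (\<lambda>p. (G p)\<^sup>2)"
  proof -
    have "(\<lambda>p. indicat_real (Q \<times> V) p *\<^sub>R (norm (case p of (z, v) \<Rightarrow> F z v))\<^sup>2) = (\<lambda>p. (G p)\<^sup>2)"
      by (auto simp: G_def indicator_def)
    then show ?thesis using L2 unfolding L2_on_def set_integrable_def lborel_prod by simp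
  qed
  have eq: "indicat_real Q z * (LINT v|lborel. \<omega> v * F z v) = \<mu> z" for z
  proof (cases "z \<in> Q")
    case True
    have "F z v = G (z, v)" for v using zero[OF True, of v] True by (auto simp: G_def indicator_def)
    then show ?thesis using True unfolding \<mu>_def by simp
  next
    case False then have "G (z, v) = 0" for v by (simp add: G_def)
    then show ?thesis using False unfolding \<mu>_def by simp
  qed
  have m: "\<mu> \<in> borel_measurable borel"
  proof -
    have "(\<lambda>z. LINT v|lborel. \<omega> v * G (z, v)) \<in> borel_measurable lborel"
      by (intro lborel.borel_measurable_lebesgue_integral) measurable
    then show ?thesis unfolding \<mu>_def by simp
  qed
  have i2: "integrable lborel (\<lambda>z. LINT v|lborel. (G (z, v))\<^sup>2)" by (rule lborel_pair.integrable_fst'[OF int])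
  define D where "D = (nrm V \<omega>)\<^sup>2"
  have "AE z in lborel. (\<mu> z)\<^sup>2 \<le> D * (LINT v|lborel. (G (z, v))\<^sup>2)"
    using lborel_pair.AE_integrable_fst'[OF int]
  proof eventually_elim
    fix z assume iz: "integrable lborel (\<lambda>v. (G (z, v))\<^sup>2)"
    have Gz: "G (z, v) = indicat_real V v * G (z, v)" for v by (auto simp: G_def indicator_def)
    have [measurable]: "(\<lambda>v. G (z, v)) \<in> borel_measurable borel"
      using measurable_compose[OF measurable_Pair1', of z lborel G lborel borel] G by simp
    have s: "sqi V (\<lambda>v. G (z, v))" by (rule sqi_integrable[OF _ iz Vb]) measurable
    have w: "sqi V \<omega>" by (intro bfun_sqi bfunI[where C = 1] Vb V(2) \<omega> \<omega>1)
    have "(LINT v:V|lborel. \<omega> v * G (z, v)) = \<mu> z" unfolding \<mu>_def set_lebesgue_integral_def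
      by (intro Bochner_Integration.integral_cong refl) (subst (2) Gz, simp)
    moreover have "(nrm V (\<lambda>v. G (z, v)))\<^sup>2 = (LINT v|lborel. (G (z, v))\<^sup>2)" unfolding nrm_sq set_lebesgue_integral_def
      by (intro Bochner_Integration.integral_cong refl) (auto simp: G_def indicator_def)
    moreover have "(LINT v:V|lborel. \<omega> v * G (z, v))\<^sup>2 \<le> (nrm V \<omega> * nrm V (\<lambda>v. G (z, v)))\<^sup>2"
      using power_mono[OF sqi_cs[OF w s], of 2] by simp
    ultimately show "(\<mu> z)\<^sup>2 \<le> D * (LINT v|lborel. (G (z, v))\<^sup>2)"
      by (simp add: D_def power_mult_distrib)
  qed
  then have "integrable lborel (\<lambda>z. (\<mu> z)\<^sup>2)"
    by (intro Bochner_Integration.integrable_bound[OF integrable_mult_right[OF i2, of D]]) (use m in \<open>auto elim: eventually_mono\<close>)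
  from sqi_integrable[OF m this Q] have "sqi Q \<mu>" .
  then show ?thesis unfolding eq .
qed

lemma vector_4:
  "(vector [a, b, c, d] :: 'a::zero^4) $ 1 = a" "(vector [a, b, c, d] :: 'a::zero^4) $ 2 = b"
  "(vector [a, b, c, d] :: 'a::zero^4) $ 3 = c" "(vector [a, b, c, d] :: 'a::zero^4) $ 4 = d"
  unfolding vector_def by simp_all

lemma vhat_bound: "\<bar>vhat v $ j\<bar> \<le> 1"
proof -
  have "\<bar>vhat v $ j\<bar> \<le> norm (vhat v)" by (rule component_le_norm_cart)
  also have "norm (vhat v) = norm v / sqrt (1 + (norm v)\<^sup>2)" unfolding vhat_def
    by (simp add: divide_inverse mult.commute)
  also have "\<dots> \<le> 1"
  proof -
    have "norm v \<le> sqrt (1 + (norm v)\<^sup>2)" by (rule real_le_rsqrt) simp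
    then show ?thesis by (simp add: divide_le_eq_1 add_pos_nonneg)
  qed
  finally show ?thesis .
qed

lemma vhat_measurable: "(\<lambda>v. vhat v $ j) \<in> borel_measurable borel"
proof (rule borel_measurable_continuous_onI)
  have "sqrt (1 + (norm v)\<^sup>2) \<noteq> 0" for v :: "real^2" by (smt (verit) real_sqrt_eq_zero_cancel_iff zero_le_power2)
  then show "continuous_on UNIV (\<lambda>v. vhat v $ j)" unfolding vhat_def by (intro continuous_intros) auto
qed

lemma maxwell_rhs_sqv:
  fixes F :: "real \<times> real \<Rightarrow> real^2 \<Rightarrow> real"
  assumes F: "admissible_density T {al<..<be} Kx V F" and V: "bounded_domain V" and Kx: "Kx \<subseteq> {al<..<be}"
    and rb: "continuous_on UNIV \<rho>b" "\<And>x. x \<notin> Kx \<Longrightarrow> \<rho>b x = 0"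
  defines "Q \<equiv> {0..T} \<times> {al<..<be}"
  shows "sqv ({0..T} \<times> {al..be}) (\<lambda>z. indicat_real Q z *\<^sub>R maxwell_rhs \<rho>b F z)"
    and "x \<notin> Kx \<Longrightarrow> indicat_real Q (t, x) *\<^sub>R maxwell_rhs \<rho>b F (t, x) = 0"
proof -
  have V': "open V" "bounded V" using V unfolding bounded_domain_def by auto
  have Q: "Q \<in> sets borel" "bounded Q" unfolding Q_def
    by (auto intro!: borel_Times bounded_Times bounded_Ioo)
  have L2: "L2_on (Q \<times> V) (\<lambda>(z, v). F z v)" using F unfolding admissible_density_def Q_def by blast
  have zv: "F z v = 0" if "z \<in> Q" "v \<notin> V" for z v
  proof -
    obtain Kv where "Kv \<subseteq> V" "\<forall>t\<in>{0..T}. \<forall>x v. v \<notin> Kv \<longrightarrow> F (t, x) v = 0"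
      using F unfolding admissible_density_def by blast
    then show ?thesis using that unfolding Q_def by (cases z) blast
  qed
  have zx: "F (t, x) v = 0" if "t \<in> {0..T}" "x \<notin> Kx" for t x v
    using F that unfolding admissible_density_def by blast
  have m0: "sqi Q (\<lambda>z. indicat_real Q z * (LINT v|lborel. F z v))"
    using velocity_moment_sqi[OF L2 Q(1) V', of "\<lambda>v. 1"] zv by simp
  have mj: "sqi Q (\<lambda>z. indicat_real Q z * (LINT v|lborel. vhat v $ j * F z v))" for j
    by (rule velocity_moment_sqi[OF L2 Q(1) V' vhat_measurable vhat_bound zv])
  have mr: "sqi Q (\<lambda>z. indicat_real Q z * \<rho>b (snd z))"
  proof (rule sqi_dominated[of Q "\<lambda>z. \<rho>b (snd z)" _ 1])
    have c: "continuous_on UNIV (\<lambda>z::real\<times>real. \<rho>b (snd z))"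
      by (intro continuous_on_compose2[OF rb(1)] continuous_intros) auto
    show "sqi Q (\<lambda>z. \<rho>b (snd z))" by (intro bfun_sqi bfun_continuous c Q)
    show "(\<lambda>z. indicat_real Q z * \<rho>b (snd z)) \<in> borel_measurable borel"
      using borel_measurable_continuous_onI[OF c] Q(1) by simp
  qed (auto simp: indicator_def)
  have "sqi ({0..T} \<times> {al..be}) (\<lambda>z. (indicat_real Q z *\<^sub>R maxwell_rhs \<rho>b F z) $ j)" for j
  proof (rule sqi_extend[of Q])
    have "\<forall>j. sqi Q (\<lambda>z. (indicat_real Q z *\<^sub>R maxwell_rhs \<rho>b F z) $ j)"
      unfolding forall_4 maxwell_rhs_def vector_scaleR_component vector_4
      using sqi_diff[OF m0 mr] sqi_uminus[OF mj[of 1]] sqi_uminus[OF mj[of 2]] sqi_cmult[OF m0, of 0]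
      by (simp add: right_diff_distrib)
    then show "sqi Q (\<lambda>z. (indicat_real Q z *\<^sub>R maxwell_rhs \<rho>b F z) $ j)" by blast
  qed (auto simp: Q_def intro!: borel_Times)
  then show "sqv ({0..T} \<times> {al..be}) (\<lambda>z. indicat_real Q z *\<^sub>R maxwell_rhs \<rho>b F z)" by (rule sqv_vec)
  show "indicat_real Q (t, x) *\<^sub>R maxwell_rhs \<rho>b F (t, x) = 0" if x: "x \<notin> Kx"
  proof (cases "(t, x) \<in> Q")
    case True
    then have "F (t, x) = (\<lambda>v. 0)" using zx x unfolding Q_def by auto
    then show ?thesis using rb(2)[OF x] unfolding maxwell_rhs_def by (simp add: vec_eq_iff forall_4 vector_4)
  qed simp
qed

text \<open>The change of the integral in time is split into that of \<open>V\<close>, which is small in \<open>L\<^sub>2\<close>, and that of \<open>u\<close>.\<close>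

lemma sqi_inner_continuous:
  fixes V :: "real \<times> real \<Rightarrow> 'b::euclidean_space"
  assumes sq: "\<And>t. t \<in> {0..T} \<Longrightarrow> sqv {al..be} (\<lambda>x. V (t, x))"
    and con: "\<And>s. s \<in> {0..T} \<Longrightarrow> ((\<lambda>t. nrm {al..be} (\<lambda>x. norm (V (t, x) - V (s, x)))) \<longlongrightarrow> 0) (at s within {0..T})"
    and u: "continuous_on UNIV (u :: real \<times> real \<Rightarrow> real)"
  shows "continuous_on {0..T} (\<lambda>t. LINT x:{al..be}|lborel. (V (t, x) \<bullet> d) * u (t, x))"
  unfolding continuous_on_def
proof
  fix s assume s: "s \<in> {0..T}"
  let ?X = "{al..be}"
  let ?F = "at s within {0..T}"
  have cu: "continuous_on S (\<lambda>x. u (t, x))" for t S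
    by (intro continuous_on_compose2[OF u] continuous_intros) auto
  have bu: "bfun ?X (\<lambda>x. u (t, x))" for t by (intro bfun_continuous cu bounded_closed_interval)
  have su: "sqi ?X (\<lambda>x. u (t, x))" "sqi ?X (\<lambda>x. u (t, x) - u (s, x))" for t
    by (intro bfun_sqi bfun_diff bu; simp)+
  have cn: "((\<lambda>t. nrm ?X (\<lambda>x. u (t, x) - f x)) \<longlongrightarrow> nrm ?X (\<lambda>x. u (s, x) - f x)) ?F"
    if f: "continuous_on UNIV f" for f
  proof -
    have c2: "continuous_on S (\<lambda>(t, x). (u (t, x) - f x)\<^sup>2)" for S
      unfolding case_prod_beta by (intro continuous_intros continuous_on_compose2[OF u] continuous_on_compose2[OF f]) auto
    have "continuous_on UNIV (\<lambda>t. integral (cbox al be) (\<lambda>x. (u (t, x) - f x)\<^sup>2))"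
      by (rule integral_continuous_on_param[OF c2])
    moreover have "(nrm ?X (\<lambda>x. u (t, x) - f x)) = sqrt (integral (cbox al be) (\<lambda>x. (u (t, x) - f x)\<^sup>2))" for t
      unfolding nrm_def using f cu by (subst LINT_continuous(1)) (auto intro!: continuous_intros)
    ultimately have "continuous_on UNIV (\<lambda>t. nrm ?X (\<lambda>x. u (t, x) - f x))"
      by (simp add: continuous_on_real_sqrt)
    then have "continuous (at s) (\<lambda>t. nrm ?X (\<lambda>x. u (t, x) - f x))" by (simp add: continuous_on_eq_continuous_at)
    then have "((\<lambda>t. nrm ?X (\<lambda>x. u (t, x) - f x)) \<longlongrightarrow> nrm ?X (\<lambda>x. u (s, x) - f x)) (at s)"
      by (simp add: continuous_at)
    then show ?thesis by (rule filterlim_mono[OF _ order_refl at_le]) simp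
  qed
  define B where "B t = norm d * nrm ?X (\<lambda>x. norm (V (t, x) - V (s, x))) * nrm ?X (\<lambda>x. u (t, x)) +
     nrm ?X (\<lambda>x. V (s, x) \<bullet> d) * nrm ?X (\<lambda>x. u (t, x) - u (s, x))" for t
  have "(B \<longlongrightarrow> norm d * 0 * nrm ?X (\<lambda>x. u (s, x) - 0) + nrm ?X (\<lambda>x. V (s, x) \<bullet> d) * nrm ?X (\<lambda>x. u (s, x) - u (s, x))) ?F"
    unfolding B_def by (intro tendsto_intros con s cn cu cn[of "\<lambda>x. 0", unfolded diff_0_right])
       (use cn[of "\<lambda>x. 0"] in \<open>simp add: continuous_on_const\<close>)
  then have B0: "(B \<longlongrightarrow> 0) ?F" by (simp add: nrm_def)
  have bd: "norm ((LINT x:?X|lborel. (V (t, x) \<bullet> d) * u (t, x)) - (LINT x:?X|lborel. (V (s, x) \<bullet> d) * u (s, x))) \<le> B t"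
    if t: "t \<in> {0..T}" for t
  proof -
    note vt = sq[OF t] and vs = sq[OF s] and vd = sqv_diff[OF sq[OF t] sq[OF s]]
    have "(LINT x:?X|lborel. (V (t, x) \<bullet> d) * u (t, x)) - (LINT x:?X|lborel. (V (s, x) \<bullet> d) * u (s, x))
      = (LINT x:?X|lborel. (V (t, x) \<bullet> d) * u (t, x) - (V (s, x) \<bullet> d) * u (s, x))"
      by (intro set_integral_diff(2)[symmetric] sqi_mult_integrable sqv_inner vt vs su)
    also have "\<dots> = (LINT x:?X|lborel. ((V (t, x) - V (s, x)) \<bullet> d) * u (t, x) + (V (s, x) \<bullet> d) * (u (t, x) - u (s, x)))"
      by (simp add: inner_diff_left algebra_simps)
    also have "\<dots> = (LINT x:?X|lborel. ((V (t, x) - V (s, x)) \<bullet> d) * u (t, x)) + (LINT x:?X|lborel. (V (s, x) \<bullet> d) * (u (t, x) - u (s, x)))"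
      by (intro set_integral_add(2) sqi_mult_integrable sqv_inner vd vs su)
    finally have e: "norm ((LINT x:?X|lborel. (V (t, x) \<bullet> d) * u (t, x)) - (LINT x:?X|lborel. (V (s, x) \<bullet> d) * u (s, x)))
      \<le> \<bar>LINT x:?X|lborel. ((V (t, x) - V (s, x)) \<bullet> d) * u (t, x)\<bar> + \<bar>LINT x:?X|lborel. (V (s, x) \<bullet> d) * (u (t, x) - u (s, x))\<bar>"
      by simp
    have "\<bar>LINT x:?X|lborel. ((V (t, x) - V (s, x)) \<bullet> d) * u (t, x)\<bar>
      \<le> nrm ?X (\<lambda>x. (V (t, x) - V (s, x)) \<bullet> d) * nrm ?X (\<lambda>x. u (t, x))" by (rule sqi_cs[OF sqv_inner[OF vd] su(1)])
    also have "\<dots> \<le> norm d * nrm ?X (\<lambda>x. norm (V (t, x) - V (s, x))) * nrm ?X (\<lambda>x. u (t, x))"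
      by (intro mult_right_mono nrm_inner_le vd) simp
    finally show ?thesis using e sqi_cs[OF sqv_inner[OF vs, of d] su(2)[of t]] unfolding B_def by linarith
  qed
  show "((\<lambda>t. LINT x:?X|lborel. (V (t, x) \<bullet> d) * u (t, x)) \<longlongrightarrow> (LINT x:?X|lborel. (V (s, x) \<bullet> d) * u (s, x))) ?F"
    by (rule LIM_zero_cancel, rule Lim_null_comparison[OF _ B0])
      (use bd in \<open>auto simp: eventually_at_filter\<close>)
qed

section \<open>Characteristic directions\<close>

text \<open>The components \<open>E\<^sub>2 \<plusminus> B\<close> travel with speed \<open>\<plusminus>1\<close>. For \<open>E\<^sub>1\<close> the test vector \<open>hat4 v\<close> adds the equations for
  \<open>\<partial>\<^sub>x E\<^sub>1\<close> and \<open>\<partial>\<^sub>t E\<^sub>1\<close>, and this sum is a transport equation with speed 1.\<close>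

definition direction :: "real \<Rightarrow> real^3 \<Rightarrow> bool" where
  "direction s v \<longleftrightarrow> (s, v) \<in> {(1, vector [1, 0, 0]), (1, vector [0, 1, 1]), (-1, vector [0, 1, -1])}"

lemmas matrix_simps = M1_def M2_def hat4_def matrix_vector_mult_def inner_vec_def sum_4 sum_3 vector_4

lemma M1_hat4: "(M1 *v w) \<bullet> hat4 v = w \<bullet> v"
  by (simp add: matrix_simps)

lemma M2_hat4: "direction s v \<Longrightarrow> (M2 *v w) \<bullet> hat4 v = s * (w \<bullet> v)"
  unfolding direction_def by (auto simp: matrix_simps)

lemma direction_norms:
  assumes "direction s v"
  shows "norm (hat4 v) \<le> sqrt 2" "norm (M1 *v v) \<le> sqrt 2" "norm (M2 *v v) \<le> sqrt 2" "norm v \<le> sqrt 2"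
  using assms unfolding direction_def norm_eq_sqrt_inner by (auto simp: matrix_simps)

text \<open>The three directions are orthogonal, with squared lengths 1, 2 and 2.\<close>

lemma direction_split:
  fixes u f :: "real^3"
  shows "u \<bullet> f = (u \<bullet> vector [1, 0, 0]) * (f \<bullet> vector [1, 0, 0]) + (u \<bullet> vector [0, 1, 1]) * (f \<bullet> vector [0, 1, 1]) / 2
    + (u \<bullet> vector [0, 1, -1]) * (f \<bullet> vector [0, 1, -1]) / 2"
  by (simp add: matrix_simps) (simp add: field_simps)

lemma hat4_scaleR: "hat4 (a *\<^sub>R v) = a *\<^sub>R hat4 v"
  by (simp add: hat4_def vec_eq_iff forall_4 vector_4)

lemma vec3_sum: "(\<chi> l. a l) = (\<Sum>l\<in>UNIV. a l *\<^sub>R (axis l 1 :: real^3))" for a :: "3 \<Rightarrow> real"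
  by (simp add: vec_eq_iff forall_3 sum_3 axis_def)

section \<open>Functions on slabs\<close>

lemma slab_sum:
  fixes f :: "nat \<Rightarrow> 'b::real_vector"
  assumes h: "h > 0" and m: "m \<in> {1..M}" and s: "s \<in> {real (m - 1) * h<..real m * h}"
  shows "(\<Sum>n=1..M. indicat_real {real (n - 1) * h<..real n * h} s *\<^sub>R f n) = f m"
proof -
  have "indicat_real {real (n - 1) * h<..real n * h} s *\<^sub>R f n = (if n = m then f n else 0)" if "n \<in> {1..M}" for n
  proof (cases "n = m")
    case False
    from disjoint_family_onD[OF slab_disjoint[OF h, of "UNIV::unit set" M] that m False]
    have "s \<notin> {real (n - 1) * h<..real n * h}" using s by blast
    then show ?thesis using False by simp
  qed (use s in simp)
  then have "(\<Sum>n=1..M. indicat_real {real (n - 1) * h<..real n * h} s *\<^sub>R f n) = (\<Sum>n=1..M. if n = m then f n else 0)"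
    by (intro sum.cong refl)
  also have "\<dots> = f m" using m by simp
  finally show ?thesis .
qed

lemma sqi_snd_cylinder:
  fixes g :: "real \<Rightarrow> real" and A :: "real set"
  assumes g: "sqi X g" and A: "A \<in> sets borel" "bounded A"
  shows "sqi (A \<times> X) (\<lambda>z. g (snd z))"
proof -
  have X[measurable]: "X \<in> sets borel" and [measurable]: "g \<in> borel_measurable borel" "A \<in> sets borel"
    and gi: "integrable lborel (\<lambda>x. indicat_real X x *\<^sub>R (g x)\<^sup>2)"
    using g A unfolding sqi_def set_integrable_def by auto
  have Ai: "integrable lborel (indicat_real A)"
    using A by (intro integrable_real_indicator) (use emeasure_bounded_finite[of A] in simp_all)
  have "integrable (lborel \<Otimes>\<^sub>M lborel) (\<lambda>z. indicat_real A (fst z) * (indicat_real X (snd z) *\<^sub>R (g (snd z))\<^sup>2))"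
  proof (rule lborel_pair.Fubini_integrable)
    show "(\<lambda>z. indicat_real A (fst z) * (indicat_real X (snd z) *\<^sub>R (g (snd z))\<^sup>2)) \<in> borel_measurable (lborel \<Otimes>\<^sub>M lborel)"
      by measurable
    have "(\<lambda>s. LINT x|lborel. norm (indicat_real A (fst (s, x)) * (indicat_real X (snd (s, x)) *\<^sub>R (g (snd (s, x)))\<^sup>2))) =
      (\<lambda>s. indicat_real A s * (LINT x|lborel. indicat_real X x *\<^sub>R (g x)\<^sup>2))"
      by (simp add: abs_mult)
    then show "integrable lborel (\<lambda>s. LINT x|lborel. norm (indicat_real A (fst (s, x)) * (indicat_real X (snd (s, x)) *\<^sub>R (g (snd (s, x)))\<^sup>2)))"
      using Ai by simp
    show "AE s in lborel. integrable lborel (\<lambda>x. indicat_real A (fst (s, x)) * (indicat_real X (snd (s, x)) *\<^sub>R (g (snd (s, x)))\<^sup>2))"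
      using gi by simp
  qed
  moreover have "(\<lambda>z. indicat_real A (fst z) * (indicat_real X (snd z) *\<^sub>R (g (snd z))\<^sup>2)) = (\<lambda>z. indicat_real (A \<times> X) z *\<^sub>R (g (snd z))\<^sup>2)"
    by (auto simp: indicator_def)
  ultimately have "set_integrable lborel (A \<times> X) (\<lambda>z. (g (snd z))\<^sup>2)" unfolding set_integrable_def lborel_prod by simp
  moreover have "(\<lambda>z::real \<times> real. g (snd z)) \<in> borel_measurable borel"
    unfolding borel_prod[symmetric] by measurable
  moreover have "A \<times> X \<in> sets borel" by (intro borel_Times) auto
  ultimately show ?thesis unfolding sqi_def by simp
qed

lemma nrm_snd_cylinder:
  fixes g :: "real \<Rightarrow> real"
  assumes g: "sqi X g" and ab: "a \<le> b"
  shows "(nrm ({a<..b} \<times> X) (\<lambda>z. g (snd z)))\<^sup>2 = (b - a) * (nrm X g)\<^sup>2"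
proof -
  have "bounded {a<..b}" by (auto intro: bounded_subset[OF bounded_closed_interval])
  from sqi_snd_cylinder[OF g _ this] have "set_integrable lborel ({a<..b} \<times> X) (\<lambda>z. (g (snd z))\<^sup>2)" unfolding sqi_def by simp
  from set_fubini_tx[OF this] have "(nrm ({a<..b} \<times> X) (\<lambda>z. g (snd z)))\<^sup>2 = (LINT t:{a<..b}|lborel. (nrm X g)\<^sup>2)"
    unfolding nrm_sq by simp
  also have "\<dots> = (b - a) * (nrm X g)\<^sup>2" using ab by (simp add: set_lebesgue_integral_def)
  finally show ?thesis .
qed

lemma sqv_sum:
  assumes "S \<in> sets borel" "\<And>i. i \<in> I \<Longrightarrow> sqv S (f i)" shows "sqv S (\<lambda>x. \<Sum>i\<in>I. f i x)"
  using assms(2)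
proof (induction I rule: infinite_finite_induct)
  case empty show ?case using assms(1) by (auto simp: sqv_def sqi_def set_integrable_def)
next
  case (infinite I) then show ?case using assms(1) by (auto simp: sqv_def sqi_def set_integrable_def)
next
  case (insert i I) then show ?case using sqv_add[of S "f i"] by simp
qed

lemma set_integrable_inner_combination:
  assumes F: "sqv S F" and a: "bfun S a" and b: "bfun S b" and c: "bfun S c" and S: "bounded S"
  shows "set_integrable lborel S (\<lambda>z. F z \<bullet> (a z *\<^sub>R p + d *\<^sub>R (b z *\<^sub>R q + c z *\<^sub>R r)))"
proof -
  have Sb: "S \<in> sets borel" using F unfolding sqv_def sqi_def by simp
  have "set_integrable lborel S (\<lambda>z. a z * (F z \<bullet> p) + d * (b z * (F z \<bullet> q) + c z * (F z \<bullet> r)))"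
    by (intro set_integral_add(1) set_integrable_mult_right impI sqi_mult_integrable bfun_sqi sqv_inner F a b c S Sb)
  then show ?thesis by (simp add: inner_add_right)
qed

lemma test_function_scaleR:
  fixes y :: "'a::euclidean_space \<Rightarrow> real"
  assumes "smooth y" "compact (closure {z. y z \<noteq> 0})" "closure {z. y z \<noteq> 0} \<subseteq> G"
  shows "test_function G (\<lambda>z. y z *\<^sub>R \<eta>)"
proof -
  have sub: "{z. y z *\<^sub>R \<eta> \<noteq> 0} \<subseteq> {z. y z \<noteq> 0}" by auto
  have "bounded {z. y z *\<^sub>R \<eta> \<noteq> 0}" using assms(2) bounded_subset[OF _ sub] by (simp add: compact_closure)
  then show ?thesis unfolding test_function_def
    using assms C_diff_linear[OF bounded_linear_scaleR_left[of \<eta>]] closure_mono[OF sub]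
    by (auto simp: smooth_def compact_closure)
qed

section \<open>The residual estimate for the discretized Maxwell system\<close>

text \<open>The Maxwell problem in terms of representatives: \<open>cf\<close> are the coefficients of the components of the
  discrete fields, \<open>B\<close> and \<open>V\<close> are Borel functions that represent the right-hand side and the exact
  fields on the space-time domain.\<close>

locale fe_maxwell = mesh al be h \<T> k for al be h \<T> k +
  fixes T :: real and M :: nat and cc K1 K2 rho :: real and cf :: "nat \<Rightarrow> 3 \<Rightarrow> nat \<Rightarrow> real \<Rightarrow> real"
    and B b :: "real \<times> real \<Rightarrow> real^4" and V W Wh :: "real \<times> real \<Rightarrow> real^3" and W0 :: "real \<Rightarrow> real^3" and t :: "nat \<Rightarrow> real"
  assumes Mh: "T = real M * h" "T > 0" and cc: "cc > 0"
    and K: "rho > 0" "al + 4 * rho < K1" "K1 \<le> K2" "K2 < be - 4 * rho"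
    and tm: "\<And>m. m \<le> M \<Longrightarrow> t m = real m * h"
    and cf: "\<And>m l. m \<in> {1..M} \<Longrightarrow> \<forall>i\<le>k. pw (cf m l i) \<and> cf m l i al = 0 \<and> cf m l i be = 0"
    and Wh: "\<And>m z l. m \<in> {1..M} \<Longrightarrow> z \<in> {real (m - 1) * h<..real m * h} \<times> {al..be} \<Longrightarrow> Wh z $ l = pf (cf m l) z"
    and B: "sqv ({0..T} \<times> {al..be}) B" "\<And>t x. x \<notin> {K1..K2} \<Longrightarrow> B (t, x) = 0" "\<And>z. z \<in> {0..T} \<times> {al<..<be} \<Longrightarrow> b z = B z"
    and V: "sqv ({0..T} \<times> {al..be}) V" "\<And>t x. x \<notin> {K1..K2} \<Longrightarrow> V (t, x) = 0" "\<And>z. z \<in> {0..T} \<times> {al<..<be} \<Longrightarrow> W z = V z"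
    and Vt: "\<And>t. t \<in> {0..T} \<Longrightarrow> sqv {al..be} (\<lambda>x. V (t, x))"
    and V0: "AE x in lborel. x \<in> {al<..<be} \<longrightarrow> W0 x = V (0, x)"
    and Vc: "\<And>s. s \<in> {0..T} \<Longrightarrow> ((\<lambda>t. nrm {al..be} (\<lambda>x. norm (V (t, x) - V (s, x)))) \<longlongrightarrow> 0) (at s within {0..T})"
    and sol: "sd_solution {al<..<be} M t \<T> k (cc * h) b W0 Wh"
    and weak: "\<And>\<psi>. test_function ({0<..<T} \<times> {al<..<be}) \<psi> \<Longrightarrow>
        - L2_inner ({0..T} \<times> {al<..<be}) (\<lambda>z. M1 *v W z) (dt \<psi>) -
          L2_inner ({0..T} \<times> {al<..<be}) (\<lambda>z. M2 *v W z) (dx \<psi>) = L2_inner ({0..T} \<times> {al<..<be}) b \<psi>"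
begin

definition S :: "nat \<Rightarrow> real set" where "S m = {real (m - 1) * h<..real m * h}"
definition X :: "real set" where "X = {al..be}"
definition Pf :: "nat \<Rightarrow> real \<times> real \<Rightarrow> real^3" where "Pf m z = (\<chi> l. pf (cf m l) z)"
definition Pt :: "nat \<Rightarrow> real \<times> real \<Rightarrow> real^3" where "Pt m z = (\<chi> l. pt (cf m l) z)"
definition Px :: "nat \<Rightarrow> real \<times> real \<Rightarrow> real^3" where "Px m z = (\<chi> l. px (cf m l) z)"
definition Op :: "nat \<Rightarrow> real \<times> real \<Rightarrow> real^4" where "Op m z = M1 *v Pt m z + M2 *v Px m z"
text \<open>\<open>R\<close> represents \<open>residual1\<close>, and \<open>jump m\<close> the jump at the beginning of slab \<open>m\<close>. Both are Borel functions
  that are defined without pointwise derivatives and limits; \<open>cv v\<close> are the coefficients of \<open>Wh \<bullet> v\<close>.\<close>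

definition R :: "real \<times> real \<Rightarrow> real^4" where
  "R z = B z - (\<Sum>m=1..M. indicat_real (S m) (fst z) *\<^sub>R Op m z)"
definition before :: "nat \<Rightarrow> real \<Rightarrow> real^3" where
  "before m x = (if m = 1 then V (0, x) else Pf (m - 1) (real (m - 1) * h, x))"
definition jump :: "nat \<Rightarrow> real \<Rightarrow> real^3" where "jump m x = Pf m (real (m - 1) * h, x) - before m x"
definition cv :: "real^3 \<Rightarrow> nat \<Rightarrow> nat \<Rightarrow> real \<Rightarrow> real" where "cv v m i x = (\<Sum>l\<in>UNIV. v $ l * cf m l i x)"

lemma Xb: "X \<in> sets borel" "bounded X" unfolding X_def by auto

lemma Sb: "S m \<in> sets borel" "bounded (S m)" unfolding S_def
  by (auto intro: bounded_subset[OF bounded_closed_interval])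

lemma SXb: "S m \<times> X \<in> sets borel" "bounded (S m \<times> X)" using Sb Xb by (auto intro!: borel_Times bounded_Times)

lemma M_pos: "M \<ge> 1" using Mh by (cases M) auto

lemma S_sub: "m \<in> {1..M} \<Longrightarrow> S m \<subseteq> {0..T}"
proof -
  assume m: "m \<in> {1..M}"
  have "real m * h \<le> real M * h" "0 \<le> real (m - 1) * h" using m h0 by (auto intro!: mult_right_mono)
  then show ?thesis unfolding S_def Mh(1) by auto
qed

lemma t_eq: "m \<in> {1..M} \<Longrightarrow> t m = real m * h" "m \<in> {1..M} \<Longrightarrow> t (m - 1) = real (m - 1) * h"
  using tm[of m] tm[of "m - 1"] by auto

lemma R_slab: "m \<in> {1..M} \<Longrightarrow> z \<in> S m \<times> A \<Longrightarrow> R z = B z - Op m z"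
  unfolding R_def S_def using slab_sum[OF h0, of m M "fst z" "\<lambda>m. Op m z"] by auto

lemma cv_pw: "m \<in> {1..M} \<Longrightarrow> \<forall>i\<le>k. pw (cv v m i) \<and> cv v m i al = 0 \<and> cv v m i be = 0"
  using cf unfolding cv_def[abs_def] by (auto intro!: pw_lincomb(1))

lemma pf_cv: "pf (cv v m) z = Pf m z \<bullet> v" "pt (cv v m) z = Pt m z \<bullet> v"
proof -
  have "(\<Sum>i\<le>k. a i * (\<Sum>l\<in>UNIV. v $ l * cf m l i (snd z))) = (\<Sum>l\<in>UNIV. (\<Sum>i\<le>k. a i * cf m l i (snd z)) * v $ l)" for a
    unfolding sum_distrib_left sum_distrib_right by (subst sum.swap) (simp add: mult_ac)
  then show "pf (cv v m) z = Pf m z \<bullet> v" "pt (cv v m) z = Pt m z \<bullet> v"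
    unfolding pf_def pt_def cv_def Pf_def Pt_def by (simp_all add: inner_vec_def)
qed

lemma px_cv: assumes "m \<in> {1..M}" shows "px (cv v m) z = Px m z \<bullet> v"
proof -
  have "pd (cv v m i) (snd z) = (\<Sum>l\<in>UNIV. v $ l * pd (cf m l i) (snd z))" if "i \<le> k" for i
    unfolding cv_def[abs_def] by (rule pd_lincomb) (use cf assms that in auto)
  then have "px (cv v m) z = (\<Sum>i\<le>k. fst z ^ i * (\<Sum>l\<in>UNIV. v $ l * pd (cf m l i) (snd z)))"
    unfolding px_def by simp
  also have "\<dots> = (\<Sum>l\<in>UNIV. (\<Sum>i\<le>k. fst z ^ i * pd (cf m l i) (snd z)) * v $ l)"
    unfolding sum_distrib_left sum_distrib_right by (subst sum.swap) (simp add: mult_ac)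
  finally show ?thesis unfolding px_def Px_def by (simp add: inner_vec_def)
qed

lemma Op_sqv: assumes m: "m \<in> {1..M}" and A: "A \<in> sets borel" "bounded A" shows "sqv (A \<times> X) (Op m)"
proof -
  have c: "\<forall>i\<le>k. pw (cf m l i)" for l using cf[OF m] by blast
  have AX: "A \<times> X \<in> sets borel" "bounded (A \<times> X)" using A Xb by (auto intro!: borel_Times bounded_Times)
  have "sqv (A \<times> X) (Pt m)" "sqv (A \<times> X) (Px m)"
    unfolding Pt_def[abs_def] Px_def[abs_def] by (rule sqv_vec; simp; intro bfun_sqi pf_bfun A c AX)+
  then show ?thesis unfolding Op_def[abs_def] by (intro sqv_add sqv_matrix)
qed

lemma R_sqv: "sqv ({0..T} \<times> X) R"
proof -
  have "sqv ({0..T} \<times> X) (\<lambda>z. indicat_real (S m) (fst z) *\<^sub>R Op m z)" if m: "m \<in> {1..M}" for m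
  proof (rule sqvI[of _ _ "\<lambda>z. norm (Op m z)" 1])
    have o: "sqv ({0..T} \<times> X) (Op m)" by (rule Op_sqv[OF m]) auto
    have "(\<lambda>z::real \<times> real. indicat_real (S m) (fst z)) \<in> borel_measurable borel"
      using Sb[of m] unfolding borel_prod[symmetric] by measurable
    then show "(\<lambda>z. indicat_real (S m) (fst z) *\<^sub>R Op m z) \<in> borel_measurable borel"
      using sqv_meas[OF o] by (rule borel_measurable_scaleR)
    show "sqi ({0..T} \<times> X) (\<lambda>z. norm (Op m z))" by (rule sqv_norm[OF o])
  qed (auto simp: indicator_def)
  moreover have "{0..T} \<times> X \<in> sets borel" using Xb by (auto intro!: borel_Times)
  ultimately show ?thesis unfolding R_def[abs_def] using B(1) by (intro sqv_diff sqv_sum) (auto simp: X_def)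
qed

lemma R_slab_sqv: "m \<in> {1..M} \<Longrightarrow> sqv (S m \<times> X) R"
  using sqv_subset[OF R_sqv, of "S m \<times> X"] S_sub SXb(1) by blast

lemma Pf_slice_sqv: assumes m: "m \<in> {1..M}" shows "sqv X (\<lambda>x. Pf m (s, x))"
  unfolding Pf_def
proof (rule sqv_vec; simp)
  fix l
  have "\<forall>i\<le>k. pw (cf m l i)" using cf[OF m] by blast
  then have "bfun X (\<lambda>x. pf (cf m l) (s, x))" by (intro bfun_slice[of "{s}" X] pf_bfun) auto
  then show "sqi X (\<lambda>x. pf (cf m l) (s, x))" by (intro bfun_sqi Xb)
qed

lemma before_sqv: assumes "m \<in> {1..M}" shows "sqv X (before m)"
proof (cases "m = 1")
  case True then show ?thesis using Vt[of 0] Mh(2) unfolding before_def X_def by simp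
next
  case False
  then have "m - 1 \<in> {1..M}" using assms by auto
  from Pf_slice_sqv[OF this] show ?thesis unfolding before_def[abs_def] using False by simp
qed

lemma jump_sqv: "m \<in> {1..M} \<Longrightarrow> sqv X (jump m)"
  unfolding jump_def[abs_def] by (intro sqv_diff Pf_slice_sqv before_sqv)

lemma Pf_dt: "((\<lambda>s. Pf m (s, x)) has_vector_derivative Pt m (s, x)) (at s)"
proof -
  have e: "(\<chi> l. a l) = (\<Sum>l\<in>UNIV. a l *\<^sub>R (axis l 1 :: real^3))" for a :: "3 \<Rightarrow> real"
    by (rule vec3_sum)
  show ?thesis unfolding Pf_def Pt_def e
    by (intro has_vector_derivative_sum bounded_linear.has_vector_derivative[OF bounded_linear_scaleR_left] pf_dt)
qed

lemma Pf_dx: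
  assumes m: "m \<in> {1..M}" and x: "x \<in> {al..be} - nodes"
  shows "((\<lambda>x. Pf m (s, x)) has_vector_derivative Px m (s, x)) (at x)"
proof -
  have e: "(\<chi> l. a l) = (\<Sum>l\<in>UNIV. a l *\<^sub>R (axis l 1 :: real^3))" for a :: "3 \<Rightarrow> real"
    by (rule vec3_sum)
  have c: "\<forall>i\<le>k. pw (cf m l i)" for l using cf[OF m] by blast
  show ?thesis unfolding Pf_def Px_def e
    by (intro has_vector_derivative_sum bounded_linear.has_vector_derivative[OF bounded_linear_scaleR_left] pf_dx c x)
qed

lemma Wh_Pf: "m \<in> {1..M} \<Longrightarrow> s \<in> S m \<Longrightarrow> x \<in> {al..be} \<Longrightarrow> Wh (s, x) = Pf m (s, x)"
  using Wh[of m "(s, x)"] unfolding Pf_def S_def by (simp add: vec_eq_iff)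

lemma maxwell_op_Wh:
  assumes m: "m \<in> {1..M}" and s: "s \<in> S m" "s \<noteq> real m * h" and x: "x \<in> {al<..<be}" "x \<notin> nodes"
  shows "maxwell_op Wh (s, x) = Op m (s, x)"
proof -
  have "((\<lambda>s. Wh (s, x)) has_vector_derivative Pt m (s, x)) (at s)"
  proof (rule has_vector_derivative_transform_within_open[OF Pf_dt, where S = "{real (m - 1) * h<..<real m * h}"])
    show "Pf m (r, x) = Wh (r, x)" if "r \<in> {real (m - 1) * h<..<real m * h}" for r
      using Wh_Pf[OF m, of r x] that x unfolding S_def by simp
  qed (use s in \<open>auto simp: S_def\<close>)
  moreover have "((\<lambda>x. Wh (s, x)) has_vector_derivative Px m (s, x)) (at x)"
  proof (rule has_vector_derivative_transform_within_open[OF Pf_dx[OF m], where S = "{al<..<be}"])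
    show "Pf m (s, y) = Wh (s, y)" if "y \<in> {al<..<be}" for y
      using Wh_Pf[OF m s(1), of y] that by simp
  qed (use x in auto)
  ultimately show ?thesis unfolding maxwell_op_def Op_def dt_def dx_def by (simp add: vector_derivative_at)
qed

lemma AE_off: "AE z in lborel. snd (z :: real \<times> real) \<notin> nodes" "AE z in lborel. fst (z :: real \<times> real) \<noteq> c"
proof -
  have "AE x in lborel. x \<notin> nodes" by (intro AE_not_in finite_imp_null_set_lborel fin_nodes)
  from AE_snd[OF this] show "AE z in lborel. snd (z :: real \<times> real) \<notin> nodes" .
  have "AE x in lborel. x \<notin> {c}" by (intro AE_not_in finite_imp_null_set_lborel) simp
  then have "AE x in lborel. x \<noteq> c" by simp
  from AE_fst[OF this] show "AE z in lborel. fst (z :: real \<times> real) \<noteq> c" .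
qed

lemma AE_maxwell_op_Wh:
  "m \<in> {1..M} \<Longrightarrow> AE z in lborel. z \<in> S m \<times> {al<..<be} \<longrightarrow> maxwell_op Wh z = Op m z"
  using AE_off(1) AE_off(2)[of "real m * h"] by eventually_elim (use maxwell_op_Wh in auto)

lemma trace_plus_Wh:
  assumes m: "m \<in> {1..M}" and x: "x \<in> {al..be}"
  shows "trace_plus Wh (real (m - 1) * h) x = Pf m (real (m - 1) * h, x)"
proof -
  let ?t = "real (m - 1) * h"
  have lt: "?t < real m * h" using m h0 by (intro mult_strict_right_mono) auto
  have "((\<lambda>s. Pf m (s, x)) \<longlongrightarrow> Pf m (?t, x)) (at_right ?t)"
    using has_vector_derivative_continuous[OF Pf_dt[of m x ?t]] by (simp add: continuous_at filterlim_at_split)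
  moreover have "eventually (\<lambda>s. Pf m (s, x) = Wh (s, x)) (at_right ?t)"
    unfolding eventually_at_right[OF lt] using Wh_Pf[OF m _ x] lt by (intro exI[of _ "real m * h"]) (auto simp: S_def)
  ultimately have "((\<lambda>s. Wh (s, x)) \<longlongrightarrow> Pf m (?t, x)) (at_right ?t)" by (rule Lim_transform_eventually)
  then show ?thesis unfolding trace_plus_def by (intro tendsto_Lim trivial_limit_at_right_real)
qed

lemma trace_minus_Wh:
  assumes m: "m \<in> {1..M}" and x: "x \<in> {al..be}"
  shows "trace_minus Wh (real m * h) x = Pf m (real m * h, x)"
proof -
  let ?t = "real m * h"
  have lt: "real (m - 1) * h < ?t" using m h0 by (intro mult_strict_right_mono) auto
  have "((\<lambda>s. Pf m (s, x)) \<longlongrightarrow> Pf m (?t, x)) (at_left ?t)"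
    using has_vector_derivative_continuous[OF Pf_dt[of m x ?t]] by (simp add: continuous_at filterlim_at_split)
  moreover have "eventually (\<lambda>s. Pf m (s, x) = Wh (s, x)) (at_left ?t)"
    unfolding eventually_at_left[OF lt] using Wh_Pf[OF m _ x] lt by (intro exI[of _ "real (m - 1) * h"]) (auto simp: S_def)
  ultimately have "((\<lambda>s. Wh (s, x)) \<longlongrightarrow> Pf m (?t, x)) (at_left ?t)" by (rule Lim_transform_eventually)
  then show ?thesis unfolding trace_minus_def by (intro tendsto_Lim trivial_limit_at_left_real)
qed

lemma AE_trace_minus0:
  assumes m: "m \<in> {1..M}"
  shows "AE x in lborel. x \<in> {al<..<be} \<longrightarrow> trace_minus0 W0 Wh (real (m - 1) * h) x = before m x"
proof (cases "m = 1")
  case True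
  show ?thesis using V0 by eventually_elim (simp add: True trace_minus0_def before_def)
next
  case False
  then have "m - 1 \<in> {1..M}" "real (m - 1) * h \<noteq> 0" using m h0 by auto
  then show ?thesis using trace_minus_Wh[of "m - 1"] False by (auto simp: trace_minus0_def before_def)
qed

lemma jump_AE:
  assumes m: "m \<in> {1..M}"
  shows "AE x in lborel. x \<in> {al<..<be} \<longrightarrow> trace_plus Wh (t (m - 1)) x - trace_minus0 W0 Wh (t (m - 1)) x = jump m x"
  using AE_trace_minus0[OF m] unfolding t_eq(2)[OF m]
  by eventually_elim (use trace_plus_Wh[OF m] in \<open>auto simp: jump_def\<close>)

text \<open>The discrete equation is tested with a scalar discrete function times \<open>v\<close>.\<close>

lemma galerkin_direction:
  assumes m: "m \<in> {1..M}" and \<gamma>: "\<forall>i\<le>k. pw (\<gamma> i) \<and> \<gamma> i al = 0 \<and> \<gamma> i be = 0"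
  shows "(LINT z:S m \<times> X|lborel. (R z \<bullet> hat4 v) * pf \<gamma> z + cc * h * ((R z \<bullet> (M1 *v v)) * pt \<gamma> z + (R z \<bullet> (M2 *v v)) * px \<gamma> z)) =
    (LINT x:X|lborel. (jump m x \<bullet> v) * pf \<gamma> (real (m - 1) * h, x))"
proof -
  let ?t = "real (m - 1) * h"
  define g where "g z = pf \<gamma> z *\<^sub>R v" for z
  define test where "test z = pf \<gamma> z *\<^sub>R hat4 v + (cc * h) *\<^sub>R (pt \<gamma> z *\<^sub>R (M1 *v v) + px \<gamma> z *\<^sub>R (M2 *v v))" for z
  have c: "\<forall>i\<le>k. pw (\<gamma> i)" using \<gamma> by blast
  have b: "bfun (S m \<times> X) (pf \<gamma>)" "bfun (S m \<times> X) (pt \<gamma>)" "bfun (S m \<times> X) (px \<gamma>)" by (intro pf_bfun c Sb)+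
  have mb[measurable]: "pf \<gamma> \<in> borel_measurable borel" "pt \<gamma> \<in> borel_measurable borel" "px \<gamma> \<in> borel_measurable borel"
    using b by (auto dest: bfun_meas)
  have sl: "bfun X (\<lambda>x. pf \<gamma> (?t, x))" by (intro bfun_slice[of "{?t}" X] pf_bfun c) auto
  have [measurable]: "test \<in> borel_measurable borel" unfolding test_def[abs_def] by measurable
  have Os: "sqv (S m \<times> X) (Op m)" by (rule Op_sqv[OF m Sb])
  have Bs: "sqv (S m \<times> X) B" using sqv_subset[OF B(1), of "S m \<times> X"] S_sub[OF m] SXb(1) unfolding X_def by blast
  have g_fe: "g \<in> fe_space {al<..<be} M t \<T> k" unfolding g_def[abs_def]
  proof (rule pf_in_fe_space[OF \<gamma>])
    show "t (n - 1) < t n" if "n \<in> {1..M}" for n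
      unfolding t_eq[OF that] using that h0 by (intro mult_strict_right_mono) auto
  qed
  have op_g: "hat4 (g z) + (cc * h) *\<^sub>R maxwell_op g z = test z" if x: "snd z \<in> {al..be} - nodes" for z
  proof -
    obtain s x where z: "z = (s, x)" by force
    have "((\<lambda>s. g (s, x)) has_vector_derivative pt \<gamma> (s, x) *\<^sub>R v) (at s)"
      unfolding g_def by (intro bounded_linear.has_vector_derivative[OF bounded_linear_scaleR_left] pf_dt)
    moreover have "((\<lambda>x. g (s, x)) has_vector_derivative px \<gamma> (s, x) *\<^sub>R v) (at x)"
      unfolding g_def by (intro bounded_linear.has_vector_derivative[OF bounded_linear_scaleR_left] pf_dx c) (use x z in auto)
    ultimately have "maxwell_op g z = pt \<gamma> z *\<^sub>R (M1 *v v) + px \<gamma> z *\<^sub>R (M2 *v v)"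
      unfolding maxwell_op_def dt_def dx_def z by (simp add: vector_derivative_at matrix_vector_mult_scaleR)
    then show ?thesis unfolding test_def g_def by (simp add: hat4_scaleR)
  qed
  have ae_g: "AE z in lborel. z \<in> S m \<times> {al<..<be} \<longrightarrow> hat4 (g z) + (cc * h) *\<^sub>R maxwell_op g z = test z"
    using AE_off(1) by eventually_elim (use op_g in auto)
  have tp_g: "trace_plus g ?t x = pf \<gamma> (?t, x) *\<^sub>R v" for x
  proof -
    have "((\<lambda>s. pf \<gamma> (s, x) *\<^sub>R v) has_vector_derivative pt \<gamma> (?t, x) *\<^sub>R v) (at ?t)"
      by (intro bounded_linear.has_vector_derivative[OF bounded_linear_scaleR_left] pf_dt)
    from has_vector_derivative_continuous[OF this]
    have "((\<lambda>s. g (s, x)) \<longlongrightarrow> pf \<gamma> (?t, x) *\<^sub>R v) (at_right ?t)"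
      unfolding g_def by (simp add: continuous_at filterlim_at_split)
    then show ?thesis unfolding trace_plus_def by (intro tendsto_Lim trivial_limit_at_right_real)
  qed
  have slab: "slab t {al<..<be} m = S m \<times> {al<..<be}" unfolding slab_def S_def t_eq[OF m] ..
  have E: "L2_inner (S m \<times> {al<..<be}) (maxwell_op Wh) (\<lambda>z. hat4 (g z) + (cc * h) *\<^sub>R maxwell_op g z) +
      L2_inner {al<..<be} (trace_plus Wh ?t) (trace_plus g ?t) =
      L2_inner (S m \<times> {al<..<be}) b (\<lambda>z. hat4 (g z) + (cc * h) *\<^sub>R maxwell_op g z) +
      L2_inner {al<..<be} (trace_minus0 W0 Wh ?t) (trace_plus g ?t)"
    using sol m g_fe unfolding sd_solution_def slab[symmetric] t_eq(2)[OF m, symmetric] by blast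
  have e1: "L2_inner (S m \<times> {al<..<be}) (maxwell_op Wh) (\<lambda>z. hat4 (g z) + (cc * h) *\<^sub>R maxwell_op g z) =
      (LINT z:S m \<times> X|lborel. Op m z \<bullet> test z)"
    unfolding X_def by (intro L2_inner_cylinder Sb AE_maxwell_op_Wh[OF m] ae_g) (use sqv_meas[OF Os] in auto)
  have e2: "L2_inner (S m \<times> {al<..<be}) b (\<lambda>z. hat4 (g z) + (cc * h) *\<^sub>R maxwell_op g z) =
      (LINT z:S m \<times> X|lborel. B z \<bullet> test z)"
    unfolding X_def
  proof (intro L2_inner_cylinder Sb ae_g)
    have "b z = B z" if "z \<in> S m \<times> {al<..<be}" for z using B(3) S_sub[OF m] that by blast
    then show "AE z in lborel. z \<in> S m \<times> {al<..<be} \<longrightarrow> b z = B z" by simp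
  qed (use sqv_meas[OF Bs] in auto)
  have slm: "(\<lambda>x. pf \<gamma> (?t, x) *\<^sub>R v) \<in> borel_measurable borel" using sl by (intro borel_measurable_scaleR) (auto dest: bfun_meas)
  have e3: "L2_inner {al<..<be} (trace_plus Wh ?t) (trace_plus g ?t) = (LINT x:X|lborel. Pf m (?t, x) \<bullet> (pf \<gamma> (?t, x) *\<^sub>R v))"
    unfolding X_def
    by (intro L2_inner_interval sqv_meas[OF Pf_slice_sqv[OF m]] slm) (auto simp: tp_g trace_plus_Wh[OF m] simp del: One_nat_def)
  have e4: "L2_inner {al<..<be} (trace_minus0 W0 Wh ?t) (trace_plus g ?t) = (LINT x:X|lborel. before m x \<bullet> (pf \<gamma> (?t, x) *\<^sub>R v))"
    unfolding X_def
    by (intro L2_inner_interval sqv_meas[OF before_sqv[OF m]] slm AE_trace_minus0[OF m]) (auto simp: tp_g simp del: One_nat_def)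
  have "(LINT z:S m \<times> X|lborel. (R z \<bullet> hat4 v) * pf \<gamma> z + cc * h * ((R z \<bullet> (M1 *v v)) * pt \<gamma> z + (R z \<bullet> (M2 *v v)) * px \<gamma> z))
      = (LINT z:S m \<times> X|lborel. B z \<bullet> test z - Op m z \<bullet> test z)"
  proof (rule set_lebesgue_integral_cong)
    show "\<forall>z. z \<in> S m \<times> X \<longrightarrow> (R z \<bullet> hat4 v) * pf \<gamma> z + cc * h * ((R z \<bullet> (M1 *v v)) * pt \<gamma> z + (R z \<bullet> (M2 *v v)) * px \<gamma> z)
       = B z \<bullet> test z - Op m z \<bullet> test z"
    proof (intro allI impI)
      fix z assume "z \<in> S m \<times> X"
      then have r: "R z = B z - Op m z" by (rule R_slab[OF m])
      show "(R z \<bullet> hat4 v) * pf \<gamma> z + cc * h * ((R z \<bullet> (M1 *v v)) * pt \<gamma> z + (R z \<bullet> (M2 *v v)) * px \<gamma> z)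
        = B z \<bullet> test z - Op m z \<bullet> test z"
        unfolding r test_def by (simp add: inner_diff_left inner_add_right algebra_simps)
    qed
  qed (use SXb in simp)
  also have "\<dots> = (LINT z:S m \<times> X|lborel. B z \<bullet> test z) - (LINT z:S m \<times> X|lborel. Op m z \<bullet> test z)"
    unfolding test_def by (intro set_integral_diff(2) set_integrable_inner_combination Bs Os b SXb)
  also have "\<dots> = (LINT x:X|lborel. Pf m (?t, x) \<bullet> (pf \<gamma> (?t, x) *\<^sub>R v)) - (LINT x:X|lborel. before m x \<bullet> (pf \<gamma> (?t, x) *\<^sub>R v))"
    using E unfolding e1 e2 e3 e4 by linarith
  also have "\<dots> = (LINT x:X|lborel. Pf m (?t, x) \<bullet> (pf \<gamma> (?t, x) *\<^sub>R v) - before m x \<bullet> (pf \<gamma> (?t, x) *\<^sub>R v))"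
  proof (rule set_integral_diff(2)[symmetric])
    show "set_integrable lborel X (\<lambda>x. Pf m (?t, x) \<bullet> (pf \<gamma> (?t, x) *\<^sub>R v))" "set_integrable lborel X (\<lambda>x. before m x \<bullet> (pf \<gamma> (?t, x) *\<^sub>R v))"
      unfolding inner_scaleR_right
      by (intro sqi_mult_integrable bfun_sqi sl Xb sqv_inner Pf_slice_sqv before_sqv m)+
  qed
  also have "\<dots> = (LINT x:X|lborel. (jump m x \<bullet> v) * pf \<gamma> (?t, x))"
    unfolding jump_def by (simp add: inner_diff_left algebra_simps)
  finally show ?thesis .
qed

text \<open>The weak Maxwell equations are tested with a scalar function times \<open>hat4 v\<close>.\<close>

lemma trace_identity_direction:
  assumes d: "direction s v" and u: "smooth u" "\<And>t x. ((\<lambda>t. u (t, x)) has_real_derivative ut (t, x)) (at t)"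
      "\<And>t x. ((\<lambda>x. u (t, x)) has_real_derivative ux (t, x)) (at x)"
      "continuous_on UNIV ut" "continuous_on UNIV ux"
  shows "(LINT x:{al..be}|lborel. (V (T, x) \<bullet> v) * u (T, x)) - (LINT x:{al..be}|lborel. (V (0, x) \<bullet> v) * u (0, x)) =
      (LINT z:{0..T} \<times> {al..be}|lborel. (V z \<bullet> v) * (ut z + s * ux z) + (B z \<bullet> hat4 v) * u z)"
proof (rule weak_trace_identity[OF Mh(2) _ K(3) _ _ _ _ _ _ _ u])
  let ?Q = "{0..T} \<times> {al..be}" and ?Q' = "{0..T} \<times> {al<..<be}"
  show "al < K1" "K2 < be" using K by auto
  have Qb: "?Q \<in> sets borel" "bounded ?Q" by (auto intro!: borel_Times bounded_Times)
  have i: "set_integrable lborel ?Q f" if "sqi ?Q f" for f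
    using sqi_mult_integrable[OF that bfun_sqi[OF bfun_const[of ?Q 1] Qb]] by simp
  have sv: "sqi ?Q (\<lambda>z. V z \<bullet> v)" "sqi ?Q (\<lambda>z. B z \<bullet> hat4 v)" by (intro sqv_inner V B)+
  show "set_integrable lborel ?Q (\<lambda>z. V z \<bullet> v)" "set_integrable lborel ?Q (\<lambda>z. B z \<bullet> hat4 v)" using sv by (intro i; simp)+
  show "(\<lambda>z. V z \<bullet> v) \<in> borel_measurable borel" "(\<lambda>z. B z \<bullet> hat4 v) \<in> borel_measurable borel" using sv by (auto dest: sqi_meas)
  show "V (t, x) \<bullet> v = 0" "B (t, x) \<bullet> hat4 v = 0" if "x \<notin> {K1..K2}" for t x using V(2) B(2) that by simp_all
  show "continuous_on {0..T} (\<lambda>t. LINT x:{al..be}|lborel. (V (t, x) \<bullet> v) * u (t, x))"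
    by (rule sqi_inner_continuous[OF Vt Vc smooth_continuous[OF u(1)]])
  fix y yt yx :: "real \<times> real \<Rightarrow> real"
  assume y: "smooth y" "compact (closure {z. y z \<noteq> 0})" "closure {z. y z \<noteq> 0} \<subseteq> {0<..<T} \<times> {al<..<be}"
    "\<And>t x. ((\<lambda>t. y (t, x)) has_real_derivative yt (t, x)) (at t)"
    "\<And>t x. ((\<lambda>x. y (t, x)) has_real_derivative yx (t, x)) (at x)"
  have tf: "test_function ({0<..<T} \<times> {al<..<be}) y" using y(1-3) unfolding test_function_def smooth_def by blast
  note p = test_function_partials[OF tf]
  have yt: "yt = (\<lambda>z. frechet_derivative y (at z) (1, 0))" using DERIV_unique[OF y(4) p(1)] by auto
  have yx: "yx = (\<lambda>z. frechet_derivative y (at z) (0, 1))" using DERIV_unique[OF y(5) p(2)] by auto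
  have [measurable]: "y \<in> borel_measurable borel" "yt \<in> borel_measurable borel" "yx \<in> borel_measurable borel"
    unfolding yt yx by (intro borel_measurable_continuous_onI p)+
  have [measurable]: "V \<in> borel_measurable borel" "B \<in> borel_measurable borel" using V(1) B(1) by (auto dest: sqv_meas)
  have mm: "(\<lambda>z. M1 *v V z) \<in> borel_measurable borel" "(\<lambda>z. M2 *v V z) \<in> borel_measurable borel"
    using sqv_matrix[OF V(1)] by (auto dest: sqv_meas)
  let ?\<psi> = "\<lambda>z. y z *\<^sub>R hat4 v"
  have dp: "dt ?\<psi> = (\<lambda>z. yt z *\<^sub>R hat4 v)" "dx ?\<psi> = (\<lambda>z. yx z *\<^sub>R hat4 v)"
    unfolding dt_def dx_def
    by (auto intro!: ext vector_derivative_at bounded_linear.has_vector_derivative[OF bounded_linear_scaleR_left]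
       y(4,5)[unfolded has_real_derivative_iff_has_vector_derivative])
  have eq: "- L2_inner ?Q' (\<lambda>z. M1 *v W z) (\<lambda>z. yt z *\<^sub>R hat4 v) - L2_inner ?Q' (\<lambda>z. M2 *v W z) (\<lambda>z. yx z *\<^sub>R hat4 v)
     = L2_inner ?Q' b ?\<psi>"
    using weak[OF test_function_scaleR[OF y(1-3), of "hat4 v"]] unfolding dp .
  have "L2_inner ?Q' (\<lambda>z. M1 *v W z) (\<lambda>z. yt z *\<^sub>R hat4 v) = (LINT z:?Q|lborel. (M1 *v V z) \<bullet> (yt z *\<^sub>R hat4 v))"
    by (intro L2_inner_cylinder mm) (auto simp: V(3))
  moreover have "L2_inner ?Q' (\<lambda>z. M2 *v W z) (\<lambda>z. yx z *\<^sub>R hat4 v) = (LINT z:?Q|lborel. (M2 *v V z) \<bullet> (yx z *\<^sub>R hat4 v))"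
    by (intro L2_inner_cylinder mm) (auto simp: V(3))
  moreover have "L2_inner ?Q' b ?\<psi> = (LINT z:?Q|lborel. B z \<bullet> (y z *\<^sub>R hat4 v))"
    by (intro L2_inner_cylinder) (auto simp: B(3))
  moreover have "(LINT z:?Q|lborel. (M2 *v V z) \<bullet> (yx z *\<^sub>R hat4 v)) = s * (LINT z:?Q|lborel. (V z \<bullet> v) * yx z)"
  proof -
    have "(LINT z:?Q|lborel. (M2 *v V z) \<bullet> (yx z *\<^sub>R hat4 v)) = (LINT z:?Q|lborel. s * ((V z \<bullet> v) * yx z))"
      by (simp add: M2_hat4[OF d] mult_ac)
    then show ?thesis by (simp only: set_integral_mult_right)
  qed
  ultimately show "- (LINT z:?Q|lborel. (V z \<bullet> v) * yt z) - s * (LINT z:?Q|lborel. (V z \<bullet> v) * yx z) = (LINT z:?Q|lborel. (B z \<bullet> hat4 v) * y z)"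
    using eq by (simp add: M1_hat4 mult.commute)
qed

text \<open>For \<open>v = (1, 0, 0)\<close> the vectors \<open>M1 *v v\<close> and \<open>M2 *v v\<close> select the residuals of the equations for
  \<open>\<partial>\<^sub>t E\<^sub>1\<close> and \<open>\<partial>\<^sub>x E\<^sub>1\<close>, which are \<open>- pt\<close> and \<open>- px\<close> where the source vanishes. In the other two directions
  \<open>M1 *v v = hat4 v\<close> and \<open>M2 *v v = s *\<^sub>R hat4 v\<close>.\<close>

lemma scheme_direction:
  assumes d: "direction s v"
  shows "scheme al be h \<T> k T M s cc K1 K2 rho (cv v) (\<lambda>x. V (0, x) \<bullet> v) (\<lambda>x. V (T, x) \<bullet> v)
    (\<lambda>z. V z \<bullet> v) (\<lambda>z. B z \<bullet> hat4 v) (\<lambda>z. R z \<bullet> hat4 v) (\<lambda>z. R z \<bullet> (M1 *v v)) (\<lambda>z. R z \<bullet> (M2 *v v))"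
proof (intro scheme.intro mesh_axioms scheme_axioms.intro)
  show "T = real M * h" "T > 0" "cc > 0" "rho > 0" "al + 4 * rho < K1" "K1 \<le> K2" "K2 < be - 4 * rho" by (rule Mh cc K)+
  show "s = 1 \<or> s = -1" using d unfolding direction_def by auto
  show "\<forall>i\<le>k. pw (cv v m i)" if "m \<in> {1..M}" for m using cv_pw[OF that] by blast
  show "cv v m i al = 0" "cv v m i be = 0" if "m \<in> {1..M}" "i \<le> k" for m i using cv_pw[OF that(1)] that(2) by blast+
  show "sqi {al..be} (\<lambda>x. V (0, x) \<bullet> v)" "sqi {al..be} (\<lambda>x. V (T, x) \<bullet> v)" using Mh(2) by (intro sqv_inner Vt; simp)+
  show "sqi ({0..T} \<times> {al..be}) (\<lambda>z. V z \<bullet> v)" "sqi ({0..T} \<times> {al..be}) (\<lambda>z. B z \<bullet> hat4 v)" by (intro sqv_inner V B)+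
  show "V (0, x) \<bullet> v = 0" "V (T, x) \<bullet> v = 0" if "x \<notin> {K1..K2}" for x using V(2)[OF that] by simp_all
  show "V (t, x) \<bullet> v = 0" "B (t, x) \<bullet> hat4 v = 0" if "x \<notin> {K1..K2}" for t x using V(2)[OF that] B(2)[OF that] by simp_all
  show "sqi ({real (m - 1) * h<..real m * h} \<times> {al..be}) (\<lambda>z. R z \<bullet> u)" if "m \<in> {1..M}" for m u
    using sqv_inner[OF R_slab_sqv[OF that]] unfolding S_def X_def .
  then show "\<And>m. m \<in> {1..M} \<Longrightarrow> sqi ({real (m - 1) * h<..real m * h} \<times> {al..be}) (\<lambda>z. R z \<bullet> (M1 *v v))"
    "\<And>m. m \<in> {1..M} \<Longrightarrow> sqi ({real (m - 1) * h<..real m * h} \<times> {al..be}) (\<lambda>z. R z \<bullet> (M2 *v v))" by blast+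
  show "R z \<bullet> hat4 v = B z \<bullet> hat4 v - (pt (cv v m) z + s * px (cv v m) z)"
    if "m \<in> {1..M}" "z \<in> {real (m - 1) * h<..real m * h} \<times> {al..be}" for m z
    using R_slab[OF that(1), of z "{al..be}"] that unfolding S_def Op_def
    by (simp add: inner_diff_left inner_add_left M1_hat4 M2_hat4[OF d] pf_cv px_cv)
  show "(s = 1 \<and> (\<forall>m\<in>{1..M}. \<forall>z\<in>{real (m - 1) * h<..real m * h} \<times> {al..be}. snd z \<notin> {K1..K2} \<longrightarrow>
        R z \<bullet> (M1 *v v) = - pt (cv v m) z \<and> R z \<bullet> (M2 *v v) = - px (cv v m) z)) \<or>
      (\<forall>m\<in>{1..M}. \<forall>z\<in>{real (m - 1) * h<..real m * h} \<times> {al..be}. R z \<bullet> (M1 *v v) = R z \<bullet> hat4 v \<and> R z \<bullet> (M2 *v v) = s * (R z \<bullet> hat4 v))"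
  proof (cases "v = vector [1, 0, 0]")
    case True
    have "s = 1" using d True unfolding direction_def by (auto simp: vec_eq_iff forall_3)
    moreover have "R z \<bullet> (M1 *v v) = - pt (cv v m) z \<and> R z \<bullet> (M2 *v v) = - px (cv v m) z"
      if "m \<in> {1..M}" "z \<in> {real (m - 1) * h<..real m * h} \<times> {al..be}" "snd z \<notin> {K1..K2}" for m z
    proof -
      have "R z = - Op m z" using R_slab[OF that(1), of z "{al..be}"] B(2)[of "snd z" "fst z"] that unfolding S_def by simp
      then show ?thesis unfolding pf_cv px_cv[OF that(1)] Op_def True by (simp add: matrix_simps)
    qed
    ultimately show ?thesis by blast
  next
    case False
    have "M1 *v v = hat4 v \<and> M2 *v v = s *\<^sub>R hat4 v" using d False unfolding direction_def
      by (auto simp: matrix_simps vec_eq_iff forall_4)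
    then show ?thesis by simp
  qed
  show "(LINT z:{real (m - 1) * h<..real m * h} \<times> {al..be}|lborel. (R z \<bullet> hat4 v) * pf \<gamma> z + cc * h * ((R z \<bullet> (M1 *v v)) * pt \<gamma> z + (R z \<bullet> (M2 *v v)) * px \<gamma> z)) =
       (LINT x:{al..be}|lborel. (pf (cv v m) (real (m - 1) * h, x) - (if m = 1 then V (0, x) \<bullet> v else pf (cv v (m - 1)) (real (m - 1) * h, x))) * pf \<gamma> (real (m - 1) * h, x))"
    if "m \<in> {1..M}" "\<forall>i\<le>k. pw (\<gamma> i) \<and> \<gamma> i al = 0 \<and> \<gamma> i be = 0" for m \<gamma>
  proof -
    have "jump m x \<bullet> v = pf (cv v m) (real (m - 1) * h, x) - (if m = 1 then V (0, x) \<bullet> v else pf (cv v (m - 1)) (real (m - 1) * h, x))" for x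
      unfolding jump_def before_def pf_cv by (simp add: inner_diff_left)
    then show ?thesis using galerkin_direction[OF that, of v] unfolding S_def X_def by simp
  qed
qed (rule trace_identity_direction[OF d])

end

lemma sqv_continuous:
  fixes f :: "'a::euclidean_space \<Rightarrow> 'b::euclidean_space"
  assumes "continuous_on UNIV f" "S \<in> sets borel" "bounded S" shows "sqv S f"
  unfolding sqv_def
  by (intro conjI borel_measurable_continuous_onI assms bfun_sqi bfun_continuous continuous_on_norm)

lemma L2_norm_interval:
  assumes f: "continuous_on UNIV (f :: real \<Rightarrow> 'b::euclidean_space)"
  shows "L2_norm {a<..<b} f = nrm {a..b} (\<lambda>x. norm (f x))"
proof -
  have "L2_inner {a<..<b} f f = (LINT x:{a..b}|lborel. f x \<bullet> f x)"
    by (intro L2_inner_interval borel_measurable_continuous_onI f) auto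
  then show ?thesis unfolding L2_norm_def nrm_def by (simp add: power2_norm_eq_inner)
qed

lemma H1_norm_interval:
  fixes f :: "real \<Rightarrow> 'b::euclidean_space"
  assumes f: "smooth f"
  shows "nrm {a..b} (\<lambda>x. norm (f x)) \<le> H1_norm {a<..<b} f"
    and "nrm {a..b} (\<lambda>x. norm (frechet_derivative f (at x) 1)) \<le> H1_norm {a<..<b} f"
proof -
  have e: "L2_norm {a<..<b} f = nrm {a..b} (\<lambda>x. norm (f x))"
    "L2_norm {a<..<b} (\<lambda>x. frechet_derivative f (at x) 1) = nrm {a..b} (\<lambda>x. norm (frechet_derivative f (at x) 1))"
    by (intro L2_norm_interval smooth_continuous C1_real f)+
  show "nrm {a..b} (\<lambda>x. norm (f x)) \<le> H1_norm {a<..<b} f" unfolding H1_norm_def e by (intro real_le_rsqrt) (simp add: sum_nonneg)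
  show "nrm {a..b} (\<lambda>x. norm (frechet_derivative f (at x) 1)) \<le> H1_norm {a<..<b} f"
    unfolding H1_norm_def Basis_real_def by (intro real_le_rsqrt) (simp add: e)
qed

lemma sqv_extend:
  assumes "sqv S f" "\<And>x. x \<notin> S \<Longrightarrow> f x = 0" "S' \<in> sets borel" "S \<subseteq> S'" shows "sqv S' f"
  using assms unfolding sqv_def by (auto intro: sqi_extend)

context fe_maxwell begin

lemma L2_norm_slabs:
  fixes G :: "real \<times> real \<Rightarrow> 'b::euclidean_space"
  assumes G: "sqv ({0..T} \<times> X) G" and ae: "AE z in lborel. z \<in> {0..T} \<times> {al<..<be} \<longrightarrow> f z = G z"
  shows "(L2_norm ({0..T} \<times> {al<..<be}) f)\<^sup>2 = (\<Sum>m=1..M. (nrm (S m \<times> X) (\<lambda>z. norm (G z)))\<^sup>2)"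
proof -
  have [measurable]: "G \<in> borel_measurable borel" using G by (rule sqv_meas)
  have e: "L2_inner ({0..T} \<times> {al<..<be}) f f = (LINT z:{0..T} \<times> X|lborel. (norm (G z))\<^sup>2)"
    unfolding X_def power2_norm_eq_inner by (intro L2_inner_cylinder ae) auto
  have "0 \<le> (LINT z:{0..T} \<times> X|lborel. (norm (G z))\<^sup>2)"
    unfolding set_lebesgue_integral_def by (intro Bochner_Integration.integral_nonneg) simp
  then have "(L2_norm ({0..T} \<times> {al<..<be}) f)\<^sup>2 = (LINT z:{0..T} \<times> X|lborel. (norm (G z))\<^sup>2)"
    unfolding L2_norm_def e by simp
  also have "\<dots> = (\<Sum>m=1..M. (nrm (S m \<times> X) (\<lambda>z. norm (G z)))\<^sup>2)"
    unfolding nrm_sq S_def Mh(1)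
    by (rule slab_split[OF h0 Xb(1)]) (use G in \<open>auto simp: sqv_def sqi_def Mh(1)\<close>)
  finally show ?thesis .
qed

lemma residual1_norm:
  "(L2_norm ({0..T} \<times> {al<..<be}) (\<lambda>z. h *\<^sub>R residual1 b Wh z))\<^sup>2 = (\<Sum>m=1..M. h\<^sup>2 * (nrm (S m \<times> X) (\<lambda>z. norm (R z)))\<^sup>2)"
proof -
  have "AE z in lborel. \<forall>m\<in>{1..M}. z \<in> S m \<times> {al<..<be} \<longrightarrow> maxwell_op Wh z = Op m z"
    by (intro AE_finite_allI AE_maxwell_op_Wh) simp
  then have ae: "AE z in lborel. z \<in> {0..T} \<times> {al<..<be} \<longrightarrow> h *\<^sub>R residual1 b Wh z = h *\<^sub>R R z"
    using AE_off(2)[of 0]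
  proof eventually_elim
    fix z assume op: "\<forall>m\<in>{1..M}. z \<in> S m \<times> {al<..<be} \<longrightarrow> maxwell_op Wh z = Op m z" and z0: "fst z \<noteq> 0"
    show "z \<in> {0..T} \<times> {al<..<be} \<longrightarrow> h *\<^sub>R residual1 b Wh z = h *\<^sub>R R z"
    proof
      assume z: "z \<in> {0..T} \<times> {al<..<be}"
      then have "fst z \<in> (\<Union>m\<in>{1..M}. S m)" using z0 slab_union[OF h0, of M] Mh(1) unfolding S_def by auto
      then obtain m where m: "m \<in> {1..M}" "z \<in> S m \<times> {al<..<be}" using z by (auto simp: mem_Times_iff)
      then show "h *\<^sub>R residual1 b Wh z = h *\<^sub>R R z"
        using op R_slab[OF m] B(3)[OF z] unfolding residual1_def by simp
    qed
  qed
  have "sqv ({0..T} \<times> X) (\<lambda>z. h *\<^sub>R R z)" by (rule sqv_linear[OF bounded_linear_scaleR_right R_sqv])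
  from L2_norm_slabs[OF this ae] show ?thesis
    using h0 by (simp add: nrm_sq power_mult_distrib)
qed

lemma residual2_norm:
  "(L2_norm ({0..T} \<times> {al<..<be}) (\<lambda>z. h *\<^sub>R residual2 M t h W0 Wh z))\<^sup>2 = (\<Sum>m=1..M. h * (nrm X (\<lambda>x. norm (jump m x)))\<^sup>2)"
proof -
  define G where "G z = (\<Sum>m=1..M. indicat_real (S m) (fst z) *\<^sub>R jump m (snd z))" for z
  have "AE x in lborel. \<forall>m\<in>{1..M}. x \<in> {al<..<be} \<longrightarrow> trace_plus Wh (t (m - 1)) x - trace_minus0 W0 Wh (t (m - 1)) x = jump m x"
    by (intro AE_finite_allI jump_AE) simp
  from AE_snd[OF this] have ae: "AE z in lborel. z \<in> {0..T} \<times> {al<..<be} \<longrightarrow> h *\<^sub>R residual2 M t h W0 Wh z = G z"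
  proof eventually_elim
    fix z :: "real \<times> real"
    assume j: "\<forall>m\<in>{1..M}. snd z \<in> {al<..<be} \<longrightarrow> trace_plus Wh (t (m - 1)) (snd z) - trace_minus0 W0 Wh (t (m - 1)) (snd z) = jump m (snd z)"
    show "z \<in> {0..T} \<times> {al<..<be} \<longrightarrow> h *\<^sub>R residual2 M t h W0 Wh z = G z"
    proof
      assume z: "z \<in> {0..T} \<times> {al<..<be}"
      have "h *\<^sub>R residual2 M t h W0 Wh z = (\<Sum>m=1..M. h *\<^sub>R (indicat_real {t (m - 1)<..t m} (fst z) *\<^sub>R
        ((trace_plus Wh (t (m - 1)) (snd z) - trace_minus0 W0 Wh (t (m - 1)) (snd z)) /\<^sub>R h)))"
        unfolding residual2_def by (simp only: case_prod_beta scaleR_sum_right)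
      also have "\<dots> = G z" unfolding G_def
      proof (rule sum.cong[OF refl])
        fix m assume m: "m \<in> {1..M}"
        have "trace_plus Wh (t (m - 1)) (snd z) - trace_minus0 W0 Wh (t (m - 1)) (snd z) = jump m (snd z)"
          using j m z by (auto simp: mem_Times_iff)
        moreover have "{t (m - 1)<..t m} = S m" unfolding S_def t_eq[OF m] ..
        ultimately show "h *\<^sub>R (indicat_real {t (m - 1)<..t m} (fst z) *\<^sub>R
          ((trace_plus Wh (t (m - 1)) (snd z) - trace_minus0 W0 Wh (t (m - 1)) (snd z)) /\<^sub>R h)) = indicat_real (S m) (fst z) *\<^sub>R jump m (snd z)"
          using h0 by (simp only:) simp
      qed
      finally show "h *\<^sub>R residual2 M t h W0 Wh z = G z" .
    qed
  qed
  have "sqv ({0..T} \<times> X) (\<lambda>z. indicat_real (S m) (fst z) *\<^sub>R jump m (snd z))" if m: "m \<in> {1..M}" for m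
  proof (rule sqvI[of _ _ "\<lambda>z. norm (jump m (snd z))" 1])
    have [measurable]: "S m \<in> sets borel" "jump m \<in> borel_measurable borel" using Sb sqv_meas[OF jump_sqv[OF m]] by auto
    show "(\<lambda>z. indicat_real (S m) (fst z) *\<^sub>R jump m (snd z)) \<in> borel_measurable borel"
      unfolding borel_prod[symmetric] by measurable
    show "sqi ({0..T} \<times> X) (\<lambda>z. norm (jump m (snd z)))"
      by (rule sqi_snd_cylinder[OF sqv_norm[OF jump_sqv[OF m]]]) auto
  qed (auto simp: indicator_def)
  then have "sqv ({0..T} \<times> X) G" unfolding G_def[abs_def] using Xb by (intro sqv_sum borel_Times) auto
  from L2_norm_slabs[OF this ae] have "(L2_norm ({0..T} \<times> {al<..<be}) (\<lambda>z. h *\<^sub>R residual2 M t h W0 Wh z))\<^sup>2 =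
    (\<Sum>m=1..M. (nrm (S m \<times> X) (\<lambda>z. norm (G z)))\<^sup>2)" .
  also have "\<dots> = (\<Sum>m=1..M. h * (nrm X (\<lambda>x. norm (jump m x)))\<^sup>2)"
  proof (rule sum.cong[OF refl])
    fix m assume m: "m \<in> {1..M}"
    have "G z = jump m (snd z)" if "z \<in> S m \<times> X" for z
      using slab_sum[OF h0 m, of "fst z" "\<lambda>n. jump n (snd z)"] that unfolding G_def S_def by auto
    then have "(nrm (S m \<times> X) (\<lambda>z. norm (G z)))\<^sup>2 = (nrm (S m \<times> X) (\<lambda>z. norm (jump m (snd z))))\<^sup>2"
      unfolding nrm_sq using SXb by (intro set_lebesgue_integral_cong) auto
    also have "\<dots> = (real m * h - real (m - 1) * h) * (nrm X (\<lambda>x. norm (jump m x)))\<^sup>2"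
      unfolding S_def using h0 by (intro nrm_snd_cylinder sqv_norm jump_sqv m mult_right_mono) auto
    also have "real m * h - real (m - 1) * h = h" using m by (simp add: of_nat_diff algebra_simps)
    finally show "(nrm (S m \<times> X) (\<lambda>z. norm (G z)))\<^sup>2 = h * (nrm X (\<lambda>x. norm (jump m x)))\<^sup>2" .
  qed
  finally show ?thesis .
qed

abbreviation "residual_norms \<equiv> L2_norm ({0..T} \<times> {al<..<be}) (\<lambda>z. h *\<^sub>R residual1 b Wh z) +
  L2_norm ({0..T} \<times> {al<..<be}) (\<lambda>z. h *\<^sub>R residual2 M t h W0 Wh z)"

lemma L2_norm_nonneg: "0 \<le> L2_norm A (f :: 'c::euclidean_space \<Rightarrow> 'd::euclidean_space)"
  unfolding L2_norm_def L2_inner_def set_lebesgue_integral_def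
  by (intro real_sqrt_ge_zero Bochner_Integration.integral_nonneg) simp

text \<open>The vectors in \<open>direction_norms\<close> have length at most \<open>sqrt 2\<close>, and three components of the first
  residual occur in \<open>D.Y\<close>; this is the factor \<open>sqrt 6\<close>.\<close>

lemma pairing_direction:
  assumes d: "direction s v" and f: "test_function {al<..<be} (f :: real \<Rightarrow> real^3)"
  shows "\<bar>LINT x:X|lborel. ((V (T, x) - Pf M (T, x)) \<bullet> v) * (f x \<bullet> v)\<bar>
    \<le> \<bar>dual_const T cc k rho\<bar> * (sqrt 6 * residual_norms) * (2 * sqrt 2 * H1_norm {al<..<be} f)"
proof -
  interpret D: scheme al be h \<T> k T M s cc K1 K2 rho "cv v" "\<lambda>x. V (0, x) \<bullet> v" "\<lambda>x. V (T, x) \<bullet> v"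
    "\<lambda>z. V z \<bullet> v" "\<lambda>z. B z \<bullet> hat4 v" "\<lambda>z. R z \<bullet> hat4 v" "\<lambda>z. R z \<bullet> (M1 *v v)" "\<lambda>z. R z \<bullet> (M2 *v v)"
    by (rule scheme_direction[OF d])
  let ?N1 = "L2_norm ({0..T} \<times> {al<..<be}) (\<lambda>z. h *\<^sub>R residual1 b Wh z)"
  let ?N2 = "L2_norm ({0..T} \<times> {al<..<be}) (\<lambda>z. h *\<^sub>R residual2 M t h W0 Wh z)"
  note dn = direction_norms[OF d]
  have sq: "(nrm A (\<lambda>z. F z \<bullet> u))\<^sup>2 \<le> 2 * (nrm A (\<lambda>z. norm (F z)))\<^sup>2"
    if "sqv A F" "norm u \<le> sqrt 2" for A and F :: "'c::euclidean_space \<Rightarrow> real^'e" and u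
  proof -
    have "nrm A (\<lambda>z. F z \<bullet> u) \<le> norm u * nrm A (\<lambda>z. norm (F z))" by (rule nrm_inner_le[OF that(1)])
    also have "\<dots> \<le> sqrt 2 * nrm A (\<lambda>z. norm (F z))" by (intro mult_right_mono that(2)) simp
    finally have "(nrm A (\<lambda>z. F z \<bullet> u))\<^sup>2 \<le> (sqrt 2 * nrm A (\<lambda>z. norm (F z)))\<^sup>2" by (intro power_mono) simp_all
    then show ?thesis by (simp add: power_mult_distrib)
  qed
  have y2: "D.y2 m \<le> 6 * (h\<^sup>2 * (nrm (S m \<times> X) (\<lambda>z. norm (R z)))\<^sup>2) + 2 * (h * (nrm X (\<lambda>x. norm (jump m x)))\<^sup>2)"
    if m: "m \<in> {1..M}" for m
  proof -
    have IX: "D.I m = S m" "D.X = X" unfolding D.I_def D.X_def S_def X_def by simp_all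
    have "D.J m = (\<lambda>x. jump m x \<bullet> v)"
      unfolding D.J_def D.prev_def D.tm_def jump_def before_def pf_cv by (auto simp: inner_diff_left)
    then have "(nrm X (D.J m))\<^sup>2 \<le> 2 * (nrm X (\<lambda>x. norm (jump m x)))\<^sup>2" using sq[OF jump_sqv[OF m] dn(4)] by simp
    moreover have "D.R2 m \<le> 6 * (nrm (S m \<times> X) (\<lambda>z. norm (R z)))\<^sup>2"
      using sq[OF R_slab_sqv[OF m] dn(1)] sq[OF R_slab_sqv[OF m] dn(2)] sq[OF R_slab_sqv[OF m] dn(3)]
      unfolding D.R2_def IX by linarith
    ultimately have "h\<^sup>2 * D.R2 m + h * (nrm X (D.J m))\<^sup>2 \<le> h\<^sup>2 * (6 * (nrm (S m \<times> X) (\<lambda>z. norm (R z)))\<^sup>2) + h * (2 * (nrm X (\<lambda>x. norm (jump m x)))\<^sup>2)"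
      using h0 by (intro add_mono mult_left_mono) auto
    then show ?thesis unfolding D.y2_def IX by (simp add: mult_ac)
  qed
  have "D.Y\<^sup>2 \<le> (\<Sum>m=1..M. 6 * (h\<^sup>2 * (nrm (S m \<times> X) (\<lambda>z. norm (R z)))\<^sup>2) + 2 * (h * (nrm X (\<lambda>x. norm (jump m x)))\<^sup>2))"
    unfolding D.Y2(1) by (rule sum_mono[OF y2])
  also have "\<dots> = 6 * ?N1\<^sup>2 + 2 * ?N2\<^sup>2"
    unfolding residual1_norm residual2_norm by (simp add: sum.distrib sum_distrib_left)
  also have "\<dots> \<le> 6 * (?N1 + ?N2)\<^sup>2"
  proof -
    have "0 \<le> ?N1 * ?N2" by (intro mult_nonneg_nonneg L2_norm_nonneg)
    moreover have "0 \<le> ?N2\<^sup>2" by simp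
    moreover have "6 * (?N1 + ?N2)\<^sup>2 = 6 * ?N1\<^sup>2 + 6 * ?N2\<^sup>2 + 12 * (?N1 * ?N2)" by (simp add: power2_eq_square algebra_simps)
    ultimately show ?thesis by linarith
  qed
  also have "\<dots> = (sqrt 6 * (?N1 + ?N2))\<^sup>2" by (simp add: power_mult_distrib)
  finally have Y: "D.Y \<le> sqrt 6 * residual_norms"
    by (rule power2_le_imp_le) (intro mult_nonneg_nonneg add_nonneg_nonneg L2_norm_nonneg, simp)
  have sm: "smooth f" using f unfolding test_function_def smooth_def by blast
  let ?f' = "\<lambda>x. frechet_derivative f (at x) 1"
  have smv: "smooth (\<lambda>x. f x \<bullet> v)"
    using sm C_diff_linear[OF bounded_linear_inner_left[of v]] unfolding smooth_def by blast
  have der: "((\<lambda>x. f x \<bullet> v) has_real_derivative ?f' x \<bullet> v) (at x)" for x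
    unfolding has_real_derivative_iff_has_vector_derivative
    by (rule bounded_linear.has_vector_derivative[OF bounded_linear_inner_left C1_real(1)[OF sm]])
  have cf': "continuous_on UNIV ?f'" by (rule C1_real(2)[OF sm])
  have e: "(LINT x:X|lborel. ((V (T, x) - Pf M (T, x)) \<bullet> v) * (f x \<bullet> v)) =
    (LINT x:D.X|lborel. (V (T, x) \<bullet> v - pf (cv v M) (T, x)) * (f x \<bullet> v))"
    unfolding D.X_def X_def pf_cv by (simp add: inner_diff_left)
  have "\<bar>LINT x:X|lborel. ((V (T, x) - Pf M (T, x)) \<bullet> v) * (f x \<bullet> v)\<bar>
    \<le> dual_const T cc k rho * D.Y * (nrm X (\<lambda>x. f x \<bullet> v) + nrm X (\<lambda>x. ?f' x \<bullet> v))"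
    unfolding e using D.dual_estimate[OF smv der continuous_on_inner[OF cf' continuous_on_const]]
      test_function_zero[OF f] by (simp add: D.X_def X_def)
  also have "\<dots> \<le> \<bar>dual_const T cc k rho\<bar> * (sqrt 6 * residual_norms) * (2 * sqrt 2 * H1_norm {al<..<be} f)"
  proof (intro mult_mono Y)
    have nv: "nrm X (\<lambda>x. g x \<bullet> v) \<le> sqrt 2 * H1_norm {al<..<be} f"
      if g: "continuous_on UNIV g" "nrm X (\<lambda>x. norm (g x)) \<le> H1_norm {al<..<be} f" for g
    proof -
      have "nrm X (\<lambda>x. g x \<bullet> v) \<le> norm v * nrm X (\<lambda>x. norm (g x))" by (rule nrm_inner_le[OF sqv_continuous[OF g(1) Xb]])
      also have "\<dots> \<le> sqrt 2 * H1_norm {al<..<be} f" by (intro mult_mono dn(4) g(2)) simp_all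
      finally show ?thesis .
    qed
    show "nrm X (\<lambda>x. f x \<bullet> v) + nrm X (\<lambda>x. ?f' x \<bullet> v) \<le> 2 * sqrt 2 * H1_norm {al<..<be} f"
      using nv[OF smooth_continuous[OF sm]] nv[OF cf'] H1_norm_interval[OF sm, of al be] unfolding X_def by simp
    show "0 \<le> \<bar>dual_const T cc k rho\<bar> * (sqrt 6 * residual_norms)"
      by (intro mult_nonneg_nonneg add_nonneg_nonneg L2_norm_nonneg) simp_all
  qed (use D.Y2(2) in auto)
  finally show ?thesis .
qed

lemma pairing_bound:
  assumes f: "test_function {al<..<be} (f :: real \<Rightarrow> real^3)"
  shows "L2_inner {al<..<be} (\<lambda>x. W (T, x) - trace_minus Wh T x) f
    \<le> 4 * sqrt 2 * sqrt 6 * \<bar>dual_const T cc k rho\<bar> * residual_norms * H1_norm {al<..<be} f"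
proof -
  define g where "g x = V (T, x) - Pf M (T, x)" for x
  define E where "E v = (LINT x:X|lborel. (g x \<bullet> v) * (f x \<bullet> v))" for v
  let ?a = "vector [1, 0, 0] :: real^3" let ?b = "vector [0, 1, 1] :: real^3" let ?c = "vector [0, 1, -1] :: real^3"
  have M: "M \<in> {1..M}" using M_pos by simp
  have sm: "smooth f" using f unfolding test_function_def smooth_def by blast
  have fs: "sqv X f" by (rule sqv_continuous[OF smooth_continuous[OF sm] Xb])
  have gs: "sqv X g" unfolding g_def[abs_def] using Vt[of T] Mh(2) by (intro sqv_diff Pf_slice_sqv M) (simp add: X_def)
  have int: "set_integrable lborel X (\<lambda>x. (g x \<bullet> v) * (f x \<bullet> v))" for v
    by (intro sqi_mult_integrable sqv_inner gs fs)
  have "L2_inner {al<..<be} (\<lambda>x. W (T, x) - trace_minus Wh T x) f = (LINT x:X|lborel. g x \<bullet> f x)"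
    unfolding X_def
  proof (intro L2_inner_interval sqv_meas[OF gs] sqv_meas[OF fs])
    have "W (T, x) - trace_minus Wh T x = g x" if "x \<in> {al<..<be}" for x
      using V(3)[of "(T, x)"] trace_minus_Wh[OF M, of x] Mh that unfolding g_def by simp
    then show "AE x in lborel. x \<in> {al<..<be} \<longrightarrow> W (T, x) - trace_minus Wh T x = g x" by simp
  qed simp
  also have "\<dots> = (LINT x:X|lborel. (g x \<bullet> ?a) * (f x \<bullet> ?a) + ((g x \<bullet> ?b) * (f x \<bullet> ?b) / 2 + (g x \<bullet> ?c) * (f x \<bullet> ?c) / 2))"
    by (subst direction_split) (simp only: add.assoc)
  also have "\<dots> = E ?a + (E ?b / 2 + E ?c / 2)"
    unfolding E_def by (simp add: set_integral_add int set_integrable_divide)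
  also have "\<dots> \<le> \<bar>E ?a\<bar> + (\<bar>E ?b\<bar> / 2 + \<bar>E ?c\<bar> / 2)" by linarith
  also have "\<dots> \<le> 2 * (\<bar>dual_const T cc k rho\<bar> * (sqrt 6 * residual_norms) * (2 * sqrt 2 * H1_norm {al<..<be} f))"
    using pairing_direction[OF _ f, of 1 ?a] pairing_direction[OF _ f, of 1 ?b] pairing_direction[OF _ f, of "-1" ?c]
    unfolding E_def g_def by (simp add: direction_def)
  finally show ?thesis by (simp add: mult_ac)
qed

end

section \<open>The error estimate\<close>

lemma compact_in_interval:
  fixes K :: "real set"
  assumes "compact K" "K \<subseteq> {al<..<be}" "al < be"
  obtains K1 K2 where "al < K1" "K1 \<le> K2" "K2 < be" "K \<subseteq> {K1..K2}"
proof (cases "K = {}")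
  case True then show ?thesis using that[of "(al + be) / 2" "(al + be) / 2"] assms(3) by auto
next
  case False
  obtain a where a: "a \<in> K" "\<forall>x\<in>K. a \<le> x" using compact_attains_inf[OF assms(1) False] by blast
  obtain b where b: "b \<in> K" "\<forall>x\<in>K. x \<le> b" using compact_attains_sup[OF assms(1) False] by blast
  have "al < a" "b < be" "a \<le> b" "K \<subseteq> {a..b}" using a b assms(2) by auto
  then show ?thesis using that by blast
qed

lemma discrete_fields_representation:
  assumes mesh: "mesh al be h \<T> k" and Wh: "Wh \<in> fe_space {al<..<be} M t \<T> k"
    and t: "\<And>m. m \<le> M \<Longrightarrow> t m = real m * h"
  obtains cf where "\<And>m l. m \<in> {1..M} \<Longrightarrow> \<forall>i\<le>k. mesh.pw al be \<T> k (cf m l i) \<and> cf m l i al = 0 \<and> cf m l i be = 0"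
    "\<And>m z l. m \<in> {1..M} \<Longrightarrow> z \<in> {real (m - 1) * h<..real m * h} \<times> {al..be} \<Longrightarrow> Wh z $ l = mesh.pf k (cf m l) z"
proof -
  interpret mesh al be h \<T> k by fact
  define P where "P m l c \<longleftrightarrow> (\<forall>i\<le>k. pw (c i) \<and> c i al = 0 \<and> c i be = 0) \<and>
    (\<forall>s\<in>{real (m - 1) * h<..real m * h}. \<forall>x\<in>{al..be}. Wh (s, x) $ l = pf c (s, x))" for m l c
  have ex: "\<exists>c. P m l c" if m: "m \<in> {1..M}" for m l
  proof -
    have lt: "real (m - 1) * h < real m * h" using m h0 by (intro mult_strict_right_mono) auto
    have te: "t (m - 1) = real (m - 1) * h" "t m = real m * h" using t[of "m - 1"] t[of m] m by auto
    have fr: "frontier {al<..<be} = {al, be}" using ab by (auto simp: frontier_def)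
    have rep: "(\<forall>s\<in>{real (m - 1) * h<..real m * h}. \<forall>x\<in>{al, be}. Wh (s, x) $ l = 0) \<and>
      (\<forall>\<tau>\<in>\<T>. \<exists>a. \<forall>s\<in>{real (m - 1) * h<..real m * h}. \<forall>x\<in>\<tau>. Wh (s, x) $ l = (\<Sum>p\<le>k. \<Sum>q\<le>k. a p q * s ^ p * x ^ q))"
      using Wh m unfolding fe_space_def mem_Collect_eq fr te[symmetric] by blast
    have "infinite {real (m - 1) * h<..real m * h}" using lt by (rule infinite_Ioc)
    from fe_slab_representation[OF this, of "\<lambda>z. Wh z $ l"] rep show ?thesis unfolding P_def by auto
  qed
  define cf where "cf m l = (SOME c. P m l c)" for m l
  have cf: "P m l (cf m l)" if "m \<in> {1..M}" for m l using ex[OF that] unfolding cf_def by (rule someI_ex)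
  show thesis
  proof (rule that)
    show "\<forall>i\<le>k. pw (cf m l i) \<and> cf m l i al = 0 \<and> cf m l i be = 0" if "m \<in> {1..M}" for m l
      using cf[OF that, of l] unfolding P_def by blast
    show "Wh z $ l = pf (cf m l) z" if "m \<in> {1..M}" "z \<in> {real (m - 1) * h<..real m * h} \<times> {al..be}" for m z l
      using cf[OF that(1), of l] that(2) unfolding P_def by (cases z) auto
  qed
qed

theorem theorem3p4:
  fixes T c :: real and \<Omega>x Kx :: "real set" and \<Omega>v :: "(real^2) set" and k :: nat
  assumes "T > 0"
    and "bounded_domain \<Omega>x" and "bounded_domain \<Omega>v"
    and "compact Kx" and "Kx \<subseteq> \<Omega>x"
    and "k \<ge> 1" and "c > 0"
  shows "\<exists>C>0. \<forall>\<rho>b f0 E20 B0 h M t \<T>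
      (fh :: nat \<Rightarrow> real \<times> real \<Rightarrow> real^2 \<Rightarrow> real)
      (Wh :: nat \<Rightarrow> real \<times> real \<Rightarrow> real^3) (W :: nat \<Rightarrow> real \<times> real \<Rightarrow> real^3) (i :: nat).
    let W0 = initial_field \<rho>b f0 E20 B0;
        b = maxwell_rhs \<rho>b (fh (i - 1));
        Q = {0..T} \<times> \<Omega>x
    in
      admissible_data \<Omega>x Kx \<Omega>v \<rho>b f0 E20 B0 \<longrightarrow>
      h > 0 \<longrightarrow> time_mesh T h M t \<longrightarrow> space_mesh \<Omega>x h \<T> \<longrightarrow>
      i \<ge> 1 \<longrightarrow>
      admissible_density T \<Omega>x Kx \<Omega>v (fh (i - 1)) \<longrightarrow>
      sd_solution \<Omega>x M t \<T> k (c * h) b W0 (Wh i) \<longrightarrow>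
      maxwell_solution T \<Omega>x b W0 (W i) \<longrightarrow>
      (\<forall>s\<in>{0..T}. \<forall>x\<in>\<Omega>x - Kx. W i (s, x) = 0) \<longrightarrow>
      Hminus1_norm \<Omega>x (\<lambda>x. W i (T, x) - trace_minus (Wh i) T x) \<le>
        ereal (C * (L2_norm Q (\<lambda>z. h *\<^sub>R residual1 b (Wh i) z) +
                    L2_norm Q (\<lambda>z. h *\<^sub>R residual2 M t h W0 (Wh i) z)))"
proof -
  obtain al be where ab: "al < be" and \<Omega>: "\<Omega>x = {al<..<be}" using bounded_domain_real[OF assms(2)] by blast
  obtain K1 K2 where K: "al < K1" "K1 \<le> K2" "K2 < be" "Kx \<subseteq> {K1..K2}"
    using compact_in_interval[OF assms(4) assms(5)[unfolded \<Omega>] ab] by blast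
  \<comment> \<open>The factor 5 leaves a strict inequality after subtracting \<open>4 * rho\<close>.\<close>
  define rho where "rho = min (K1 - al) (be - K2) / 5"
  have rho: "rho > 0" "al + 4 * rho < K1" "K2 < be - 4 * rho" using K unfolding rho_def by (simp_all add: min_def field_simps)
  define C where "C = 4 * sqrt 2 * sqrt 6 * (\<bar>dual_const T c k rho\<bar> + 1)"
  have C: "C > 0" unfolding C_def by (intro mult_pos_pos) (simp_all add: add_nonneg_pos)
  have main: "Hminus1_norm \<Omega>x (\<lambda>x. W (T, x) - trace_minus Wh T x) \<le>
      ereal (C * (L2_norm ({0..T} \<times> \<Omega>x) (\<lambda>z. h *\<^sub>R residual1 (maxwell_rhs \<rho>b F) Wh z) +
        L2_norm ({0..T} \<times> \<Omega>x) (\<lambda>z. h *\<^sub>R residual2 M t h W0 Wh z)))"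
    if dat: "test_function \<Omega>x \<rho>b" "\<forall>x. x \<notin> Kx \<longrightarrow> \<rho>b x = 0" and h: "h > 0" and tm: "time_mesh T h M t" and xm: "space_mesh \<Omega>x h \<T>"
      and F: "admissible_density T \<Omega>x Kx \<Omega>v F" and sd: "sd_solution \<Omega>x M t \<T> k (c * h) (maxwell_rhs \<rho>b F) W0 Wh"
      and sol: "maxwell_solution T \<Omega>x (maxwell_rhs \<rho>b F) W0 W" and off: "\<forall>s\<in>{0..T}. \<forall>x\<in>\<Omega>x - Kx. W (s, x) = 0"
    for \<rho>b h M t \<T> F W0 Wh W
  proof -
    let ?Q = "{0..T} \<times> {al<..<be}" let ?X = "{al..be}"
    have mesh: "mesh al be h \<T> k"
      using xm ab h assms(6) unfolding space_mesh_def \<Omega> by unfold_locales auto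
    interpret mesh al be h \<T> k by (rule mesh)
    have t_eq: "t m = real m * h" if "m \<le> M" for m using that
    proof (induction m)
      case 0 then show ?case using tm unfolding time_mesh_def by simp
    next
      case (Suc m)
      have "t (Suc m) - t m = h" using tm Suc.prems unfolding time_mesh_def by (auto dest!: bspec[of _ _ "Suc m"])
      then show ?case using Suc by (simp add: algebra_simps)
    qed
    have TM: "T = real M * h" using tm t_eq[of M] unfolding time_mesh_def by simp
    have fe: "Wh \<in> fe_space {al<..<be} M t \<T> k" using sd unfolding sd_solution_def \<Omega> by blast
    obtain cf where cf: "\<And>m l. m \<in> {1..M} \<Longrightarrow> \<forall>i\<le>k. pw (cf m l i) \<and> cf m l i al = 0 \<and> cf m l i be = 0"
      "\<And>m z l. m \<in> {1..M} \<Longrightarrow> z \<in> {real (m - 1) * h<..real m * h} \<times> {al..be} \<Longrightarrow> Wh z $ l = pf (cf m l) z"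
      by (rule discrete_fields_representation[OF mesh fe t_eq]) blast+
    have Kx: "Kx \<subseteq> {al<..<be}" using assms(5) unfolding \<Omega> .
    have rb: "continuous_on UNIV \<rho>b" using dat(1) unfolding test_function_def by (metis C_diff.simps(1))
    define B where "B z = indicat_real ?Q z *\<^sub>R maxwell_rhs \<rho>b F z" for z
    note Br = maxwell_rhs_sqv[OF F[unfolded \<Omega>] assms(3) Kx rb, folded B_def]
    define V where "V z = indicat_real ?Q z *\<^sub>R W z" for z
    have Qb: "?Q \<in> sets borel" "{0..T} \<times> ?X \<in> sets borel" by (auto intro!: borel_Times)
    have L2W: "L2_on ?Q W" "\<And>t. t \<in> {0..T} \<Longrightarrow> L2_on {al<..<be} (\<lambda>x. W (t, x))"
      and conW: "\<And>s. s \<in> {0..T} \<Longrightarrow> ((\<lambda>t. L2_norm {al<..<be} (\<lambda>x. W (t, x) - W (s, x))) \<longlongrightarrow> 0) (at s within {0..T})"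
      and W0: "AE x in lborel. x \<in> {al<..<be} \<longrightarrow> W (0, x) = W0 x"
      and weak: "\<And>\<psi>. test_function ({0<..<T} \<times> {al<..<be}) \<psi> \<Longrightarrow>
        - L2_inner ?Q (\<lambda>z. M1 *v W z) (dt \<psi>) - L2_inner ?Q (\<lambda>z. M2 *v W z) (dx \<psi>) = L2_inner ?Q (maxwell_rhs \<rho>b F) \<psi>"
      using sol unfolding maxwell_solution_def \<Omega> by blast+
    have Vt: "sqv ?X (\<lambda>x. V (t, x))" if "t \<in> {0..T}" for t
    proof (rule sqv_extend)
      have "(\<lambda>x. V (t, x)) = (\<lambda>x. indicat_real {al<..<be} x *\<^sub>R W (t, x))" using that unfolding V_def by (auto simp: indicator_def)
      then show "sqv {al<..<be} (\<lambda>x. V (t, x))" using L2_on_sqv[OF L2W(2)[OF that]] by simp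
    qed (auto simp: V_def)
    have nV: "nrm ?X (\<lambda>x. norm (V (t, x) - V (s, x))) = L2_norm {al<..<be} (\<lambda>x. W (t, x) - W (s, x))"
      if "t \<in> {0..T}" "s \<in> {0..T}" for t s
    proof -
      have m: "(\<lambda>x. V (t, x) - V (s, x)) \<in> borel_measurable borel" using sqv_diff[OF Vt Vt] that by (auto dest: sqv_meas)
      have "L2_inner {al<..<be} (\<lambda>x. W (t, x) - W (s, x)) (\<lambda>x. W (t, x) - W (s, x)) = (LINT x:?X|lborel. (V (t, x) - V (s, x)) \<bullet> (V (t, x) - V (s, x)))"
        using that by (intro L2_inner_interval m) (auto simp: V_def)
      then show ?thesis unfolding L2_norm_def nrm_def by (simp add: power2_norm_eq_inner)
    qed
    interpret fe_maxwell al be h \<T> k T M c K1 K2 rho cf B "maxwell_rhs \<rho>b F" V W Wh W0 t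
    proof (intro fe_maxwell.intro mesh fe_maxwell_axioms.intro)
      show "T = real M * h" "T > 0" "c > 0" "rho > 0" "al + 4 * rho < K1" "K1 \<le> K2" "K2 < be - 4 * rho"
        by (rule TM assms rho K)+
      show "sqv ({0..T} \<times> ?X) B" using Br(1) dat(2) by blast
      show "B (t, x) = 0" if "x \<notin> {K1..K2}" for t x
        using Br(2)[of x t] dat(2) K(4) that by blast
      show "sqv ({0..T} \<times> ?X) V"
      proof (rule sqv_extend)
        show "sqv ?Q V" using L2_on_sqv[OF L2W(1) Qb(1)] unfolding V_def[abs_def] .
      qed (use Qb in \<open>auto simp: V_def\<close>)
      show "V (t, x) = 0" if "x \<notin> {K1..K2}" for t x
      proof -
        have "x \<notin> Kx" using K(4) that by blast
        then show ?thesis using off unfolding V_def \<Omega> by (cases "(t, x) \<in> ?Q") auto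
      qed
      show "AE x in lborel. x \<in> {al<..<be} \<longrightarrow> W0 x = V (0, x)"
        using W0 by eventually_elim (use assms(1) in \<open>auto simp: V_def\<close>)
      show "((\<lambda>t. nrm ?X (\<lambda>x. norm (V (t, x) - V (s, x)))) \<longlongrightarrow> 0) (at s within {0..T})" if s: "s \<in> {0..T}" for s
      proof (rule Lim_transform_eventually[OF conW[OF s]])
        show "\<forall>\<^sub>F t in at s within {0..T}. L2_norm {al<..<be} (\<lambda>x. W (t, x) - W (s, x)) = nrm ?X (\<lambda>x. norm (V (t, x) - V (s, x)))"
          using nV[OF _ s] by (auto simp: eventually_at_filter)
      qed
      show "sd_solution {al<..<be} M t \<T> k (c * h) (maxwell_rhs \<rho>b F) W0 Wh" using sd unfolding \<Omega> .
    qed (fact t_eq cf Vt weak | simp add: B_def V_def)+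
    show ?thesis unfolding Hminus1_norm_def \<Omega>
    proof (rule SUP_least)
      fix f :: "real \<Rightarrow> real^3" assume "f \<in> {f. test_function {al<..<be} f \<and> f \<noteq> (\<lambda>x. 0)}"
      then have f: "test_function {al<..<be} f" by simp
      have r: "0 \<le> residual_norms" by (intro add_nonneg_nonneg L2_norm_nonneg)
      have H: "0 \<le> H1_norm {al<..<be} f" unfolding H1_norm_def by (simp add: sum_nonneg)
      have "L2_inner {al<..<be} (\<lambda>x. W (T, x) - trace_minus Wh T x) f
        \<le> 4 * sqrt 2 * sqrt 6 * \<bar>dual_const T c k rho\<bar> * residual_norms * H1_norm {al<..<be} f" by (rule pairing_bound[OF f])
      also have "\<dots> \<le> C * residual_norms * H1_norm {al<..<be} f"
        unfolding C_def by (intro mult_right_mono mult_left_mono r H) simp_all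
      finally have "L2_inner {al<..<be} (\<lambda>x. W (T, x) - trace_minus Wh T x) f / H1_norm {al<..<be} f \<le> C * residual_norms"
        using H r C by (cases "H1_norm {al<..<be} f = 0") (simp_all add: divide_le_eq)
      then show "ereal (L2_inner {al<..<be} (\<lambda>x. W (T, x) - trace_minus Wh T x) f / H1_norm {al<..<be} f) \<le> ereal (C * residual_norms)" by simp
    qed
  qed
  show ?thesis
  proof (intro exI[of _ C] conjI C allI)
    fix \<rho>b f0 E20 B0 h M t \<T>
      and fh :: "nat \<Rightarrow> real \<times> real \<Rightarrow> real^2 \<Rightarrow> real" and Wh W :: "nat \<Rightarrow> real \<times> real \<Rightarrow> real^3" and i :: nat
    show "let W0 = initial_field \<rho>b f0 E20 B0; b = maxwell_rhs \<rho>b (fh (i - 1)); Q = {0..T} \<times> \<Omega>x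
    in
      admissible_data \<Omega>x Kx \<Omega>v \<rho>b f0 E20 B0 \<longrightarrow>
      h > 0 \<longrightarrow> time_mesh T h M t \<longrightarrow> space_mesh \<Omega>x h \<T> \<longrightarrow>
      i \<ge> 1 \<longrightarrow>
      admissible_density T \<Omega>x Kx \<Omega>v (fh (i - 1)) \<longrightarrow>
      sd_solution \<Omega>x M t \<T> k (c * h) b W0 (Wh i) \<longrightarrow>
      maxwell_solution T \<Omega>x b W0 (W i) \<longrightarrow>
      (\<forall>s\<in>{0..T}. \<forall>x\<in>\<Omega>x - Kx. W i (s, x) = 0) \<longrightarrow>
      Hminus1_norm \<Omega>x (\<lambda>x. W i (T, x) - trace_minus (Wh i) T x) \<le>
        ereal (C * (L2_norm Q (\<lambda>z. h *\<^sub>R residual1 b (Wh i) z) +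
                    L2_norm Q (\<lambda>z. h *\<^sub>R residual2 M t h W0 (Wh i) z)))"
      unfolding Let_def admissible_data_def by (intro impI main; blast)
  qed
qed

end
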